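(* Let $d\in\{2,3\}$, and let $r>2$ if $d=2$, $r=3$ if $d=3$. Let $\mathbf A\in\mathrm L^r_{\mathrm{loc}}(\mathbb R^d;\mathbb R^d)$ be a magnetic potential with magnetic field $\mathbf B=\mathrm{curl}\,\mathbf A$, such that the inequality $\|\nabla_{\mathbf A}\psi\|_2^2\ge\Lambda\,\|\psi\|_2^2$ holds for all $\psi\in\mathrm H^1_{\mathbf A}(\mathbb R^d)$ for some $\Lambda=\Lambda[\mathbf B]>0$, with equality for some nonzero $\psi\in\mathrm H^1_{\mathbf A}(\mathbb R^d)$. Then the following properties hold. (i) Let $p\in(2,2^* )$ and assume $$\lim_{\sigma\to+\infty}\sigma^{d-2}\int_{\mathbb R^d}|\mathbf A(x)|^2\,e^{-\sigma|x|}\,dx=0.$$ Then the function $\mu_{\mathbf B}:(-\Lambda,+\infty)\to(0,+\infty)$ is monotone increasing, concave and such that $$\lim_{\alpha\to(-\Lambda)_+}\mu_{\mathbf B}(\alpha)=0\quad\text{and}\quad\lim_{\alpha\to+\infty}\mu_{\mathbf B}(\alpha)\,\alpha^{\frac{d-2}2-\frac dp}=\mathsf C_p.$$ (ii) Let $p\in(1,2)$ and assume $$\lim_{\sigma\to+\infty}\sigma^{d-2}\int_{|x|<1/\sigma}|\mathbf A(x)|^2\,dx=0.$$ Then the function $\nu_{\mathbf B}:(0,+\infty)\to(\Lambda,+\infty)$ is monotone increasing, concave and such that $$\lim_{\beta\to0_+}\nu_{\mathbf B}(\beta)=\Lambda\quad\text{and}\quad\lim_{\beta\to+\infty}\nu_{\mathbf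 B}(\beta)\,\beta^{-\frac{2p}{2p+d(2-p)}}=\mathsf C_p.$$ (iii) Assume $$\lim_{\sigma\to+\infty}\frac{\sigma^{\frac d2-1}}{\log\sigma}\int_{\mathbb R^d}|\mathbf A(x)|^2\,e^{-\sigma|x|^2}\,dx=0.$$ Then the function $\xi_{\mathbf B}:[0,+\infty)\to\mathbb R$ is continuous, concave, such that $\xi_{\mathbf B}(0)=\Lambda[\mathbf B]$ and $$\xi_{\mathbf B}(\gamma)=\tfrac d2\,\gamma\,\log\Big(\frac{\pi e^2}\gamma\Big)\,(1+o(1))\quad\text{as }\gamma\to+\infty.$$
   Context: Notation. $2^*=+\infty$ if $d=2$ and $2^*=6$ if $d=3$. $\|\cdot\|_q$ is the norm of $\mathrm L^q(\mathbb R^d)$, with $\|\psi\|_q=+\infty$ if $\psi\notin\mathrm L^q(\mathbb R^d)$; functions are complex-valued. $\nabla_{\mathbf A}:=\nabla+i\mathbf A$ and $\mathrm H^1_{\mathbf A}(\mathbb R^d):=\{\psi\in\mathrm L^2(\mathbb R^d):\nabla_{\mathbf A}\psi\in\mathrm L^2(\mathbb R^d)\}$. $\Lambda[\mathbf B]$ is the optimal constant in $\|\nabla_{\mathbf A}\psi\|_2^2\ge\Lambda[\mathbf B]\,\|\psi\|_2^2$ for all $\psi\in\mathrm H^1_{\mathbf A}(\mathbb R^d)$. The Gagliardo–Nirenberg constant is $$\mathsf C_p:=\min_{u\in\mathrm H^1(\mathbb R^d)\setminus\{0\}}\frac{\|\nabla u\|_2^2+\|u\|_2^2}{\|u\|_p^2}\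 \text{ if }p\in(2,2^* ),\qquad \mathsf C_p:=\min_{u\in\mathrm H^1(\mathbb R^d)\setminus\{0\}}\frac{\|\nabla u\|_2^2+\|u\|_p^2}{\|u\|_2^2}\ \text{ if }p\in(1,2).$$ $\mu_{\mathbf B}(\alpha)$, $\nu_{\mathbf B}(\beta)$, $\xi_{\mathbf B}(\gamma)$ denote the optimal (largest) constants in the following inequalities, required for all $\psi\in\mathrm H^1_{\mathbf A}(\mathbb R^d)$: - $\|\nabla_{\mathbf A}\psi\|_2^2+\alpha\|\psi\|_2^2\ge\mu_{\mathbf B}(\alpha)\|\psi\|_p^2$, for $\alpha\in(-\Lambda[\mathbf B],+\infty)$, $p\in(2,2^* )$; - $\|\nabla_{\mathbf A}\psi\|_2^2+\beta\|\psi\|_p^2\ge\nu_{\mathbf B}(\beta)\|\psi\|_2^2$, for $\beta\in(0,+\infty)$, $p\in(1,2)$; - $\|\nabla_{\mathbf A}\psi\|_2^2\ge\gamma\int_{\mathbb R^d}|\psi|^2\log\big(|\psi|^2/\|\psi\|_2^2\big)\,dx+\xi_{\mathbf B}(\gamma)\|\psi\|_2^2$, for $\gamma\in(0,+\infty)$; for $\gamma=0$, $\xi_{\mathbf B}(0)$ is the optimal constant with the logarithmic term absent. *)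

theory Defs
  imports "HOL-Analysis.Analysis" "HOL-Library.Landau_Symbols"
begin

text \<open>
  The space \<open>\<real>\<^sup>d\<close> is \<open>real ^ 'n\<close> with \<open>d = CARD('n)\<close>.  Norms, energies and optimal constants
  take values in \<^typ>\<open>ereal\<close>, so that non-membership in \<open>L\<^sup>q\<close> and degenerate suprema or infima
  appear as \<open>\<plusminus>\<infinity>\<close> and not as default values.  The magnetic field \<open>B = curl A\<close> enters
  only through the potential \<open>A\<close>; quantities written with an index \<open>B\<close> in the mathematics
  are therefore functions of \<open>A\<close> here.
\<close>

subsection \<open>Lebesgue spaces\<close>

definition Lspace :: "real \<Rightarrow> (real ^ 'n \<Rightarrow> 'b::euclidean_space) set" where
  "Lspace q = {f \<in> borel_measurable lebesgue.
     (\<integral>\<^sup>+ x. ennreal (norm (f x) powr q) \<partial>lebesgue) < \<infinity>}"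

definition Lnorm :: "real \<Rightarrow> (real ^ 'n \<Rightarrow> 'b::euclidean_space) \<Rightarrow> ereal" where
  "Lnorm q f =
     (if f \<in> Lspace q
      then ereal (enn2real (\<integral>\<^sup>+ x. ennreal (norm (f x) powr q) \<partial>lebesgue) powr (1 / q))
      else \<infinity>)"

definition Lspace_loc :: "real \<Rightarrow> (real ^ 'n \<Rightarrow> 'b::euclidean_space) set" where
  "Lspace_loc q = {f \<in> borel_measurable lebesgue. \<forall>K. compact K \<longrightarrow>
     (\<integral>\<^sup>+ x \<in> K. ennreal (norm (f x) powr q) \<partial>lebesgue) < \<infinity>}"

definition ae_zero :: "(real ^ 'n \<Rightarrow> 'b::euclidean_space) \<Rightarrow> bool" where
  "ae_zero f \<longleftrightarrow> (AE x in lebesgue. f x = 0)"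

subsection \<open>Weak and magnetic gradients\<close>

primrec C_k :: "nat \<Rightarrow> (real ^ 'n \<Rightarrow> real) \<Rightarrow> bool" where
  "C_k 0 f \<longleftrightarrow> continuous_on UNIV f"
| "C_k (Suc k) f \<longleftrightarrow> (\<forall>x. f differentiable (at x)) \<and>
     (\<forall>v. C_k k (\<lambda>x. frechet_derivative f (at x) v))"

definition test_function :: "(real ^ 'n \<Rightarrow> real) \<Rightarrow> bool" where
  "test_function \<phi> \<longleftrightarrow> (\<forall>k. C_k k \<phi>) \<and> compact (closure {x. \<phi> x \<noteq> 0})"

text \<open>
  \<open>h\<close> is the distributional gradient of \<open>\<psi>\<close>.  Real-valued test functions suffice, by linearity.
\<close>

definition weak_gradient :: "(real ^ 'n \<Rightarrow> complex) \<Rightarrow> (real ^ 'n \<Rightarrow> complex ^ 'n) \<Rightarrow> bool" where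
  "weak_gradient \<psi> h \<longleftrightarrow> \<psi> \<in> Lspace_loc 1 \<and> h \<in> Lspace_loc 1 \<and>
     (\<forall>\<phi> j. test_function \<phi> \<longrightarrow>
        (\<integral>x. frechet_derivative \<phi> (at x) (axis j 1) *\<^sub>R \<psi> x \<partial>lebesgue) =
        - (\<integral>x. \<phi> x *\<^sub>R (h x $ j) \<partial>lebesgue))"

text \<open>
  \<open>g = \<nabla>\<psi> + i A \<psi>\<close> in the sense of distributions.  For \<open>A \<in> L\<^sup>2\<^sub>l\<^sub>o\<^sub>c\<close> and \<open>\<psi> \<in> L\<^sup>2\<close> the product
  \<open>A \<psi>\<close> is locally integrable, so the local integrability demanded by \<^const>\<open>weak_gradient\<close> is no
  restriction when \<open>g \<in> L\<^sup>2\<close>.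
\<close>

definition is_mag_gradient ::
    "(real ^ 'n \<Rightarrow> real ^ 'n) \<Rightarrow> (real ^ 'n \<Rightarrow> complex) \<Rightarrow> (real ^ 'n \<Rightarrow> complex ^ 'n) \<Rightarrow> bool" where
  "is_mag_gradient A \<psi> g \<longleftrightarrow>
     weak_gradient \<psi> (\<lambda>x. g x - (\<chi> j. \<i> * complex_of_real (A x $ j) * \<psi> x))"

text \<open>The choice below is unique up to null sets, hence immaterial for norms.\<close>

definition mag_gradient ::
    "(real ^ 'n \<Rightarrow> real ^ 'n) \<Rightarrow> (real ^ 'n \<Rightarrow> complex) \<Rightarrow> (real ^ 'n \<Rightarrow> complex ^ 'n)" where
  "mag_gradient A \<psi> = (SOME g. is_mag_gradient A \<psi> g)"

definition H1_mag :: "(real ^ 'n \<Rightarrow> real ^ 'n) \<Rightarrow> (real ^ 'n \<Rightarrow> complex) set" where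
  "H1_mag A = {\<psi> \<in> Lspace 2. \<exists>g \<in> Lspace 2. is_mag_gradient A \<psi> g}"

abbreviation H1 :: "(real ^ 'n \<Rightarrow> complex) set" where
  "H1 \<equiv> H1_mag (\<lambda>_. 0)"

abbreviation gradient :: "(real ^ 'n \<Rightarrow> complex) \<Rightarrow> (real ^ 'n \<Rightarrow> complex ^ 'n)" where
  "gradient \<equiv> mag_gradient (\<lambda>_. 0)"

subsection \<open>Optimal constants\<close>

definition critical_exponent :: "nat \<Rightarrow> ereal" where
  "critical_exponent d = (if d = 2 then \<infinity> else 6)"

definition GN_constant :: "'n::finite itself \<Rightarrow> real \<Rightarrow> ereal" where
  "GN_constant (_ :: 'n itself) p =
     (INF u \<in> {u \<in> (H1 :: (real ^ 'n \<Rightarrow> complex) set). \<not> ae_zero u}.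
        if p > 2 then ((Lnorm 2 (gradient u))\<^sup>2 + (Lnorm 2 u)\<^sup>2) / (Lnorm p u)\<^sup>2
        else ((Lnorm 2 (gradient u))\<^sup>2 + (Lnorm p u)\<^sup>2) / (Lnorm 2 u)\<^sup>2)"

definition optimal_constant :: "(real \<Rightarrow> bool) \<Rightarrow> ereal" where
  "optimal_constant P = (SUP c \<in> {c. P c}. ereal c)"

definition Lambda_mag :: "(real ^ 'n \<Rightarrow> real ^ 'n) \<Rightarrow> ereal" where
  "Lambda_mag A = optimal_constant (\<lambda>c. \<forall>\<psi> \<in> H1_mag A.
     (Lnorm 2 (mag_gradient A \<psi>))\<^sup>2 \<ge> ereal c * (Lnorm 2 \<psi>)\<^sup>2)"

definition mu_mag :: "(real ^ 'n \<Rightarrow> real ^ 'n) \<Rightarrow> real \<Rightarrow> real \<Rightarrow> ereal" where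
  "mu_mag A p \<alpha> = optimal_constant (\<lambda>c. \<forall>\<psi> \<in> H1_mag A.
     (Lnorm 2 (mag_gradient A \<psi>))\<^sup>2 + ereal \<alpha> * (Lnorm 2 \<psi>)\<^sup>2 \<ge> ereal c * (Lnorm p \<psi>)\<^sup>2)"

definition nu_mag :: "(real ^ 'n \<Rightarrow> real ^ 'n) \<Rightarrow> real \<Rightarrow> real \<Rightarrow> ereal" where
  "nu_mag A p \<beta> = optimal_constant (\<lambda>c. \<forall>\<psi> \<in> H1_mag A.
     (Lnorm 2 (mag_gradient A \<psi>))\<^sup>2 + ereal \<beta> * (Lnorm p \<psi>)\<^sup>2 \<ge> ereal c * (Lnorm 2 \<psi>)\<^sup>2)"

definition entropy_density :: "(real ^ 'n \<Rightarrow> complex) \<Rightarrow> real ^ 'n \<Rightarrow> real" where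
  "entropy_density \<psi> x =
     (cmod (\<psi> x))\<^sup>2 * ln ((cmod (\<psi> x))\<^sup>2 / (real_of_ereal (Lnorm 2 \<psi>))\<^sup>2)"

text \<open>
  For \<open>\<psi> \<in> H\<^sup>1\<^sub>A\<close> the positive part of the density is integrable by the Sobolev inequality,
  but the negative part need not be; the integral is then \<open>-\<infinity>\<close> (a Bochner integral would be 0).
\<close>

definition entropy_integral :: "(real ^ 'n \<Rightarrow> complex) \<Rightarrow> ereal" where
  "entropy_integral \<psi> =
     enn2ereal (\<integral>\<^sup>+ x. ennreal (entropy_density \<psi> x) \<partial>lebesgue)
     - enn2ereal (\<integral>\<^sup>+ x. ennreal (- entropy_density \<psi> x) \<partial>lebesgue)"

text \<open>
  In \<^typ>\<open>ereal\<close> one has \<open>0 * (-\<infinity>) = 0\<close>, so for \<open>\<gamma> = 0\<close> the logarithmic term is absent.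
\<close>

definition xi_mag :: "(real ^ 'n \<Rightarrow> real ^ 'n) \<Rightarrow> real \<Rightarrow> ereal" where
  "xi_mag A \<gamma> = optimal_constant (\<lambda>c. \<forall>\<psi> \<in> H1_mag A.
     (Lnorm 2 (mag_gradient A \<psi>))\<^sup>2
       \<ge> ereal \<gamma> * entropy_integral \<psi> + ereal c * (Lnorm 2 \<psi>)\<^sup>2)"

end

theory Submission imports Defs begin

text \<open>
  Each of the three constants is an infimum of quotients \<open>(X \<psi> + a Y \<psi>) / Z \<psi>\<close>, affine in the parameter \<open>a\<close>,
  hence concave in \<open>a\<close>; strict monotonicity then follows from unboundedness.

  For large parameters, the diamagnetic inequality bounds the constants from below by the field-free ones, whose
  dependence on the parameter is a pure power by scaling.  For the upper bounds, a bounded, compactly supported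
  near-optimiser \<open>u\<close> of the field-free problem is concentrated to \<open>u (\<sigma> x)\<close>; the hypotheses on \<open>A\<close> say
  that the additional energy \<open>\<integral> |A x|\<^sup>2 |u (\<sigma> x)|\<^sup>2 dx\<close> is negligible.  The limits at the left end point come from
  the ground state, cut off to compact support where \<open>L\<^sup>p\<close> with \<open>p < 2\<close> or the entropy is involved.

  In the logarithmic case only the leading term \<open>- (d / 2) \<gamma> ln \<gamma>\<close> matters, so a non-sharp logarithmic Sobolev
  inequality suffices; it follows from the embedding into \<open>L\<^sup>3\<close> and the concavity of the logarithm.

  The subcritical Sobolev inequality is obtained from the translation estimate
  \<open>\<parallel>u (\<cdot> + v) - u\<parallel>\<^sub>2 \<le> |v| \<parallel>\<nabla>u\<parallel>\<^sub>2\<close>, which bounds the measure of level sets.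
\<close>

subsection \<open>Smooth test functions\<close>

text \<open>No smoothing is used. Weak derivatives are handled through one identity, the increment
  of a function as the integral of its gradient along a segment. In mean square it gives the
  translation estimate behind the Sobolev inequality; in local mean it gives convergence of
  difference quotients, hence the chain rule for the modulus and the diamagnetic inequality.

  Near-optimisers have to be bounded with bounded support because the hypotheses control |A|^2 only
  against weights concentrating at the origin, and the square of such a dilated profile lies below a
  constant times the weight. The truncations (\<open>sat\<close> in height,
  \<open>cutoff_seq\<close> in space) raise the energy by a vanishing amount at most.

  A nondecreasing concave function can be flat only from some point on, which unboundedness
  excludes; \<open>nu_mag\<close> then lies strictly above the ground state level by comparison with
  half the parameter.

  The constants are extended reals, but competitors with an infinite norm or entropy impose no
  constraint or have an infinite quotient. The estimates are made for real infima over admissible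
  functions, for which a finite lower bound must always be supplied.\<close>

definition exp_bump :: "nat \<Rightarrow> real \<Rightarrow> real" where
  "exp_bump k t = (if t \<le> 0 then 0 else exp (- 1 / t) / t ^ k)"

lemma exp_bump_tendsto_0: "(exp_bump k \<longlongrightarrow> 0) (at 0)"
proof (rule filterlim_split_at)
  show "(exp_bump k \<longlongrightarrow> 0) (at_left 0)"
    by (rule tendsto_eventually) (auto simp: exp_bump_def eventually_at_filter)
next
  have "((\<lambda>t::real. (inverse t) ^ k / exp (inverse t)) \<longlongrightarrow> 0) (at_right 0)"
    using filterlim_compose[OF tendsto_power_div_exp_0 filterlim_inverse_at_top_right] .
  then show "(exp_bump k \<longlongrightarrow> 0) (at_right 0)"
    by (rule Lim_transform_eventually)
       (auto simp: exp_bump_def eventually_at_filter exp_minus field_simps)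
qed

text \<open>Dividing by powers of t makes the family closed under differentiation: members k + 1 and
  k + 2 suffice. At the origin the difference quotient of member k is member k + 1, so the
  derivative 0 follows from \<open>exp_bump_tendsto_0\<close>.\<close>

lemma exp_bump_has_derivative:
  "(exp_bump k has_real_derivative exp_bump (k + 2) t - of_nat k * exp_bump (k + 1) t) (at t)"
proof (cases t "0 :: real" rule: linorder_cases)
  case less
  have "((\<lambda>_. 0) has_real_derivative 0) (at t)" by simp
  then have "(exp_bump k has_real_derivative 0) (at t)"
    by (rule has_field_derivative_transform_within_open[where S="{..<0}"])
       (use less in \<open>auto simp: exp_bump_def\<close>)
  then show ?thesis using less by (simp add: exp_bump_def)
next
  case equal
  have "((\<lambda>y. exp_bump k y / y) \<longlongrightarrow> 0) (at 0)"
    by (rule Lim_transform_eventually[OF exp_bump_tendsto_0[of "k + 1"]])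
       (auto simp: eventually_at_filter exp_bump_def)
  then show ?thesis
    using equal by (simp add: has_field_derivative_iff exp_bump_def)
next
  case greater
  have "((\<lambda>t. exp (- 1 / t) / t ^ k) has_real_derivative
          exp_bump (k + 2) t - of_nat k * exp_bump (k + 1) t) (at t)"
  proof -
    have e: "((\<lambda>t. exp (- 1 / t)) has_real_derivative exp (- 1 / t) / t\<^sup>2) (at t)"
      using greater by (auto intro!: derivative_eq_intros simp: power2_eq_square)
    have p: "((\<lambda>t. t ^ k) has_real_derivative of_nat k * t ^ (k - 1)) (at t)"
      using DERIV_pow[of k t] by simp
    have "t ^ k * t ^ k \<noteq> 0" using greater by simp
    then have "(exp (- 1 / t) / t\<^sup>2 * t ^ k - exp (- 1 / t) * (of_nat k * t ^ (k - 1))) / (t ^ k * t ^ k)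
       = exp_bump (k + 2) t - of_nat k * exp_bump (k + 1) t"
      using greater by (cases k) (auto simp: exp_bump_def field_simps power2_eq_square)
    then show ?thesis using DERIV_divide[OF e p] greater by simp
  qed
  then show ?thesis
    by (rule has_field_derivative_transform_within_open[where S="{0<..}"])
       (use greater in \<open>auto simp: exp_bump_def\<close>)
qed

lemma exp_bump_0_nonneg: "0 \<le> exp_bump 0 t" and exp_bump_0_le_1: "exp_bump 0 t \<le> 1"
  by (auto simp: exp_bump_def)

text \<open>A syntactic class closed under directional derivatives, by the sum, product and chain
  rules and the derivative formula for \<open>exp_bump\<close>. Membership therefore yields every
  \<open>C_k\<close> by a plain induction, with no bookkeeping for higher derivatives. Its
  generators are what the box bumps and the radial cut-off are built from.\<close>

inductive smooth_fn :: "(real ^ 'n \<Rightarrow> real) \<Rightarrow> bool" where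
  smooth_const: "smooth_fn (\<lambda>_. c)"
| smooth_inner: "smooth_fn (\<lambda>x. a \<bullet> x)"
| smooth_add: "smooth_fn f \<Longrightarrow> smooth_fn g \<Longrightarrow> smooth_fn (\<lambda>x. f x + g x)"
| smooth_mult: "smooth_fn f \<Longrightarrow> smooth_fn g \<Longrightarrow> smooth_fn (\<lambda>x. f x * g x)"
| smooth_bump: "smooth_fn f \<Longrightarrow> smooth_fn (\<lambda>x. exp_bump k (f x))"

lemma smooth_fn_derivative:
  "smooth_fn f \<Longrightarrow> \<exists>f'. (\<forall>x. (f has_derivative f' x) (at x)) \<and> (\<forall>v. smooth_fn (\<lambda>x. f' x v))"
proof (induction rule: smooth_fn.induct)
  case (smooth_const c)
  show ?case by (rule exI[of _ "\<lambda>_ _. 0"]) (auto intro: smooth_fn.intros)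
next
  case (smooth_inner a)
  show ?case by (rule exI[of _ "\<lambda>_ v. a \<bullet> v"]) (auto intro!: smooth_fn.intros derivative_eq_intros)
next
  case (smooth_add f g)
  then obtain f' g' where "\<forall>x. (f has_derivative f' x) (at x)" "\<forall>v. smooth_fn (\<lambda>x. f' x v)"
    "\<forall>x. (g has_derivative g' x) (at x)" "\<forall>v. smooth_fn (\<lambda>x. g' x v)" by blast
  then show ?case
    by (intro exI[of _ "\<lambda>x v. f' x v + g' x v"]) (auto intro!: smooth_fn.intros derivative_eq_intros)
next
  case (smooth_mult f g)
  then obtain f' g' where "\<forall>x. (f has_derivative f' x) (at x)" "\<forall>v. smooth_fn (\<lambda>x. f' x v)"
    "\<forall>x. (g has_derivative g' x) (at x)" "\<forall>v. smooth_fn (\<lambda>x. g' x v)" by blast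
  with smooth_mult.hyps show ?case
    by (intro exI[of _ "\<lambda>x v. f x * g' x v + f' x v * g x"])
       (auto intro!: smooth_fn.intros derivative_eq_intros)
next
  case (smooth_bump f k)
  then obtain f' where f': "\<forall>x. (f has_derivative f' x) (at x)" "\<forall>v. smooth_fn (\<lambda>x. f' x v)" by blast
  let ?d = "\<lambda>x. exp_bump (k + 2) (f x) + (- of_nat k) * exp_bump (k + 1) (f x)"
  have d: "((\<lambda>x. exp_bump k (f x)) has_derivative (\<lambda>v. ?d x * f' x v)) (at x)" for x
  proof -
    have "(exp_bump k has_derivative (\<lambda>h. ?d x * h)) (at (f x))"
      using exp_bump_has_derivative[of k "f x"] by (simp add: has_field_derivative_def)
    from has_derivative_compose[OF f'(1)[rule_format, of x] this] show ?thesis .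
  qed
  show ?case
    by (intro exI[of _ "\<lambda>x v. ?d x * f' x v"] conjI allI d)
       (intro smooth_fn.intros smooth_bump.hyps f'(2)[rule_format])+
qed

lemma smooth_fn_C_k: "smooth_fn f \<Longrightarrow> C_k k f"
proof (induction k arbitrary: f)
  case 0
  then obtain f' where "\<forall>x. (f has_derivative f' x) (at x)" using smooth_fn_derivative by blast
  then show ?case by (auto simp: continuous_on_eq_continuous_at intro: has_derivative_continuous)
next
  case (Suc k)
  then obtain f' where f': "\<And>x. (f has_derivative f' x) (at x)" "\<And>v. smooth_fn (\<lambda>x. f' x v)"
    using smooth_fn_derivative by blast
  have "frechet_derivative f (at x) = f' x" for x
    using frechet_derivative_at[OF f'(1)] by simp
  then show ?case using f' Suc.IH by (auto simp: differentiable_def)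
qed

section \<open>Closure properties of test functions\<close>

lemma C_k_Suc_imp: "C_k (Suc k) f \<Longrightarrow> C_k k f"
proof (induction k arbitrary: f)
  case 0
  then show ?case
    by (auto simp: continuous_on_eq_continuous_at differentiable_imp_continuous_within)
next
  case (Suc k)
  then show ?case using C_k.simps(2) by blast
qed

lemma frechet_derivative_add:
  assumes "f differentiable at x" "g differentiable at x"
  shows "frechet_derivative (\<lambda>x. f x + g x) (at x) v
    = frechet_derivative f (at x) v + frechet_derivative g (at x) v"
  unfolding frechet_derivative_at[OF has_derivative_add[OF assms[unfolded frechet_derivative_works]],
      symmetric] ..

lemma frechet_derivative_mult:
  fixes f g :: "_ \<Rightarrow> real"
  assumes "f differentiable at x" "g differentiable at x"
  shows "frechet_derivative (\<lambda>x. f x * g x) (at x) v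
    = f x * frechet_derivative g (at x) v + frechet_derivative f (at x) v * g x"
  unfolding frechet_derivative_at[OF has_derivative_mult[OF assms[unfolded frechet_derivative_works]],
      symmetric] ..

lemma C_k_add: "C_k k f \<Longrightarrow> C_k k g \<Longrightarrow> C_k k (\<lambda>x. f x + g x)"
proof (induction k arbitrary: f g)
  case 0
  then show ?case by (auto intro: continuous_intros)
next
  case (Suc k)
  then show ?case by (auto simp: frechet_derivative_add)
qed

lemma C_k_mult: "C_k k f \<Longrightarrow> C_k k g \<Longrightarrow> C_k k (\<lambda>x. f x * g x)"
proof (induction k arbitrary: f g)
  case 0
  then show ?case by (auto intro: continuous_intros)
next
  case (Suc k)
  then have "C_k k f" "C_k k g" using C_k_Suc_imp by blast+
  with Suc show ?case by (auto simp: frechet_derivative_mult intro!: C_k_add)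
qed

lemma frechet_derivative_affine:
  fixes f :: "real ^ 'n \<Rightarrow> real"
  assumes "\<And>x. f differentiable at x"
  shows "((\<lambda>x. f (v + c *\<^sub>R x)) has_derivative
           (\<lambda>w. frechet_derivative f (at (v + c *\<^sub>R x)) (c *\<^sub>R w))) (at x)"
proof -
  have "((\<lambda>x. v + c *\<^sub>R x) has_derivative (\<lambda>w. c *\<^sub>R w)) (at x)"
    by (auto intro!: derivative_eq_intros)
  from has_derivative_compose[OF this assms[unfolded frechet_derivative_works]] show ?thesis .
qed

lemma C_k_affine: "C_k k f \<Longrightarrow> C_k k (\<lambda>x. f (v + c *\<^sub>R x))"
proof (induction k arbitrary: f)
  case 0
  then show ?case
    by (auto intro!: continuous_on_compose2[of UNIV f] continuous_intros)
next
  case (Suc k)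
  then have d: "((\<lambda>x. f (v + c *\<^sub>R x)) has_derivative
           (\<lambda>w. frechet_derivative f (at (v + c *\<^sub>R x)) (c *\<^sub>R w))) (at x)" for x
    by (intro frechet_derivative_affine) auto
  show ?case
    unfolding C_k.simps
  proof (intro conjI allI)
    fix x show "(\<lambda>x. f (v + c *\<^sub>R x)) differentiable at x"
      using d by (auto simp: differentiable_def)
    fix w
    have "C_k k (\<lambda>y. frechet_derivative f (at y) (c *\<^sub>R w))" using Suc.prems by simp
    from Suc.IH[OF this] show "C_k k (\<lambda>x. frechet_derivative (\<lambda>x. f (v + c *\<^sub>R x)) (at x) w)"
      unfolding frechet_derivative_at[OF d, symmetric] .
  qed
qed

lemma test_function_affine:
  assumes "test_function \<phi>" "c \<noteq> 0"
  shows "test_function (\<lambda>x. \<phi> (v + c *\<^sub>R x))"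
proof -
  let ?K = "closure {x. \<phi> x \<noteq> 0}"
  have K: "compact ?K" using assms by (simp add: test_function_def)
  let ?T = "\<lambda>y. (1 / c) *\<^sub>R (y - v)"
  have "compact (?T ` ?K)"
    by (rule compact_continuous_image[OF _ K]) (auto intro!: continuous_intros)
  moreover have "{x. \<phi> (v + c *\<^sub>R x) \<noteq> 0} \<subseteq> ?T ` ?K"
  proof
    fix x assume "x \<in> {x. \<phi> (v + c *\<^sub>R x) \<noteq> 0}"
    then have "v + c *\<^sub>R x \<in> ?K" by (intro subsetD[OF closure_subset]) simp
    moreover have "x = ?T (v + c *\<^sub>R x)" using assms by simp
    ultimately show "x \<in> ?T ` ?K" by blast
  qed
  ultimately have "closure {x. \<phi> (v + c *\<^sub>R x) \<noteq> 0} \<subseteq> ?T ` ?K"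
    by (intro closure_minimal) (auto intro: compact_imp_closed)
  with \<open>compact (?T ` ?K)\<close> have "compact (closure {x. \<phi> (v + c *\<^sub>R x) \<noteq> 0})"
    by (metis closed_closure compact_Int_closed inf.absorb_iff2)
  then show ?thesis using assms C_k_affine[of _ \<phi> v c] by (simp add: test_function_def)
qed

lemma test_functionI_bounded:
  assumes "\<And>k. C_k k \<phi>" "\<And>x. norm x > R \<Longrightarrow> \<phi> x = 0"
  shows "test_function \<phi>"
proof -
  have "{x. \<phi> x \<noteq> 0} \<subseteq> cball 0 R" using assms(2) by (fastforce simp: not_less[symmetric])
  then have "bounded {x. \<phi> x \<noteq> 0}" using bounded_cball bounded_subset by blast
  then show ?thesis using assms by (simp add: test_function_def)
qed

lemma test_function_bounds:
  assumes "test_function \<phi>"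
  shows "\<exists>R>0. \<exists>M>0. (\<forall>x. \<bar>\<phi> x\<bar> \<le> M) \<and> (\<forall>x. norm x > R \<longrightarrow> \<phi> x = 0)"
proof -
  have K: "compact (closure {x. \<phi> x \<noteq> 0})" and c: "continuous_on UNIV \<phi>"
    using assms C_k.simps(1) unfolding test_function_def by blast+
  have "bounded (closure {x. \<phi> x \<noteq> 0})" using K compact_imp_bounded by blast
  then obtain R where R: "R > 0" "\<And>x. x \<in> closure {x. \<phi> x \<noteq> 0} \<Longrightarrow> norm x \<le> R"
    using bounded_pos by blast
  have "bounded (\<phi> ` closure {x. \<phi> x \<noteq> 0})"
    by (intro compact_imp_bounded compact_continuous_image K continuous_on_subset[OF c]) auto
  then obtain M where M: "M > 0" "\<And>x. x \<in> closure {x. \<phi> x \<noteq> 0} \<Longrightarrow> \<bar>\<phi> x\<bar> \<le> M"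
    unfolding bounded_pos by auto
  have "\<bar>\<phi> x\<bar> \<le> M" for x
      using M closure_subset[of "{x. \<phi> x \<noteq> 0}"] by (cases "\<phi> x = 0") auto
  moreover have "norm x > R \<Longrightarrow> \<phi> x = 0" for x
      using R(2)[of x] closure_subset[of "{x. \<phi> x \<noteq> 0}"] by (cases "\<phi> x = 0") auto
  ultimately show ?thesis using R(1) M(1) by blast
qed

lemma test_function_mult_smooth:
  assumes "test_function \<phi>" "\<And>k. C_k k \<eta>"
  shows "test_function (\<lambda>x. \<phi> x * \<eta> x)"
proof -
  obtain R M where R: "R > 0" "M > 0" "\<And>x. \<bar>\<phi> x\<bar> \<le> M" "\<And>x. norm x > R \<Longrightarrow> \<phi> x = 0"
    using test_function_bounds[OF assms(1)] by blast
  show ?thesis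
    by (rule test_functionI_bounded[where R=R])
       (use assms R in \<open>auto simp: test_function_def intro!: C_k_mult\<close>)
qed

lemma test_function_has_derivative:
  assumes "test_function \<phi>"
  shows "(\<phi> has_derivative frechet_derivative \<phi> (at x)) (at x)"
proof -
  have "C_k (Suc 0) \<phi>" using assms by (simp add: test_function_def)
  then show ?thesis by (simp add: frechet_derivative_works[symmetric])
qed

lemma test_function_derivative:
  assumes "test_function \<phi>"
  shows "test_function (\<lambda>x. frechet_derivative \<phi> (at x) v)"
proof -
  obtain R M where R: "R > 0" "M > 0" "\<And>x. \<bar>\<phi> x\<bar> \<le> M" "\<And>x. norm x > R \<Longrightarrow> \<phi> x = 0"
    using test_function_bounds[OF assms] by blast
  show ?thesis
  proof (rule test_functionI_bounded[where R=R])
    show "C_k k (\<lambda>x. frechet_derivative \<phi> (at x) v)" for k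
      using assms C_k.simps(2) unfolding test_function_def by blast
    fix x :: "real ^ 'a" assume x: "norm x > R"
    have "((\<lambda>_. 0) has_derivative (\<lambda>_. 0)) (at x)" by simp
    then have "(\<phi> has_derivative (\<lambda>_. 0)) (at x)"
      by (rule has_derivative_transform_within_open[where s="{x. norm x > R}"])
         (use x R in \<open>auto intro!: open_Collect_less continuous_intros\<close>)
    from frechet_derivative_at[OF this, symmetric] show "frechet_derivative \<phi> (at x) v = 0" by simp
  qed
qed

lemma test_function_continuous: "test_function \<phi> \<Longrightarrow> continuous_on UNIV \<phi>"
  unfolding test_function_def using C_k.simps(1) by blast

lemma test_function_measurable [measurable_dest]: "test_function \<phi> \<Longrightarrow> \<phi> \<in> borel_measurable borel"
  using test_function_continuous borel_measurable_continuous_onI by blast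

section \<open>Smooth approximation of the indicator of a box\<close>

lemma smooth_fn_prod: "finite I \<Longrightarrow> (\<And>i. i \<in> I \<Longrightarrow> smooth_fn (f i)) \<Longrightarrow> smooth_fn (\<lambda>x. \<Prod>i\<in>I. f i x)"
  by (induction rule: finite_induct) (auto intro: smooth_fn.intros)

lemma smooth_fn_component: "smooth_fn (\<lambda>x::real^'n. x $ i)"
  using smooth_inner[of "axis i 1"] by (simp add: inner_axis')

text \<open>As m grows, each factor tends to 1 strictly between the two faces, so these test
  functions tend boundedly to the indicator of the open box. The sums with \<open>- a $ i\<close>
  and \<open>(-1) * x $ i\<close> are written in the shape of the rules of
  \<open>smooth_fn\<close>.\<close>

definition box_bump :: "nat \<Rightarrow> real ^ 'n \<Rightarrow> real ^ 'n \<Rightarrow> real ^ 'n \<Rightarrow> real" where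
  "box_bump m a b x = (\<Prod>i\<in>UNIV. exp_bump 0 (of_nat m * ((x $ i + (- a $ i)) * (b $ i + (-1) * x $ i))))"

text \<open>If a side is reversed, the two linear factors can both be negative and their product
  positive, so the bump need not vanish although the box is empty; hence the exceptional
  alternative.\<close>

lemma box_bump_zero: "x \<notin> box a b \<Longrightarrow> box_bump m a b x = 0 \<or> (\<exists>i. a $ i > b $ i)"
proof -
  assume "x \<notin> box a b"
  then obtain i where "\<not> (a $ i < x $ i \<and> x $ i < b $ i)" by (auto simp: mem_box_cart)
  then show ?thesis
  proof (cases "a $ i > b $ i")
    case False
    with \<open>\<not> (a $ i < x $ i \<and> x $ i < b $ i)\<close>
    have "(x $ i - a $ i) * (b $ i - x $ i) \<le> 0"
      by (cases "x $ i \<le> a $ i") (auto simp: mult_le_0_iff)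
    then have "exp_bump 0 (of_nat m * ((x $ i + (- a $ i)) * (b $ i + (-1) * x $ i))) = 0"
      by (simp add: exp_bump_def mult_nonneg_nonpos)
    then show ?thesis unfolding box_bump_def by (auto intro!: prod_zero)
  qed auto
qed

lemma box_bump_01: "0 \<le> box_bump m a b x" "box_bump m a b x \<le> 1"
  unfolding box_bump_def
  by (auto intro!: prod_nonneg prod_le_1 simp: exp_bump_0_nonneg exp_bump_0_le_1)

lemma box_bump_tendsto:
  fixes x :: "real ^ 'n"
  assumes "x \<in> box a b" shows "(\<lambda>m. box_bump m a b x) \<longlonglongrightarrow> 1"
proof -
  have *: "(\<lambda>m. exp_bump 0 (of_nat m * c)) \<longlonglongrightarrow> 1" if "c > 0" for c
  proof -
    have "(\<lambda>m. - 1 / (of_nat m * c)) \<longlonglongrightarrow> 0"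
      by (rule tendsto_divide_0[OF tendsto_const])
         (intro filterlim_at_top_imp_at_infinity
           filterlim_at_top_mult_tendsto_pos[OF tendsto_const that] filterlim_real_sequentially)
    from tendsto_exp[OF this] have "(\<lambda>m. exp (- 1 / (of_nat m * c))) \<longlonglongrightarrow> 1" by simp
    moreover have "\<forall>\<^sub>F m in sequentially. exp (- 1 / (of_nat m * c)) = exp_bump 0 (of_nat m * c)"
      using eventually_gt_at_top[of 0]
      by eventually_elim (use that in \<open>auto simp: exp_bump_def mult_le_0_iff\<close>)
    ultimately show ?thesis by (rule Lim_transform_eventually)
  qed
  have "(\<lambda>m. box_bump m a b x) \<longlonglongrightarrow> (\<Prod>i\<in>(UNIV::'n set). 1)"
    unfolding box_bump_def using assms
    by (intro tendsto_prod *) (auto simp: mem_box_cart)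
  then show ?thesis by simp
qed

lemma test_function_box_bump:
  fixes a b :: "real ^ 'n"
  assumes "\<And>i. a $ i \<le> b $ i"
  shows "test_function (box_bump m a b)"
proof -
  have "bounded (box a b)" by simp
  then obtain R where R: "\<And>x. x \<in> box a b \<Longrightarrow> norm x \<le> R" using bounded_pos by blast
  show ?thesis
  proof (rule test_functionI_bounded[where R=R])
    have "smooth_fn (box_bump m a b)"
      unfolding box_bump_def
      by (intro smooth_fn_prod smooth_fn.intros smooth_fn_component finite)
    then show "C_k k (box_bump m a b)" for k by (rule smooth_fn_C_k)
    show "box_bump m a b x = 0" if "norm x > R" for x
      using box_bump_zero[of x a b m] R[of x] that assms by (auto simp: not_less[symmetric])
  qed
qed

subsection \<open>Locally integrable functions\<close>

lemma sets_lebesgue_borel [measurable, simp]: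
  "cball a r \<in> sets lebesgue" "ball a r \<in> sets lebesgue" "box b c \<in> sets lebesgue"
  by (auto intro: sets_completionI_sets)

lemma sets_borel_balls [measurable]:
  "cball a r \<in> sets borel" "ball a r \<in> sets borel" "box b c \<in> sets borel"
  by simp_all

text \<open>For Borel f the map (x, s) -> f (x + s v) is measurable for the product of the Borel
  structures, as Fubini requires; for a merely Lebesgue measurable f this can fail. Each coordinate
  is replaced by a Borel function and the vector is reassembled.\<close>

lemma borel_version:
  fixes f :: "real ^ 'n \<Rightarrow> 'b::euclidean_space"
  assumes "f \<in> borel_measurable lebesgue"
  shows "\<exists>f'\<in>borel_measurable borel. AE x in lebesgue. f x = f' x"
proof -
  have "\<forall>b\<in>Basis. \<exists>g\<in>borel_measurable lborel. AE x in lborel. f x \<bullet> b = g x"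
    using assms by (intro ballI completion_ex_borel_measurable_real) auto
  then obtain g where g: "\<And>b. b \<in> Basis \<Longrightarrow> g b \<in> borel_measurable lborel"
      "\<And>b. b \<in> Basis \<Longrightarrow> AE x in lborel. f x \<bullet> b = g b x"
    by metis
  show ?thesis
  proof
    show "(\<lambda>x. \<Sum>b\<in>Basis. g b x *\<^sub>R b) \<in> borel_measurable borel"
      using g(1) by (intro borel_measurable_sum borel_measurable_scaleR) auto
    have "AE x in lebesgue. \<forall>b\<in>Basis. f x \<bullet> b = g b x"
      using g(2) by (intro AE_finite_allI) (auto simp: AE_completion_iff)
    then show "AE x in lebesgue. f x = (\<Sum>b\<in>Basis. g b x *\<^sub>R b)"
    proof eventually_elim
      case (elim x)
      then have "(\<Sum>b\<in>Basis. g b x *\<^sub>R b) = (\<Sum>b\<in>Basis. (f x \<bullet> b) *\<^sub>R b)"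
        by (intro sum.cong) auto
      then show ?case by (simp add: euclidean_representation)
    qed
  qed
qed

lemma Lspace_loc_1_iff:
  "f \<in> Lspace_loc 1 \<longleftrightarrow> f \<in> borel_measurable lebesgue \<and>
    (\<forall>R. (\<integral>\<^sup>+x. ennreal (norm (f x)) * indicator (cball 0 R) x \<partial>lebesgue) < \<infinity>)"
proof -
  have "(\<integral>\<^sup>+x. ennreal (norm (f x)) * indicator K x \<partial>lebesgue) < \<infinity>"
    if fin: "\<forall>R. (\<integral>\<^sup>+x. ennreal (norm (f x)) * indicator (cball 0 R) x \<partial>lebesgue) < \<infinity>"
      and K: "compact K" for K
  proof -
    obtain R where "\<forall>x\<in>K. norm x \<le> R"
      using compact_imp_bounded[OF K] unfolding bounded_iff by blast
    then have "K \<subseteq> cball 0 R" by auto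
    then have "(\<integral>\<^sup>+x. ennreal (norm (f x)) * indicator K x \<partial>lebesgue)
      \<le> (\<integral>\<^sup>+x. ennreal (norm (f x)) * indicator (cball 0 R) x \<partial>lebesgue)"
      by (intro nn_integral_mono) (auto simp: indicator_def)
    then show ?thesis using fin[rule_format, of R] by simp
  qed
  then show ?thesis
    unfolding Lspace_loc_def by (simp add: powr_one_gt_zero_iff) (meson compact_cball)
qed

lemma integrable_test_mult:
  fixes f :: "real ^ 'n \<Rightarrow> 'b::euclidean_space"
  assumes f: "f \<in> Lspace_loc 1" and [measurable]: "\<phi> \<in> borel_measurable lebesgue"
    and M: "\<And>x. \<bar>\<phi> x\<bar> \<le> M" and R: "\<And>x. norm x > R \<Longrightarrow> \<phi> x = 0"
  shows "integrable lebesgue (\<lambda>x. \<phi> x *\<^sub>R f x)"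
proof (rule integrableI_bounded)
  have [measurable]: "f \<in> borel_measurable lebesgue" using f by (simp add: Lspace_loc_1_iff)
  show "(\<lambda>x. \<phi> x *\<^sub>R f x) \<in> borel_measurable lebesgue" by measurable
  have M0: "0 \<le> M" using M[of undefined] by linarith
  have "(\<integral>\<^sup>+x. ennreal (norm (\<phi> x *\<^sub>R f x)) \<partial>lebesgue)
    \<le> (\<integral>\<^sup>+x. ennreal M * (ennreal (norm (f x)) * indicator (cball 0 R) x) \<partial>lebesgue)"
  proof (rule nn_integral_mono)
    fix x
    show "ennreal (norm (\<phi> x *\<^sub>R f x)) \<le> ennreal M * (ennreal (norm (f x)) * indicator (cball 0 R) x)"
      using R[of x] M[of x] M0
      by (cases "norm x > R") (auto simp: ennreal_mult[symmetric] intro!: ennreal_leI mult_right_mono)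
  qed
  also have "\<dots> = ennreal M * (\<integral>\<^sup>+x. (ennreal (norm (f x)) * indicator (cball 0 R) x) \<partial>lebesgue)"
    by (rule nn_integral_cmult) measurable
  also have "\<dots> < \<infinity>" using f by (auto simp: Lspace_loc_1_iff ennreal_mult_less_top)
  finally show "(\<integral>\<^sup>+x. ennreal (norm (\<phi> x *\<^sub>R f x)) \<partial>lebesgue) < \<infinity>" .
qed

lemma test_function_lebesgue_measurable [measurable_dest]:
  "test_function \<phi> \<Longrightarrow> \<phi> \<in> borel_measurable lebesgue"
  using test_function_measurable measurable_completion[of \<phi> lborel borel] by auto

lemma integrable_test_function_mult:
  fixes f :: "real ^ 'n \<Rightarrow> 'b::euclidean_space"
  assumes "f \<in> Lspace_loc 1" "test_function \<phi>"
  shows "integrable lebesgue (\<lambda>x. \<phi> x *\<^sub>R f x)"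
proof -
  obtain R M where "\<And>x. \<bar>\<phi> x\<bar> \<le> M" "\<And>x. norm x > R \<Longrightarrow> \<phi> x = 0"
    using test_function_bounds[OF assms(2)] by blast
  then show ?thesis
    by (rule integrable_test_mult[OF assms(1) test_function_lebesgue_measurable[OF assms(2)]])
qed

lemma enn2real_eqD: "a \<noteq> \<infinity> \<Longrightarrow> b \<noteq> \<infinity> \<Longrightarrow> enn2real a = enn2real b \<Longrightarrow> a = b"
  by (cases a rule: ennreal_cases; cases b rule: ennreal_cases) auto

text \<open>Box bumps tend boundedly to indicators of boxes, so f has integral 0 over each box. Its
  positive and negative parts, taken as densities, then agree on an intersection-stable generator of
  the Borel sets, hence as measures, and densities are unique almost everywhere.\<close>

lemma fundamental_lemma_real:
  fixes f :: "real ^ 'n \<Rightarrow> real"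
  assumes f: "f \<in> Lspace_loc 1"
    and 0: "\<And>\<phi>. test_function \<phi> \<Longrightarrow> (\<integral>x. \<phi> x *\<^sub>R f x \<partial>lebesgue) = 0"
  shows "AE x in lebesgue. f x = 0"
proof -
  have [measurable]: "f \<in> borel_measurable lebesgue" using f by (simp add: Lspace_loc_1_iff)
  obtain g where g [measurable]: "g \<in> borel_measurable borel" and fg: "AE x in lebesgue. f x = g x"
    using borel_version[of f] \<open>f \<in> borel_measurable lebesgue\<close> by blast
  define P where "P = (\<lambda>x. ennreal (g x))"
  define N where "N = (\<lambda>x. ennreal (- g x))"
  have [measurable]: "P \<in> borel_measurable borel" "N \<in> borel_measurable borel"
    unfolding P_def N_def by measurable
  have int: "integrable lebesgue (\<lambda>x. indicator (box a b) x *\<^sub>R f x)" for a b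
  proof -
    have "bounded (box a b)" by simp
    then obtain R where R: "\<And>x. x \<in> box a b \<Longrightarrow> norm x \<le> R" using bounded_pos by blast
    show ?thesis
    proof (rule integrable_test_mult[OF f, where M=1 and R=R])
      show "indicator (box a b) \<in> borel_measurable lebesgue" by measurable
    qed (use R in \<open>auto simp: indicator_def not_less[symmetric]\<close>)
  qed
  have eq0: "(\<integral>x. indicator (box a b) x *\<^sub>R f x \<partial>lebesgue) = 0" if ab: "\<And>i. a $ i \<le> b $ i" for a b
  proof -
    have "(\<lambda>m. \<integral>x. box_bump m a b x *\<^sub>R f x \<partial>lebesgue)
      \<longlonglongrightarrow> (\<integral>x. indicator (box a b) x *\<^sub>R f x \<partial>lebesgue)"
    proof (rule integral_dominated_convergence[where w="\<lambda>x. norm (indicator (box a b) x *\<^sub>R f x)"])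
      show "integrable lebesgue (\<lambda>x. norm (indicator (box a b) x *\<^sub>R f x))" using int by simp
      show "(\<lambda>x. box_bump m a b x *\<^sub>R f x) \<in> borel_measurable lebesgue" for m
        using test_function_lebesgue_measurable[OF test_function_box_bump[OF ab]] by measurable
      show "AE x in lebesgue. (\<lambda>m. box_bump m a b x *\<^sub>R f x) \<longlonglongrightarrow> indicator (box a b) x *\<^sub>R f x"
      proof (rule AE_I2)
        fix x
        show "(\<lambda>m. box_bump m a b x *\<^sub>R f x) \<longlonglongrightarrow> indicator (box a b) x *\<^sub>R f x"
        proof (cases "x \<in> box a b")
          case True
          then show ?thesis by (auto intro!: tendsto_eq_intros box_bump_tendsto)
        next
          case False
          then have "box_bump m a b x = 0" for m
            using box_bump_zero[OF False, of m] ab by (auto simp: not_less[symmetric])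
          then show ?thesis using False by simp
        qed
      qed
      show "AE x in lebesgue. norm (box_bump m a b x *\<^sub>R f x) \<le> norm (indicator (box a b) x *\<^sub>R f x)" for m
      proof (rule AE_I2)
        fix x
        show "norm (box_bump m a b x *\<^sub>R f x) \<le> norm (indicator (box a b) x *\<^sub>R f x)"
        proof (cases "x \<in> box a b")
          case True
          then show ?thesis using box_bump_01[of m a b x]
            by (auto simp: abs_mult intro!: mult_left_le_one_le)
        next
          case False
          then have "box_bump m a b x = 0"
            using box_bump_zero[OF False, of m] ab by (auto simp: not_less[symmetric])
          then show ?thesis by simp
        qed
      qed
    qed simp
    moreover have "(\<integral>x. box_bump m a b x *\<^sub>R f x \<partial>lebesgue) = 0" for m
      by (rule 0[OF test_function_box_bump[OF ab]])
    ultimately show ?thesis by (simp add: LIMSEQ_const_iff)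
  qed
  have PN: "(\<integral>\<^sup>+x. P x * indicator (box a b) x \<partial>lborel) = (\<integral>\<^sup>+x. N x * indicator (box a b) x \<partial>lborel) \<and>
     (\<integral>\<^sup>+x. P x * indicator (box a b) x \<partial>lborel) \<noteq> \<infinity>" for a b
  \<comment> \<open>A reversed side spoils the bump, but the box is then empty and both integrals
    vanish.\<close>
  proof (cases "\<forall>i. a $ i \<le> b $ i")
    case False
    then have "box a b = {}" by (auto simp: interval_eq_empty_cart not_le intro: less_imp_le)
    then show ?thesis by simp
  next
    case True
    let ?h = "\<lambda>x. indicator (box a b) x *\<^sub>R g x"
    have gf: "AE x in lebesgue. ?h x = indicator (box a b) x *\<^sub>R f x"
      using fg by eventually_elim simp
    have hi: "integrable lebesgue ?h"
      by (rule integrable_cong_AE_imp[OF int[of a b]]) (use gf in \<open>auto simp: measurable_completion\<close>)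
    then have hi': "integrable lborel ?h" by (subst (asm) integrable_completion) auto
    have "(\<integral>x. ?h x \<partial>lborel) = (\<integral>x. ?h x \<partial>lebesgue)"
      by (rule integral_completion[symmetric]) simp
    also have "\<dots> = (\<integral>x. indicator (box a b) x *\<^sub>R f x \<partial>lebesgue)"
      by (rule integral_cong_AE) (use gf in \<open>auto simp: measurable_completion\<close>)
    also have "\<dots> = 0" using eq0 True by blast
    finally have z: "(\<integral>x. ?h x \<partial>lborel) = 0" .
    have p: "(\<integral>\<^sup>+x. ennreal (?h x) \<partial>lborel) = (\<integral>\<^sup>+x. P x * indicator (box a b) x \<partial>lborel)"
      and n: "(\<integral>\<^sup>+x. ennreal (- ?h x) \<partial>lborel) = (\<integral>\<^sup>+x. N x * indicator (box a b) x \<partial>lborel)"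
      by (auto simp: P_def N_def indicator_def intro!: nn_integral_cong)
    have fin: "(\<integral>\<^sup>+x. ennreal (?h x) \<partial>lborel) \<noteq> \<infinity>" "(\<integral>\<^sup>+x. ennreal (- ?h x) \<partial>lborel) \<noteq> \<infinity>"
      using hi' by (auto simp: real_integrable_def)
    have "enn2real (\<integral>\<^sup>+x. ennreal (?h x) \<partial>lborel) = enn2real (\<integral>\<^sup>+x. ennreal (- ?h x) \<partial>lborel)"
      using z real_lebesgue_integral_def[OF hi'] by simp
    then have "(\<integral>\<^sup>+x. ennreal (?h x) \<partial>lborel) = (\<integral>\<^sup>+x. ennreal (- ?h x) \<partial>lborel)"
      using fin by (rule enn2real_eqD[rotated 2])
    then show ?thesis using p n fin by simp
  qed
  \<comment> \<open>Extending equality from the generator requires finite values on an exhausting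
    sequence of boxes; this is why \<open>PN\<close> also asserts finiteness.\<close>
  have "density lborel P = density lborel N"
  proof (rule measure_eqI_generator_eq[where E="range (\<lambda>(a, b). box a b :: (real ^ 'n) set)" and \<Omega>=UNIV
        and A="\<lambda>n::nat. box (- (real n *\<^sub>R One)) (real n *\<^sub>R One)"])
    show "Int_stable (range (\<lambda>(a, b). box a b :: (real ^ 'n) set))"
      by (auto simp: Int_stable_def box_Int_box)
    show "emeasure (density lborel P) X = emeasure (density lborel N) X"
      if "X \<in> range (\<lambda>(a, b). box a b)" for X
      using that PN by (auto simp: emeasure_density)
    show "emeasure (density lborel P) (box (- (real i *\<^sub>R One)) (real i *\<^sub>R One)) \<noteq> \<infinity>" for i
      using PN[of "- (real i *\<^sub>R One)" "real i *\<^sub>R One", THEN conjunct2] by (simp add: emeasure_density)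
    show "(\<Union>i::nat. box (- (real i *\<^sub>R One)) (real i *\<^sub>R One)) = (UNIV :: (real ^ 'n) set)"
      by (rule UN_box_eq_UNIV)
  qed (auto simp: borel_eq_box)
  then have "AE x in lborel. P x = N x"
    by (subst (asm) sigma_finite_measure.density_unique_iff[OF lborel.sigma_finite_measure_axioms]) auto
  then have "AE x in lebesgue. P x = N x" by (simp add: AE_completion_iff)
  with fg show ?thesis
  proof eventually_elim
    case (elim x)
    then have "ennreal (g x) = ennreal (- g x)" by (simp add: P_def N_def)
    then have "g x = 0"
      by (cases "g x" "0::real" rule: linorder_cases)
         (auto simp: ennreal_neg ennreal_eq_0_iff dest: sym)
    then show ?case using elim by simp
  qed
qed

lemma fundamental_lemma:
  fixes f :: "real ^ 'n \<Rightarrow> complex"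
  assumes f: "f \<in> Lspace_loc 1"
    and 0: "\<And>\<phi>. test_function \<phi> \<Longrightarrow> (\<integral>x. \<phi> x *\<^sub>R f x \<partial>lebesgue) = 0"
  shows "AE x in lebesgue. f x = 0"
proof -
  have [measurable]: "f \<in> borel_measurable lebesgue" using f by (simp add: Lspace_loc_1_iff)
  have loc: "(\<lambda>x. L (f x)) \<in> Lspace_loc 1" if [measurable]: "L \<in> borel_measurable borel"
    and L: "\<And>z. \<bar>L z\<bar> \<le> norm z" for L :: "complex \<Rightarrow> real"
    unfolding Lspace_loc_1_iff
  proof (intro conjI allI)
    fix R
    have "(\<integral>\<^sup>+x. ennreal (norm (L (f x))) * indicator (cball 0 R) x \<partial>lebesgue)
      \<le> (\<integral>\<^sup>+x. ennreal (norm (f x)) * indicator (cball 0 R) x \<partial>lebesgue)"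
      by (intro nn_integral_mono mult_right_mono) (auto intro!: ennreal_leI L)
    also have "\<dots> < \<infinity>" using f by (auto simp: Lspace_loc_1_iff)
    finally show "(\<integral>\<^sup>+x. ennreal (norm (L (f x))) * indicator (cball 0 R) x \<partial>lebesgue) < \<infinity>" .
  qed measurable
  have "AE x in lebesgue. Re (f x) = 0"
  proof (rule fundamental_lemma_real)
    fix \<phi> :: "real ^ 'n \<Rightarrow> real" assume \<phi>: "test_function \<phi>"
    show "(\<integral>x. \<phi> x *\<^sub>R Re (f x) \<partial>lebesgue) = 0"
      using integral_Re[OF integrable_test_function_mult[OF f \<phi>]] 0[OF \<phi>] by simp
  qed (rule loc, simp_all add: abs_Re_le_cmod)
  moreover have "AE x in lebesgue. Im (f x) = 0"
  proof (rule fundamental_lemma_real)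
    fix \<phi> :: "real ^ 'n \<Rightarrow> real" assume \<phi>: "test_function \<phi>"
    show "(\<integral>x. \<phi> x *\<^sub>R Im (f x) \<partial>lebesgue) = 0"
      using integral_Im[OF integrable_test_function_mult[OF f \<phi>]] 0[OF \<phi>] by simp
  qed (rule loc, simp_all add: abs_Im_le_cmod)
  ultimately show ?thesis by eventually_elim (simp add: complex_eq_iff)
qed

section \<open>Affine changes of variables\<close>

lemma lebesgue_affine:
  fixes t :: "real ^ 'n"
  assumes "c \<noteq> 0"
  shows "lebesgue = density (distr lebesgue lebesgue (\<lambda>x. t + c *\<^sub>R x)) (\<lambda>_. ennreal (\<bar>c\<bar> ^ CARD('n)))"
    and lebesgue_affine_measurable': "(\<lambda>x. t + c *\<^sub>R x) \<in> lebesgue \<rightarrow>\<^sub>M lebesgue"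
  using lebesgue_affine_euclidean[where c="\<lambda>_::real ^ 'n. c" and t=t]
    lebesgue_affine_measurable[where c="\<lambda>_::real ^ 'n. c" and t=t] assms
  unfolding scaleR_scaleR[symmetric] scaleR_sum_right[symmetric] euclidean_representation prod_constant
  by (simp_all add: ennreal_power)

lemma measurable_affine:
  fixes t :: "real ^ 'n"
  assumes "c \<noteq> 0" "f \<in> borel_measurable lebesgue"
  shows "(\<lambda>x. f (t + c *\<^sub>R x)) \<in> borel_measurable lebesgue"
  using measurable_compose[OF lebesgue_affine_measurable'[OF assms(1)] assms(2)] .

lemma nn_integral_affine:
  fixes t :: "real ^ 'n"
  assumes "c \<noteq> 0" and [measurable]: "f \<in> borel_measurable lebesgue"
  shows "(\<integral>\<^sup>+x. f x \<partial>lebesgue) = ennreal (\<bar>c\<bar> ^ CARD('n)) * (\<integral>\<^sup>+x. f (t + c *\<^sub>R x) \<partial>lebesgue)"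
proof -
  note [measurable] = lebesgue_affine_measurable'[OF assms(1), of t] measurable_affine[OF assms, of t]
  show ?thesis
    by (subst lebesgue_affine[OF assms(1), of t])
       (simp add: nn_integral_density nn_integral_distr nn_integral_cmult)
qed

lemma integral_affine:
  fixes t :: "real ^ 'n" and f :: "real ^ 'n \<Rightarrow> 'b::euclidean_space"
  assumes "c \<noteq> 0" and [measurable]: "f \<in> borel_measurable lebesgue"
  shows "(\<integral>x. f x \<partial>lebesgue) = \<bar>c\<bar> ^ CARD('n) *\<^sub>R (\<integral>x. f (t + c *\<^sub>R x) \<partial>lebesgue)"
proof -
  note [measurable] = lebesgue_affine_measurable'[OF assms(1), of t] measurable_affine[OF assms, of t]
  show ?thesis
    by (subst lebesgue_affine[OF assms(1), of t])
       (simp add: integral_density integral_distr)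
qed

subsection \<open>Weak gradients and translations\<close>

lemma Lspace_loc_1_bound:
  fixes f :: "real ^ 'n \<Rightarrow> 'b::euclidean_space" and g :: "real ^ 'n \<Rightarrow> 'c::euclidean_space"
    and k :: "real ^ 'n \<Rightarrow> 'd::euclidean_space"
  assumes [measurable]: "f \<in> borel_measurable lebesgue"
    and g: "g \<in> Lspace_loc 1" and k: "k \<in> Lspace_loc 1" and C: "0 \<le> C" "0 \<le> D"
    and le: "\<And>x. norm (f x) \<le> C * norm (g x) + D * norm (k x)"
  shows "f \<in> Lspace_loc 1"
  unfolding Lspace_loc_1_iff
proof (intro conjI allI)
  have [measurable]: "g \<in> borel_measurable lebesgue" "k \<in> borel_measurable lebesgue"
    using g k by (simp_all add: Lspace_loc_1_iff)
  fix R
  have "(\<integral>\<^sup>+x. ennreal (norm (f x)) * indicator (cball 0 R) x \<partial>lebesgue)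
    \<le> (\<integral>\<^sup>+x. ennreal C * (ennreal (norm (g x)) * indicator (cball 0 R) x)
         + ennreal D * (ennreal (norm (k x)) * indicator (cball 0 R) x) \<partial>lebesgue)"
    using le C
    by (intro nn_integral_mono)
       (auto simp: indicator_def ennreal_mult[symmetric] ennreal_plus[symmetric]
         simp del: ennreal_plus intro!: ennreal_leI)
  also have "\<dots> = ennreal C * (\<integral>\<^sup>+x. ennreal (norm (g x)) * indicator (cball 0 R) x \<partial>lebesgue)
     + ennreal D * (\<integral>\<^sup>+x. ennreal (norm (k x)) * indicator (cball 0 R) x \<partial>lebesgue)"
    by (simp add: nn_integral_add nn_integral_cmult)
  also have "\<dots> < \<infinity>"
    using g k by (auto simp: Lspace_loc_1_iff ennreal_mult_less_top)
  finally show "(\<integral>\<^sup>+x. ennreal (norm (f x)) * indicator (cball 0 R) x \<partial>lebesgue) < \<infinity>" .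
qed measurable

lemma Lspace_loc_1_affine:
  fixes f :: "real ^ 'n \<Rightarrow> 'b::euclidean_space"
  assumes f: "f \<in> Lspace_loc 1" and c: "c \<noteq> 0"
  shows "(\<lambda>x. f (v + c *\<^sub>R x)) \<in> Lspace_loc 1"
  unfolding Lspace_loc_1_iff
proof (intro conjI allI)
  have [measurable]: "f \<in> borel_measurable lebesgue" using f by (simp add: Lspace_loc_1_iff)
  show "(\<lambda>x. f (v + c *\<^sub>R x)) \<in> borel_measurable lebesgue" by (rule measurable_affine[OF c]) measurable
  fix R
  let ?R = "norm v + \<bar>c\<bar> * R"
  let ?g = "\<lambda>x. ennreal (norm (f x)) * indicator (cball 0 ?R) x"
  have "(\<integral>\<^sup>+x. ennreal (norm (f (v + c *\<^sub>R x))) * indicator (cball 0 R) x \<partial>lebesgue)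
     \<le> (\<integral>\<^sup>+x. ?g (v + c *\<^sub>R x) \<partial>lebesgue)"
  proof (intro nn_integral_mono)
    fix x
    have "norm x \<le> R \<Longrightarrow> norm (v + c *\<^sub>R x) \<le> ?R"
      by (rule order_trans[OF norm_triangle_ineq]) (auto intro: mult_left_mono)
    then show "ennreal (norm (f (v + c *\<^sub>R x))) * indicator (cball 0 R) x \<le> ?g (v + c *\<^sub>R x)"
      by (auto simp: indicator_def)
  qed
  also have "\<dots> < \<infinity>"
  proof -
    have "?g \<in> borel_measurable lebesgue" by measurable
    from nn_integral_affine[OF c this, of v]
    have "ennreal (\<bar>c\<bar> ^ CARD('n)) * (\<integral>\<^sup>+x. ?g (v + c *\<^sub>R x) \<partial>lebesgue) = (\<integral>\<^sup>+x. ?g x \<partial>lebesgue)"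
      by (rule sym)
    also have "\<dots> < \<infinity>" using f by (simp add: Lspace_loc_1_iff)
    finally have *: "ennreal (\<bar>c\<bar> ^ CARD('n)) * (\<integral>\<^sup>+x. ?g (v + c *\<^sub>R x) \<partial>lebesgue) < \<infinity>" .
    have "\<bar>c\<bar> ^ CARD('n) > 0" using c by simp
    then have "ennreal (\<bar>c\<bar> ^ CARD('n)) \<noteq> 0" by (simp add: ennreal_eq_0_iff not_le)
    then show ?thesis using * by (auto simp: ennreal_mult_less_top)
  qed
  finally show "(\<integral>\<^sup>+x. ennreal (norm (f (v + c *\<^sub>R x))) * indicator (cball 0 R) x \<partial>lebesgue) < \<infinity>" .
qed

text \<open>The product v . h is bilinear and complex-valued; the inner product of the type
  \<open>complex ^ 'n\<close> is real-valued and would lose the imaginary part.\<close>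

definition along :: "real ^ 'n \<Rightarrow> (real ^ 'n \<Rightarrow> complex ^ 'n) \<Rightarrow> real ^ 'n \<Rightarrow> complex" where
  "along v h x = (\<Sum>j\<in>UNIV. v $ j *\<^sub>R h x $ j)"

lemma norm_along_le: "norm (along v h x) \<le> norm v * norm (h x)"
proof -
  have "norm (along v h x) \<le> (\<Sum>j\<in>UNIV. \<bar>v $ j\<bar> * \<bar>norm (h x $ j)\<bar>)"
    unfolding along_def by (rule order_trans[OF norm_sum]) simp
  also have "\<dots> \<le> norm v * norm (h x)"
    using L2_set_mult_ineq[of "\<lambda>j. v $ j" "\<lambda>j. norm (h x $ j)" UNIV]
    by (simp add: norm_vec_def L2_set_def)
  finally show ?thesis .
qed

lemma along_scaleR: "along (t *\<^sub>R v) h x = t *\<^sub>R along v h x"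
  by (simp add: along_def scaleR_sum_right)

lemma along_axis: "along (axis j 1) h x = h x $ j"
proof -
  have "along (axis j 1) h x = (\<Sum>i\<in>UNIV. if i = j then h x $ i else 0)"
    unfolding along_def by (rule sum.cong) (auto simp: axis_def)
  then show ?thesis by simp
qed

lemma measurable_vec_nth [measurable (raw)]:
  fixes h :: "'a \<Rightarrow> 'b::euclidean_space ^ 'n"
  assumes "h \<in> borel_measurable M" shows "(\<lambda>x. h x $ j) \<in> borel_measurable M"
  using assms by (rule measurable_compose)
    (auto intro!: borel_measurable_continuous_onI continuous_intros)

lemma measurable_along [measurable (raw)]:
  "h \<in> borel_measurable M \<Longrightarrow> along v h \<in> borel_measurable M"
  unfolding along_def[abs_def] by measurable

lemma Lspace_loc_1_along:
  assumes h: "h \<in> Lspace_loc 1" shows "along v h \<in> Lspace_loc 1"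
proof (rule Lspace_loc_1_bound[OF _ h h])
  show "along v h \<in> borel_measurable lebesgue"
    using h by (intro measurable_along) (simp add: Lspace_loc_1_iff)
  show "norm (along v h x) \<le> norm v * norm (h x) + 0 * norm (h x)" for x
    using norm_along_le[of v h x] by simp
qed auto

lemma weak_gradient_along:
  fixes \<psi> :: "real ^ 'n \<Rightarrow> complex"
  assumes w: "weak_gradient \<psi> h" and \<phi>: "test_function \<phi>"
  shows "(\<integral>x. frechet_derivative \<phi> (at x) v *\<^sub>R \<psi> x \<partial>lebesgue) = - (\<integral>x. \<phi> x *\<^sub>R along v h x \<partial>lebesgue)"
proof -
  have \<psi>: "\<psi> \<in> Lspace_loc 1" and h: "h \<in> Lspace_loc 1" using w by (auto simp: weak_gradient_def)
  have d: "frechet_derivative \<phi> (at x) v = (\<Sum>j\<in>UNIV. v $ j * frechet_derivative \<phi> (at x) (axis j 1))" for x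
  proof -
    have l: "linear (frechet_derivative \<phi> (at x))"
      using test_function_has_derivative[OF \<phi>, of x] has_derivative_linear by blast
    have "v = (\<Sum>j\<in>UNIV. v $ j *\<^sub>R axis j 1)"
      using basis_expansion[of v] by (simp add: scalar_mult_eq_scaleR)
    then have "frechet_derivative \<phi> (at x) v = frechet_derivative \<phi> (at x) (\<Sum>j\<in>UNIV. v $ j *\<^sub>R axis j 1)"
      by (rule arg_cong)
    also have "\<dots> = (\<Sum>j\<in>UNIV. frechet_derivative \<phi> (at x) (v $ j *\<^sub>R axis j 1))"
      by (rule linear_sum[OF l])
    finally show ?thesis by (simp add: linear_scale[OF l])
  qed
  have i1: "integrable lebesgue (\<lambda>x. frechet_derivative \<phi> (at x) (axis j 1) *\<^sub>R \<psi> x)" for j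
    by (rule integrable_test_function_mult[OF \<psi> test_function_derivative[OF \<phi>]])
  have i2: "integrable lebesgue (\<lambda>x. \<phi> x *\<^sub>R h x $ j)" for j
    using integrable_test_function_mult[OF Lspace_loc_1_along[OF h, of "axis j 1"] \<phi>]
    by (simp add: along_axis)
  have "(\<integral>x. frechet_derivative \<phi> (at x) v *\<^sub>R \<psi> x \<partial>lebesgue)
     = (\<integral>x. (\<Sum>j\<in>UNIV. v $ j *\<^sub>R (frechet_derivative \<phi> (at x) (axis j 1) *\<^sub>R \<psi> x)) \<partial>lebesgue)"
    by (simp add: d scaleR_sum_left)
  also have "\<dots> = (\<Sum>j\<in>UNIV. v $ j *\<^sub>R (\<integral>x. frechet_derivative \<phi> (at x) (axis j 1) *\<^sub>R \<psi> x \<partial>lebesgue))"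
    using i1 by (subst Bochner_Integration.integral_sum) (auto simp del: scaleR_scaleR)
  also have "\<dots> = (\<Sum>j\<in>UNIV. v $ j *\<^sub>R (- (\<integral>x. \<phi> x *\<^sub>R h x $ j \<partial>lebesgue)))"
    using w \<phi> by (simp add: weak_gradient_def)
  also have "\<dots> = - (\<Sum>j\<in>UNIV. v $ j *\<^sub>R (\<integral>x. \<phi> x *\<^sub>R h x $ j \<partial>lebesgue))"
    by (simp add: sum_negf)
  also have "(\<Sum>j\<in>UNIV. v $ j *\<^sub>R (\<integral>x. \<phi> x *\<^sub>R h x $ j \<partial>lebesgue))
     = (\<integral>x. (\<Sum>j\<in>UNIV. v $ j *\<^sub>R (\<phi> x *\<^sub>R h x $ j)) \<partial>lebesgue)"
    using i2 by (subst Bochner_Integration.integral_sum) (auto simp del: scaleR_scaleR)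
  also have "\<dots> = (\<integral>x. \<phi> x *\<^sub>R along v h x \<partial>lebesgue)"
    by (simp add: along_def scaleR_sum_right mult.commute)
  finally show ?thesis .
qed

lemma weak_gradient_cong_AE:
  assumes w: "weak_gradient \<psi> h" and [measurable]: "\<psi>' \<in> borel_measurable lebesgue" "h' \<in> borel_measurable lebesgue"
    and ae: "AE x in lebesgue. \<psi> x = \<psi>' x" "AE x in lebesgue. h x = h' x"
  shows "weak_gradient \<psi>' h'"
proof -
  have \<psi>: "\<psi> \<in> Lspace_loc 1" and h: "h \<in> Lspace_loc 1" using w by (auto simp: weak_gradient_def)
  then have [measurable]: "\<psi> \<in> borel_measurable lebesgue" "h \<in> borel_measurable lebesgue"
    by (simp_all add: Lspace_loc_1_iff)
  have "(\<integral>\<^sup>+x. ennreal (norm (\<psi>' x)) * indicator (cball 0 R) x \<partial>lebesgue)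
    = (\<integral>\<^sup>+x. ennreal (norm (\<psi> x)) * indicator (cball 0 R) x \<partial>lebesgue)" for R
    by (rule nn_integral_cong_AE) (use ae(1) in \<open>eventually_elim, simp\<close>)
  moreover have "(\<integral>\<^sup>+x. ennreal (norm (h' x)) * indicator (cball 0 R) x \<partial>lebesgue)
    = (\<integral>\<^sup>+x. ennreal (norm (h x)) * indicator (cball 0 R) x \<partial>lebesgue)" for R
    by (rule nn_integral_cong_AE) (use ae(2) in \<open>eventually_elim, simp\<close>)
  moreover have "(\<integral>x. frechet_derivative \<phi> (at x) (axis j 1) *\<^sub>R \<psi>' x \<partial>lebesgue) =
        - (\<integral>x. \<phi> x *\<^sub>R (h' x $ j) \<partial>lebesgue)" if t: "test_function \<phi>" for \<phi> j
  proof -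
    note [measurable] = test_function_lebesgue_measurable[OF t]
      test_function_lebesgue_measurable[OF test_function_derivative[OF t]]
    have "(\<integral>x. frechet_derivative \<phi> (at x) (axis j 1) *\<^sub>R \<psi>' x \<partial>lebesgue)
      = (\<integral>x. frechet_derivative \<phi> (at x) (axis j 1) *\<^sub>R \<psi> x \<partial>lebesgue)"
      by (rule integral_cong_AE) (measurable, use ae(1) in \<open>eventually_elim, simp\<close>)
    also have "\<dots> = - (\<integral>x. \<phi> x *\<^sub>R (h x $ j) \<partial>lebesgue)"
      using w t by (simp add: weak_gradient_def)
    also have "(\<integral>x. \<phi> x *\<^sub>R (h x $ j) \<partial>lebesgue) = (\<integral>x. \<phi> x *\<^sub>R (h' x $ j) \<partial>lebesgue)"
      by (rule integral_cong_AE) (measurable, use ae(2) in \<open>eventually_elim, simp\<close>)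
    finally show ?thesis .
  qed
  ultimately show ?thesis
    using \<psi> h by (simp add: weak_gradient_def Lspace_loc_1_iff)
qed

lemma weak_gradient_borel_version:
  assumes w: "weak_gradient \<psi> h"
  obtains \<psi>' h' where "\<psi>' \<in> borel_measurable borel" "h' \<in> borel_measurable borel"
    "AE x in lebesgue. \<psi> x = \<psi>' x" "AE x in lebesgue. h x = h' x" "weak_gradient \<psi>' h'"
proof -
  have m: "\<psi> \<in> borel_measurable lebesgue" "h \<in> borel_measurable lebesgue"
    using w by (simp_all add: weak_gradient_def Lspace_loc_1_iff)
  obtain \<psi>' where 1: "\<psi>' \<in> borel_measurable borel" "AE x in lebesgue. \<psi> x = \<psi>' x"
    using borel_version[OF m(1)] by blast
  obtain h' where 2: "h' \<in> borel_measurable borel" "AE x in lebesgue. h x = h' x"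
    using borel_version[OF m(2)] by blast
  have "weak_gradient \<psi>' h'"
    by (rule weak_gradient_cong_AE[OF w]) (use 1 2 in \<open>auto simp: measurable_completion\<close>)
  with 1 2 show thesis by (intro that)
qed

lemma nn_integral_translate:
  fixes f :: "real ^ 'n \<Rightarrow> ennreal"
  assumes "f \<in> borel_measurable borel"
  shows "(\<integral>\<^sup>+x. f (x + v) \<partial>lborel) = (\<integral>\<^sup>+x. f x \<partial>lborel)"
  using nn_integral_affine[of 1 f v] assms
  by (simp add: measurable_completion nn_integral_completion add.commute)

lemma nn_integral_segment_bound:
  fixes k :: "real ^ 'n \<Rightarrow> complex"
  assumes [measurable]: "k \<in> borel_measurable borel" and s: "0 \<le> s" "s \<le> 1"
  shows "(\<integral>\<^sup>+x. ennreal (norm (k (x + s *\<^sub>R v))) * indicator (cball 0 R) x \<partial>lborel)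
    \<le> (\<integral>\<^sup>+x. ennreal (norm (k x)) * indicator (cball 0 (R + norm v)) x \<partial>lborel)"
proof -
  have "(\<integral>\<^sup>+x. ennreal (norm (k (x + s *\<^sub>R v))) * indicator (cball 0 R) x \<partial>lborel)
    \<le> (\<integral>\<^sup>+x. ennreal (norm (k (x + s *\<^sub>R v))) * indicator (cball 0 (R + norm v)) (x + s *\<^sub>R v) \<partial>lborel)"
  proof (intro nn_integral_mono)
    fix x
    have "norm (s *\<^sub>R v) \<le> norm v" using s by (simp add: mult_left_le_one_le)
    then have "norm x \<le> R \<Longrightarrow> norm (x + s *\<^sub>R v) \<le> R + norm v"
      using norm_triangle_ineq[of x "s *\<^sub>R v"] by linarith
    then show "ennreal (norm (k (x + s *\<^sub>R v))) * indicator (cball 0 R) x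
       \<le> ennreal (norm (k (x + s *\<^sub>R v))) * indicator (cball 0 (R + norm v)) (x + s *\<^sub>R v)"
      by (auto simp: indicator_def)
  qed
  also have "\<dots> = (\<integral>\<^sup>+x. ennreal (norm (k x)) * indicator (cball 0 (R + norm v)) x \<partial>lborel)"
    by (rule nn_integral_translate[of "\<lambda>x. ennreal (norm (k x)) * indicator (cball 0 (R + norm v)) x"]) measurable
  finally show ?thesis .
qed

lemma nn_integral_segment_finite:
  fixes k :: "real ^ 'n \<Rightarrow> complex"
  assumes [measurable]: "k \<in> borel_measurable borel" and k: "k \<in> Lspace_loc 1"
  shows "(\<integral>\<^sup>+s. \<integral>\<^sup>+x. indicator {0..1} s * (ennreal (norm (k (x + s *\<^sub>R v))) * indicator (cball 0 R) x)
      \<partial>lborel \<partial>lborel) < \<infinity>"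
proof -
  let ?C = "\<integral>\<^sup>+x. ennreal (norm (k x)) * indicator (cball 0 (R + norm v)) x \<partial>lborel"
  have "(\<integral>\<^sup>+s. \<integral>\<^sup>+x. indicator {0..1} s * (ennreal (norm (k (x + s *\<^sub>R v))) * indicator (cball 0 R) x)
      \<partial>lborel \<partial>lborel) \<le> (\<integral>\<^sup>+s. ?C * indicator {0..1::real} s \<partial>lborel)"
  proof (intro nn_integral_mono)
    fix s :: real
    show "(\<integral>\<^sup>+x. indicator {0..1} s * (ennreal (norm (k (x + s *\<^sub>R v))) * indicator (cball 0 R) x) \<partial>lborel)
      \<le> ?C * indicator {0..1} s"
      using nn_integral_segment_bound[OF assms(1), of s v R] by (auto simp: indicator_def[of "{0..1}"])
  qed
  also have "\<dots> = ?C" by (simp add: nn_integral_cmult_indicator)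
  also have "\<dots> < \<infinity>"
    using k by (simp add: Lspace_loc_1_iff nn_integral_completion)
  finally show ?thesis .
qed

text \<open>Local integrability allows Tonelli only on balls: translation by s v with s in [0, 1]
  moves the ball of radius R into that of radius R + \<open>norm v\<close>, where k is integrable.
  So the segment integral exists almost everywhere on each of countably many balls and is locally
  integrable there. The bound and the support of a test function bring its product with k within the
  range of Fubini.\<close>

lemma segment_integral:
  fixes k :: "real ^ 'n \<Rightarrow> complex"
  assumes [measurable]: "k \<in> borel_measurable borel" and k: "k \<in> Lspace_loc 1"
  shows "AE x in lborel. integrable lborel (\<lambda>s. indicator {0..1} s *\<^sub>R k (x + s *\<^sub>R v))" (is ?ae)
    and "(\<lambda>x. \<integral>s. indicator {0..1} s *\<^sub>R k (x + s *\<^sub>R v) \<partial>lborel) \<in> Lspace_loc 1" (is ?loc)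
    and "test_function \<phi> \<Longrightarrow> (\<integral>x. \<phi> x *\<^sub>R (\<integral>s. indicator {0..1} s *\<^sub>R k (x + s *\<^sub>R v) \<partial>lborel) \<partial>lborel)
      = (\<integral>s. indicator {0..1} s *\<^sub>R (\<integral>x. \<phi> x *\<^sub>R k (x + s *\<^sub>R v) \<partial>lborel) \<partial>lborel)"
proof -
  have swap: "(\<integral>\<^sup>+x. (\<integral>\<^sup>+s. indicator {0..1} s * (ennreal (norm (k (x + s *\<^sub>R v))) * indicator (cball 0 R) x) \<partial>lborel) \<partial>lborel)
     < \<infinity>" for R
  proof -
    have "(\<integral>\<^sup>+x. (\<integral>\<^sup>+s. indicator {0..1} s * (ennreal (norm (k (x + s *\<^sub>R v))) * indicator (cball 0 R) x) \<partial>lborel) \<partial>lborel)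
     = (\<integral>\<^sup>+s. \<integral>\<^sup>+x. indicator {0..1} s * (ennreal (norm (k (x + s *\<^sub>R v))) * indicator (cball 0 R) x)
      \<partial>lborel \<partial>lborel)"
      by (rule lborel_pair.Fubini'[symmetric]) measurable
    then show ?thesis using nn_integral_segment_finite[OF assms, of v R] by simp
  qed
  have "AE x in lborel. norm x \<le> real R \<longrightarrow> integrable lborel (\<lambda>s. indicator {0..1} s *\<^sub>R k (x + s *\<^sub>R v))" for R :: nat
  proof -
    have "AE x in lborel. (\<integral>\<^sup>+s. indicator {0..1} s * (ennreal (norm (k (x + s *\<^sub>R v))) * indicator (cball 0 (real R)) x) \<partial>lborel) \<noteq> \<infinity>"
      by (rule nn_integral_PInf_AE) (use swap[of R] in auto)
    then show ?thesis
    proof eventually_elim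
      case (elim x)
      show ?case
      proof
        assume "norm x \<le> real R"
        then have "(\<integral>\<^sup>+s. ennreal (norm (indicator {0..1} s *\<^sub>R k (x + s *\<^sub>R v))) \<partial>lborel)
          = (\<integral>\<^sup>+s. indicator {0..1} s * (ennreal (norm (k (x + s *\<^sub>R v))) * indicator (cball 0 (real R)) x) \<partial>lborel)"
          by (intro nn_integral_cong) (auto simp: indicator_def)
        then show "integrable lborel (\<lambda>s. indicator {0..1} s *\<^sub>R k (x + s *\<^sub>R v))"
          using elim by (intro integrableI_bounded) (auto simp: less_top)
      qed
    qed
  qed
  then have "AE x in lborel. \<forall>R::nat. norm x \<le> real R \<longrightarrow> integrable lborel (\<lambda>s. indicator {0..1} s *\<^sub>R k (x + s *\<^sub>R v))"
    unfolding AE_all_countable by blast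
  then show ?ae
    by eventually_elim (meson real_arch_simple)
  show ?loc
    unfolding Lspace_loc_1_iff
  proof (intro conjI allI)
    have "(\<lambda>x. \<integral>s. indicator {0..1} s *\<^sub>R k (x + s *\<^sub>R v) \<partial>lborel) \<in> borel_measurable lborel"
      by measurable
    then show "(\<lambda>x. \<integral>s. indicator {0..1} s *\<^sub>R k (x + s *\<^sub>R v) \<partial>lborel) \<in> borel_measurable lebesgue"
      by (rule measurable_completion)
    fix R
    have "(\<integral>\<^sup>+x. ennreal (norm (\<integral>s. indicator {0..1} s *\<^sub>R k (x + s *\<^sub>R v) \<partial>lborel)) * indicator (cball 0 R) x \<partial>lborel)
      \<le> (\<integral>\<^sup>+x. (\<integral>\<^sup>+s. indicator {0..1} s * (ennreal (norm (k (x + s *\<^sub>R v))) * indicator (cball 0 R) x) \<partial>lborel) \<partial>lborel)"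
    proof (rule nn_integral_mono)
      fix x
      have "ennreal (norm (\<integral>s. indicator {0..1} s *\<^sub>R k (x + s *\<^sub>R v) \<partial>lborel))
        \<le> (\<integral>\<^sup>+s. ennreal (norm (indicator {0..1} s *\<^sub>R k (x + s *\<^sub>R v))) \<partial>lborel)"
      \<comment> \<open>A section that is not integrable has Bochner integral 0, so the bound
        persists there.\<close>
      proof (cases "integrable lborel (\<lambda>s. indicator {0..1} s *\<^sub>R k (x + s *\<^sub>R v))")
        case True
        then show ?thesis by (rule integral_norm_bound_ennreal)
      qed (simp add: not_integrable_integral_eq)
      also have "\<dots> = (\<integral>\<^sup>+s. indicator {0..1} s * ennreal (norm (k (x + s *\<^sub>R v))) \<partial>lborel)"
        by (intro nn_integral_cong) (auto simp: indicator_def)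
      finally show "ennreal (norm (\<integral>s. indicator {0..1} s *\<^sub>R k (x + s *\<^sub>R v) \<partial>lborel)) * indicator (cball 0 R) x
       \<le> (\<integral>\<^sup>+s. indicator {0..1} s * (ennreal (norm (k (x + s *\<^sub>R v))) * indicator (cball 0 R) x) \<partial>lborel)"
        by (cases "x \<in> cball 0 R") (auto simp: indicator_def)
    qed
    then show "(\<integral>\<^sup>+x. ennreal (norm (\<integral>s. indicator {0..1} s *\<^sub>R k (x + s *\<^sub>R v) \<partial>lborel)) * indicator (cball 0 R) x \<partial>lebesgue)
      < \<infinity>"
      unfolding nn_integral_completion using swap[of R] by (rule order.strict_trans1)
  qed
  assume \<phi>: "test_function \<phi>"
  then have [measurable]: "\<phi> \<in> borel_measurable borel" by measurable
  obtain R M where R: "\<And>x. norm x > R \<Longrightarrow> \<phi> x = 0" and M: "M > 0" "\<And>x. \<bar>\<phi> x\<bar> \<le> M"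
    using test_function_bounds[OF \<phi>] by blast
  let ?f = "\<lambda>s x. indicator {0..1} s *\<^sub>R (\<phi> x *\<^sub>R k (x + s *\<^sub>R v))"
  have "integrable (lborel \<Otimes>\<^sub>M lborel) (case_prod ?f)"
  proof (rule integrableI_bounded)
    have "(\<integral>\<^sup>+z. ennreal (norm (case_prod ?f z)) \<partial>(lborel \<Otimes>\<^sub>M lborel))
      = (\<integral>\<^sup>+s. \<integral>\<^sup>+x. ennreal (norm (?f s x)) \<partial>lborel \<partial>lborel)"
      by (subst lborel.nn_integral_fst[symmetric]) auto
    also have "\<dots> \<le> (\<integral>\<^sup>+s. \<integral>\<^sup>+x. ennreal M * (indicator {0..1} s *
        (ennreal (norm (k (x + s *\<^sub>R v))) * indicator (cball 0 R) x)) \<partial>lborel \<partial>lborel)"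
    proof (intro nn_integral_mono)
      fix s :: real and x
      show "ennreal (norm (?f s x)) \<le> ennreal M * (indicator {0..1} s *
        (ennreal (norm (k (x + s *\<^sub>R v))) * indicator (cball 0 R) x))"
        using R[of x] M(1) M(2)[of x]
        by (cases "norm x > R")
           (auto simp: indicator_def ennreal_mult[symmetric] intro!: ennreal_leI mult_right_mono)
    qed
    also have "\<dots> = ennreal M * (\<integral>\<^sup>+s. \<integral>\<^sup>+x. (indicator {0..1} s *
        (ennreal (norm (k (x + s *\<^sub>R v))) * indicator (cball 0 R) x)) \<partial>lborel \<partial>lborel)"
      by (simp add: nn_integral_cmult)
    also have "\<dots> < \<infinity>"
      using nn_integral_segment_finite[OF assms, of v R] by (simp add: ennreal_mult_less_top)
    finally show "(\<integral>\<^sup>+z. ennreal (norm (case_prod ?f z)) \<partial>(lborel \<Otimes>\<^sub>M lborel)) < \<infinity>" .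
  qed measurable
  from lborel_pair.Fubini_integral[OF this]
  have "(\<integral>x. (\<integral>s. ?f s x \<partial>lborel) \<partial>lborel) = (\<integral>s. (\<integral>x. ?f s x \<partial>lborel) \<partial>lborel)" .
  moreover have "(\<integral>s. ?f s x \<partial>lborel) = \<phi> x *\<^sub>R (\<integral>s. indicator {0..1} s *\<^sub>R k (x + s *\<^sub>R v) \<partial>lborel)" for x
    by (simp only: scaleR_left_commute[of _ "\<phi> x"] integral_scaleR_right)
  moreover have "(\<integral>x. ?f s x \<partial>lborel) = indicator {0..1} s *\<^sub>R (\<integral>x. \<phi> x *\<^sub>R k (x + s *\<^sub>R v) \<partial>lborel)" for s
    by (simp only: integral_scaleR_right)
  ultimately show "(\<integral>x. \<phi> x *\<^sub>R (\<integral>s. indicator {0..1} s *\<^sub>R k (x + s *\<^sub>R v) \<partial>lborel) \<partial>lborel)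
      = (\<integral>s. indicator {0..1} s *\<^sub>R (\<integral>x. \<phi> x *\<^sub>R k (x + s *\<^sub>R v) \<partial>lborel) \<partial>lborel)"
    by simp
qed

text \<open>The companion exchange once the translation sits on the test function. The inner
  integral over s is then that of a continuous function, open to the fundamental theorem of
  calculus.\<close>

lemma test_function_segment_fubini:
  fixes \<psi> :: "real ^ 'n \<Rightarrow> complex"
  assumes [measurable]: "\<psi> \<in> borel_measurable borel" and \<psi>: "\<psi> \<in> Lspace_loc 1" and \<phi>: "test_function \<phi>"
  shows "(\<integral>s. indicator {0..1} s *\<^sub>R (\<integral>x. \<phi> (x - s *\<^sub>R v) *\<^sub>R \<psi> x \<partial>lborel) \<partial>lborel)
     = (\<integral>x. (\<integral>s. indicator {0..1} s *\<^sub>R \<phi> (x - s *\<^sub>R v) \<partial>lborel) *\<^sub>R \<psi> x \<partial>lborel)"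
proof -
  have [measurable]: "\<phi> \<in> borel_measurable borel" using \<phi> by measurable
  obtain R M where R: "\<And>x. norm x > R \<Longrightarrow> \<phi> x = 0" and M: "M > 0" "\<And>x. \<bar>\<phi> x\<bar> \<le> M"
    using test_function_bounds[OF \<phi>] by blast
  let ?f = "\<lambda>s x. indicator {0..1} s *\<^sub>R (\<phi> (x - s *\<^sub>R v) *\<^sub>R \<psi> x)"
  let ?C = "\<integral>\<^sup>+x. ennreal (norm (\<psi> x)) * indicator (cball 0 (R + norm v)) x \<partial>lborel"
  have "integrable (lborel \<Otimes>\<^sub>M lborel) (case_prod ?f)"
  proof (rule integrableI_bounded)
    have "(\<integral>\<^sup>+z. ennreal (norm (case_prod ?f z)) \<partial>(lborel \<Otimes>\<^sub>M lborel))
      = (\<integral>\<^sup>+s. \<integral>\<^sup>+x. ennreal (norm (?f s x)) \<partial>lborel \<partial>lborel)"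
      by (subst lborel.nn_integral_fst[symmetric]) auto
    also have "\<dots> \<le> (\<integral>\<^sup>+s. \<integral>\<^sup>+x. ennreal M * (indicator {0..1::real} s *
        (ennreal (norm (\<psi> x)) * indicator (cball 0 (R + norm v)) x)) \<partial>lborel \<partial>lborel)"
    proof (intro nn_integral_mono)
      fix s :: real and x
      show "ennreal (norm (?f s x)) \<le> ennreal M * (indicator {0..1} s *
        (ennreal (norm (\<psi> x)) * indicator (cball 0 (R + norm v)) x))"
      proof (cases "0 \<le> s \<and> s \<le> 1")
        case True
        then have "norm (s *\<^sub>R v) \<le> norm v" by (simp add: mult_left_le_one_le)
        then have "norm x > R + norm v \<Longrightarrow> norm (x - s *\<^sub>R v) > R"
          using norm_triangle_ineq2[of x "s *\<^sub>R v"] by linarith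
        then show ?thesis
          using R[of "x - s *\<^sub>R v"] M(1) M(2)[of "x - s *\<^sub>R v"]
          by (cases "norm x > R + norm v")
             (auto simp: indicator_def ennreal_mult[symmetric] intro!: ennreal_leI mult_right_mono)
      qed (auto simp: indicator_def)
    qed
    also have "\<dots> = ennreal M * ?C"
      by (simp add: nn_integral_cmult nn_integral_multc)
    also have "\<dots> < \<infinity>"
      using \<psi> by (simp add: ennreal_mult_less_top Lspace_loc_1_iff nn_integral_completion)
    finally show "(\<integral>\<^sup>+z. ennreal (norm (case_prod ?f z)) \<partial>(lborel \<Otimes>\<^sub>M lborel)) < \<infinity>" .
  qed measurable
  from lborel_pair.Fubini_integral[OF this]
  have "(\<integral>s. (\<integral>x. ?f s x \<partial>lborel) \<partial>lborel) = (\<integral>x. (\<integral>s. ?f s x \<partial>lborel) \<partial>lborel)" by (rule sym)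
  moreover have "(\<integral>s. ?f s x \<partial>lborel) = (\<integral>s. indicator {0..1} s *\<^sub>R \<phi> (x - s *\<^sub>R v) \<partial>lborel) *\<^sub>R \<psi> x" for x
  proof -
    have "(\<integral>s. (indicator {0..1} s * \<phi> (x - s *\<^sub>R v)) *\<^sub>R \<psi> x \<partial>lborel)
      = (\<integral>s. indicator {0..1} s * \<phi> (x - s *\<^sub>R v) \<partial>lborel) *\<^sub>R \<psi> x"
    proof (cases "\<psi> x = 0")
      case False
      have "integrable lborel (\<lambda>s. indicator {0..1} s *\<^sub>R \<phi> (x - s *\<^sub>R v))"
      proof -
        have "continuous_on {0..1} (\<lambda>s. \<phi> (x - s *\<^sub>R v))"
          by (auto intro!: continuous_on_compose2[OF test_function_continuous[OF \<phi>]] continuous_intros)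
        then show ?thesis
          using borel_integrable_atLeastAtMost'[of 0 1 "\<lambda>s. \<phi> (x - s *\<^sub>R v)"]
          unfolding set_integrable_def by simp
      qed
      then show ?thesis by (intro integral_scaleR_left) auto
    qed simp
    then show ?thesis by simp
  qed
  moreover have "(\<integral>x. ?f s x \<partial>lborel) = indicator {0..1} s *\<^sub>R (\<integral>x. \<phi> (x - s *\<^sub>R v) *\<^sub>R \<psi> x \<partial>lborel)" for s
    by (simp only: integral_scaleR_right)
  ultimately show ?thesis by simp
qed

text \<open>Testing against \<open>\<phi>\<close> and moving the translation onto \<open>\<phi>\<close> reduces the identity to the fundamental
  theorem of calculus for \<open>s \<mapsto> \<phi> (x - s v)\<close>.\<close>

lemma weak_gradient_translation:
  fixes \<psi> :: "real ^ 'n \<Rightarrow> complex"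
  assumes w: "weak_gradient \<psi> h" and [measurable]: "\<psi> \<in> borel_measurable borel" "h \<in> borel_measurable borel"
  shows "AE x in lborel. \<psi> (x + v) - \<psi> x = (\<integral>s. indicator {0..1} s *\<^sub>R along v h (x + s *\<^sub>R v) \<partial>lborel)"
proof -
  have \<psi>: "\<psi> \<in> Lspace_loc 1" and h: "h \<in> Lspace_loc 1" using w by (auto simp: weak_gradient_def)
  note k = Lspace_loc_1_along[OF h, of v]
  have kb [measurable]: "along v h \<in> borel_measurable borel" by measurable
  have \<psi>v: "(\<lambda>x. \<psi> (x + v)) \<in> Lspace_loc 1"
    using Lspace_loc_1_affine[OF \<psi>, of 1 v] by (simp add: add.commute)
  define H where "H x = (\<integral>s. indicator {0..1} s *\<^sub>R along v h (x + s *\<^sub>R v) \<partial>lborel)" for x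
  have H: "H \<in> Lspace_loc 1" unfolding H_def[abs_def] by (rule segment_integral(2)[OF kb k])
  have [measurable]: "H \<in> borel_measurable borel"
  proof -
    have "H \<in> borel_measurable lborel" unfolding H_def[abs_def] by measurable
    then show ?thesis by simp
  qed
  have D: "(\<lambda>x. \<psi> (x + v) - \<psi> x) \<in> Lspace_loc 1"
    by (rule Lspace_loc_1_bound[OF _ \<psi>v \<psi>, of _ 1 1])
       (auto intro!: measurable_completion norm_triangle_ineq4)
  have "AE x in lebesgue. \<psi> (x + v) - \<psi> x - H x = 0"
  proof (rule fundamental_lemma)
    show "(\<lambda>x. \<psi> (x + v) - \<psi> x - H x) \<in> Lspace_loc 1"
      by (rule Lspace_loc_1_bound[OF _ D H, of _ 1 1])
         (auto intro!: measurable_completion norm_triangle_ineq4)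
    fix \<phi> :: "real ^ 'n \<Rightarrow> real" assume \<phi>: "test_function \<phi>"
    note [measurable] = test_function_measurable[OF \<phi>]
    have \<phi>s: "test_function (\<lambda>x. \<phi> (x - a))" for a
      using test_function_affine[OF \<phi>, of 1 "- a"] by simp
    have d\<phi>s: "frechet_derivative (\<lambda>x. \<phi> (x - a)) (at x) v = frechet_derivative \<phi> (at (x - a)) v" for x a
    proof -
      have "\<And>x. \<phi> differentiable at x" using test_function_has_derivative[OF \<phi>] by (auto simp: differentiable_def)
      from frechet_derivative_at[OF frechet_derivative_affine[OF this, of "- a" 1]] show ?thesis
        by (simp add: fun_eq_iff)
    qed
    have shift: "(\<integral>x. \<phi> x *\<^sub>R f (x + a) \<partial>lborel) = (\<integral>x. \<phi> (x - a) *\<^sub>R f x \<partial>lborel)"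
      if [measurable]: "f \<in> borel_measurable borel" for f :: "real ^ 'n \<Rightarrow> complex" and a
      using integral_affine[of 1 "\<lambda>x. \<phi> (x - a) *\<^sub>R f x" a]
      by (simp add: measurable_completion integral_completion add.commute)
    have i: "integrable lborel (\<lambda>x. \<phi> x *\<^sub>R f x)"
      if [measurable]: "f \<in> borel_measurable borel" and "f \<in> Lspace_loc 1" for f :: "real ^ 'n \<Rightarrow> complex"
      using integrable_test_function_mult[OF that(2) \<phi>] by (subst (asm) integrable_completion) auto
    have i2: "integrable lborel (\<lambda>x. \<phi> (x - a) *\<^sub>R \<psi> x)" for a
      using integrable_test_function_mult[OF \<psi> \<phi>s[of a]] by (subst (asm) integrable_completion) auto
    have "(\<integral>x. \<phi> x *\<^sub>R H x \<partial>lborel)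
      = (\<integral>s. indicator {0..1} s *\<^sub>R (\<integral>x. \<phi> x *\<^sub>R along v h (x + s *\<^sub>R v) \<partial>lborel) \<partial>lborel)"
      unfolding H_def by (rule segment_integral(3)[OF kb k \<phi>])
    also have "\<dots> = (\<integral>s. - (indicator {0..1} s *\<^sub>R (\<integral>x. frechet_derivative \<phi> (at (x - s *\<^sub>R v)) v *\<^sub>R \<psi> x \<partial>lborel)) \<partial>lborel)"
    proof (rule Bochner_Integration.integral_cong[OF refl])
      fix s :: real
      have [measurable]: "(\<lambda>x. frechet_derivative \<phi> (at (x - s *\<^sub>R v)) v) \<in> borel_measurable borel"
        using test_function_measurable[OF test_function_affine[OF test_function_derivative[OF \<phi>, of v], of 1 "- (s *\<^sub>R v)"]]
        by simp
      have "(\<integral>x. \<phi> x *\<^sub>R along v h (x + s *\<^sub>R v) \<partial>lborel) = (\<integral>x. \<phi> (x - s *\<^sub>R v) *\<^sub>R along v h x \<partial>lborel)"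
        by (rule shift) measurable
      also have "\<dots> = - (\<integral>x. frechet_derivative \<phi> (at (x - s *\<^sub>R v)) v *\<^sub>R \<psi> x \<partial>lborel)"
        using weak_gradient_along[OF w \<phi>s[of "s *\<^sub>R v"], of v]
        by (simp add: d\<phi>s integral_completion)
      finally show "indicator {0..1} s *\<^sub>R (\<integral>x. \<phi> x *\<^sub>R along v h (x + s *\<^sub>R v) \<partial>lborel)
         = - (indicator {0..1} s *\<^sub>R (\<integral>x. frechet_derivative \<phi> (at (x - s *\<^sub>R v)) v *\<^sub>R \<psi> x \<partial>lborel))"
        by simp
    qed
    also have "\<dots> = - (\<integral>x. (\<integral>s. indicator {0..1} s *\<^sub>R frechet_derivative \<phi> (at (x - s *\<^sub>R v)) v \<partial>lborel) *\<^sub>R \<psi> x \<partial>lborel)"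
      using test_function_segment_fubini[OF _ \<psi> test_function_derivative[OF \<phi>, of v], of v] by simp
    also have "\<dots> = - (\<integral>x. (\<phi> x - \<phi> (x - v)) *\<^sub>R \<psi> x \<partial>lborel)"
    proof -
      have "(\<integral>s. indicator {0..1} s *\<^sub>R frechet_derivative \<phi> (at (x - s *\<^sub>R v)) v \<partial>lborel) = \<phi> x - \<phi> (x - v)" for x
      proof -
        \<comment> \<open>The sign comes from the inner derivative of x - s v, so the antiderivative
          in s is \<open>- \<phi> (x - s *\<^sub>R v)\<close>.\<close>
        have der: "((\<lambda>s. - \<phi> (x - s *\<^sub>R v)) has_vector_derivative frechet_derivative \<phi> (at (x - s *\<^sub>R v)) v) (at s within {0..1})" for s
        proof -
          have l: "linear (frechet_derivative \<phi> (at (x - s *\<^sub>R v)))"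
            using test_function_has_derivative[OF \<phi>] has_derivative_linear by blast
          have "((\<lambda>s. x - s *\<^sub>R v) has_derivative (\<lambda>t. - (t *\<^sub>R v))) (at s within {0..1})"
            by (auto intro!: derivative_eq_intros)
          from has_derivative_compose[OF this test_function_has_derivative[OF \<phi>]]
          have "((\<lambda>s. \<phi> (x - s *\<^sub>R v)) has_derivative (\<lambda>t. frechet_derivative \<phi> (at (x - s *\<^sub>R v)) (- (t *\<^sub>R v)))) (at s within {0..1})" .
          from has_derivative_minus[OF this] show ?thesis
            by (simp add: has_vector_derivative_def linear_neg[OF l] linear_scale[OF l])
        qed
        have "(\<integral>s. indicator {0..1} s *\<^sub>R frechet_derivative \<phi> (at (x - s *\<^sub>R v)) v \<partial>lborel)
          = - \<phi> (x - 1 *\<^sub>R v) - (- \<phi> (x - 0 *\<^sub>R v))"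
          by (rule integral_FTC_Icc[OF _ der])
             (auto intro!: continuous_on_compose2[OF test_function_continuous[OF test_function_derivative[OF \<phi>, of v]]] continuous_intros)
        then show ?thesis by simp
      qed
      then show ?thesis by simp
    qed
    also have "\<dots> = (\<integral>x. \<phi> (x - v) *\<^sub>R \<psi> x \<partial>lborel) - (\<integral>x. \<phi> x *\<^sub>R \<psi> x \<partial>lborel)"
      using i2[of 0] i2[of v] by (simp add: scaleR_diff_left)
    also have "(\<integral>x. \<phi> (x - v) *\<^sub>R \<psi> x \<partial>lborel) = (\<integral>x. \<phi> x *\<^sub>R \<psi> (x + v) \<partial>lborel)"
      by (rule shift[symmetric]) measurable
    finally have eq: "(\<integral>x. \<phi> x *\<^sub>R H x \<partial>lborel) = (\<integral>x. \<phi> x *\<^sub>R \<psi> (x + v) \<partial>lborel) - (\<integral>x. \<phi> x *\<^sub>R \<psi> x \<partial>lborel)" .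
    have "(\<integral>x. \<phi> x *\<^sub>R (\<psi> (x + v) - \<psi> x - H x) \<partial>lebesgue) = (\<integral>x. \<phi> x *\<^sub>R (\<psi> (x + v) - \<psi> x - H x) \<partial>lborel)"
      by (rule integral_completion) measurable
    also have "\<dots> = (\<integral>x. \<phi> x *\<^sub>R \<psi> (x + v) \<partial>lborel) - (\<integral>x. \<phi> x *\<^sub>R \<psi> x \<partial>lborel) - (\<integral>x. \<phi> x *\<^sub>R H x \<partial>lborel)"
      using i[OF _ \<psi>] i[OF _ H] i[OF _ \<psi>v] by (simp add: scaleR_diff_right)
    finally show "(\<integral>x. \<phi> x *\<^sub>R (\<psi> (x + v) - \<psi> x - H x) \<partial>lebesgue) = 0" using eq by simp
  qed
  then show ?thesis by (simp add: AE_completion_iff H_def algebra_simps)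
qed

subsection \<open>Difference quotients in mean\<close>

text \<open>Cauchy-Schwarz on the unit segment bounds the squared increment by the mean of the
  squared directional derivative; after Tonelli, translation invariance makes the integral over x
  independent of s.\<close>

lemma weak_gradient_translation_L2:
  fixes \<psi> :: "real ^ 'n \<Rightarrow> complex"
  assumes w: "weak_gradient \<psi> h" and [measurable]: "\<psi> \<in> borel_measurable borel" "h \<in> borel_measurable borel"
  shows "(\<integral>\<^sup>+x. ennreal ((norm (\<psi> (x + v) - \<psi> x))\<^sup>2) \<partial>lborel)
    \<le> ennreal ((norm v)\<^sup>2) * (\<integral>\<^sup>+x. ennreal ((norm (h x))\<^sup>2) \<partial>lborel)"
proof -
  have h: "h \<in> Lspace_loc 1" using w by (auto simp: weak_gradient_def)
  define k where "k = along v h"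
  have k: "k \<in> Lspace_loc 1" unfolding k_def by (rule Lspace_loc_1_along[OF h])
  have kb [measurable]: "k \<in> borel_measurable borel" unfolding k_def by measurable
  have "AE x in lborel. ennreal ((norm (\<psi> (x + v) - \<psi> x))\<^sup>2)
      \<le> (\<integral>\<^sup>+s. indicator {0..1} s * ennreal ((norm (k (x + s *\<^sub>R v)))\<^sup>2) \<partial>lborel)"
    using weak_gradient_translation[OF w assms(2,3), of v, folded k_def]
      segment_integral(1)[OF kb k, of v]
  proof eventually_elim
    case (elim x)
    have "ennreal (norm (\<psi> (x + v) - \<psi> x)) \<le> (\<integral>\<^sup>+s. ennreal (norm (indicator {0..1} s *\<^sub>R k (x + s *\<^sub>R v))) \<partial>lborel)"
      unfolding elim(1) by (rule integral_norm_bound_ennreal[OF elim(2)])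
    \<comment> \<open>The indicator is written twice so that Cauchy-Schwarz has one factor of mean
      square 1.\<close>
    also have "\<dots> = (\<integral>\<^sup>+s. indicator {0..1} s * (indicator {0..1} s * ennreal (norm (k (x + s *\<^sub>R v)))) \<partial>lborel)"
      by (rule nn_integral_cong) (auto simp: indicator_def)
    finally have "(ennreal (norm (\<psi> (x + v) - \<psi> x)))\<^sup>2
       \<le> (\<integral>\<^sup>+s. indicator {0..1} s * (indicator {0..1} s * ennreal (norm (k (x + s *\<^sub>R v)))) \<partial>lborel)\<^sup>2"
      by (rule power_mono) simp
    also have "\<dots> \<le> (\<integral>\<^sup>+s. (indicator {0..1::real} s)\<^sup>2 \<partial>lborel) *
        (\<integral>\<^sup>+s. (indicator {0..1} s * ennreal (norm (k (x + s *\<^sub>R v))))\<^sup>2 \<partial>lborel)"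
      by (rule Cauchy_Schwarz_nn_integral) measurable
    also have "(\<integral>\<^sup>+s. (indicator {0..1::real} s)\<^sup>2 \<partial>lborel) = (\<integral>\<^sup>+s. indicator {0..1::real} s \<partial>lborel)"
      by (rule nn_integral_cong) (auto simp: indicator_def)
    also have "\<dots> = 1" by simp
    also have "(\<integral>\<^sup>+s. (indicator {0..1} s * ennreal (norm (k (x + s *\<^sub>R v))))\<^sup>2 \<partial>lborel)
       = (\<integral>\<^sup>+s. indicator {0..1} s * ennreal ((norm (k (x + s *\<^sub>R v)))\<^sup>2) \<partial>lborel)"
      by (rule nn_integral_cong) (auto simp: indicator_def ennreal_power)
    finally show ?case by (simp add: ennreal_power)
  qed
  then have "(\<integral>\<^sup>+x. ennreal ((norm (\<psi> (x + v) - \<psi> x))\<^sup>2) \<partial>lborel)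
    \<le> (\<integral>\<^sup>+x. \<integral>\<^sup>+s. indicator {0..1} s * ennreal ((norm (k (x + s *\<^sub>R v)))\<^sup>2) \<partial>lborel \<partial>lborel)"
    by (rule nn_integral_mono_AE)
  also have "\<dots> = (\<integral>\<^sup>+s. \<integral>\<^sup>+x. indicator {0..1} s * ennreal ((norm (k (x + s *\<^sub>R v)))\<^sup>2) \<partial>lborel \<partial>lborel)"
    by (rule lborel_pair.Fubini') measurable
  also have "\<dots> = (\<integral>\<^sup>+s. (\<integral>\<^sup>+x. ennreal ((norm (k x))\<^sup>2) \<partial>lborel) * indicator {0..1::real} s \<partial>lborel)"
  proof (rule nn_integral_cong)
    fix s :: real
    have "(\<integral>\<^sup>+x. ennreal ((norm (k (x + s *\<^sub>R v)))\<^sup>2) \<partial>lborel) = (\<integral>\<^sup>+x. ennreal ((norm (k x))\<^sup>2) \<partial>lborel)"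
      by (rule nn_integral_translate[of "\<lambda>x. ennreal ((norm (k x))\<^sup>2)"]) measurable
    then show "(\<integral>\<^sup>+x. indicator {0..1} s * ennreal ((norm (k (x + s *\<^sub>R v)))\<^sup>2) \<partial>lborel)
       = (\<integral>\<^sup>+x. ennreal ((norm (k x))\<^sup>2) \<partial>lborel) * indicator {0..1} s"
      by (simp add: nn_integral_cmult mult.commute)
  qed
  also have "\<dots> = (\<integral>\<^sup>+x. ennreal ((norm (k x))\<^sup>2) \<partial>lborel)"
    by (simp add: nn_integral_cmult_indicator)
  also have "\<dots> \<le> (\<integral>\<^sup>+x. ennreal ((norm v)\<^sup>2) * ennreal ((norm (h x))\<^sup>2) \<partial>lborel)"
  proof (rule nn_integral_mono)
    fix x
    have "(norm (k x))\<^sup>2 \<le> (norm v * norm (h x))\<^sup>2"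
      unfolding k_def by (rule power_mono[OF norm_along_le]) simp
    then show "ennreal ((norm (k x))\<^sup>2) \<le> ennreal ((norm v)\<^sup>2) * ennreal ((norm (h x))\<^sup>2)"
      by (simp add: ennreal_mult[symmetric] power_mult_distrib ennreal_leI)
  qed
  also have "\<dots> = ennreal ((norm v)\<^sup>2) * (\<integral>\<^sup>+x. ennreal ((norm (h x))\<^sup>2) \<partial>lborel)"
    by (rule nn_integral_cmult) measurable
  finally show ?thesis .
qed

lemma ennreal_tendsto_0I:
  fixes f :: "'a \<Rightarrow> ennreal"
  assumes "\<And>e::real. e > 0 \<Longrightarrow> eventually (\<lambda>x. f x \<le> ennreal e) F"
  shows "(f \<longlongrightarrow> 0) F"
proof (rule order_tendstoI)
  fix a :: ennreal assume "0 < a"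
  then obtain e :: real where "0 < e" "ennreal e < a"
    by (metis ennreal_cases ennreal_less_zero_iff ennreal_lessI dense less_top ennreal_enn2real enn2real_positive_iff order.strict_trans)
  then show "eventually (\<lambda>x. f x < a) F"
    using assms[of e] by (auto elim!: eventually_mono)
qed simp

text \<open>By openness each point of U stays in U under small translations, so the indicators tend
  to 0 pointwise, dominated by the indicator of U. Open sets are the case from which outer
  regularity reaches measurable ones.\<close>

lemma translation_indicator_open:
  fixes U :: "(real ^ 'n) set"
  assumes U: "open U" and fin: "emeasure lborel U < \<infinity>" and w: "w \<longlonglongrightarrow> 0"
  shows "(\<lambda>n. \<integral>\<^sup>+x. indicator {x \<in> U. x + w n \<notin> U} x \<partial>lborel) \<longlonglongrightarrow> (0::ennreal)"
proof -
  have [measurable]: "U \<in> sets borel" using U by simp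
  have "(\<lambda>n. \<integral>\<^sup>+x. indicator {x \<in> U. x + w n \<notin> U} x \<partial>lborel) \<longlonglongrightarrow> (\<integral>\<^sup>+x. 0 \<partial>(lborel :: (real ^ 'n) measure))"
  proof (rule nn_integral_dominated_convergence[where w="indicator U"])
    show "(\<lambda>x. indicator {x \<in> U. x + w n \<notin> U} x) \<in> borel_measurable lborel" for n by measurable
    show "AE x in lborel. (\<lambda>n. indicator {x \<in> U. x + w n \<notin> U} x) \<longlonglongrightarrow> (0::ennreal)"
    proof (rule AE_I2)
      fix x
      show "(\<lambda>n. indicator {x \<in> U. x + w n \<notin> U} x) \<longlonglongrightarrow> (0::ennreal)"
      proof (cases "x \<in> U")
        case True
        have "(\<lambda>n. x + w n) \<longlonglongrightarrow> x + 0" by (intro tendsto_intros w)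
        then have "eventually (\<lambda>n. x + w n \<in> U) sequentially"
          using U True by (simp add: topological_tendstoD)
        then show ?thesis by (intro tendsto_eventually) (auto elim!: eventually_mono)
      qed simp
    qed
  qed (use fin in \<open>auto split: split_indicator\<close>)
  then show ?thesis by simp
qed

text \<open>Induction over integrable functions: outer regularity compares the indicator of A with
  that of an open set, sums use the triangle inequality, and limits use that translating the
  approximation error does not change its norm.\<close>

lemma translation_continuous_L1:
  fixes f :: "real ^ 'n \<Rightarrow> complex"
  assumes "integrable lborel f" "w \<longlonglongrightarrow> 0"
  shows "(\<lambda>n. \<integral>\<^sup>+x. ennreal (norm (f (x + w n) - f x)) \<partial>lborel) \<longlonglongrightarrow> 0"
  using assms(1)
proof (induction rule: integrable_induct)
  case (base A c)
  then have [measurable]: "A \<in> sets borel" and A: "emeasure lborel A < \<infinity>" by auto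
  show ?case
  proof (rule ennreal_tendsto_0I)
    fix e :: real assume e: "e > 0"
    \<comment> \<open>The set U - A is counted twice, each time with measure below d and weight
      \<open>norm c\<close>, for a total of at most e / 2. The added 1 keeps the divisor positive
      when c = 0.\<close>
    define d where "d = e / (4 * (norm c + 1))"
    have d: "d > 0" using e by (simp add: d_def add_nonneg_pos)
    have d2: "norm c * (2 * d) \<le> e / 2"
    proof -
      have "norm c * (2 * d) = (e / 2) * (norm c / (norm c + 1))"
        using add_nonneg_pos[OF norm_ge_zero[of c] zero_less_one] by (simp add: d_def field_simps)
      also have "\<dots> \<le> (e / 2) * 1" using e by (intro mult_left_mono) (auto simp: divide_le_eq_1 add_nonneg_pos)
      finally show ?thesis by simp
    qed
    obtain U where U: "open U" "A \<subseteq> U" "emeasure lborel (U - A) < ennreal d"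
      using outer_regular_lborel[of A d] d by auto
    have [measurable]: "U \<in> sets borel" using U by simp
    have "emeasure lborel U \<le> emeasure lborel A + emeasure lborel (U - A)"
      by (rule order_trans[OF emeasure_mono emeasure_subadditive]) auto
    also have "\<dots> < \<infinity>" using A U(3) by (auto simp: less_top[symmetric])
    finally have fin: "emeasure lborel U < \<infinity>" .
    let ?F = "\<lambda>w. \<integral>\<^sup>+x. indicator {x \<in> U. x + w \<notin> U} x \<partial>lborel :: ennreal"
    have "(\<lambda>n. - w n) \<longlonglongrightarrow> 0" using tendsto_minus[OF assms(2)] by simp
    then have "(\<lambda>n. ?F (w n) + ?F (- w n)) \<longlonglongrightarrow> 0 + 0"
      by (intro tendsto_add translation_indicator_open[OF U(1) fin] assms(2))
    then have "(\<lambda>n. ennreal (norm c) * (?F (w n) + ?F (- w n))) \<longlonglongrightarrow> ennreal (norm c) * (0 + 0)"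
      by (intro ennreal_tendsto_cmult) auto
    then have "eventually (\<lambda>n. ennreal (norm c) * (?F (w n) + ?F (- w n)) < ennreal (e / 2)) sequentially"
      using e by (intro order_tendstoD(2)) auto
    then show "eventually (\<lambda>n. (\<integral>\<^sup>+x. ennreal (norm (indicator A (x + w n) *\<^sub>R c - indicator A x *\<^sub>R c)) \<partial>lborel) \<le> ennreal e) sequentially"
    proof eventually_elim
      case (elim n)
      \<comment> \<open>If exactly one of x and x + w lies in A, then either the other one is
        outside U, which the first two indicators count, or it lies in U - A, which the last two
        count.\<close>
      have "(\<integral>\<^sup>+x. ennreal (norm (indicator A (x + w n) *\<^sub>R c - indicator A x *\<^sub>R c)) \<partial>lborel)
        \<le> (\<integral>\<^sup>+x. ennreal (norm c) * ((indicator {x \<in> U. x + w n \<notin> U} x + indicator {x \<in> U. x + - w n \<notin> U} (x + w n))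
             + (indicator (U - A) (x + w n) + indicator (U - A) x)) \<partial>lborel)"
        using U(2) by (intro nn_integral_mono) (auto simp: indicator_def)
      also have "\<dots> = ennreal (norm c) * ((?F (w n) + (\<integral>\<^sup>+x. indicator {x \<in> U. x + - w n \<notin> U} (x + w n) \<partial>lborel))
             + ((\<integral>\<^sup>+x. indicator (U - A) (x + w n) \<partial>lborel) + (\<integral>\<^sup>+x. indicator (U - A) x \<partial>lborel)))"
        by (simp add: nn_integral_cmult nn_integral_add)
      also have "(\<integral>\<^sup>+x. indicator {x \<in> U. x + - w n \<notin> U} (x + w n) \<partial>lborel) = ?F (- w n)"
        by (rule nn_integral_translate) measurable
      also have "(\<integral>\<^sup>+x. indicator (U - A) (x + w n) \<partial>lborel) = (\<integral>\<^sup>+x. indicator (U - A) x \<partial>lborel)"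
        by (rule nn_integral_translate) measurable
      also have "(\<integral>\<^sup>+x. indicator (U - A) x \<partial>lborel) = emeasure lborel (U - A)" by simp
      also have "ennreal (norm c) * ((?F (w n) + ?F (- w n)) + (emeasure lborel (U - A) + emeasure lborel (U - A)))
        \<le> ennreal (e / 2) + ennreal (norm c) * (ennreal d + ennreal d)"
        unfolding distrib_left[of "ennreal (norm c)" "?F (w n) + ?F (- w n)"]
        using elim U(3) by (intro add_mono mult_left_mono) auto
      also have "\<dots> = ennreal (e / 2 + norm c * (2 * d))"
        using e d by (simp add: ennreal_plus[symmetric] ennreal_mult[symmetric] del: ennreal_plus)
      also have "\<dots> \<le> ennreal e" using d2 by (intro ennreal_leI) linarith
      finally show ?case .
    qed
  qed
next
  case (add f g)
  from add.hyps have [measurable]: "f \<in> borel_measurable borel" "g \<in> borel_measurable borel"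
    using borel_measurable_integrable by force+
  have "(\<lambda>n. (\<integral>\<^sup>+x. ennreal (norm (f (x + w n) - f x)) \<partial>lborel) + (\<integral>\<^sup>+x. ennreal (norm (g (x + w n) - g x)) \<partial>lborel)) \<longlonglongrightarrow> 0 + 0"
    by (intro tendsto_add add.IH)
  then have sum: "(\<lambda>n. (\<integral>\<^sup>+x. ennreal (norm (f (x + w n) - f x)) \<partial>lborel) + (\<integral>\<^sup>+x. ennreal (norm (g (x + w n) - g x)) \<partial>lborel)) \<longlonglongrightarrow> 0"
    by simp
  show ?case
  proof (rule tendsto_sandwich[OF _ _ tendsto_const sum])
    show "\<forall>\<^sub>F n in sequentially. 0 \<le> (\<integral>\<^sup>+x. ennreal (norm (f (x + w n) + g (x + w n) - (f x + g x))) \<partial>lborel)"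
      by simp
    show "\<forall>\<^sub>F n in sequentially. (\<integral>\<^sup>+x. ennreal (norm (f (x + w n) + g (x + w n) - (f x + g x))) \<partial>lborel)
      \<le> (\<integral>\<^sup>+x. ennreal (norm (f (x + w n) - f x)) \<partial>lborel) + (\<integral>\<^sup>+x. ennreal (norm (g (x + w n) - g x)) \<partial>lborel)"
    proof (intro always_eventually allI)
      fix n
      have "norm (f (x + w n) + g (x + w n) - (f x + g x)) \<le> norm (f (x + w n) - f x) + norm (g (x + w n) - g x)" for x
        using norm_triangle_ineq[of "f (x + w n) - f x" "g (x + w n) - g x"] by (simp add: algebra_simps)
      then have "(\<integral>\<^sup>+x. ennreal (norm (f (x + w n) + g (x + w n) - (f x + g x))) \<partial>lborel)
         \<le> (\<integral>\<^sup>+x. ennreal (norm (f (x + w n) - f x)) + ennreal (norm (g (x + w n) - g x)) \<partial>lborel)"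
        by (intro nn_integral_mono) (simp add: ennreal_plus[symmetric] ennreal_leI del: ennreal_plus)
      also have "\<dots> = (\<integral>\<^sup>+x. ennreal (norm (f (x + w n) - f x)) \<partial>lborel) + (\<integral>\<^sup>+x. ennreal (norm (g (x + w n) - g x)) \<partial>lborel)"
        by (rule nn_integral_add) measurable
      finally show "(\<integral>\<^sup>+x. ennreal (norm (f (x + w n) + g (x + w n) - (f x + g x))) \<partial>lborel)
      \<le> (\<integral>\<^sup>+x. ennreal (norm (f (x + w n) - f x)) \<partial>lborel) + (\<integral>\<^sup>+x. ennreal (norm (g (x + w n) - g x)) \<partial>lborel)" .
    qed
  qed
next
  case (lim f s)
  from lim.hyps have [measurable]: "f \<in> borel_measurable borel" "\<And>i. s i \<in> borel_measurable borel"
    using borel_measurable_integrable by force+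
  have "(\<lambda>i. \<integral>\<^sup>+x. ennreal (norm (s i x - f x)) \<partial>lborel) \<longlonglongrightarrow> (\<integral>\<^sup>+x. 0 \<partial>(lborel :: (real ^ 'n) measure))"
  proof (rule nn_integral_dominated_convergence[where w="\<lambda>x. ennreal (3 * norm (f x))"])
    show "AE x in lborel. ennreal (norm (s j x - f x)) \<le> ennreal (3 * norm (f x))" for j
    proof (rule AE_I2, rule ennreal_leI)
      fix x show "norm (s j x - f x) \<le> 3 * norm (f x)"
        using norm_triangle_ineq4[of "s j x" "f x"] lim.hyps(3)[of x j] by simp
    qed
    show "(\<integral>\<^sup>+x. ennreal (3 * norm (f x)) \<partial>lborel) < \<infinity>"
      using lim.hyps(4) by (simp add: integrable_iff_bounded ennreal_mult nn_integral_cmult ennreal_mult_less_top)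
    show "AE x in lborel. (\<lambda>i. ennreal (norm (s i x - f x))) \<longlonglongrightarrow> 0"
    proof (rule AE_I2)
      fix x
      have "(\<lambda>i. norm (s i x - f x)) \<longlonglongrightarrow> norm (f x - f x)"
        by (intro tendsto_intros lim.hyps(2)) simp
      from tendsto_ennrealI[OF this] show "(\<lambda>i. ennreal (norm (s i x - f x))) \<longlonglongrightarrow> 0" by simp
    qed
  qed measurable
  then have conv: "(\<lambda>i. \<integral>\<^sup>+x. ennreal (norm (s i x - f x)) \<partial>lborel) \<longlonglongrightarrow> 0" by simp
  show ?case
  proof (rule ennreal_tendsto_0I)
    fix e :: real assume e: "e > 0"
    have "eventually (\<lambda>i. (\<integral>\<^sup>+x. ennreal (norm (s i x - f x)) \<partial>lborel) < ennreal (e / 3)) sequentially"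
      using e by (intro order_tendstoD(2)[OF conv]) auto
    then obtain i where i: "(\<integral>\<^sup>+x. ennreal (norm (s i x - f x)) \<partial>lborel) < ennreal (e / 3)"
      by (auto simp: eventually_sequentially)
    have "eventually (\<lambda>n. (\<integral>\<^sup>+x. ennreal (norm (s i (x + w n) - s i x)) \<partial>lborel) < ennreal (e / 3)) sequentially"
      using e by (intro order_tendstoD(2)[OF lim.IH[of i]]) auto
    then show "eventually (\<lambda>n. (\<integral>\<^sup>+x. ennreal (norm (f (x + w n) - f x)) \<partial>lborel) \<le> ennreal e) sequentially"
    proof eventually_elim
      case (elim n)
      have "norm (f (x + w n) - f x) \<le> norm (s i (x + w n) - f (x + w n)) + norm (s i (x + w n) - s i x) + norm (s i x - f x)" for x
        by norm
      then have "(\<integral>\<^sup>+x. ennreal (norm (f (x + w n) - f x)) \<partial>lborel)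
        \<le> (\<integral>\<^sup>+x. ennreal (norm (s i (x + w n) - f (x + w n))) + ennreal (norm (s i (x + w n) - s i x)) + ennreal (norm (s i x - f x)) \<partial>lborel)"
        by (intro nn_integral_mono) (simp add: ennreal_plus[symmetric] ennreal_leI del: ennreal_plus)
      also have "\<dots> = (\<integral>\<^sup>+x. ennreal (norm (s i (x + w n) - f (x + w n))) \<partial>lborel)
         + (\<integral>\<^sup>+x. ennreal (norm (s i (x + w n) - s i x)) \<partial>lborel) + (\<integral>\<^sup>+x. ennreal (norm (s i x - f x)) \<partial>lborel)"
        by (simp add: nn_integral_add)
      also have "(\<integral>\<^sup>+x. ennreal (norm (s i (x + w n) - f (x + w n))) \<partial>lborel) = (\<integral>\<^sup>+x. ennreal (norm (s i x - f x)) \<partial>lborel)"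
        by (rule nn_integral_translate[of "\<lambda>x. ennreal (norm (s i x - f x))"]) measurable
      also have "(\<integral>\<^sup>+x. ennreal (norm (s i x - f x)) \<partial>lborel)
         + (\<integral>\<^sup>+x. ennreal (norm (s i (x + w n) - s i x)) \<partial>lborel) + (\<integral>\<^sup>+x. ennreal (norm (s i x - f x)) \<partial>lborel)
         \<le> ennreal (e / 3) + ennreal (e / 3) + ennreal (e / 3)"
        using i elim by (intro add_mono) auto
      also have "\<dots> = ennreal e" using e by (simp add: ennreal_plus[symmetric] del: ennreal_plus)
      finally show ?case .
    qed
  qed
qed

text \<open>The quotient minus the directional derivative is the mean over s in [0, 1] of k (x + s t
  v) - k x. For fixed s this tends to 0 in mean by continuity of translations, and dominated
  convergence in s concludes.\<close>

lemma weak_gradient_difference_quotient: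
  fixes \<psi> :: "real ^ 'n \<Rightarrow> complex"
  assumes w: "weak_gradient \<psi> h" and [measurable]: "\<psi> \<in> borel_measurable borel" "h \<in> borel_measurable borel"
    and t: "t \<longlonglongrightarrow> 0" "\<And>n. t n \<noteq> 0"
  shows "(\<lambda>n. \<integral>\<^sup>+x. ennreal (norm ((\<psi> (x + t n *\<^sub>R v) - \<psi> x) /\<^sub>R t n - along v h x)) * indicator (cball 0 R) x \<partial>lborel) \<longlonglongrightarrow> 0"
proof -
  have h: "h \<in> Lspace_loc 1" using w by (auto simp: weak_gradient_def)
  define k where "k = along v h"
  have k: "k \<in> Lspace_loc 1" unfolding k_def by (rule Lspace_loc_1_along[OF h])
  have kb [measurable]: "k \<in> borel_measurable borel" unfolding k_def by measurable
  \<comment> \<open>Cutting k off beyond radius R + \<open>norm v\<close> makes it integrable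
    without affecting the segments that start in the ball of radius R, as long as |t| \<le>
    1.\<close>
  define g where "g x = indicator (cball 0 (R + norm v)) x *\<^sub>R k x" for x
  have [measurable]: "g \<in> borel_measurable borel" unfolding g_def[abs_def] by measurable
  have gi: "integrable lborel g"
  proof -
    have "integrable lebesgue (\<lambda>x. indicator (cball 0 (R + norm v)) x *\<^sub>R k x)"
    proof (rule integrable_test_mult[OF k, where M=1 and R="R + norm v"])
      show "indicator (cball 0 (R + norm v)) \<in> borel_measurable lebesgue" by measurable
    qed (auto simp: indicator_def)
    then show ?thesis unfolding g_def[abs_def] by (subst (asm) integrable_completion) auto
  qed
  have Gfin: "(\<integral>\<^sup>+x. ennreal (norm (g x)) \<partial>lborel) < \<infinity>"
    using gi by (simp add: integrable_iff_bounded)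
  let ?\<Phi> = "\<lambda>n s. \<integral>\<^sup>+x. ennreal (norm (g (x + s *\<^sub>R (t n *\<^sub>R v)) - g x)) \<partial>lborel"
  have lim: "(\<lambda>n. \<integral>\<^sup>+s. indicator {0..1} s * ?\<Phi> n s \<partial>lborel) \<longlonglongrightarrow> (\<integral>\<^sup>+s. 0 \<partial>(lborel :: real measure))"
  proof (rule nn_integral_dominated_convergence[where w="\<lambda>s. (2 * (\<integral>\<^sup>+x. ennreal (norm (g x)) \<partial>lborel)) * indicator {0..1} s"])
    show "AE s in lborel. indicator {0..1} s * ?\<Phi> n s \<le> (2 * (\<integral>\<^sup>+x. ennreal (norm (g x)) \<partial>lborel)) * indicator {0..1} s" for n
    proof (rule AE_I2)
      fix s :: real
      have "?\<Phi> n s \<le> (\<integral>\<^sup>+x. ennreal (norm (g (x + s *\<^sub>R (t n *\<^sub>R v)))) + ennreal (norm (g x)) \<partial>lborel)"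
        by (intro nn_integral_mono) (simp add: ennreal_plus[symmetric] ennreal_leI norm_triangle_ineq4 del: ennreal_plus)
      also have "\<dots> = (\<integral>\<^sup>+x. ennreal (norm (g (x + s *\<^sub>R (t n *\<^sub>R v)))) \<partial>lborel) + (\<integral>\<^sup>+x. ennreal (norm (g x)) \<partial>lborel)"
        by (rule nn_integral_add) measurable
      also have "(\<integral>\<^sup>+x. ennreal (norm (g (x + s *\<^sub>R (t n *\<^sub>R v)))) \<partial>lborel) = (\<integral>\<^sup>+x. ennreal (norm (g x)) \<partial>lborel)"
        by (rule nn_integral_translate[of "\<lambda>x. ennreal (norm (g x))"]) measurable
      finally show "indicator {0..1} s * ?\<Phi> n s \<le> (2 * (\<integral>\<^sup>+x. ennreal (norm (g x)) \<partial>lborel)) * indicator {0..1} s"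
        by (auto simp: indicator_def mult_2)
    qed
    show "(\<integral>\<^sup>+s. (2 * (\<integral>\<^sup>+x. ennreal (norm (g x)) \<partial>lborel)) * indicator {0..1} s \<partial>(lborel :: real measure)) < \<infinity>"
      using Gfin by (simp add: nn_integral_cmult_indicator ennreal_mult_less_top)
    show "AE s in lborel. (\<lambda>n. indicator {0..1} s * ?\<Phi> n s) \<longlonglongrightarrow> 0"
    proof (rule AE_I2)
      fix s :: real
      have "(\<lambda>n. s *\<^sub>R (t n *\<^sub>R v)) \<longlonglongrightarrow> s *\<^sub>R (0 *\<^sub>R v)" by (intro tendsto_intros t)
      then have "(\<lambda>n. s *\<^sub>R (t n *\<^sub>R v)) \<longlonglongrightarrow> 0" by simp
      from translation_continuous_L1[OF gi this]
      have "(\<lambda>n. indicator {0..1} s * ?\<Phi> n s) \<longlonglongrightarrow> indicator {0..1} s * 0"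
        by (intro ennreal_tendsto_cmult) (auto simp: indicator_def)
      then show "(\<lambda>n. indicator {0..1} s * ?\<Phi> n s) \<longlonglongrightarrow> 0" by simp
    qed
  qed measurable
  have le: "(\<integral>\<^sup>+x. ennreal (norm ((\<psi> (x + t n *\<^sub>R v) - \<psi> x) /\<^sub>R t n - along v h x)) * indicator (cball 0 R) x \<partial>lborel)
     \<le> (\<integral>\<^sup>+s. indicator {0..1} s * ?\<Phi> n s \<partial>lborel)" if tn: "\<bar>t n\<bar> \<le> 1" for n
  proof -
    let ?v = "t n *\<^sub>R v"
    have k': "along ?v h x = t n *\<^sub>R k x" for x by (simp add: along_scaleR k_def)
    have "AE x in lborel. ennreal (norm ((\<psi> (x + ?v) - \<psi> x) /\<^sub>R t n - along v h x)) * indicator (cball 0 R) x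
      \<le> (\<integral>\<^sup>+s. indicator {0..1} s * ennreal (norm (g (x + s *\<^sub>R ?v) - g x)) \<partial>lborel)"
      using weak_gradient_translation[OF w assms(2,3), of ?v, unfolded k']
        segment_integral(1)[OF kb k, of ?v]
    proof eventually_elim
      case (elim x)
      show ?case
      proof (cases "norm x \<le> R")
        case True
        have "(\<psi> (x + ?v) - \<psi> x) /\<^sub>R t n = (\<integral>s. indicator {0..1} s *\<^sub>R k (x + s *\<^sub>R ?v) \<partial>lborel)"
          using t(2)[of n] unfolding elim(1) integral_scaleR_right scaleR_left_commute[of _ "t n"] by simp
        moreover have c: "has_bochner_integral lborel (\<lambda>s. indicator {0..1::real} s *\<^sub>R k x) (k x)"
          using has_bochner_integral_scaleR_left[OF has_bochner_integral_real_indicator[of "{0..1::real}" lborel], of "k x"] by simp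
        ultimately have "(\<psi> (x + ?v) - \<psi> x) /\<^sub>R t n - k x
          = (\<integral>s. indicator {0..1} s *\<^sub>R k (x + s *\<^sub>R ?v) - indicator {0..1} s *\<^sub>R k x \<partial>lborel)"
          using elim(2) by (simp add: has_bochner_integral_iff)
        also have "\<dots> = (\<integral>s. indicator {0..1} s *\<^sub>R (g (x + s *\<^sub>R ?v) - g x) \<partial>lborel)"
        proof (rule Bochner_Integration.integral_cong[OF refl])
          fix s :: real
          have "norm (x + s *\<^sub>R ?v) \<le> R + norm v" if "0 \<le> s" "s \<le> 1"
          proof -
            have "\<bar>s * t n\<bar> \<le> 1" using that tn by (simp add: abs_mult mult_le_one)
            then have "norm (s *\<^sub>R ?v) \<le> norm v" by (simp add: mult_left_le_one_le)
            then show ?thesis using True norm_triangle_ineq[of x "s *\<^sub>R ?v"] by linarith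
          qed
          moreover have "norm x \<le> R + norm v" using True by (simp add: add_increasing2)
          ultimately show "indicator {0..1} s *\<^sub>R k (x + s *\<^sub>R ?v) - indicator {0..1} s *\<^sub>R k x
              = indicator {0..1} s *\<^sub>R (g (x + s *\<^sub>R ?v) - g x)"
            by (auto simp: g_def indicator_def)
        qed
        finally have eq: "(\<psi> (x + ?v) - \<psi> x) /\<^sub>R t n - k x = (\<integral>s. indicator {0..1} s *\<^sub>R (g (x + s *\<^sub>R ?v) - g x) \<partial>lborel)" .
        have "ennreal (norm ((\<psi> (x + ?v) - \<psi> x) /\<^sub>R t n - k x))
           \<le> (\<integral>\<^sup>+s. ennreal (norm (indicator {0..1} s *\<^sub>R (g (x + s *\<^sub>R ?v) - g x))) \<partial>lborel)"
          unfolding eq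
        proof (cases "integrable lborel (\<lambda>s. indicator {0..1} s *\<^sub>R (g (x + s *\<^sub>R ?v) - g x))")
          case True
          then show "ennreal (norm (\<integral>s. indicator {0..1} s *\<^sub>R (g (x + s *\<^sub>R ?v) - g x) \<partial>lborel))
             \<le> (\<integral>\<^sup>+s. ennreal (norm (indicator {0..1} s *\<^sub>R (g (x + s *\<^sub>R ?v) - g x))) \<partial>lborel)"
            by (rule integral_norm_bound_ennreal)
        qed (simp add: not_integrable_integral_eq)
        also have "\<dots> = (\<integral>\<^sup>+s. indicator {0..1} s * ennreal (norm (g (x + s *\<^sub>R ?v) - g x)) \<partial>lborel)"
          by (rule nn_integral_cong) (auto simp: indicator_def)
        finally show ?thesis using True by (simp add: k_def)
      qed simp
    qed
    then have "(\<integral>\<^sup>+x. ennreal (norm ((\<psi> (x + ?v) - \<psi> x) /\<^sub>R t n - along v h x)) * indicator (cball 0 R) x \<partial>lborel)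
      \<le> (\<integral>\<^sup>+x. \<integral>\<^sup>+s. indicator {0..1} s * ennreal (norm (g (x + s *\<^sub>R ?v) - g x)) \<partial>lborel \<partial>lborel)"
      by (rule nn_integral_mono_AE)
    also have "\<dots> = (\<integral>\<^sup>+s. \<integral>\<^sup>+x. indicator {0..1} s * ennreal (norm (g (x + s *\<^sub>R ?v) - g x)) \<partial>lborel \<partial>lborel)"
      by (rule lborel_pair.Fubini') measurable
    also have "\<dots> = (\<integral>\<^sup>+s. indicator {0..1} s * ?\<Phi> n s \<partial>lborel)"
      by (rule nn_integral_cong, rule nn_integral_cmult) measurable
    finally show ?thesis .
  qed
  have ev: "eventually (\<lambda>n. \<bar>t n\<bar> \<le> 1) sequentially"
    using tendstoD[OF t(1), of 1] by (auto elim!: eventually_mono)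
  show ?thesis
  proof (rule tendsto_sandwich[OF _ _ tendsto_const])
    show "\<forall>\<^sub>F n in sequentially. (\<integral>\<^sup>+x. ennreal (norm ((\<psi> (x + t n *\<^sub>R v) - \<psi> x) /\<^sub>R t n - along v h x)) * indicator (cball 0 R) x \<partial>lborel)
      \<le> (\<integral>\<^sup>+s. indicator {0..1} s * ?\<Phi> n s \<partial>lborel)"
      using ev by eventually_elim (rule le)
    show "(\<lambda>n. \<integral>\<^sup>+s. indicator {0..1} s * ?\<Phi> n s \<partial>lborel) \<longlonglongrightarrow> 0" using lim by simp
  qed simp
qed

subsection \<open>The modulus of a function with a weak gradient\<close>

lemma borel_measurable_vec_lambda:
  fixes f :: "'a \<Rightarrow> 'n::finite \<Rightarrow> 'b::euclidean_space"
  assumes "\<And>j. (\<lambda>x. f x j) \<in> borel_measurable M"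
  shows "(\<lambda>x. \<chi> j. f x j) \<in> borel_measurable M"
  using assms by (subst borel_measurable_euclidean_space) (auto simp: Basis_vec_def inner_axis)

lemma measurable_cnj [measurable]: "cnj \<in> borel_measurable borel"
  by (intro borel_measurable_continuous_onI continuous_intros)

lemma norm_of_real_Re_mult_le:
  assumes "norm a \<le> 1"
  shows "norm (complex_of_real (Re (cnj a * y))) \<le> norm y"
proof -
  have "norm (complex_of_real (Re (cnj a * y))) \<le> norm (cnj a * y)"
    unfolding norm_of_real by (rule abs_Re_le_cmod)
  also have "\<dots> \<le> 1 * norm y"
    unfolding norm_mult complex_mod_cnj by (rule mult_right_mono[OF assms]) simp
  finally show ?thesis by simp
qed

lemma test_function_derivative_line:
  assumes "test_function \<phi>"
  shows "((\<lambda>s. \<phi> (x + s *\<^sub>R v)) has_real_derivative frechet_derivative \<phi> (at (x + s *\<^sub>R v)) v) (at s)"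
proof -
  have l: "linear (frechet_derivative \<phi> (at (x + s *\<^sub>R v)))"
    using test_function_has_derivative[OF assms] has_derivative_linear by blast
  have "((\<lambda>s. x + s *\<^sub>R v) has_derivative (\<lambda>t. t *\<^sub>R v)) (at s)"
    by (auto intro!: derivative_eq_intros)
  from has_derivative_compose[OF this test_function_has_derivative[OF assms]]
  have "((\<lambda>s. \<phi> (x + s *\<^sub>R v)) has_derivative (\<lambda>t. frechet_derivative \<phi> (at (x + s *\<^sub>R v)) (t *\<^sub>R v))) (at s)" .
  then show ?thesis
    by (simp add: has_field_derivative_def linear_scale[OF l] mult.commute[of _ "frechet_derivative \<phi> (at (x + s *\<^sub>R v)) v"] fun_eq_iff)
qed

lemma symmetric_quotient:
  fixes g :: "real \<Rightarrow> real"
  assumes "(g has_real_derivative D) (at 0)" "t \<longlonglongrightarrow> 0" "\<And>n. t n \<noteq> 0"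
  shows "(\<lambda>n. (g (t n) - g (- t n)) / (2 * t n)) \<longlonglongrightarrow> D"
proof -
  have lim: "((\<lambda>y. (g y - g 0) / y) \<longlongrightarrow> D) (at 0)"
    using assms(1) by (simp add: has_field_derivative_iff)
  have *: "(\<lambda>n. (g (u n) - g 0) / u n) \<longlonglongrightarrow> D" if "u \<longlonglongrightarrow> 0" "\<And>n. u n \<noteq> 0" for u
    by (rule filterlim_compose[OF lim]) (use that in \<open>auto simp: filterlim_at\<close>)
  have L: "(\<lambda>n. ((g (t n) - g 0) / t n + (g (- t n) - g 0) / (- t n)) / 2) \<longlonglongrightarrow> (D + D) / 2"
    using assms(2,3) tendsto_minus[OF assms(2)] by (intro tendsto_intros *) auto
  have E: "((g (t n) - g 0) / t n + (g (- t n) - g 0) / (- t n)) / 2 = (g (t n) - g (- t n)) / (2 * t n)" for n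
    using assms(3)[of n] by (simp add: field_simps)
  show ?thesis using L unfolding E by simp
qed

text \<open>The mean value theorem bounds the quotients by a bound for the directional derivative,
  and t \<le> 1 keeps their supports in one ball; together these dominate the integrands by a
  multiple of |f| on that ball.\<close>

lemma test_function_symmetric_quotient:
  fixes f :: "real ^ 'n \<Rightarrow> real"
  assumes \<phi>: "test_function \<phi>" and f: "f \<in> Lspace_loc 1"
    and t: "t \<longlonglongrightarrow> 0" "\<And>n. 0 < t n" "\<And>n. t n \<le> 1"
  shows "(\<lambda>n. \<integral>x. ((\<phi> (x + t n *\<^sub>R v) - \<phi> (x - t n *\<^sub>R v)) / (2 * t n)) *\<^sub>R f x \<partial>lebesgue)
    \<longlonglongrightarrow> (\<integral>x. frechet_derivative \<phi> (at x) v *\<^sub>R f x \<partial>lebesgue)"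
proof -
  have [measurable]: "f \<in> borel_measurable lebesgue" using f by (simp add: Lspace_loc_1_iff)
  note D = test_function_derivative[OF \<phi>, of v]
  obtain R where R: "R > 0" "\<And>x. norm x > R \<Longrightarrow> \<phi> x = 0" using test_function_bounds[OF \<phi>] by blast
  obtain M where M: "M > 0" "\<And>x. \<bar>frechet_derivative \<phi> (at x) v\<bar> \<le> M" using test_function_bounds[OF D] by blast
  let ?R = "R + norm v"
  let ?q = "\<lambda>n x. (\<phi> (x + t n *\<^sub>R v) - \<phi> (x - t n *\<^sub>R v)) / (2 * t n)"
  have q: "\<bar>?q n x\<bar> \<le> M * indicator (cball 0 ?R) x" for n x
  proof (cases "norm x \<le> ?R")
    case True
    have "\<exists>z>- t n. z < t n \<and> \<phi> (x + t n *\<^sub>R v) - \<phi> (x + (- t n) *\<^sub>R v)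
      = (t n - (- t n)) * frechet_derivative \<phi> (at (x + z *\<^sub>R v)) v"
      by (rule MVT2) (use t(2)[of n] in \<open>auto intro: test_function_derivative_line[OF \<phi>]\<close>)
    then obtain z where "\<phi> (x + t n *\<^sub>R v) - \<phi> (x - t n *\<^sub>R v) = (2 * t n) * frechet_derivative \<phi> (at (x + z *\<^sub>R v)) v"
      by auto
    then show ?thesis using True M(2)[of "x + z *\<^sub>R v"] t(2)[of n] by simp
  next
    case False
    have "norm (t n *\<^sub>R v) \<le> norm v" using t(2,3)[of n] by (simp add: mult_left_le_one_le)
    then have "norm (x + t n *\<^sub>R v) > R" "norm (x - t n *\<^sub>R v) > R"
      using False norm_triangle_ineq2[of x "t n *\<^sub>R v"] norm_triangle_ineq2[of x "- (t n *\<^sub>R v)"] by auto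
    then show ?thesis using R(2) False by simp
  qed
  show ?thesis
  proof (rule integral_dominated_convergence[where w="\<lambda>x. norm ((M * indicator (cball 0 ?R) x) *\<^sub>R f x)"])
    have "integrable lebesgue (\<lambda>x. (M * indicator (cball 0 ?R) x) *\<^sub>R f x)"
    proof (rule integrable_test_mult[OF f, where M=M and R="?R"])
      show "(\<lambda>x. M * indicator (cball 0 ?R) x) \<in> borel_measurable lebesgue" by measurable
    qed (use M(1) in \<open>auto simp: indicator_def\<close>)
    then show "integrable lebesgue (\<lambda>x. norm ((M * indicator (cball 0 ?R) x) *\<^sub>R f x))" by simp
    have "test_function (\<lambda>x. \<phi> (x + a))" for a
      using test_function_affine[OF \<phi>, of 1 a] by (simp add: add.commute)
    from this[THEN test_function_lebesgue_measurable]
    have [measurable]: "(\<lambda>x. \<phi> (x + a)) \<in> borel_measurable lebesgue" for a .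
    have [measurable]: "(\<lambda>x. \<phi> (x - a)) \<in> borel_measurable lebesgue" for a
      using \<open>(\<lambda>x. \<phi> (x + - a)) \<in> borel_measurable lebesgue\<close> by simp
    show "(\<lambda>x. ?q n x *\<^sub>R f x) \<in> borel_measurable lebesgue" for n by measurable
    show "(\<lambda>x. frechet_derivative \<phi> (at x) v *\<^sub>R f x) \<in> borel_measurable lebesgue"
      using test_function_lebesgue_measurable[OF D] by measurable
    show "AE x in lebesgue. (\<lambda>n. ?q n x *\<^sub>R f x) \<longlonglongrightarrow> frechet_derivative \<phi> (at x) v *\<^sub>R f x"
    proof (rule AE_I2)
      fix x
      have "((\<lambda>s. \<phi> (x + s *\<^sub>R v)) has_real_derivative frechet_derivative \<phi> (at x) v) (at 0)"
        using test_function_derivative_line[OF \<phi>, of x v 0] by simp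
      from symmetric_quotient[OF this t(1)] t(2)
      have "(\<lambda>n. ?q n x) \<longlonglongrightarrow> frechet_derivative \<phi> (at x) v" by (simp add: less_imp_neq[symmetric])
      then show "(\<lambda>n. ?q n x *\<^sub>R f x) \<longlonglongrightarrow> frechet_derivative \<phi> (at x) v *\<^sub>R f x"
        by (intro tendsto_intros)
    qed
    show "AE x in lebesgue. norm (?q n x *\<^sub>R f x) \<le> norm ((M * indicator (cball 0 ?R) x) *\<^sub>R f x)" for n
    proof (rule AE_I2)
      fix x
      have "\<bar>?q n x\<bar> * \<bar>f x\<bar> \<le> (M * indicator (cball 0 ?R) x) * \<bar>f x\<bar>"
        by (rule mult_right_mono[OF q]) simp
      then show "norm (?q n x *\<^sub>R f x) \<le> norm ((M * indicator (cball 0 ?R) x) *\<^sub>R f x)"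
        using M(1) by (simp add: abs_mult)
    qed
  qed
qed

lemma Lspace_loc_1_const: "(\<lambda>_ :: real ^ 'a. c) \<in> Lspace_loc 1"
proof -
  have "emeasure lborel (cball (0 :: real ^ 'a) R) < top" for R
    using emeasure_lborel_cball_finite[of "0 :: real ^ 'a" R] by simp
  then show ?thesis
    unfolding Lspace_loc_1_iff
    by (auto simp: nn_integral_cmult_indicator ennreal_mult_less_top nn_integral_completion)
qed

text \<open>The symmetric difference quotient of \<open>F\<close> exists everywhere for \<open>F = norm\<close>, also at the origin,
  so that no regularisation is needed on the zero set of \<open>\<psi>\<close>.\<close>

lemma weak_gradient_compose:
  fixes \<psi> :: "real ^ 'n \<Rightarrow> complex" and F :: "complex \<Rightarrow> real" and a :: "complex \<Rightarrow> complex"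
  assumes w: "weak_gradient \<psi> h"
    and lip: "\<And>y z. \<bar>F y - F z\<bar> \<le> norm (y - z)"
    and a [measurable]: "a \<in> borel_measurable borel" and a1: "\<And>z. norm (a z) \<le> 1"
    and der: "\<And>z y t. t \<longlonglongrightarrow> 0 \<Longrightarrow> (\<And>n. 0 < t n) \<Longrightarrow>
      (\<lambda>n. (F (z + t n *\<^sub>R y) - F (z - t n *\<^sub>R y)) / (2 * t n)) \<longlonglongrightarrow> Re (cnj (a z) * y)"
  shows "weak_gradient (\<lambda>x. complex_of_real (F (\<psi> x)))
    (\<lambda>x. \<chi> j. complex_of_real (Re (cnj (a (\<psi> x)) * h x $ j)))"
proof -
  have "continuous_on UNIV F"
  proof (rule continuous_onI)
    fix x e :: real and z :: complex assume "e > 0"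
    then show "\<exists>d>0. \<forall>z'\<in>UNIV. dist z' z < d \<longrightarrow> dist (F z') (F z) \<le> e"
      using lip by (intro exI[of _ e]) (auto simp: dist_norm intro!: order_trans[OF lip less_imp_le])
  qed
  then have [measurable]: "F \<in> borel_measurable borel" by (rule borel_measurable_continuous_onI)
  have vecm: "(\<lambda>x. \<chi> j. complex_of_real (Re (cnj (a (f x)) * k x $ j))) \<in> borel_measurable M"
    if [measurable]: "f \<in> borel_measurable M" "k \<in> borel_measurable M"
    for f and k :: "real ^ 'n \<Rightarrow> complex ^ 'n" and M
    by (rule borel_measurable_vec_lambda) measurable
  obtain \<psi>' h' where [measurable]: "\<psi>' \<in> borel_measurable borel" "h' \<in> borel_measurable borel"
    and ae: "AE x in lebesgue. \<psi> x = \<psi>' x" "AE x in lebesgue. h x = h' x" and w': "weak_gradient \<psi>' h'"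
    by (rule weak_gradient_borel_version[OF w])
  have \<psi>': "\<psi>' \<in> Lspace_loc 1" and h': "h' \<in> Lspace_loc 1" using w' by (auto simp: weak_gradient_def)
  have [measurable]: "\<psi>' \<in> borel_measurable lebesgue" "h' \<in> borel_measurable lebesgue"
    using \<psi>' h' by (simp_all add: Lspace_loc_1_iff)
  have m0: "\<psi> \<in> borel_measurable lebesgue" "h \<in> borel_measurable lebesgue"
    using w by (auto simp: weak_gradient_def Lspace_loc_1_iff)
  have F1: "(\<lambda>x. F (\<psi>' x)) \<in> Lspace_loc 1"
  proof (rule Lspace_loc_1_bound[OF _ \<psi>' Lspace_loc_1_const[of "F 0"], of _ 1 1])
    show "norm (F (\<psi>' x)) \<le> 1 * norm (\<psi>' x) + 1 * norm (F 0)" for x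
      using lip[of "\<psi>' x" 0] by simp
  qed auto
  have k1: "(\<lambda>x. \<chi> j. complex_of_real (Re (cnj (a (\<psi>' x)) * h' x $ j))) \<in> Lspace_loc 1"
  proof (rule Lspace_loc_1_bound[OF _ h' h', of _ 1 0])
    show "(\<lambda>x. \<chi> j. complex_of_real (Re (cnj (a (\<psi>' x)) * h' x $ j))) \<in> borel_measurable lebesgue"
      by (rule vecm) measurable
    show "norm (\<chi> j. complex_of_real (Re (cnj (a (\<psi>' x)) * h' x $ j))) \<le> 1 * norm (h' x) + 0 * norm (h' x)" for x
    proof -
      have "norm (complex_of_real (Re (cnj (a (\<psi>' x)) * h' x $ j))) \<le> norm (h' x $ j)" for j
        by (rule norm_of_real_Re_mult_le[OF a1])
      then show ?thesis by (simp add: norm_vec_def L2_set_mono)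
    qed
  qed auto
  \<comment> \<open>A change of variables (\<open>B\<close>) moves the symmetric quotient from the
    test function onto \<open>F\<close>. There the increments of \<psi>' are replaced by their
    first-order parts t k with an error vanishing in mean (\<open>C2\<close>), and the assumed
    symmetric derivative of \<open>F\<close> gives the limit of what remains
    (\<open>C1\<close>).\<close>
  have main: "(\<integral>x. frechet_derivative \<phi> (at x) (axis j 1) *\<^sub>R F (\<psi>' x) \<partial>lebesgue)
     = - (\<integral>x. \<phi> x *\<^sub>R Re (cnj (a (\<psi>' x)) * h' x $ j) \<partial>lebesgue)" if \<phi>: "test_function \<phi>" for \<phi> j
  proof -
    define v :: "real ^ 'n" where "v = axis j 1"
    define k where "k x = h' x $ j" for x
    have kv: "along v h' = k" by (auto simp: v_def k_def along_axis)
    have [measurable]: "k \<in> borel_measurable borel" unfolding kv[symmetric] by measurable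
    have kl: "k \<in> Lspace_loc 1" using Lspace_loc_1_along[OF h', of v] by (simp add: kv)
    define t where "t n = 1 / real (Suc n)" for n
    have t: "t \<longlonglongrightarrow> 0" "\<And>n. 0 < t n" "\<And>n. t n \<le> 1"
      unfolding t_def[abs_def] using LIMSEQ_inverse_real_of_nat by (auto simp: inverse_eq_divide)
    have tn: "(\<lambda>n. - t n) \<longlonglongrightarrow> 0" "\<And>n. - t n \<noteq> 0" "\<And>n. t n \<noteq> 0"
      using tendsto_minus[OF t(1)] t(2) by (auto simp: less_imp_neq[symmetric])
    obtain R M where R: "\<And>x. norm x > R \<Longrightarrow> \<phi> x = 0" and M: "M > 0" "\<And>x. \<bar>\<phi> x\<bar> \<le> M"
      using test_function_bounds[OF \<phi>] by blast
    note [measurable] = test_function_measurable[OF \<phi>]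
    let ?G = "\<lambda>n x. (F (\<psi>' (x + t n *\<^sub>R v)) - F (\<psi>' (x - t n *\<^sub>R v))) / (2 * t n)"
    let ?Q = "\<lambda>n x. (F (\<psi>' x + t n *\<^sub>R k x) - F (\<psi>' x - t n *\<^sub>R k x)) / (2 * t n)"
    let ?E = "\<lambda>s x. norm ((\<psi>' (x + s *\<^sub>R v) - \<psi>' x) /\<^sub>R s - k x)"
    have shift: "(\<integral>x. \<phi> (x + b) *\<^sub>R F (\<psi>' x) \<partial>lborel) = (\<integral>x. \<phi> x *\<^sub>R F (\<psi>' (x - b)) \<partial>lborel)" for b
      using integral_affine[of 1 "\<lambda>x. \<phi> (x + b) *\<^sub>R F (\<psi>' x)" "- b"]
      by (simp add: measurable_completion integral_completion)
    have \<phi>s: "test_function (\<lambda>x. \<phi> (x + b))" for b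
      using test_function_affine[OF \<phi>, of 1 b] by (simp add: add.commute)
    have i1: "integrable lborel (\<lambda>x. \<phi> (x + b) *\<^sub>R F (\<psi>' x))" for b
      using integrable_test_function_mult[OF F1 \<phi>s[of b]] by (subst (asm) integrable_completion) auto
    have i2: "integrable lborel (\<lambda>x. \<phi> x *\<^sub>R F (\<psi>' (x + b)))" for b
    proof -
      have "(\<lambda>x. F (\<psi>' (x + b))) \<in> Lspace_loc 1"
        using Lspace_loc_1_affine[OF F1, of 1 b] by (simp add: add.commute)
      from integrable_test_function_mult[OF this \<phi>] show ?thesis by (subst (asm) integrable_completion) auto
    qed
    have A: "(\<lambda>n. \<integral>x. ((\<phi> (x + t n *\<^sub>R v) - \<phi> (x - t n *\<^sub>R v)) / (2 * t n)) *\<^sub>R F (\<psi>' x) \<partial>lebesgue)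
      \<longlonglongrightarrow> (\<integral>x. frechet_derivative \<phi> (at x) v *\<^sub>R F (\<psi>' x) \<partial>lebesgue)"
      by (rule test_function_symmetric_quotient[OF \<phi> F1 t])
    have B: "(\<integral>x. ((\<phi> (x + t n *\<^sub>R v) - \<phi> (x - t n *\<^sub>R v)) / (2 * t n)) *\<^sub>R F (\<psi>' x) \<partial>lebesgue)
      = - (\<integral>x. \<phi> x * ?G n x \<partial>lborel)" for n
    proof -
      have "(\<integral>x. ((\<phi> (x + t n *\<^sub>R v) - \<phi> (x - t n *\<^sub>R v)) / (2 * t n)) *\<^sub>R F (\<psi>' x) \<partial>lebesgue)
        = (\<integral>x. ((\<phi> (x + t n *\<^sub>R v) - \<phi> (x - t n *\<^sub>R v)) / (2 * t n)) *\<^sub>R F (\<psi>' x) \<partial>lborel)"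
        by (rule integral_completion) measurable
      also have "\<dots> = (\<integral>x. (\<phi> (x + t n *\<^sub>R v) *\<^sub>R F (\<psi>' x) - \<phi> (x + - (t n *\<^sub>R v)) *\<^sub>R F (\<psi>' x)) / (2 * t n) \<partial>lborel)"
        by (rule Bochner_Integration.integral_cong) (auto simp: algebra_simps diff_divide_distrib)
      also have "\<dots> = ((\<integral>x. \<phi> (x + t n *\<^sub>R v) *\<^sub>R F (\<psi>' x) \<partial>lborel) - (\<integral>x. \<phi> (x + - (t n *\<^sub>R v)) *\<^sub>R F (\<psi>' x) \<partial>lborel)) / (2 * t n)"
        using i1[of "t n *\<^sub>R v"] i1[of "- (t n *\<^sub>R v)"]
        by (subst integral_divide_zero, subst Bochner_Integration.integral_diff) auto
      also have "\<dots> = ((\<integral>x. \<phi> x *\<^sub>R F (\<psi>' (x - t n *\<^sub>R v)) \<partial>lborel) - (\<integral>x. \<phi> x *\<^sub>R F (\<psi>' (x + t n *\<^sub>R v)) \<partial>lborel)) / (2 * t n)"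
        unfolding shift by simp
      also have "\<dots> = - ((\<integral>x. (\<phi> x *\<^sub>R F (\<psi>' (x + t n *\<^sub>R v)) - \<phi> x *\<^sub>R F (\<psi>' (x + - (t n *\<^sub>R v)))) / (2 * t n) \<partial>lborel))"
        using i2[of "t n *\<^sub>R v"] i2[of "- (t n *\<^sub>R v)"]
        by (subst integral_divide_zero, subst Bochner_Integration.integral_diff) (auto simp: minus_divide_left)
      also have "(\<integral>x. (\<phi> x *\<^sub>R F (\<psi>' (x + t n *\<^sub>R v)) - \<phi> x *\<^sub>R F (\<psi>' (x + - (t n *\<^sub>R v)))) / (2 * t n) \<partial>lborel)
         = (\<integral>x. \<phi> x * ?G n x \<partial>lborel)"
        by (rule Bochner_Integration.integral_cong) (auto simp: algebra_simps diff_divide_distrib)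
      finally show ?thesis .
    qed
    have dom: "integrable lborel (\<lambda>x. \<phi> x *\<^sub>R k x)"
      using integrable_test_function_mult[OF kl \<phi>] by (subst (asm) integrable_completion) auto
    have Qb: "\<bar>?Q n x\<bar> \<le> norm (k x)" for n x
    proof -
      have "\<bar>F (\<psi>' x + t n *\<^sub>R k x) - F (\<psi>' x - t n *\<^sub>R k x)\<bar> \<le> norm ((2 * t n) *\<^sub>R k x)"
        using lip[of "\<psi>' x + t n *\<^sub>R k x" "\<psi>' x - t n *\<^sub>R k x"] by (simp add: scaleR_2[symmetric])
      then show ?thesis using t(2)[of n] by (simp add: abs_mult divide_le_eq mult.commute)
    qed
    have Qb2: "norm (\<phi> x * ?Q n x) \<le> norm (\<phi> x *\<^sub>R k x)" for n x
      unfolding real_norm_def abs_mult norm_scaleR by (rule mult_left_mono[OF Qb]) simp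
    have C1: "(\<lambda>n. \<integral>x. \<phi> x * ?Q n x \<partial>lborel) \<longlonglongrightarrow> (\<integral>x. \<phi> x * Re (cnj (a (\<psi>' x)) * k x) \<partial>lborel)"
    proof (rule integral_dominated_convergence[where w="\<lambda>x. norm (\<phi> x *\<^sub>R k x)"])
      show "integrable lborel (\<lambda>x. norm (\<phi> x *\<^sub>R k x))" by (rule integrable_norm[OF dom])
      show "AE x in lborel. (\<lambda>n. \<phi> x * ?Q n x) \<longlonglongrightarrow> \<phi> x * Re (cnj (a (\<psi>' x)) * k x)"
        by (rule AE_I2, intro tendsto_intros der t)
      show "AE x in lborel. norm (\<phi> x * ?Q n x) \<le> norm (\<phi> x *\<^sub>R k x)" for n
        by (intro AE_I2 Qb2)
    qed measurable
    have iQ: "integrable lborel (\<lambda>x. \<phi> x * ?Q n x)" for n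
    proof (rule Bochner_Integration.integrable_bound[OF dom])
      show "(\<lambda>x. \<phi> x * ?Q n x) \<in> borel_measurable lborel" by measurable
    qed (intro AE_I2 Qb2)
    have iG: "integrable lborel (\<lambda>x. \<phi> x * ?G n x)" for n
    proof -
      have "integrable lborel (\<lambda>x. (\<phi> x *\<^sub>R F (\<psi>' (x + t n *\<^sub>R v)) - \<phi> x *\<^sub>R F (\<psi>' (x + - (t n *\<^sub>R v)))) / (2 * t n))"
        by (intro Bochner_Integration.integrable_diff integrable_divide_zero i2)
      then show ?thesis
        by (rule Bochner_Integration.integrable_cong[THEN iffD1, rotated 2]) (auto simp: algebra_simps diff_divide_distrib)
    qed
    \<comment> \<open>The Lipschitz bound turns the error of each first-order expansion into t times
      \<open>?E\<close>, and the division by 2 t leaves only the errors of the two difference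
      quotients.\<close>
    have GQ: "\<bar>?G n x - ?Q n x\<bar> \<le> ?E (t n) x + ?E (- t n) x" for n x
    proof -
      have s: "norm (\<psi>' (x + s *\<^sub>R v) - (\<psi>' x + s *\<^sub>R k x)) = \<bar>s\<bar> * ?E s x" if "s \<noteq> 0" for s
      proof -
        have "\<psi>' (x + s *\<^sub>R v) - (\<psi>' x + s *\<^sub>R k x) = s *\<^sub>R ((\<psi>' (x + s *\<^sub>R v) - \<psi>' x) /\<^sub>R s - k x)"
          using that by (simp add: scaleR_diff_right)
        then show ?thesis by simp
      qed
      have "\<bar>F (\<psi>' (x + t n *\<^sub>R v)) - F (\<psi>' x + t n *\<^sub>R k x)\<bar> \<le> t n * ?E (t n) x"
        using lip[of "\<psi>' (x + t n *\<^sub>R v)" "\<psi>' x + t n *\<^sub>R k x"] s[of "t n"] t(2)[of n] by simp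
      moreover have "\<bar>F (\<psi>' (x - t n *\<^sub>R v)) - F (\<psi>' x - t n *\<^sub>R k x)\<bar> \<le> t n * ?E (- t n) x"
        using lip[of "\<psi>' (x - t n *\<^sub>R v)" "\<psi>' x - t n *\<^sub>R k x"] s[of "- t n"] t(2)[of n] by simp
      ultimately have "\<bar>(F (\<psi>' (x + t n *\<^sub>R v)) - F (\<psi>' (x - t n *\<^sub>R v))) - (F (\<psi>' x + t n *\<^sub>R k x) - F (\<psi>' x - t n *\<^sub>R k x))\<bar>
        \<le> t n * (?E (t n) x + ?E (- t n) x)"
        unfolding distrib_left by linarith
      also have "\<dots> \<le> (2 * t n) * (?E (t n) x + ?E (- t n) x)"
        using t(2)[of n] by (intro mult_right_mono add_nonneg_nonneg) auto
      finally show ?thesis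
        using t(2)[of n] unfolding diff_divide_distrib[symmetric] by (simp add: divide_le_eq mult.commute)
    qed
    have C2: "(\<lambda>n. (\<integral>x. \<phi> x * ?G n x \<partial>lborel) - (\<integral>x. \<phi> x * ?Q n x \<partial>lborel)) \<longlonglongrightarrow> 0"
    proof -
      let ?I = "\<lambda>s. \<integral>\<^sup>+x. ennreal (?E s x) * indicator (cball 0 R) x \<partial>lborel"
      have "(\<lambda>n. ?I (t n)) \<longlonglongrightarrow> 0"
        using weak_gradient_difference_quotient[OF w' _ _ t(1) tn(3), of v R] by (simp add: kv)
      moreover have "(\<lambda>n. ?I (- t n)) \<longlonglongrightarrow> 0"
        using weak_gradient_difference_quotient[OF w' _ _ tn(1,2), of v R] by (simp add: kv)
      ultimately have "(\<lambda>n. ennreal M * (?I (t n) + ?I (- t n))) \<longlonglongrightarrow> ennreal M * (0 + 0)"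
        by (intro ennreal_tendsto_cmult tendsto_add) auto
      then have lim: "(\<lambda>n. ennreal M * (?I (t n) + ?I (- t n))) \<longlonglongrightarrow> 0" by simp
      have "(\<lambda>n. ennreal (norm ((\<integral>x. \<phi> x * ?G n x \<partial>lborel) - (\<integral>x. \<phi> x * ?Q n x \<partial>lborel)))) \<longlonglongrightarrow> 0"
      proof (rule tendsto_sandwich[OF _ _ tendsto_const lim])
        show "\<forall>\<^sub>F n in sequentially. ennreal (norm ((\<integral>x. \<phi> x * ?G n x \<partial>lborel) - (\<integral>x. \<phi> x * ?Q n x \<partial>lborel)))
          \<le> ennreal M * (?I (t n) + ?I (- t n))"
        proof (intro always_eventually allI)
          fix n
          have "(\<integral>x. \<phi> x * ?G n x \<partial>lborel) - (\<integral>x. \<phi> x * ?Q n x \<partial>lborel) = (\<integral>x. \<phi> x * ?G n x - \<phi> x * ?Q n x \<partial>lborel)"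
            by (rule Bochner_Integration.integral_diff[OF iG iQ, symmetric])
          then have "ennreal (norm ((\<integral>x. \<phi> x * ?G n x \<partial>lborel) - (\<integral>x. \<phi> x * ?Q n x \<partial>lborel)))
             \<le> (\<integral>\<^sup>+x. ennreal (norm (\<phi> x * ?G n x - \<phi> x * ?Q n x)) \<partial>lborel)"
            using integral_norm_bound_ennreal[OF Bochner_Integration.integrable_diff[OF iG iQ]] by simp
          also have "\<dots> \<le> (\<integral>\<^sup>+x. ennreal M * (ennreal (?E (t n) x) * indicator (cball 0 R) x + ennreal (?E (- t n) x) * indicator (cball 0 R) x) \<partial>lborel)"
          proof (rule nn_integral_mono)
            fix x
            have "norm (\<phi> x * ?G n x - \<phi> x * ?Q n x) = \<bar>\<phi> x\<bar> * \<bar>?G n x - ?Q n x\<bar>"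
              by (simp only: right_diff_distrib[symmetric] real_norm_def abs_mult)
            also have "\<dots> \<le> M * (?E (t n) x + ?E (- t n) x) * indicator (cball 0 R) x"
            proof (cases "norm x \<le> R")
              case True
              then have i: "indicator (cball 0 R) x = (1 :: real)" by simp
              show ?thesis unfolding i mult_1_right by (intro mult_mono M GQ) (use M(1) in auto)
            qed (simp add: R)
            finally show "ennreal (norm (\<phi> x * ?G n x - \<phi> x * ?Q n x))
              \<le> ennreal M * (ennreal (?E (t n) x) * indicator (cball 0 R) x + ennreal (?E (- t n) x) * indicator (cball 0 R) x)"
              using M(1)
              by (cases "norm x \<le> R") (simp_all add: ennreal_mult[symmetric] ennreal_plus[symmetric] ennreal_leI del: ennreal_plus)
          qed
          also have "\<dots> = ennreal M * (?I (t n) + ?I (- t n))"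
            by (simp add: nn_integral_cmult nn_integral_add)
          finally show "ennreal (norm ((\<integral>x. \<phi> x * ?G n x \<partial>lborel) - (\<integral>x. \<phi> x * ?Q n x \<partial>lborel)))
          \<le> ennreal M * (?I (t n) + ?I (- t n))" .
        qed
      qed simp
      then have "(\<lambda>n. ennreal (norm ((\<integral>x. \<phi> x * ?G n x \<partial>lborel) - (\<integral>x. \<phi> x * ?Q n x \<partial>lborel)))) \<longlonglongrightarrow> ennreal 0" by simp
      then have "(\<lambda>n. norm ((\<integral>x. \<phi> x * ?G n x \<partial>lborel) - (\<integral>x. \<phi> x * ?Q n x \<partial>lborel))) \<longlonglongrightarrow> 0"
        by (subst (asm) tendsto_ennreal_iff) auto
      then show ?thesis by (rule tendsto_norm_zero_cancel)
    qed
    have "(\<lambda>n. \<integral>x. \<phi> x * ?G n x \<partial>lborel) \<longlonglongrightarrow> 0 + (\<integral>x. \<phi> x * Re (cnj (a (\<psi>' x)) * k x) \<partial>lborel)"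
      using tendsto_add[OF C2 C1] by simp
    then have "(\<lambda>n. - (\<integral>x. \<phi> x * ?G n x \<partial>lborel)) \<longlonglongrightarrow> - (\<integral>x. \<phi> x * Re (cnj (a (\<psi>' x)) * k x) \<partial>lborel)"
      by (intro tendsto_minus) simp
    from LIMSEQ_unique[OF A[unfolded B] this]
    have "(\<integral>x. frechet_derivative \<phi> (at x) v *\<^sub>R F (\<psi>' x) \<partial>lebesgue) = - (\<integral>x. \<phi> x * Re (cnj (a (\<psi>' x)) * k x) \<partial>lborel)" .
    also have "(\<integral>x. \<phi> x * Re (cnj (a (\<psi>' x)) * k x) \<partial>lborel) = (\<integral>x. \<phi> x * Re (cnj (a (\<psi>' x)) * k x) \<partial>lebesgue)"
      by (rule integral_completion[symmetric]) measurable
    finally show ?thesis by (simp add: v_def k_def)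
  qed
  have w2: "weak_gradient (\<lambda>x. complex_of_real (F (\<psi>' x))) (\<lambda>x. \<chi> j. complex_of_real (Re (cnj (a (\<psi>' x)) * h' x $ j)))"
    unfolding weak_gradient_def
  proof (intro conjI allI impI k1)
    show "(\<lambda>x. complex_of_real (F (\<psi>' x))) \<in> Lspace_loc 1"
      by (rule Lspace_loc_1_bound[OF _ F1 F1, of _ 1 0]) auto
    fix \<phi> :: "real ^ 'n \<Rightarrow> real" and j assume \<phi>: "test_function \<phi>"
    have "(\<integral>x. frechet_derivative \<phi> (at x) (axis j 1) *\<^sub>R complex_of_real (F (\<psi>' x)) \<partial>lebesgue)
      = (\<integral>x. complex_of_real (frechet_derivative \<phi> (at x) (axis j 1) *\<^sub>R F (\<psi>' x)) \<partial>lebesgue)"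
      by (simp add: scaleR_conv_of_real)
    also have "\<dots> = complex_of_real (- (\<integral>x. \<phi> x *\<^sub>R Re (cnj (a (\<psi>' x)) * h' x $ j) \<partial>lebesgue))"
      unfolding integral_complex_of_real main[OF \<phi>] ..
    also have "\<dots> = - (\<integral>x. complex_of_real (\<phi> x *\<^sub>R Re (cnj (a (\<psi>' x)) * h' x $ j)) \<partial>lebesgue)"
      unfolding integral_complex_of_real of_real_minus ..
    finally show "(\<integral>x. frechet_derivative \<phi> (at x) (axis j 1) *\<^sub>R complex_of_real (F (\<psi>' x)) \<partial>lebesgue) =
        - (\<integral>x. \<phi> x *\<^sub>R ((\<chi> j. complex_of_real (Re (cnj (a (\<psi>' x)) * h' x $ j))) $ j) \<partial>lebesgue)"
      by (simp only: vec_lambda_beta scaleR_conv_of_real of_real_mult real_scaleR_def of_real_eq_id id_apply)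
  qed
  show ?thesis
  proof (rule weak_gradient_cong_AE[OF w2])
    show "(\<lambda>x. complex_of_real (F (\<psi> x))) \<in> borel_measurable lebesgue" using m0(1) by measurable
    show "(\<lambda>x. \<chi> j. complex_of_real (Re (cnj (a (\<psi> x)) * h x $ j))) \<in> borel_measurable lebesgue"
      by (rule vecm[OF m0])
    show "AE x in lebesgue. complex_of_real (F (\<psi>' x)) = complex_of_real (F (\<psi> x))"
      using ae(1) by eventually_elim simp
    show "AE x in lebesgue. (\<chi> j. complex_of_real (Re (cnj (a (\<psi>' x)) * h' x $ j))) =
        (\<chi> j. complex_of_real (Re (cnj (a (\<psi> x)) * h x $ j)))"
      using ae by eventually_elim simp
  qed
qed

text \<open>For \<open>e = 0\<close> this is the modulus; for \<open>e > 0\<close> it is a bounded minorant of the modulus, so composing with it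
  truncates a function without increasing its energy.\<close>

definition sat :: "real \<Rightarrow> complex \<Rightarrow> real" where
  "sat e z = norm z / (1 + e * norm z)"

text \<open>The gradient of \<open>sat e\<close> away from the origin. Since
  \<open>sgn 0 = 0\<close>, the value at the origin is 0, and this agrees with the symmetric
  difference quotients there, which vanish because \<open>sat e\<close> is even.\<close>

definition sat' :: "real \<Rightarrow> complex \<Rightarrow> complex" where
  "sat' e z = sgn z /\<^sub>R (1 + e * norm z)\<^sup>2"

lemma sat_nonneg: "0 \<le> e \<Longrightarrow> 0 \<le> sat e z"
  by (simp add: sat_def)

lemma sat_le: "0 \<le> e \<Longrightarrow> sat e z \<le> norm z"
  by (simp add: sat_def add_pos_nonneg pos_divide_le_eq algebra_simps)

lemma sat_bounded: "0 < e \<Longrightarrow> sat e z \<le> 1 / e"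
  by (simp add: sat_def add_pos_nonneg pos_divide_le_eq pos_le_divide_eq algebra_simps add_divide_distrib)

lemma sat_0: "sat 0 z = norm z"
  by (simp add: sat_def)

lemma sat_lipschitz:
  assumes e: "0 \<le> e" shows "\<bar>sat e y - sat e z\<bar> \<le> norm (y - z)"
proof -
  have p: "1 \<le> 1 + e * norm y" "1 \<le> 1 + e * norm z" using e by auto
  have "sat e y - sat e z = (norm y - norm z) / ((1 + e * norm y) * (1 + e * norm z))"
    using p by (simp add: sat_def field_simps)
  also have "\<bar>\<dots>\<bar> \<le> \<bar>norm y - norm z\<bar> / 1"
    unfolding abs_divide using p mult_mono[OF p] by (intro divide_left_mono) auto
  also have "\<dots> \<le> norm (y - z)" using norm_triangle_ineq3 by simp
  finally show ?thesis .
qed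

lemma norm_sat'_le: "0 \<le> e \<Longrightarrow> norm (sat' e z) \<le> 1"
  by (auto simp: sat'_def norm_sgn inverse_le_1_iff one_le_power)

lemma sat_symmetric_derivative:
  assumes e: "0 \<le> e" and t: "t \<longlonglongrightarrow> 0" "\<And>n. 0 < t n"
  shows "(\<lambda>n. (sat e (z + t n *\<^sub>R y) - sat e (z - t n *\<^sub>R y)) / (2 * t n)) \<longlonglongrightarrow> Re (cnj (sat' e z) * y)"
proof (cases "z = 0")
  case True
  then show ?thesis by (simp add: sat_def sat'_def)
next
  case False
  have "((\<lambda>s. norm (z + s *\<^sub>R y)) has_real_derivative y \<bullet> sgn z) (at 0)"
  proof -
    have "((\<lambda>s. z + s *\<^sub>R y) has_derivative (\<lambda>s. s *\<^sub>R y)) (at 0)"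
      by (auto intro!: derivative_eq_intros)
    from has_derivative_compose[OF this, of norm "\<lambda>h. h \<bullet> sgn z"] has_derivative_norm[OF False]
    show ?thesis by (simp add: has_field_derivative_def mult_commute_abs)
  qed
  moreover have "1 + e * norm z > 0" using e by (simp add: add_pos_nonneg)
  ultimately have "((\<lambda>s. norm (z + s *\<^sub>R y) / (1 + e * norm (z + s *\<^sub>R y))) has_real_derivative (y \<bullet> sgn z) / (1 + e * norm z)\<^sup>2) (at 0)"
    by (auto intro!: derivative_eq_intros simp: field_simps power2_eq_square)
  then have "((\<lambda>s. sat e (z + s *\<^sub>R y)) has_real_derivative (y \<bullet> sgn z) / (1 + e * norm z)\<^sup>2) (at 0)"
    by (simp add: sat_def)
  from symmetric_quotient[OF this t(1)] t(2)
  have "(\<lambda>n. (sat e (z + t n *\<^sub>R y) - sat e (z - t n *\<^sub>R y)) / (2 * t n)) \<longlonglongrightarrow> (y \<bullet> sgn z) / (1 + e * norm z)\<^sup>2"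
    by (simp add: less_imp_neq[symmetric])
  moreover have "Re (cnj (sat' e z) * y) = (y \<bullet> sgn z) / (1 + e * norm z)\<^sup>2"
    by (simp add: sat'_def inner_complex_def field_simps)
  ultimately show ?thesis by simp
qed

lemma measurable_sat' [measurable]: "sat' e \<in> borel_measurable borel"
proof -
  have "(\<lambda>z::complex. sgn z) = (\<lambda>z. z /\<^sub>R norm z)" by (auto simp: sgn_div_norm)
  then have [measurable]: "(\<lambda>z::complex. sgn z) \<in> borel_measurable borel" by simp
  show ?thesis unfolding sat'_def[abs_def] by measurable
qed

text \<open>The magnetic term \<open>i A \<psi>\<close> is orthogonal to \<open>\<psi>\<close>, so only
  \<open>Re (cnj \<psi> g) / norm \<psi>\<close> survives in the gradient of \<open>norm \<psi>\<close>.\<close>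

lemma diamagnetic:
  assumes g: "is_mag_gradient A \<psi> g" and e: "0 \<le> e"
  defines "k \<equiv> \<lambda>x. \<chi> j. complex_of_real (Re (cnj (sat' e (\<psi> x)) * g x $ j))"
  shows "weak_gradient (\<lambda>x. complex_of_real (sat e (\<psi> x))) k" and "norm (k x) \<le> norm (g x)"
proof -
  have "Re (cnj (sat' e z) * (w - \<i> * complex_of_real r * z)) = Re (cnj (sat' e z) * w)" for z w r
    by (simp add: sat'_def sgn_div_norm algebra_simps)
  then have "(\<lambda>x. \<chi> j. complex_of_real (Re (cnj (sat' e (\<psi> x)) * (g x - (\<chi> j. \<i> * complex_of_real (A x $ j) * \<psi> x)) $ j))) = k"
    by (auto simp: k_def fun_eq_iff vec_eq_iff)
  then show "weak_gradient (\<lambda>x. complex_of_real (sat e (\<psi> x))) k"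
    using weak_gradient_compose[OF g[unfolded is_mag_gradient_def] sat_lipschitz[OF e] measurable_sat' norm_sat'_le[OF e] sat_symmetric_derivative[OF e]]
    by simp
  have "norm (k x $ j) \<le> norm (g x $ j)" for j
    unfolding k_def vec_lambda_beta by (rule norm_of_real_Re_mult_le[OF norm_sat'_le[OF e]])
  then show "norm (k x) \<le> norm (g x)" by (simp add: norm_vec_def L2_set_mono)
qed

subsection \<open>The subcritical Sobolev inequality\<close>

definition Lint :: "real \<Rightarrow> (real ^ 'n \<Rightarrow> 'b::euclidean_space) \<Rightarrow> ennreal" where
  "Lint q f = (\<integral>\<^sup>+x. ennreal (norm (f x) powr q) \<partial>lebesgue)"

lemma Lint_2: "Lint 2 f = (\<integral>\<^sup>+x. ennreal ((norm (f x))\<^sup>2) \<partial>lebesgue)"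
  by (simp add: Lint_def)

lemma Lspace_iff: "f \<in> Lspace q \<longleftrightarrow> f \<in> borel_measurable lebesgue \<and> Lint q f < \<infinity>"
  by (simp add: Lspace_def Lint_def)

lemma Lint_cong_AE: "AE x in lebesgue. norm (f x) = norm (g x) \<Longrightarrow> Lint q f = Lint q g"
  unfolding Lint_def by (rule nn_integral_cong_AE) (auto elim: eventually_mono)

lemma Lint_mono_AE: "0 \<le> q \<Longrightarrow> AE x in lebesgue. norm (f x) \<le> norm (g x) \<Longrightarrow> Lint q f \<le> Lint q g"
  unfolding Lint_def
  by (rule nn_integral_mono_AE) (auto elim!: eventually_mono intro!: ennreal_leI powr_mono2)

lemma ennreal_mult_le_imp_le_divide:
  assumes "0 < a" "0 \<le> b" "ennreal a * m \<le> ennreal b"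
  shows "m \<le> ennreal (b / a)"
  using assms
  by (cases m) (auto simp: ennreal_mult[symmetric] pos_le_divide_eq mult.commute ennreal_mult_top top_unique intro!: ennreal_leI)

lemma level_set_markov:
  fixes u :: "real ^ 'n \<Rightarrow> complex"
  assumes [measurable]: "u \<in> borel_measurable borel" and q: "0 < q" and t: "0 < t" and K: "Lint q u \<le> ennreal K" "0 \<le> K"
  shows "emeasure lborel {y. t < norm (u y)} \<le> ennreal ((1 / t) powr q * K)"
proof -
  have "emeasure lborel {y. t < norm (u y)} = (\<integral>\<^sup>+y. indicator {y. t < norm (u y)} y \<partial>lborel)"
    by (rule nn_integral_indicator[symmetric]) measurable
  also have "\<dots> \<le> (\<integral>\<^sup>+y. ennreal ((1 / t) powr q) * ennreal (norm (u y) powr q) \<partial>lborel)"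
  proof (rule nn_integral_mono)
    fix y
    show "indicator {y. t < norm (u y)} y \<le> ennreal ((1 / t) powr q) * ennreal (norm (u y) powr q)"
    proof (cases "t < norm (u y)")
      case True
      have "(1 / t) powr q * norm (u y) powr q = (norm (u y) / t) powr q"
        using t by (simp add: powr_mult[symmetric])
      moreover have "1 \<le> (norm (u y) / t) powr q"
        using True t q by (intro ge_one_powr_ge_zero) auto
      ultimately show ?thesis using True by (simp add: ennreal_mult[symmetric])
    qed simp
  qed
  also have "\<dots> = ennreal ((1 / t) powr q) * (\<integral>\<^sup>+y. ennreal (norm (u y) powr q) \<partial>lborel)"
    by (rule nn_integral_cmult) measurable
  also have "\<dots> \<le> ennreal ((1 / t) powr q) * ennreal K"
    using K(1) by (intro mult_left_mono) (auto simp: Lint_def nn_integral_completion)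
  also have "\<dots> = ennreal ((1 / t) powr q * K)" using K(2) by (simp add: ennreal_mult)
  finally show ?thesis .
qed

text \<open>If the ball of radius \<open>\<epsilon>\<close> is large compared with \<open>{norm u > t / 2}\<close>, then half of the translates of a
  point of \<open>{norm u > t}\<close> by that ball change \<open>u\<close> by at least \<open>t / 2\<close>.\<close>

lemma level_set_translation:
  fixes u :: "real ^ 'n \<Rightarrow> complex"
  assumes w: "weak_gradient u h" and [measurable]: "u \<in> borel_measurable borel" "h \<in> borel_measurable borel"
    and G: "Lint 2 h \<le> 1" and q: "0 < q" and t: "0 < t" and K: "Lint q u \<le> ennreal K" "0 \<le> K"
    and \<epsilon>: "0 < \<epsilon>" "2 * ((2 / t) powr q * K) \<le> measure lborel (ball (0 :: real ^ 'n) \<epsilon>)"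
  shows "emeasure lborel {x. t < norm (u x)} \<le> ennreal (8 * \<epsilon>\<^sup>2 / t\<^sup>2)"
proof -
  let ?B = "ball (0 :: real ^ 'n) \<epsilon>"
  define \<omega> where "\<omega> = measure lborel ?B"
  have \<omega>: "0 < \<omega>" using content_ball_pos[OF \<epsilon>(1)] by (simp add: \<omega>_def)
  have B\<omega>: "emeasure lborel ?B = ennreal \<omega>"
    using emeasure_lborel_ball_finite[of "0 :: real ^ 'n" \<epsilon>]
    by (subst emeasure_eq_ennreal_measure) (auto simp: \<omega>_def less_top)
  have point: "ennreal ((t / 2)\<^sup>2 * (\<omega> / 2)) * indicator {x. t < norm (u x)} x
     \<le> (\<integral>\<^sup>+v. indicator ?B v * ennreal ((norm (u (x + v) - u x))\<^sup>2) \<partial>lborel)" for x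
  proof (cases "t < norm (u x)")
    case True
    let ?W = "{v \<in> ?B. norm (u (x + v)) \<le> t / 2}" and ?V = "{v. t / 2 < norm (u (x + v))}"
    have V: "emeasure lborel ?V \<le> ennreal (\<omega> / 2)"
    proof -
      have "emeasure lborel ?V = (\<integral>\<^sup>+v. indicator ?V v \<partial>lborel)"
        by (rule nn_integral_indicator[symmetric]) measurable
      also have "\<dots> = (\<integral>\<^sup>+v. indicator {y. t / 2 < norm (u y)} (v + x) \<partial>lborel)"
        by (rule nn_integral_cong) (simp add: indicator_def add.commute)
      also have "\<dots> = (\<integral>\<^sup>+v. indicator {y. t / 2 < norm (u y)} v \<partial>lborel)"
        by (rule nn_integral_translate) measurable
      also have "\<dots> = emeasure lborel {y. t / 2 < norm (u y)}" by (rule nn_integral_indicator) measurable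
      also have "\<dots> \<le> ennreal ((1 / (t / 2)) powr q * K)"
        using t by (intro level_set_markov[OF _ q _ K]) auto
      also have "\<dots> \<le> ennreal (\<omega> / 2)" using \<epsilon>(2) by (intro ennreal_leI) (simp add: \<omega>_def)
      finally show ?thesis .
    qed
    have "emeasure lborel ?B \<le> emeasure lborel (?W \<union> ?V)" by (intro emeasure_mono) auto
    also have "\<dots> \<le> emeasure lborel ?W + emeasure lborel ?V" by (intro emeasure_subadditive) measurable
    also have "\<dots> \<le> emeasure lborel ?W + ennreal (\<omega> / 2)" using V by (intro add_left_mono)
    finally have "ennreal (\<omega> / 2) + ennreal (\<omega> / 2) \<le> emeasure lborel ?W + ennreal (\<omega> / 2)"
      using \<omega> by (simp add: B\<omega> ennreal_plus[symmetric] del: ennreal_plus)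
    then have W: "ennreal (\<omega> / 2) \<le> emeasure lborel ?W"
      by (simp add: ennreal_add_left_cancel_le add.commute)
    have "ennreal ((t / 2)\<^sup>2 * (\<omega> / 2)) = ennreal ((t / 2)\<^sup>2) * ennreal (\<omega> / 2)"
      using \<omega> by (intro ennreal_mult) auto
    also have "\<dots> \<le> ennreal ((t / 2)\<^sup>2) * emeasure lborel ?W" using W by (intro mult_left_mono) auto
    also have "\<dots> = (\<integral>\<^sup>+v. ennreal ((t / 2)\<^sup>2) * indicator ?W v \<partial>lborel)"
      by (rule nn_integral_cmult_indicator[symmetric]) measurable
    also have "\<dots> \<le> (\<integral>\<^sup>+v. indicator ?B v * ennreal ((norm (u (x + v) - u x))\<^sup>2) \<partial>lborel)"
    proof (rule nn_integral_mono)
      fix v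
      have "t / 2 \<le> norm (u (x + v) - u x)" if "norm (u (x + v)) \<le> t / 2"
        using that True norm_triangle_ineq2[of "u x" "u (x + v)"] by (simp add: norm_minus_commute)
      then show "ennreal ((t / 2)\<^sup>2) * indicator ?W v \<le> indicator ?B v * ennreal ((norm (u (x + v) - u x))\<^sup>2)"
        using t by (auto simp: indicator_def intro!: ennreal_leI power_mono)
    qed
    finally show ?thesis using True by simp
  qed simp
  have "ennreal ((t / 2)\<^sup>2 * (\<omega> / 2)) * emeasure lborel {x. t < norm (u x)}
    = (\<integral>\<^sup>+x. ennreal ((t / 2)\<^sup>2 * (\<omega> / 2)) * indicator {x. t < norm (u x)} x \<partial>lborel)"
    by (rule nn_integral_cmult_indicator[symmetric]) measurable
  also have "\<dots> \<le> (\<integral>\<^sup>+x. \<integral>\<^sup>+v. indicator ?B v * ennreal ((norm (u (x + v) - u x))\<^sup>2) \<partial>lborel \<partial>lborel)"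
    by (rule nn_integral_mono) (rule point)
  \<comment> \<open>Integrating over x first leaves, for each v in the ball, the squared mean of a
    translation difference, which is at most \<epsilon>^2.\<close>
  also have "\<dots> = (\<integral>\<^sup>+v. \<integral>\<^sup>+x. indicator ?B v * ennreal ((norm (u (x + v) - u x))\<^sup>2) \<partial>lborel \<partial>lborel)"
    by (rule lborel_pair.Fubini') measurable
  also have "\<dots> \<le> (\<integral>\<^sup>+v. ennreal (\<epsilon>\<^sup>2) * indicator ?B v \<partial>lborel)"
  proof (rule nn_integral_mono)
    fix v
    have "(\<integral>\<^sup>+x. ennreal ((norm (u (x + v) - u x))\<^sup>2) \<partial>lborel) \<le> ennreal (\<epsilon>\<^sup>2)" if "norm v < \<epsilon>"
    proof -
      have "(\<integral>\<^sup>+x. ennreal ((norm (u (x + v) - u x))\<^sup>2) \<partial>lborel) \<le> ennreal ((norm v)\<^sup>2) * Lint 2 h"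
        using weak_gradient_translation_L2[OF w assms(2,3), of v] by (simp add: Lint_2 nn_integral_completion)
      also have "\<dots> \<le> ennreal (\<epsilon>\<^sup>2) * 1"
        using that G by (intro mult_mono ennreal_leI power_mono) auto
      finally show ?thesis by simp
    qed
    then show "(\<integral>\<^sup>+x. indicator ?B v * ennreal ((norm (u (x + v) - u x))\<^sup>2) \<partial>lborel) \<le> ennreal (\<epsilon>\<^sup>2) * indicator ?B v"
      by (auto simp: indicator_def)
  qed
  also have "\<dots> = ennreal (\<epsilon>\<^sup>2 * \<omega>)"
    using \<omega> by (simp add: nn_integral_cmult_indicator B\<omega> ennreal_mult)
  finally have "emeasure lborel {x. t < norm (u x)} \<le> ennreal ((\<epsilon>\<^sup>2 * \<omega>) / ((t / 2)\<^sup>2 * (\<omega> / 2)))"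
    using t \<omega> by (intro ennreal_mult_le_imp_le_divide) auto
  also have "(\<epsilon>\<^sup>2 * \<omega>) / ((t / 2)\<^sup>2 * (\<omega> / 2)) = 8 * \<epsilon>\<^sup>2 / t\<^sup>2"
    using t \<omega> by (simp add: field_simps power2_eq_square)
  finally show ?thesis .
qed

text \<open>For y > 1 a single term suffices: if 2^k < y \<le> 2^(k+1), the term with index k
  dominates y^s. For y \<le> 1 the square does, since s \<ge> 2.\<close>

lemma powr_le_dyadic_sum:
  fixes y s :: real
  assumes y: "0 \<le> y" and s: "2 \<le> s"
  shows "ennreal (y powr s) \<le> ennreal (y\<^sup>2) + (\<Sum>k. ennreal (2 powr (s * (real k + 1))) * indicator {z. 2 ^ k < z} y)"
proof (cases "y \<le> 1")
  case True
  have "y powr s \<le> y powr 2"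
    using True y s by (intro powr_mono') auto
  then have "ennreal (y powr s) \<le> ennreal (y\<^sup>2)" using y by (intro ennreal_leI) simp
  then show ?thesis by (simp add: add_increasing2)
next
  case False
  have ex: "\<exists>n. y \<le> 2 ^ Suc n"
  proof -
    obtain n where "y < 2 ^ n" using real_arch_pow[of 2 y] by auto
    moreover have "(2 :: real) ^ n \<le> 2 ^ Suc n" by simp
    ultimately show ?thesis by (meson less_le_trans less_imp_le)
  qed
  define k where "k = (LEAST n. y \<le> 2 ^ Suc n)"
  have k1: "y \<le> 2 ^ Suc k" unfolding k_def by (rule LeastI_ex[OF ex])
  have k2: "2 ^ k < y"
  proof (cases k)
    case 0
    then show ?thesis using False by simp
  next
    case (Suc m)
    then have "m < (LEAST n. y \<le> 2 ^ Suc n)" by (simp add: k_def)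
    from not_less_Least[OF this] show ?thesis using Suc by simp
  qed
  have term_le: "f k \<le> (\<Sum>k. f k)" for f :: "nat \<Rightarrow> ennreal"
    using sum_le_suminf[of f "{k}"] by (simp add: summableI)
  have "y powr s \<le> (2 ^ Suc k) powr s" using y k1 s by (intro powr_mono2) auto
  also have "(2 ^ Suc k :: real) = 2 powr (real k + 1)"
    using powr_realpow[of 2 "Suc k"] by (simp add: add.commute)
  also have "(2 powr (real k + 1)) powr s = 2 powr (s * (real k + 1))"
    by (simp add: powr_powr mult.commute)
  finally have "ennreal (y powr s) \<le> ennreal (2 powr (s * (real k + 1))) * indicator {z. 2 ^ k < z} y"
    using k2 by (simp add: ennreal_leI)
  also have "\<dots> \<le> (\<Sum>k. ennreal (2 powr (s * (real k + 1))) * indicator {z. 2 ^ k < z} y)"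
    by (rule term_le)
  finally show ?thesis by (simp add: add_increasing)
qed

text \<open>Boundedness on pairs with both norms at most 1 is the form in which the exponent can be
  iterated; the homogeneous inequality is recovered by normalisation in
  \<open>sobolev_inequality\<close>.\<close>

definition H1_bounded_in :: "'n::finite itself \<Rightarrow> real \<Rightarrow> bool" where
  "H1_bounded_in (_ :: 'n itself) q \<longleftrightarrow> (\<exists>K>0. \<forall>(u :: real ^ 'n \<Rightarrow> complex) h.
     weak_gradient u h \<longrightarrow> Lint 2 u \<le> 1 \<longrightarrow> Lint 2 h \<le> 1 \<longrightarrow> Lint q u \<le> ennreal K)"

text \<open>The fixed point of \<open>q \<mapsto> 2 + 2 q / d\<close> is the critical exponent \<open>2 d / (d - 2)\<close>, hence iterating this step from
  \<open>q = 2\<close> reaches every subcritical exponent.\<close>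

lemma H1_bounded_in_step:
  assumes q: "H1_bounded_in TYPE('n::finite) q" "2 \<le> q" and s: "2 \<le> s" "s < 2 + 2 * q / real CARD('n)"
  shows "H1_bounded_in TYPE('n) s"
proof -
  define d where "d = real CARD('n)"
  have d: "d > 0" by (simp add: d_def)
  obtain K where K: "K > 0" and Kq: "\<And>(u :: real ^ 'n \<Rightarrow> complex) h. weak_gradient u h \<Longrightarrow> Lint 2 u \<le> 1 \<Longrightarrow> Lint 2 h \<le> 1 \<Longrightarrow> Lint q u \<le> ennreal K"
    using q(1) unfolding H1_bounded_in_def by blast
  define c where "c = measure lborel (ball (0 :: real ^ 'n) 1)"
  have c: "c > 0" unfolding c_def by (rule content_ball_pos) simp
  \<comment> \<open>With \<epsilon>^d = D t^(-q) the ball of radius \<epsilon> has volume exactly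
    twice (2/t)^q K, the least size that \<open>level_set_translation\<close> admits.\<close>
  define D where "D = 2 * 2 powr q * K / c"
  have D: "D > 0" using K c by (simp add: D_def)
  define C where "C = 2 powr s * 8 * D powr (2 / d)"
  \<comment> \<open>The level set at height t = 2^k has measure of order t^(-2 - 2q/d). Weighted
    with t^s, the dyadic series is geometric with this ratio, and the condition on s says exactly
    that \<rho> < 1.\<close>
  define \<rho> where "\<rho> = (2 :: real) powr (s - 2 - 2 * q / d)"
  have \<rho>: "0 \<le> \<rho>" "\<rho> < 1" using s(2) by (auto simp: \<rho>_def d_def powr_less_one)
  have C: "C \<ge> 0" by (simp add: C_def)
  have bound: "Lint s u \<le> ennreal (1 + C / (1 - \<rho>))"
    if w: "weak_gradient u h" and u2: "Lint 2 u \<le> 1" and h2: "Lint 2 h \<le> 1"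
    and [measurable]: "u \<in> borel_measurable borel" "h \<in> borel_measurable borel" for u :: "real ^ 'n \<Rightarrow> complex" and h
  proof -
    have level: "ennreal (2 powr (s * (real k + 1))) * emeasure lborel {x. 2 ^ k < norm (u x)} \<le> ennreal (C * \<rho> ^ k)" for k
    proof -
      define t where "t = (2 :: real) ^ k"
      have t: "t > 0" "t = 2 powr real k" by (simp_all add: t_def powr_realpow)
      define \<epsilon> where "\<epsilon> = (D * (1 / t) powr q) powr (1 / d)"
      have \<epsilon>: "\<epsilon> > 0" using D t by (simp add: \<epsilon>_def)
      have \<epsilon>d: "\<epsilon> ^ CARD('n) = D * (1 / t) powr q"
      proof -
        have "\<epsilon> ^ CARD('n) = \<epsilon> powr d" using \<epsilon> by (simp add: d_def powr_realpow)
        also have "\<dots> = D * (1 / t) powr q" using d D t by (simp add: \<epsilon>_def powr_powr)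
        finally show ?thesis .
      qed
      have "measure lborel (ball (0 :: real ^ 'n) \<epsilon>) = \<epsilon> ^ CARD('n) * c"
        using content_ball_conv_unit_ball[of \<epsilon> "0 :: real ^ 'n"] \<epsilon> by (simp add: c_def)
      also have "\<dots> = 2 * ((2 / t) powr q * K)"
        using c t by (simp add: \<epsilon>d D_def powr_divide)
      finally have "emeasure lborel {x. t < norm (u x)} \<le> ennreal (8 * \<epsilon>\<^sup>2 / t\<^sup>2)"
        using q(2) K t(1) \<epsilon>
        by (intro level_set_translation[OF w _ _ h2 _ _ Kq[OF w u2 h2]]) auto
      then have "ennreal (2 powr (s * (real k + 1))) * emeasure lborel {x. 2 ^ k < norm (u x)}
         \<le> ennreal (2 powr (s * (real k + 1))) * ennreal (8 * \<epsilon>\<^sup>2 / t\<^sup>2)"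
        unfolding t_def by (intro mult_left_mono) auto
      also have "\<dots> = ennreal (2 powr (s * (real k + 1)) * (8 * \<epsilon>\<^sup>2 / t\<^sup>2))"
        by (rule ennreal_mult[symmetric]) auto
      also have "2 powr (s * (real k + 1)) * (8 * \<epsilon>\<^sup>2 / t\<^sup>2) = C * \<rho> ^ k"
      proof -
        have "\<epsilon>\<^sup>2 = \<epsilon> powr 2" using \<epsilon> by simp
        also have "\<dots> = D powr (2 / d) * ((1 / t) powr q) powr (2 / d)"
          using D t by (simp add: \<epsilon>_def powr_powr powr_mult)
        also have "((1 / t) powr q) powr (2 / d) = 2 powr (- (2 * q / d) * real k)"
          by (simp add: t(2) powr_powr powr_minus_divide[symmetric] mult_ac)
        finally have e: "\<epsilon>\<^sup>2 = D powr (2 / d) * 2 powr (- (2 * q / d) * real k)" .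
        have t2: "t\<^sup>2 = 2 powr (2 * real k)"
          by (simp add: t(2) power2_eq_square powr_add[symmetric])
        have r: "\<rho> ^ k = 2 powr ((s - 2 - 2 * q / d) * real k)"
          by (simp add: \<rho>_def powr_realpow[symmetric] powr_powr)
        have "2 powr (s * (real k + 1)) * (8 * \<epsilon>\<^sup>2 / t\<^sup>2)
          = (8 * D powr (2 / d)) * (2 powr (s * (real k + 1)) * 2 powr (- (2 * q / d) * real k) / 2 powr (2 * real k))"
          by (simp add: e t2)
        also have "2 powr (s * (real k + 1)) * 2 powr (- (2 * q / d) * real k) / 2 powr (2 * real k)
           = (2::real) powr (s + (s - 2 - 2 * q / d) * real k)"
          by (simp add: powr_add[symmetric] powr_diff[symmetric] algebra_simps)
        also have "\<dots> = 2 powr s * \<rho> ^ k" by (simp add: powr_add r)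
        finally show ?thesis by (simp add: C_def)
      qed
      finally show ?thesis .
    qed
    have "Lint s u \<le> (\<integral>\<^sup>+x. ennreal ((norm (u x))\<^sup>2) + (\<Sum>k. ennreal (2 powr (s * (real k + 1))) * indicator {x. 2 ^ k < norm (u x)} x) \<partial>lborel)"
      unfolding Lint_def nn_integral_completion
    proof (rule nn_integral_mono)
      fix x
      have "(indicator {z. 2 ^ k < z} (norm (u x)) :: ennreal) = indicator {x. 2 ^ k < norm (u x)} x" for k
        by (simp add: indicator_def)
      then show "ennreal (norm (u x) powr s) \<le> ennreal ((norm (u x))\<^sup>2) + (\<Sum>k. ennreal (2 powr (s * (real k + 1))) * indicator {x. 2 ^ k < norm (u x)} x)"
        using powr_le_dyadic_sum[of "norm (u x)" s] s(1) by simp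
    qed
    also have "\<dots> = Lint 2 u + (\<Sum>k. ennreal (2 powr (s * (real k + 1))) * emeasure lborel {x. 2 ^ k < norm (u x)})"
      by (simp add: nn_integral_add nn_integral_suminf nn_integral_cmult_indicator Lint_2 nn_integral_completion)
    also have "\<dots> \<le> 1 + (\<Sum>k. ennreal (C * \<rho> ^ k))"
      by (intro add_mono u2 suminf_le level summableI)
    also have "(\<Sum>k. ennreal (C * \<rho> ^ k)) = ennreal (\<Sum>k. C * \<rho> ^ k)"
      using \<rho> C by (intro suminf_ennreal2) (auto intro!: summable_mult summable_geometric)
    also have "(\<Sum>k. C * \<rho> ^ k) = C / (1 - \<rho>)"
      using \<rho> by (simp add: suminf_mult summable_geometric suminf_geometric)
    also have "1 + ennreal (C / (1 - \<rho>)) = ennreal (1 + C / (1 - \<rho>))"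
      using \<rho> C by (simp add: ennreal_plus)
    finally show ?thesis .
  qed
  show ?thesis
    unfolding H1_bounded_in_def
  proof (intro exI conjI allI impI)
    show "0 < 1 + C / (1 - \<rho>)" using \<rho> C by (intro add_pos_nonneg) auto
    fix u :: "real ^ 'n \<Rightarrow> complex" and h
    assume w: "weak_gradient u h" and u: "Lint 2 u \<le> 1" and h: "Lint 2 h \<le> 1"
    obtain u' h' where 1: "u' \<in> borel_measurable borel" "h' \<in> borel_measurable borel"
      and 2: "AE x in lebesgue. u x = u' x" "AE x in lebesgue. h x = h' x" and 3: "weak_gradient u' h'"
      by (rule weak_gradient_borel_version[OF w])
    have "Lint r u = Lint r u'" for r by (rule Lint_cong_AE) (use 2 in \<open>auto elim: eventually_mono\<close>)
    moreover have "Lint 2 h = Lint 2 h'" by (rule Lint_cong_AE) (use 2 in \<open>auto elim: eventually_mono\<close>)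
    ultimately show "Lint s u \<le> ennreal (1 + C / (1 - \<rho>))"
      using bound[OF 3 _ _ 1] u h by simp
  qed
qed

lemma H1_bounded_in_2: "H1_bounded_in TYPE('n::finite) 2"
  unfolding H1_bounded_in_def by (rule exI[of _ 1]) auto

lemma H1_bounded_in_subcritical:
  assumes dim: "CARD('n::finite) = 2 \<or> CARD('n) = 3" and p: "2 < p" "ereal p < critical_exponent CARD('n)"
  shows "H1_bounded_in TYPE('n) p"
  using dim
proof
  assume d: "CARD('n) = 2"
  \<comment> \<open>For d = 2 one step reaches every exponent below 2 + q, so increments of 1 are
    allowed.\<close>
  have "H1_bounded_in TYPE('n) (2 + real m)" for m
  proof (induction m)
    case 0
    then show ?case using H1_bounded_in_2 by simp
  next
    case (Suc m)
    show ?case by (rule H1_bounded_in_step[OF Suc]) (auto simp: d)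
  qed
  note it = this
  obtain m :: nat where m: "p \<le> real m" using real_arch_simple by blast
  then have "p < 2 + 2 * (2 + real m) / real CARD('n)" by (simp add: d field_simps)
  from H1_bounded_in_step[OF it[of m] _ _ this] show ?thesis using p by simp
next
  assume d: "CARD('n) = 3"
  then have p6: "p < 6" using p(2) by (simp add: critical_exponent_def)
  \<comment> \<open>For d = 3 the map q -> 2 + 2q/3 shrinks the distance to 6 by the factor 2/3. The
    slower factor 5/6 keeps the inequality in the step strict; the coefficient 4 makes the sequence
    start at 2.\<close>
  have "H1_bounded_in TYPE('n) (6 - 4 * (5 / 6) ^ m)" for m
  proof (induction m)
    case 0
    then show ?case using H1_bounded_in_2 by simp
  next
    case (Suc m)
    have "(5 / 6 :: real) ^ m \<le> 1" "(5 / 6 :: real) ^ m > 0" by (auto intro: power_le_one)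
    then show ?case by (intro H1_bounded_in_step[OF Suc]) (auto simp: d)
  qed
  note it = this
  \<comment> \<open>The threshold solves p < 2 + (2/3) (6 - 4 x) for x.\<close>
  have "0 < (6 - p) * 3 / 8" using p6 by simp
  from real_arch_pow_inv[OF this, of "5 / 6"] obtain m where m: "(5 / 6) ^ m < (6 - p) * 3 / 8" by auto
  have 1: "2 \<le> 6 - 4 * (5 / 6 :: real) ^ m" using power_le_one[of "5 / 6 :: real" m] by simp
  have "p < 2 + 2 * (6 - 4 * (5 / 6) ^ m) / real CARD('n)" using m by (simp add: d field_simps)
  from H1_bounded_in_step[OF it[of m] 1 _ this] show ?thesis using p by simp
qed

subsection \<open>Scaling and cut-off\<close>

lemma along_axis_fun: "along (axis j 1) h = (\<lambda>x. h x $ j)"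
  by (rule ext) (rule along_axis)

lemma weak_gradient_unique:
  assumes h: "weak_gradient \<psi> h" and k: "weak_gradient \<psi> k"
  shows "AE x in lebesgue. h x = k x"
proof -
  have l: "h \<in> Lspace_loc 1" "k \<in> Lspace_loc 1" using h k by (auto simp: weak_gradient_def)
  then have [measurable]: "h \<in> borel_measurable lebesgue" "k \<in> borel_measurable lebesgue"
    by (simp_all add: Lspace_loc_1_iff)
  have "AE x in lebesgue. h x $ j - k x $ j = 0" for j
  proof (rule fundamental_lemma)
    have c: "(\<lambda>x. h x $ j) \<in> Lspace_loc 1" "(\<lambda>x. k x $ j) \<in> Lspace_loc 1"
      using Lspace_loc_1_along[OF l(1), of "axis j 1"] Lspace_loc_1_along[OF l(2), of "axis j 1"]
      by (simp_all add: along_axis_fun)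
    show "(\<lambda>x. h x $ j - k x $ j) \<in> Lspace_loc 1"
      by (rule Lspace_loc_1_bound[OF _ c, of _ 1 1]) (auto intro: norm_triangle_ineq4)
    fix \<phi> :: "real ^ 'a \<Rightarrow> real" assume \<phi>: "test_function \<phi>"
    show "(\<integral>x. \<phi> x *\<^sub>R (h x $ j - k x $ j) \<partial>lebesgue) = 0"
      using h k \<phi> integrable_test_function_mult[OF c(1) \<phi>] integrable_test_function_mult[OF c(2) \<phi>]
      unfolding weak_gradient_def by (simp add: scaleR_diff_right)
  qed
  then have "AE x in lebesgue. \<forall>j\<in>UNIV. h x $ j - k x $ j = 0"
    by (intro AE_finite_allI) auto
  then show ?thesis by eventually_elim (simp add: vec_eq_iff)
qed

lemma weak_gradient_scaleR:
  assumes w: "weak_gradient \<psi> h"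
  shows "weak_gradient (\<lambda>x. (c::real) *\<^sub>R \<psi> x) (\<lambda>x. c *\<^sub>R h x)"
proof -
  have l: "\<psi> \<in> Lspace_loc 1" "h \<in> Lspace_loc 1" using w by (auto simp: weak_gradient_def)
  then have [measurable]: "\<psi> \<in> borel_measurable lebesgue" "h \<in> borel_measurable lebesgue"
    by (simp_all add: Lspace_loc_1_iff)
  have 1: "(\<lambda>x. c *\<^sub>R \<psi> x) \<in> Lspace_loc 1"
    by (rule Lspace_loc_1_bound[OF _ l(1) l(1), of _ "\<bar>c\<bar>" 0]) auto
  have 2: "(\<lambda>x. c *\<^sub>R h x) \<in> Lspace_loc 1"
    by (rule Lspace_loc_1_bound[OF _ l(2) l(2), of _ "\<bar>c\<bar>" 0]) auto
  show ?thesis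
    unfolding weak_gradient_def
  proof (intro conjI allI impI 1 2)
    fix \<phi> :: "real ^ 'a \<Rightarrow> real" and j assume \<phi>: "test_function \<phi>"
    have "(\<integral>x. frechet_derivative \<phi> (at x) (axis j 1) *\<^sub>R c *\<^sub>R \<psi> x \<partial>lebesgue)
      = c *\<^sub>R (\<integral>x. frechet_derivative \<phi> (at x) (axis j 1) *\<^sub>R \<psi> x \<partial>lebesgue)"
      by (simp only: scaleR_left_commute[of _ c] integral_scaleR_right)
    also have "\<dots> = - (c *\<^sub>R (\<integral>x. \<phi> x *\<^sub>R (h x $ j) \<partial>lebesgue))"
      using w \<phi> by (simp add: weak_gradient_def)
    also have "c *\<^sub>R (\<integral>x. \<phi> x *\<^sub>R (h x $ j) \<partial>lebesgue) = (\<integral>x. \<phi> x *\<^sub>R ((c *\<^sub>R h x) $ j) \<partial>lebesgue)"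
      by (simp only: vector_scaleR_component scaleR_left_commute[of _ c] integral_scaleR_right)
    finally show "(\<integral>x. frechet_derivative \<phi> (at x) (axis j 1) *\<^sub>R c *\<^sub>R \<psi> x \<partial>lebesgue)
      = - (\<integral>x. \<phi> x *\<^sub>R ((c *\<^sub>R h x) $ j) \<partial>lebesgue)" .
  qed
qed

lemma weak_gradient_dilation:
  fixes \<psi> :: "real ^ 'n \<Rightarrow> complex"
  assumes w: "weak_gradient \<psi> h" and \<sigma>: "\<sigma> > 0"
  shows "weak_gradient (\<lambda>x. \<psi> (\<sigma> *\<^sub>R x)) (\<lambda>x. \<sigma> *\<^sub>R h (\<sigma> *\<^sub>R x))"
proof -
  have l: "\<psi> \<in> Lspace_loc 1" "h \<in> Lspace_loc 1" using w by (auto simp: weak_gradient_def)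
  have [measurable]: "\<psi> \<in> borel_measurable lebesgue" "h \<in> borel_measurable lebesgue"
    using l by (simp_all add: Lspace_loc_1_iff)
  have 1: "(\<lambda>x. \<psi> (\<sigma> *\<^sub>R x)) \<in> Lspace_loc 1"
    using Lspace_loc_1_affine[OF l(1), of \<sigma> 0] \<sigma> by simp
  have hd: "(\<lambda>x. h (\<sigma> *\<^sub>R x)) \<in> Lspace_loc 1"
    using Lspace_loc_1_affine[OF l(2), of \<sigma> 0] \<sigma> by simp
  then have [measurable]: "(\<lambda>x. h (\<sigma> *\<^sub>R x)) \<in> borel_measurable lebesgue" by (simp add: Lspace_loc_1_iff)
  have 2: "(\<lambda>x. \<sigma> *\<^sub>R h (\<sigma> *\<^sub>R x)) \<in> Lspace_loc 1"
    by (rule Lspace_loc_1_bound[OF _ hd hd, of _ "\<bar>\<sigma>\<bar>" 0]) auto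
  show ?thesis
    unfolding weak_gradient_def
  proof (intro conjI allI impI 1 2)
    fix \<phi> :: "real ^ 'n \<Rightarrow> real" and j assume \<phi>: "test_function \<phi>"
    define \<eta> where "\<eta> x = \<phi> ((1 / \<sigma>) *\<^sub>R x)" for x
    have \<eta>: "test_function \<eta>"
      using test_function_affine[OF \<phi>, of "1 / \<sigma>" 0] \<sigma> by (simp add: \<eta>_def[abs_def])
    have \<phi>d: "\<phi> differentiable at x" for x
      using test_function_has_derivative[OF \<phi>] by (auto simp: differentiable_def)
    have d: "frechet_derivative \<eta> (at x) v = frechet_derivative \<phi> (at ((1 / \<sigma>) *\<^sub>R x)) ((1 / \<sigma>) *\<^sub>R v)" for x v
      using frechet_derivative_at[OF frechet_derivative_affine[OF \<phi>d, of 0 "1 / \<sigma>"], of x]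
      by (simp add: \<eta>_def[abs_def] fun_eq_iff)
    have d': "frechet_derivative \<phi> (at x) v = \<sigma> * frechet_derivative \<eta> (at (\<sigma> *\<^sub>R x)) v" for x v
    proof -
      have l: "linear (frechet_derivative \<phi> (at x))"
        using test_function_has_derivative[OF \<phi>] has_derivative_linear by blast
      show ?thesis using \<sigma> by (simp add: d linear_scale[OF l])
    qed
    note [measurable] = test_function_lebesgue_measurable[OF \<eta>]
      test_function_lebesgue_measurable[OF test_function_derivative[OF \<eta>]]
    have hj [measurable]: "(\<lambda>x. h x $ j) \<in> borel_measurable lebesgue" by measurable
    have "\<bar>\<sigma>\<bar> ^ CARD('n) *\<^sub>R (\<integral>x. frechet_derivative \<phi> (at x) (axis j 1) *\<^sub>R \<psi> (\<sigma> *\<^sub>R x) \<partial>lebesgue)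
      = \<bar>\<sigma>\<bar> ^ CARD('n) *\<^sub>R (\<sigma> *\<^sub>R (\<integral>x. frechet_derivative \<eta> (at (\<sigma> *\<^sub>R x)) (axis j 1) *\<^sub>R \<psi> (\<sigma> *\<^sub>R x) \<partial>lebesgue))"
      by (simp only: d' scaleR_scaleR[symmetric] integral_scaleR_right)
    also have "\<dots> = \<sigma> *\<^sub>R (\<integral>x. frechet_derivative \<eta> (at x) (axis j 1) *\<^sub>R \<psi> x \<partial>lebesgue)"
      using integral_affine[of \<sigma> "\<lambda>x. frechet_derivative \<eta> (at x) (axis j 1) *\<^sub>R \<psi> x" 0] \<sigma>
      by (simp add: scaleR_left_commute)
    also have "\<dots> = - (\<sigma> *\<^sub>R (\<integral>x. \<eta> x *\<^sub>R (h x $ j) \<partial>lebesgue))"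
      using w \<eta> by (simp add: weak_gradient_def)
    also have "\<dots> = - (\<sigma> *\<^sub>R (\<bar>\<sigma>\<bar> ^ CARD('n) *\<^sub>R (\<integral>x. \<phi> x *\<^sub>R (h (\<sigma> *\<^sub>R x) $ j) \<partial>lebesgue)))"
    proof -
      have m: "(\<lambda>x. \<eta> x *\<^sub>R (h x $ j)) \<in> borel_measurable lebesgue" by measurable
      have "(\<integral>x. \<eta> x *\<^sub>R (h x $ j) \<partial>lebesgue)
        = \<bar>\<sigma>\<bar> ^ CARD('n) *\<^sub>R (\<integral>x. \<eta> (0 + \<sigma> *\<^sub>R x) *\<^sub>R (h (0 + \<sigma> *\<^sub>R x) $ j) \<partial>lebesgue)"
        using \<sigma> by (intro integral_affine[OF _ m]) simp
      moreover have "\<eta> (\<sigma> *\<^sub>R x) = \<phi> x" for x using \<sigma> by (simp add: \<eta>_def)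
      ultimately show ?thesis by simp
    qed
    also have "\<dots> = \<bar>\<sigma>\<bar> ^ CARD('n) *\<^sub>R (- (\<integral>x. \<phi> x *\<^sub>R ((\<sigma> *\<^sub>R h (\<sigma> *\<^sub>R x)) $ j) \<partial>lebesgue))"
      by (simp only: vector_scaleR_component scaleR_left_commute[of _ \<sigma>] integral_scaleR_right scaleR_minus_right)
    finally show "(\<integral>x. frechet_derivative \<phi> (at x) (axis j 1) *\<^sub>R \<psi> (\<sigma> *\<^sub>R x) \<partial>lebesgue)
      = - (\<integral>x. \<phi> x *\<^sub>R ((\<sigma> *\<^sub>R h (\<sigma> *\<^sub>R x)) $ j) \<partial>lebesgue)"
      using \<sigma> by (simp only: scaleR_cancel_left) auto
  qed
qed

lemma Lint_dilation:
  fixes f :: "real ^ 'n \<Rightarrow> 'b::euclidean_space"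
  assumes [measurable]: "f \<in> borel_measurable lebesgue" and \<sigma>: "\<sigma> > 0"
  shows "Lint q (\<lambda>x. f (\<sigma> *\<^sub>R x)) = ennreal (1 / \<sigma> ^ CARD('n)) * Lint q f"
proof -
  have "ennreal (\<sigma> ^ CARD('n)) * Lint q (\<lambda>x. f (\<sigma> *\<^sub>R x)) = Lint q f"
    using nn_integral_affine[of \<sigma> "\<lambda>x. ennreal (norm (f x) powr q)" 0] \<sigma> by (simp add: Lint_def)
  then have "ennreal (1 / \<sigma> ^ CARD('n)) * Lint q f
     = (ennreal (1 / \<sigma> ^ CARD('n)) * ennreal (\<sigma> ^ CARD('n))) * Lint q (\<lambda>x. f (\<sigma> *\<^sub>R x))"
    by (simp add: mult.assoc)
  also have "ennreal (1 / \<sigma> ^ CARD('n)) * ennreal (\<sigma> ^ CARD('n)) = 1"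
    using \<sigma> by (simp add: ennreal_mult[symmetric])
  finally show ?thesis by simp
qed

lemma Lint_scaleR:
  assumes [measurable]: "f \<in> borel_measurable lebesgue"
  shows "Lint q (\<lambda>x. (c::real) *\<^sub>R f x) = ennreal (\<bar>c\<bar> powr q) * Lint q f"
proof -
  have [measurable]: "(\<lambda>x. norm (f x) powr q) \<in> borel_measurable lebesgue" by measurable
  show ?thesis
    unfolding Lint_def by (subst nn_integral_cmult[symmetric]) (auto simp: powr_mult ennreal_mult)
qed

text \<open>The product of two test functions is a test function, so the definition can be tested
  with \<phi> X, and the classical Leibniz rule for \<phi> X separates the two terms.\<close>

lemma weak_gradient_test_mult:
  fixes \<psi> :: "real ^ 'n \<Rightarrow> complex"
  assumes w: "weak_gradient \<psi> h" and \<chi>: "test_function X"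
  shows "weak_gradient (\<lambda>x. X x *\<^sub>R \<psi> x)
     (\<lambda>x. X x *\<^sub>R h x + (\<chi> j. frechet_derivative X (at x) (axis j 1) *\<^sub>R \<psi> x))"
proof -
  have l: "\<psi> \<in> Lspace_loc 1" "h \<in> Lspace_loc 1" using w by (auto simp: weak_gradient_def)
  have [measurable]: "\<psi> \<in> borel_measurable lebesgue" "h \<in> borel_measurable lebesgue"
    using l by (simp_all add: Lspace_loc_1_iff)
  note [measurable] = test_function_lebesgue_measurable[OF \<chi>]
      test_function_lebesgue_measurable[OF test_function_derivative[OF \<chi>]]
  obtain M where M: "M > 0" "\<And>x. \<bar>X x\<bar> \<le> M" using test_function_bounds[OF \<chi>] by blast
  have "\<exists>N>0. \<forall>x. \<bar>frechet_derivative X (at x) (axis j 1)\<bar> \<le> N" for j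
    using test_function_bounds[OF test_function_derivative[OF \<chi>, of "axis j 1"]] by blast
  then obtain N where N: "\<And>j. N j > 0" "\<And>j x. \<bar>frechet_derivative X (at x) (axis j 1)\<bar> \<le> N j" by metis
  have dm [measurable]: "(\<lambda>x. \<chi> j. frechet_derivative X (at x) (axis j 1) *\<^sub>R \<psi> x) \<in> borel_measurable lebesgue"
    by (rule borel_measurable_vec_lambda) measurable
  have dn: "norm (\<chi> j. frechet_derivative X (at x) (axis j 1) *\<^sub>R \<psi> x) \<le> (\<Sum>j\<in>UNIV. N j) * norm (\<psi> x)" for x
  proof -
    have "norm (\<chi> j. frechet_derivative X (at x) (axis j 1) *\<^sub>R \<psi> x) \<le> (\<Sum>j\<in>UNIV. norm (frechet_derivative X (at x) (axis j 1) *\<^sub>R \<psi> x))"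
      unfolding norm_vec_def by (rule order_trans[OF L2_set_le_sum]) auto
    also have "\<dots> \<le> (\<Sum>j\<in>UNIV. N j * norm (\<psi> x))"
      by (rule sum_mono) (auto intro!: mult_right_mono N)
    finally show ?thesis by (simp add: sum_distrib_right)
  qed
  have 1: "(\<lambda>x. X x *\<^sub>R \<psi> x) \<in> Lspace_loc 1"
    by (rule Lspace_loc_1_bound[OF _ l(1) l(1), of _ M 0]) (use M in \<open>auto intro!: mult_right_mono\<close>)
  have 2: "(\<lambda>x. X x *\<^sub>R h x + (\<chi> j. frechet_derivative X (at x) (axis j 1) *\<^sub>R \<psi> x)) \<in> Lspace_loc 1"
  proof (rule Lspace_loc_1_bound[OF _ l(2) l(1), of _ M "\<Sum>j\<in>UNIV. N j"])
    show "norm (X x *\<^sub>R h x + (\<chi> j. frechet_derivative X (at x) (axis j 1) *\<^sub>R \<psi> x)) \<le> M * norm (h x) + (\<Sum>j\<in>UNIV. N j) * norm (\<psi> x)" for x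
      by (rule order_trans[OF norm_triangle_ineq add_mono[OF _ dn]]) (auto intro!: mult_right_mono M)
  qed (use M N(1) in \<open>auto intro!: sum_nonneg intro: less_imp_le\<close>)
  show ?thesis
    unfolding weak_gradient_def
  proof (intro conjI allI impI 1 2)
    fix \<phi> :: "real ^ 'n \<Rightarrow> real" and j assume \<phi>: "test_function \<phi>"
    have \<phi>\<chi>: "test_function (\<lambda>x. \<phi> x * X x)"
      using \<chi> by (intro test_function_mult_smooth[OF \<phi>]) (simp add: test_function_def)
    have \<phi>d: "test_function (\<lambda>x. \<phi> x * frechet_derivative X (at x) (axis j 1))"
      using test_function_derivative[OF \<chi>, of "axis j 1"]
      by (intro test_function_mult_smooth[OF \<phi>]) (simp add: test_function_def)
    have diff: "\<phi> differentiable at x" "X differentiable at x" for x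
      using test_function_has_derivative[OF \<phi>] test_function_has_derivative[OF \<chi>] by (auto simp: differentiable_def)
    have hj: "(\<lambda>x. h x $ j) \<in> Lspace_loc 1"
      using Lspace_loc_1_along[OF l(2), of "axis j 1"] by (simp add: along_axis_fun)
    have i1: "integrable lebesgue (\<lambda>x. frechet_derivative (\<lambda>x. \<phi> x * X x) (at x) (axis j 1) *\<^sub>R \<psi> x)"
      by (rule integrable_test_function_mult[OF l(1) test_function_derivative[OF \<phi>\<chi>]])
    have i2: "integrable lebesgue (\<lambda>x. (\<phi> x * frechet_derivative X (at x) (axis j 1)) *\<^sub>R \<psi> x)"
      by (rule integrable_test_function_mult[OF l(1) \<phi>d])
    have i3: "integrable lebesgue (\<lambda>x. (\<phi> x * X x) *\<^sub>R h x $ j)"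
      by (rule integrable_test_function_mult[OF hj \<phi>\<chi>])
    have "(\<integral>x. frechet_derivative \<phi> (at x) (axis j 1) *\<^sub>R X x *\<^sub>R \<psi> x \<partial>lebesgue)
      = (\<integral>x. frechet_derivative (\<lambda>x. \<phi> x * X x) (at x) (axis j 1) *\<^sub>R \<psi> x
           - (\<phi> x * frechet_derivative X (at x) (axis j 1)) *\<^sub>R \<psi> x \<partial>lebesgue)"
      by (rule Bochner_Integration.integral_cong[OF refl]) (simp add: frechet_derivative_mult[OF diff] scaleR_left_distrib)
    also have "\<dots> = (\<integral>x. frechet_derivative (\<lambda>x. \<phi> x * X x) (at x) (axis j 1) *\<^sub>R \<psi> x \<partial>lebesgue)
        - (\<integral>x. (\<phi> x * frechet_derivative X (at x) (axis j 1)) *\<^sub>R \<psi> x \<partial>lebesgue)"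
      by (rule Bochner_Integration.integral_diff[OF i1 i2])
    also have "(\<integral>x. frechet_derivative (\<lambda>x. \<phi> x * X x) (at x) (axis j 1) *\<^sub>R \<psi> x \<partial>lebesgue)
        = - (\<integral>x. (\<phi> x * X x) *\<^sub>R h x $ j \<partial>lebesgue)"
      using w \<phi>\<chi> by (simp add: weak_gradient_def)
    also have "- (\<integral>x. (\<phi> x * X x) *\<^sub>R h x $ j \<partial>lebesgue) - (\<integral>x. (\<phi> x * frechet_derivative X (at x) (axis j 1)) *\<^sub>R \<psi> x \<partial>lebesgue)
       = - (\<integral>x. (\<phi> x * X x) *\<^sub>R h x $ j + (\<phi> x * frechet_derivative X (at x) (axis j 1)) *\<^sub>R \<psi> x \<partial>lebesgue)"
      by (simp add: Bochner_Integration.integral_add[OF i3 i2])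
    finally show "(\<integral>x. frechet_derivative \<phi> (at x) (axis j 1) *\<^sub>R X x *\<^sub>R \<psi> x \<partial>lebesgue)
      = - (\<integral>x. \<phi> x *\<^sub>R ((X x *\<^sub>R h x + (\<chi> j. frechet_derivative X (at x) (axis j 1) *\<^sub>R \<psi> x)) $ j) \<partial>lebesgue)"
      by (simp add: scaleR_add_right)
  qed
qed

text \<open>The gradient bound is stated after multiplication by a complex z because that vector is
  the remainder left by the product rule in \<open>weak_gradient_test_mult\<close>.\<close>

definition cutoff_seq :: "(nat \<Rightarrow> real ^ 'n \<Rightarrow> real) \<Rightarrow> real \<Rightarrow> bool" where
  "cutoff_seq X C \<longleftrightarrow> C > 0 \<and> (\<forall>n. test_function (X n)) \<and> (\<forall>n x. 0 \<le> X n x \<and> X n x \<le> 1) \<and>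
     (\<forall>n x. norm x > real (Suc n) \<longrightarrow> X n x = 0) \<and> (\<forall>x. (\<lambda>n. X n x) \<longlonglongrightarrow> 1) \<and>
     (\<forall>n x (z::complex). norm (\<chi> j. frechet_derivative (X n) (at x) (axis j 1) *\<^sub>R z) \<le> C / real (Suc n) * norm z)"

lemma cutoff_seqD:
  assumes "cutoff_seq X C"
  shows "C > 0" "test_function (X n)" "0 \<le> X n x" "X n x \<le> 1"
    "norm x > real (Suc n) \<Longrightarrow> X n x = 0" "(\<lambda>n. X n x) \<longlonglongrightarrow> 1"
    "norm (\<chi> j. frechet_derivative (X n) (at x) (axis j 1) *\<^sub>R (z::complex)) \<le> C / real (Suc n) * norm z"
  using assms by (simp_all add: cutoff_seq_def)

text \<open>One radial bump on the unit ball, with the factor \<open>exp 1\<close> making it equal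
  to 1 at the origin, is stretched by n + 1. Stretching divides its gradient by n + 1, and
  continuity at the origin gives the pointwise limit 1.\<close>

lemma ex_cutoff_seq: "\<exists>(X :: nat \<Rightarrow> real ^ 'n \<Rightarrow> real) C. cutoff_seq X C"
proof -
  define Y :: "real ^ 'n \<Rightarrow> real" where "Y x = exp 1 * exp_bump 0 (1 + (- 1) * (x \<bullet> x))" for x
  have sq: "x \<bullet> x = (\<Sum>i\<in>UNIV. x $ i * x $ i)" for x :: "real ^ 'n" by (simp add: inner_vec_def)
  have smsum: "smooth_fn (\<lambda>x :: real ^ 'n. \<Sum>i\<in>I. x $ i * x $ i)" if "finite I" for I
    using that by (induction rule: finite_induct) (auto intro!: smooth_fn.intros smooth_fn_component)
  have "smooth_fn Y" unfolding Y_def[abs_def] sq by (intro smooth_fn.intros smsum finite)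
  have Y0: "Y x = 0" if "norm x \<ge> 1" for x
  proof -
    have "x \<bullet> x \<ge> 1" using that by (simp add: dot_square_norm)
    then show ?thesis by (simp add: Y_def exp_bump_def)
  qed
  have tY: "test_function Y"
    by (rule test_functionI_bounded[where R=1]) (use smooth_fn_C_k[OF \<open>smooth_fn Y\<close>] Y0 in auto)
  have Y01: "0 \<le> Y x" "Y x \<le> 1" for x
  proof -
    show "0 \<le> Y x" by (simp add: Y_def exp_bump_0_nonneg)
    show "Y x \<le> 1"
    proof (cases "x \<bullet> x < 1")
      case True
      then have "1 \<le> 1 / (1 - x \<bullet> x)" by (simp add: pos_le_divide_eq)
      then have "exp (1 - 1 / (1 - x \<bullet> x)) \<le> exp 0" unfolding exp_le_cancel_iff by simp
      then show ?thesis using True by (simp add: Y_def exp_bump_def exp_diff exp_minus field_simps)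
    qed (simp add: Y_def exp_bump_def)
  qed
  have "\<exists>N>0. \<forall>x. \<bar>frechet_derivative Y (at x) (axis j 1)\<bar> \<le> N" for j
    using test_function_bounds[OF test_function_derivative[OF tY, of "axis j 1"]] by blast
  then obtain N where N: "\<And>j. N j > 0" "\<And>j x. \<bar>frechet_derivative Y (at x) (axis j 1)\<bar> \<le> N j" by metis
  define C where "C = (\<Sum>j\<in>UNIV. N j)"
  have C: "C > 0" unfolding C_def using N(1) by (intro sum_pos) auto
  define X where "X n x = Y ((1 / real (Suc n)) *\<^sub>R x)" for n x
  have Xeq: "X n = (\<lambda>x. Y (0 + (1 / real (Suc n)) *\<^sub>R x))" for n by (auto simp: X_def)
  have diff: "Y differentiable at x" for x
    using test_function_has_derivative[OF tY] by (auto simp: differentiable_def)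
  have dX: "frechet_derivative (X n) (at x) v = (1 / real (Suc n)) * frechet_derivative Y (at ((1 / real (Suc n)) *\<^sub>R x)) v" for n x v
  proof -
    have l: "linear (frechet_derivative Y (at ((1 / real (Suc n)) *\<^sub>R x)))"
      using test_function_has_derivative[OF tY] has_derivative_linear by blast
    have "frechet_derivative (X n) (at x) v = frechet_derivative Y (at (0 + (1 / real (Suc n)) *\<^sub>R x)) ((1 / real (Suc n)) *\<^sub>R v)"
      unfolding Xeq frechet_derivative_at[OF frechet_derivative_affine[OF diff], symmetric] ..
    then show ?thesis by (simp only: linear_scale[OF l] add_0 real_scaleR_def)
  qed
  have "cutoff_seq X C"
    unfolding cutoff_seq_def
  proof (intro conjI allI impI)
    show "C > 0" by (rule C)
    show "test_function (X n)" for n unfolding Xeq by (rule test_function_affine[OF tY]) simp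
    show "0 \<le> X n x" "X n x \<le> 1" for n x by (simp_all add: X_def Y01)
    show "X n x = 0" if "norm x > real (Suc n)" for n x
      unfolding X_def using that by (intro Y0) (simp add: field_simps)
    show "(\<lambda>n. X n x) \<longlonglongrightarrow> 1" for x
    proof -
      have "(\<lambda>n. (1 / real (Suc n)) *\<^sub>R x) \<longlonglongrightarrow> 0 *\<^sub>R x"
        using LIMSEQ_inverse_real_of_nat by (intro tendsto_intros) (simp add: inverse_eq_divide)
      moreover have "isCont Y 0" using test_function_continuous[OF tY] by (simp add: continuous_on_eq_continuous_at)
      ultimately have "(\<lambda>n. X n x) \<longlonglongrightarrow> Y 0" unfolding X_def
        using isCont_tendsto_compose[of 0 Y "\<lambda>n. (1 / real (Suc n)) *\<^sub>R x"] by simp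
      moreover have "Y 0 = 1" by (simp add: Y_def exp_bump_def exp_minus)
      ultimately show ?thesis by simp
    qed
    show "norm (\<chi> j. frechet_derivative (X n) (at x) (axis j 1) *\<^sub>R z) \<le> C / real (Suc n) * norm z" for n x and z :: complex
    proof -
      have "norm (\<chi> j. frechet_derivative (X n) (at x) (axis j 1) *\<^sub>R z) \<le> (\<Sum>j\<in>UNIV. norm (frechet_derivative (X n) (at x) (axis j 1) *\<^sub>R z))"
        unfolding norm_vec_def by (rule order_trans[OF L2_set_le_sum]) auto
      also have "\<dots> \<le> (\<Sum>j\<in>UNIV. N j / real (Suc n) * norm z)"
      proof (rule sum_mono)
        fix j
        have "\<bar>frechet_derivative (X n) (at x) (axis j 1)\<bar> \<le> N j / real (Suc n)"
          using N(2)[where j=j and x="(1 / real (Suc n)) *\<^sub>R x"] by (simp add: dX abs_mult divide_right_mono del: of_nat_Suc)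
        then show "norm (frechet_derivative (X n) (at x) (axis j 1) *\<^sub>R z) \<le> N j / real (Suc n) * norm z"
          unfolding norm_scaleR real_norm_def by (rule mult_right_mono) simp
      qed
      also have "\<dots> = C / real (Suc n) * norm z"
        by (simp add: C_def sum_distrib_right sum_divide_distrib)
      finally show ?thesis .
    qed
  qed
  then show ?thesis by blast
qed

text \<open>The term i A \<psi> contains no derivative and is linear in \<psi>, so it commutes with
  multiplication by X and the ordinary product rule carries over.\<close>

lemma mag_gradient_test_mult:
  fixes \<psi> :: "real ^ 'n \<Rightarrow> complex"
  assumes g: "is_mag_gradient A \<psi> g" and X: "test_function X"
  shows "is_mag_gradient A (\<lambda>x. X x *\<^sub>R \<psi> x)
     (\<lambda>x. X x *\<^sub>R g x + (\<chi> j. frechet_derivative X (at x) (axis j 1) *\<^sub>R \<psi> x))"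
proof -
  have "X x *\<^sub>R g x + (\<chi> j. frechet_derivative X (at x) (axis j 1) *\<^sub>R \<psi> x)
      - (\<chi> j. \<i> * complex_of_real (A x $ j) * (X x *\<^sub>R \<psi> x))
    = X x *\<^sub>R (g x - (\<chi> j. \<i> * complex_of_real (A x $ j) * \<psi> x))
      + (\<chi> j. frechet_derivative X (at x) (axis j 1) *\<^sub>R \<psi> x)" for x
    by (simp add: vec_eq_iff scaleR_diff_right)
  note eq = this
  show ?thesis
    unfolding is_mag_gradient_def eq by (rule weak_gradient_test_mult[OF g[unfolded is_mag_gradient_def] X])
qed

lemma is_mag_gradient_0: "is_mag_gradient (\<lambda>_. 0) u h \<longleftrightarrow> weak_gradient u h"
proof -
  have "(\<chi> j::'a. \<i> * complex_of_real ((0 :: real ^ 'a) $ j) * u x) = 0" for x by (simp add: vec_eq_iff)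
  then show ?thesis by (simp add: is_mag_gradient_def)
qed

text \<open>Young's inequality; its defect is the square (\<eta> b - \<delta> c)^2 / \<eta>. A small
  \<eta> keeps the constant of the main term near 1 at the price of a large one for the
  correction.\<close>

lemma Lint_2_add_le:
  assumes [measurable]: "g \<in> borel_measurable lebesgue" "k \<in> borel_measurable lebesgue"
    and le: "AE x in lebesgue. norm (f x) \<le> norm (g x) + \<delta> * norm (k x)" and "0 < \<eta>" "0 \<le> \<delta>"
  shows "Lint 2 f \<le> ennreal (1 + \<eta>) * Lint 2 g + ennreal ((1 + 1 / \<eta>) * \<delta>\<^sup>2) * Lint 2 k"
proof -
  have pt: "a\<^sup>2 \<le> (1 + \<eta>) * b\<^sup>2 + (1 + 1 / \<eta>) * \<delta>\<^sup>2 * c\<^sup>2"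
    if "0 \<le> a" "a \<le> b + \<delta> * c" for a b c :: real
  proof -
    have "a\<^sup>2 \<le> (b + \<delta> * c)\<^sup>2" using that by (intro power_mono)
    moreover have "(1 + \<eta>) * b\<^sup>2 + (1 + 1 / \<eta>) * \<delta>\<^sup>2 * c\<^sup>2 - (b + \<delta> * c)\<^sup>2 = (\<eta> * b - \<delta> * c)\<^sup>2 / \<eta>"
      using \<open>0 < \<eta>\<close> by (simp add: field_simps power2_eq_square)
    moreover have "(\<eta> * b - \<delta> * c)\<^sup>2 / \<eta> \<ge> 0" using \<open>0 < \<eta>\<close> by simp
    ultimately show ?thesis by linarith
  qed
  have "Lint 2 f \<le> (\<integral>\<^sup>+x. ennreal (1 + \<eta>) * ennreal ((norm (g x))\<^sup>2) + ennreal ((1 + 1 / \<eta>) * \<delta>\<^sup>2) * ennreal ((norm (k x))\<^sup>2) \<partial>lebesgue)"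
    unfolding Lint_2
  proof (rule nn_integral_mono_AE)
    show "AE x in lebesgue. ennreal ((norm (f x))\<^sup>2)
      \<le> ennreal (1 + \<eta>) * ennreal ((norm (g x))\<^sup>2) + ennreal ((1 + 1 / \<eta>) * \<delta>\<^sup>2) * ennreal ((norm (k x))\<^sup>2)"
      using le
    proof eventually_elim
      case (elim x)
      then show ?case
        using pt[OF norm_ge_zero elim] \<open>0 < \<eta>\<close>
        by (simp add: ennreal_mult[symmetric] ennreal_plus[symmetric] ennreal_leI del: ennreal_plus)
    qed
  qed
  also have "\<dots> = ennreal (1 + \<eta>) * Lint 2 g + ennreal ((1 + 1 / \<eta>) * \<delta>\<^sup>2) * Lint 2 k"
    unfolding Lint_2 by (simp add: nn_integral_add nn_integral_cmult)
  finally show ?thesis .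
qed

lemma Lint_tendsto:
  assumes m: "\<And>n. f n \<in> borel_measurable lebesgue" and [measurable]: "g \<in> borel_measurable lebesgue"
    and q: "0 < q" and fin: "Lint q g < \<infinity>"
    and le: "\<And>n x. norm (f n x) \<le> norm (g x)" and lim: "\<And>x. (\<lambda>n. norm (f n x)) \<longlonglongrightarrow> norm (g x)"
  shows "(\<lambda>n. Lint q (f n)) \<longlonglongrightarrow> Lint q g"
proof -
  note [measurable] = m
  show ?thesis
    unfolding Lint_def
  proof (rule nn_integral_dominated_convergence[where w="\<lambda>x. ennreal (norm (g x) powr q)"])
    show "AE x in lebesgue. (\<lambda>n. ennreal (norm (f n x) powr q)) \<longlonglongrightarrow> ennreal (norm (g x) powr q)"
    proof (rule AE_I2)
      fix x
      have "(\<lambda>n. norm (f n x) powr q) \<longlonglongrightarrow> norm (g x) powr q"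
        using lim[of x] q by (intro tendsto_powr2 tendsto_const) auto
      then show "(\<lambda>n. ennreal (norm (f n x) powr q)) \<longlonglongrightarrow> ennreal (norm (g x) powr q)"
        by (rule tendsto_ennrealI)
    qed
    show "(\<integral>\<^sup>+x. ennreal (norm (g x) powr q) \<partial>lebesgue) < \<infinity>" using fin by (simp add: Lint_def)
  qed (use le q in \<open>auto intro!: AE_I2 ennreal_leI powr_mono2\<close>)
qed

subsection \<open>Infima of affine families and the magnetic Sobolev space\<close>

text \<open>A real infimum, meaningful only if the quotients are bounded below. The lemmas carry
  such a bound as a constant k with k Z \<le> X + a Y.\<close>

definition affine_inf :: "'t set \<Rightarrow> ('t \<Rightarrow> real) \<Rightarrow> ('t \<Rightarrow> real) \<Rightarrow> ('t \<Rightarrow> real) \<Rightarrow> real \<Rightarrow> real" where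
  "affine_inf T X Y Z a = (INF t\<in>T. (X t + a * Y t) / Z t)"

lemma affine_inf_greatest:
  assumes "T \<noteq> {}" "\<And>t. t \<in> T \<Longrightarrow> 0 < Z t" "\<And>t. t \<in> T \<Longrightarrow> k * Z t \<le> X t + a * Y t"
  shows "k \<le> affine_inf T X Y Z a"
  unfolding affine_inf_def using assms by (intro cINF_greatest) (auto simp: pos_le_divide_eq)

lemma affine_inf_lower:
  assumes "\<And>t. t \<in> T \<Longrightarrow> 0 < Z t" "\<And>t. t \<in> T \<Longrightarrow> k * Z t \<le> X t + a * Y t" "t \<in> T"
  shows "affine_inf T X Y Z a \<le> (X t + a * Y t) / Z t"
  unfolding affine_inf_def
  by (intro cINF_lower assms(3) bdd_belowI2[where m=k]) (use assms in \<open>auto simp: pos_le_divide_eq\<close>)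

lemma affine_inf_mult_le:
  assumes "t \<in> T" "\<And>t. t \<in> T \<Longrightarrow> 0 < Z t" "\<And>t. t \<in> T \<Longrightarrow> k * Z t \<le> X t + a * Y t"
  shows "affine_inf T X Y Z a * Z t \<le> X t + a * Y t"
  using affine_inf_lower[where T=T and X=X and Y=Y and Z=Z and a=a and k=k and t=t] assms
  by (simp add: pos_le_divide_eq)

text \<open>With Z positive and the quotients bounded below, the infimum is itself an admissible
  constant, so the supremum is attained and finite.\<close>

lemma optimal_constant_eq_affine_inf:
  assumes T: "T \<noteq> {}" and Z: "\<And>t. t \<in> T \<Longrightarrow> 0 < Z t"
    and k: "\<And>t. t \<in> T \<Longrightarrow> k * Z t \<le> X t + a * Y t"
    and P: "\<And>c. P c \<longleftrightarrow> (\<forall>t\<in>T. c * Z t \<le> X t + a * Y t)"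
  shows "optimal_constant P = ereal (affine_inf T X Y Z a)"
  unfolding optimal_constant_def
proof (rule SUP_eqI)
  fix c assume "c \<in> {c. P c}"
  then show "ereal c \<le> ereal (affine_inf T X Y Z a)"
    by (auto simp: P intro!: affine_inf_greatest[OF T Z])
next
  fix y assume y: "\<And>i. i \<in> {c. P c} \<Longrightarrow> ereal i \<le> y"
  have "P (affine_inf T X Y Z a)"
    unfolding P
  proof
    fix t assume t: "t \<in> T"
    show "affine_inf T X Y Z a * Z t \<le> X t + a * Y t"
      by (rule affine_inf_mult_le[OF t Z k])
  qed
  then show "ereal (affine_inf T X Y Z a) \<le> y" using y by simp
qed

lemma concave_on_affine_inf:
  assumes S: "convex S" and T: "T \<noteq> {}" and Z: "\<And>t. t \<in> T \<Longrightarrow> 0 < Z t"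
    and k: "\<And>a t. a \<in> S \<Longrightarrow> t \<in> T \<Longrightarrow> k a * Z t \<le> X t + a * Y t"
  shows "concave_on S (affine_inf T X Y Z)"
  unfolding concave_on_iff
proof (intro conjI ballI allI impI S)
  fix a b u v :: real assume a: "a \<in> S" and b: "b \<in> S" and u: "0 \<le> u" and v: "0 \<le> v" and uv: "u + v = 1"
  show "u * affine_inf T X Y Z a + v * affine_inf T X Y Z b \<le> affine_inf T X Y Z (u *\<^sub>R a + v *\<^sub>R b)"
  proof (rule affine_inf_greatest[OF T Z])
    fix t assume t: "t \<in> T"
    have "affine_inf T X Y Z a * Z t \<le> X t + a * Y t" "affine_inf T X Y Z b * Z t \<le> X t + b * Y t"
      using affine_inf_mult_le[OF t Z k[OF a]] affine_inf_mult_le[OF t Z k[OF b]] by auto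
    then have "u * (affine_inf T X Y Z a * Z t) + v * (affine_inf T X Y Z b * Z t) \<le> u * (X t + a * Y t) + v * (X t + b * Y t)"
      using u v by (intro add_mono mult_left_mono)
    also have "\<dots> = (u + v) * X t + (u * a + v * b) * Y t" by (simp add: algebra_simps)
    finally show "(u * affine_inf T X Y Z a + v * affine_inf T X Y Z b) * Z t \<le> X t + (u *\<^sub>R a + v *\<^sub>R b) * Y t"
      unfolding uv by (simp add: algebra_simps)
  qed simp
qed

lemma affine_inf_mono:
  assumes T: "T \<noteq> {}" and Z: "\<And>t. t \<in> T \<Longrightarrow> 0 < Z t" and Y: "\<And>t. t \<in> T \<Longrightarrow> 0 \<le> Y t"
    and k: "\<And>t. t \<in> T \<Longrightarrow> k * Z t \<le> X t + a * Y t" and ab: "a \<le> b"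
  shows "affine_inf T X Y Z a \<le> affine_inf T X Y Z b"
proof (rule affine_inf_greatest[OF T Z])
  fix t assume t: "t \<in> T"
  have "affine_inf T X Y Z a * Z t \<le> X t + a * Y t"
    by (rule affine_inf_mult_le[OF t Z k])
  also have "\<dots> \<le> X t + b * Y t" using Y[OF t] ab by (simp add: mult_right_mono)
  finally show "affine_inf T X Y Z a * Z t \<le> X t + b * Y t" .
qed simp

text \<open>Choose e with f e > f b; monotonicity puts e beyond b, so b is a convex combination of a
  and e. Concavity gives (1 - t) f a + t f e \<le> f b, and f e > f b then forces f a < f b.\<close>

lemma concave_unbounded_strict_mono:
  fixes f :: "real \<Rightarrow> real"
  assumes c: "concave_on {l<..} f" and mono: "\<And>a b. l < a \<Longrightarrow> a \<le> b \<Longrightarrow> f a \<le> f b"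
    and unb: "\<And>M. \<exists>a>l. M < f a"
  shows "strict_mono_on {l<..} f"
proof (rule strict_mono_onI)
  fix a b assume ab: "a \<in> {l<..}" "b \<in> {l<..}" "a < b"
  obtain e where e: "e > l" "f b < f e" using unb by blast
  have be: "b < e" using mono[of e b] e ab by (meson linorder_not_le not_less_iff_gr_or_eq order.strict_trans1 less_le_not_le)
  define t where "t = (b - a) / (e - a)"
  have t: "0 < t" "t \<le> 1" using ab be by (auto simp: t_def)
  have eq: "(1 - t) *\<^sub>R a + t *\<^sub>R e = b"
  proof -
    have "(1 - t) *\<^sub>R a + t *\<^sub>R e = a + t * (e - a)" by (simp add: algebra_simps)
    also have "\<dots> = b" using ab be by (simp add: t_def)
    finally show ?thesis .
  qed
  have "(1 - t) * f a + t * f e \<le> f b"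
    using concave_onD[OF c, of t a e] t ab e unfolding eq by auto
  moreover have "t * f b < t * f e" using t e by simp
  ultimately have "(1 - t) * f a < (1 - t) * f b" by (simp add: algebra_simps)
  then show "f a < f b" using t by (simp add: mult_less_cancel_left)
qed

text \<open>The squared \<open>L\<^sup>q\<close> norm as a real number: it is \<open>0\<close>, not \<open>\<infinity>\<close>, for measurable functions outside \<open>L\<^sup>q\<close>.\<close>

definition nq :: "real \<Rightarrow> (real ^ 'n \<Rightarrow> 'b::euclidean_space) \<Rightarrow> real" where
  "nq q f = enn2real (Lint q f) powr (2 / q)"

lemma nq_nonneg [simp]: "0 \<le> nq q f" by (simp add: nq_def)

lemma nq_2: "nq 2 f = enn2real (Lint 2 f)" by (simp add: nq_def)

lemma Lint_2_eq: "f \<in> Lspace 2 \<Longrightarrow> Lint 2 f = ennreal (nq 2 f)"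
  by (simp add: nq_2 Lspace_iff)

lemma Lnorm_sq: "f \<in> Lspace q \<Longrightarrow> (Lnorm q f)\<^sup>2 = ereal (nq q f)"
  by (simp add: Lnorm_def nq_def Lint_def power2_eq_square powr_add[symmetric] add_divide_distrib[symmetric])

lemma Lnorm_sq_infinite: "f \<notin> Lspace q \<Longrightarrow> (Lnorm q f)\<^sup>2 = \<infinity>"
  by (simp add: Lnorm_def power2_eq_square)

lemma nq_mono:
  assumes "f \<in> Lspace q" "0 < q" "Lint q g \<le> Lint q f" shows "nq q g \<le> nq q f"
  using assms by (auto simp: nq_def Lspace_iff intro!: powr_mono2 enn2real_mono)

lemma Lint_eq_0_iff:
  assumes "f \<in> borel_measurable lebesgue" shows "Lint q f = 0 \<longleftrightarrow> ae_zero f"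
proof -
  have [measurable]: "(\<lambda>x. norm (f x) powr q) \<in> borel_measurable lebesgue" using assms by measurable
  have "Lint q f = 0 \<longleftrightarrow> (AE x in lebesgue. ennreal (norm (f x) powr q) = 0)"
    unfolding Lint_def by (rule nn_integral_0_iff_AE) measurable
  also have "\<dots> \<longleftrightarrow> ae_zero f"
    unfolding ae_zero_def by (intro AE_cong) (simp add: ennreal_eq_0_iff powr_nonneg_iff)
  finally show ?thesis .
qed

lemma nq_pos:
  assumes "f \<in> Lspace q" "0 < q" "\<not> ae_zero f" shows "0 < nq q f"
proof -
  have "Lint q f \<noteq> 0" "Lint q f < \<infinity>" using assms Lint_eq_0_iff[of f q] by (auto simp: Lspace_iff)
  then have "0 < enn2real (Lint q f)" by (simp add: enn2real_positive_iff less_top[symmetric] zero_less_iff_neq_zero)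
  then show ?thesis by (simp add: nq_def)
qed

lemma nq_zero: "f \<in> borel_measurable lebesgue \<Longrightarrow> ae_zero f \<Longrightarrow> nq q f = 0"
  using Lint_eq_0_iff[of f q] by (simp add: nq_def)

lemma Lspace_scaleR: "f \<in> Lspace q \<Longrightarrow> (\<lambda>x. (c::real) *\<^sub>R f x) \<in> Lspace q"
  by (auto simp: Lspace_iff Lint_scaleR ennreal_mult_less_top)

lemma nq_scaleR:
  assumes "f \<in> Lspace q" "0 < q" shows "nq q (\<lambda>x. (c::real) *\<^sub>R f x) = c\<^sup>2 * nq q f"
proof -
  have "(\<bar>c\<bar> powr q) powr (2 / q) = c\<^sup>2" using assms(2) by (simp add: powr_powr)
  then show ?thesis
    using assms by (simp add: nq_def Lspace_iff Lint_scaleR enn2real_mult powr_mult)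
qed

lemma Lspace_dilation: "f \<in> Lspace q \<Longrightarrow> \<sigma> > 0 \<Longrightarrow> (\<lambda>x. f (\<sigma> *\<^sub>R x)) \<in> Lspace q"
  using measurable_affine[of \<sigma> f 0] by (auto simp: Lspace_iff Lint_dilation ennreal_mult_less_top)

lemma nq_dilation:
  fixes f :: "real ^ 'n \<Rightarrow> 'b::euclidean_space"
  assumes "f \<in> Lspace q" "0 < q" "\<sigma> > 0"
  shows "nq q (\<lambda>x. f (\<sigma> *\<^sub>R x)) = \<sigma> powr (- 2 * real CARD('n) / q) * nq q f"
proof -
  have "(1 / \<sigma> ^ CARD('n)) powr (2 / q) = \<sigma> powr (- 2 * real CARD('n) / q)"
    using assms(3) by (simp add: powr_realpow[symmetric] powr_minus_divide[symmetric] powr_powr mult.commute)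
  moreover have "nq q (\<lambda>x. f (\<sigma> *\<^sub>R x)) = ((1 / \<sigma> ^ CARD('n)) * enn2real (Lint q f)) powr (2 / q)"
    using assms by (simp add: nq_def Lspace_iff Lint_dilation enn2real_mult)
  ultimately show ?thesis
    using assms(3) by (simp only: nq_def) (subst powr_mult, auto)
qed

section \<open>Magnetic gradients and the magnetic Sobolev space\<close>

lemma mag_gradient_props:
  assumes A: "A \<in> borel_measurable lebesgue" and g: "is_mag_gradient A \<psi> g"
  shows "is_mag_gradient A \<psi> (mag_gradient A \<psi>)" "mag_gradient A \<psi> \<in> borel_measurable lebesgue"
    "g \<in> borel_measurable lebesgue" "AE x in lebesgue. mag_gradient A \<psi> x = g x"
    "Lint q (mag_gradient A \<psi>) = Lint q g"
proof -
  note [measurable] = A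
  show m: "is_mag_gradient A \<psi> (mag_gradient A \<psi>)"
    unfolding mag_gradient_def by (rule someI[of "is_mag_gradient A \<psi>", OF g])
  have meas: "k \<in> borel_measurable lebesgue" if "is_mag_gradient A \<psi> k" for k
  proof -
    have 1: "(\<lambda>x. k x - (\<chi> j. \<i> * complex_of_real (A x $ j) * \<psi> x)) \<in> borel_measurable lebesgue"
      and [measurable]: "\<psi> \<in> borel_measurable lebesgue"
      using that by (auto simp: is_mag_gradient_def weak_gradient_def Lspace_loc_1_iff)
    have 2: "(\<lambda>x. \<chi> j. \<i> * complex_of_real (A x $ j) * \<psi> x) \<in> borel_measurable lebesgue"
      by (rule borel_measurable_vec_lambda) measurable
    from borel_measurable_add[OF 1 2] show ?thesis by simp
  qed
  show "mag_gradient A \<psi> \<in> borel_measurable lebesgue" "g \<in> borel_measurable lebesgue"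
    using meas m g by auto
  show ae: "AE x in lebesgue. mag_gradient A \<psi> x = g x"
    using weak_gradient_unique[OF m[unfolded is_mag_gradient_def] g[unfolded is_mag_gradient_def]]
    by eventually_elim simp
  show "Lint q (mag_gradient A \<psi>) = Lint q g"
    by (rule Lint_cong_AE) (use ae in \<open>eventually_elim, simp\<close>)
qed

lemma H1_magD:
  assumes A: "A \<in> borel_measurable lebesgue" and \<psi>: "\<psi> \<in> H1_mag A"
  shows "\<psi> \<in> Lspace 2" "is_mag_gradient A \<psi> (mag_gradient A \<psi>)" "mag_gradient A \<psi> \<in> Lspace 2"
proof -
  obtain g where g: "g \<in> Lspace 2" "is_mag_gradient A \<psi> g" using \<psi> by (auto simp: H1_mag_def)
  show "\<psi> \<in> Lspace 2" using \<psi> by (simp add: H1_mag_def)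
  show "is_mag_gradient A \<psi> (mag_gradient A \<psi>)" by (rule mag_gradient_props(1)[OF A g(2)])
  show "mag_gradient A \<psi> \<in> Lspace 2"
    using mag_gradient_props(2,5)[OF A g(2)] g(1) by (simp add: Lspace_iff)
qed

lemma H1_magI:
  assumes A: "A \<in> borel_measurable lebesgue" and "\<psi> \<in> Lspace 2" and g: "is_mag_gradient A \<psi> g" and "Lint 2 g < \<infinity>"
  shows "\<psi> \<in> H1_mag A" "nq q (mag_gradient A \<psi>) = nq q g"
proof -
  show "\<psi> \<in> H1_mag A"
    using assms mag_gradient_props(3)[OF A g] by (auto simp: H1_mag_def Lspace_iff)
  show "nq q (mag_gradient A \<psi>) = nq q g"
    using mag_gradient_props(5)[OF A g] by (simp add: nq_def)
qed

lemma zero_measurable: "(\<lambda>_. 0) \<in> borel_measurable lebesgue" by simp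

lemma H1D:
  assumes "u \<in> H1"
  shows "u \<in> Lspace 2" "weak_gradient u (gradient u)" "gradient u \<in> Lspace 2"
  using H1_magD[OF zero_measurable assms] by (simp_all add: is_mag_gradient_0)

lemma H1I:
  assumes "u \<in> Lspace 2" "weak_gradient u h" "Lint 2 h < \<infinity>"
  shows "u \<in> H1" "nq q (gradient u) = nq q h"
  using H1_magI[OF zero_measurable assms(1), of h] assms by (simp_all add: is_mag_gradient_0)

text \<open>Integrated form of the diamagnetic inequality: whatever the field, passing to the
  modulus and truncating it lands in the field-free space without raising the energy.\<close>

lemma H1_sat:
  assumes A: "A \<in> borel_measurable lebesgue" and \<psi>: "\<psi> \<in> H1_mag A" and e: "0 \<le> e"
  shows "(\<lambda>x. complex_of_real (sat e (\<psi> x))) \<in> H1"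
    "nq 2 (gradient (\<lambda>x. complex_of_real (sat e (\<psi> x)))) \<le> nq 2 (mag_gradient A \<psi>)"
proof -
  note D = H1_magD[OF A \<psi>]
  let ?u = "\<lambda>x. complex_of_real (sat e (\<psi> x))"
  let ?k = "\<lambda>x. \<chi> j. complex_of_real (Re (cnj (sat' e (\<psi> x)) * mag_gradient A \<psi> x $ j))"
  have w: "weak_gradient ?u ?k" and le: "\<And>x. norm (?k x) \<le> norm (mag_gradient A \<psi> x)"
    using diamagnetic[OF D(2) e] by auto
  have um: "?u \<in> borel_measurable lebesgue" using w by (simp add: weak_gradient_def Lspace_loc_1_iff)
  have "Lint 2 ?u \<le> Lint 2 \<psi>"
    by (rule Lint_mono_AE) (use sat_le[OF e] sat_nonneg[OF e] in auto)
  then have u2: "?u \<in> Lspace 2" using um D(1) by (auto simp: Lspace_iff intro: order.strict_trans1)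
  have k: "Lint 2 ?k \<le> Lint 2 (mag_gradient A \<psi>)" by (rule Lint_mono_AE) (use le in auto)
  then have k2: "Lint 2 ?k < \<infinity>" using D(3) by (auto simp: Lspace_iff intro: order.strict_trans1)
  show "?u \<in> H1" by (rule H1I(1)[OF u2 w k2])
  show "nq 2 (gradient ?u) \<le> nq 2 (mag_gradient A \<psi>)"
    unfolding H1I(2)[OF u2 w k2] using k by (intro nq_mono[OF D(3)]) auto
qed

lemma H1_scaleR:
  assumes "u \<in> H1"
  shows "(\<lambda>x. (c::real) *\<^sub>R u x) \<in> H1" "nq 2 (gradient (\<lambda>x. c *\<^sub>R u x)) = c\<^sup>2 * nq 2 (gradient u)"
proof -
  note D = H1D[OF assms]
  have w: "weak_gradient (\<lambda>x. c *\<^sub>R u x) (\<lambda>x. c *\<^sub>R gradient u x)" by (rule weak_gradient_scaleR[OF D(2)])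
  have f: "Lint 2 (\<lambda>x. c *\<^sub>R gradient u x) < \<infinity>" using Lspace_scaleR[OF D(3), of c] by (simp add: Lspace_iff)
  show "(\<lambda>x. c *\<^sub>R u x) \<in> H1" by (rule H1I(1)[OF Lspace_scaleR[OF D(1)] w f])
  show "nq 2 (gradient (\<lambda>x. c *\<^sub>R u x)) = c\<^sup>2 * nq 2 (gradient u)"
    unfolding H1I(2)[OF Lspace_scaleR[OF D(1)] w f] by (rule nq_scaleR[OF D(3)]) simp
qed

lemma H1_dilation:
  fixes u :: "real ^ 'n \<Rightarrow> complex"
  assumes "u \<in> H1" and \<sigma>: "\<sigma> > 0"
  shows "(\<lambda>x. u (\<sigma> *\<^sub>R x)) \<in> H1"
    "nq 2 (gradient (\<lambda>x. u (\<sigma> *\<^sub>R x))) = \<sigma> powr (2 - real CARD('n)) * nq 2 (gradient u)"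
proof -
  note D = H1D[OF assms(1)]
  note L = Lspace_dilation[OF D(1) \<sigma>] and G = Lspace_dilation[OF D(3) \<sigma>]
  have w: "weak_gradient (\<lambda>x. u (\<sigma> *\<^sub>R x)) (\<lambda>x. \<sigma> *\<^sub>R gradient u (\<sigma> *\<^sub>R x))"
    by (rule weak_gradient_dilation[OF D(2) \<sigma>])
  have f: "Lint 2 (\<lambda>x. \<sigma> *\<^sub>R gradient u (\<sigma> *\<^sub>R x)) < \<infinity>"
    using Lspace_scaleR[OF G, of \<sigma>] by (simp add: Lspace_iff)
  show "(\<lambda>x. u (\<sigma> *\<^sub>R x)) \<in> H1" by (rule H1I(1)[OF L w f])
  have "nq 2 (gradient (\<lambda>x. u (\<sigma> *\<^sub>R x))) = \<sigma>\<^sup>2 * (\<sigma> powr (- real CARD('n)) * nq 2 (gradient u))"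
    unfolding H1I(2)[OF L w f] nq_scaleR[OF G zero_less_numeral] nq_dilation[OF D(3) zero_less_numeral \<sigma>] by simp
  also have "\<sigma>\<^sup>2 = \<sigma> powr 2" using \<sigma> by simp
  also have "\<sigma> powr 2 * (\<sigma> powr (- real CARD('n)) * nq 2 (gradient u)) = \<sigma> powr (2 - real CARD('n)) * nq 2 (gradient u)"
    using \<sigma> by (simp add: powr_diff powr_minus_divide)
  finally show "nq 2 (gradient (\<lambda>x. u (\<sigma> *\<^sub>R x))) = \<sigma> powr (2 - real CARD('n)) * nq 2 (gradient u)" .
qed

text \<open>Dividing u by the square root of E makes both norms at most 1, and homogeneity carries
  the bound back. The slack d keeps E positive even when u vanishes almost everywhere, and is sent
  to 0 at the end.\<close>

lemma sobolev_inequality: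
  assumes dim: "CARD('n::finite) = 2 \<or> CARD('n) = 3" and p: "2 < p" "ereal p < critical_exponent CARD('n)"
  shows "\<exists>K>0. \<forall>u \<in> (H1 :: (real ^ 'n \<Rightarrow> complex) set). u \<in> Lspace p \<and> nq p u \<le> K * (nq 2 (gradient u) + nq 2 u)"
proof -
  obtain K where K: "K > 0" and B: "\<And>(u :: real ^ 'n \<Rightarrow> complex) h. weak_gradient u h \<Longrightarrow> Lint 2 u \<le> 1 \<Longrightarrow> Lint 2 h \<le> 1 \<Longrightarrow> Lint p u \<le> ennreal K"
    using H1_bounded_in_subcritical[OF assms] unfolding H1_bounded_in_def by blast
  have main: "u \<in> Lspace p \<and> nq p u \<le> K powr (2 / p) * (nq 2 (gradient u) + nq 2 u + d)"
    if u: "u \<in> H1" and d: "d > 0" for u :: "real ^ 'n \<Rightarrow> complex" and d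
  proof -
    define E where "E = nq 2 (gradient u) + nq 2 u + d"
    have E: "E > 0" using d by (simp add: E_def add_nonneg_pos)
    define c where "c = 1 / sqrt E"
    have c: "c > 0" "c\<^sup>2 * E = 1" using E by (simp_all add: c_def power_divide)
    note D = H1D[OF u] and S = H1_scaleR[OF u, of c]
    note D' = H1D[OF S(1)]
    have "c\<^sup>2 * nq 2 u \<le> c\<^sup>2 * E" "c\<^sup>2 * nq 2 (gradient u) \<le> c\<^sup>2 * E"
      using d by (auto intro!: mult_left_mono simp: E_def)
    then have "nq 2 (\<lambda>x. c *\<^sub>R u x) \<le> 1" "nq 2 (gradient (\<lambda>x. c *\<^sub>R u x)) \<le> 1"
      using c(2) nq_scaleR[OF D(1), of c] S(2) by simp_all
    then have le: "Lint p (\<lambda>x. c *\<^sub>R u x) \<le> ennreal K"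
      by (intro B[OF D'(2)]) (simp_all add: Lint_2_eq D')
    have um: "u \<in> borel_measurable lebesgue" using D(1) by (simp add: Lspace_iff)
    have "ennreal (c powr p) * Lint p u \<le> ennreal K"
      using le c(1) by (simp add: Lint_scaleR[OF um])
    then have L: "Lint p u \<le> ennreal (K / c powr p)"
      using c(1) K by (intro ennreal_mult_le_imp_le_divide) auto
    then have 1: "u \<in> Lspace p" using um by (auto simp: Lspace_iff intro: order.strict_trans1)
    have "enn2real (Lint p u) \<le> K / c powr p"
      using L K c by (simp add: enn2real_leI)
    then have "nq p u \<le> (K / c powr p) powr (2 / p)"
      unfolding nq_def using p by (intro powr_mono2) auto
    also have "\<dots> = K powr (2 / p) / c\<^sup>2"
      using K c(1) p by (simp add: powr_divide powr_powr)
    also have "\<dots> = K powr (2 / p) * E" using c by (simp add: field_simps)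
    finally show ?thesis using 1 by (simp add: E_def)
  qed
  show ?thesis
  proof (intro exI[of _ "K powr (2 / p)"] conjI ballI)
    show "0 < K powr (2 / p)" using K by simp
    fix u :: "real ^ 'n \<Rightarrow> complex" assume u: "u \<in> H1"
    show "u \<in> Lspace p" using main[OF u, of 1] by simp
    show "nq p u \<le> K powr (2 / p) * (nq 2 (gradient u) + nq 2 u)"
    proof (rule field_le_epsilon)
      fix e :: real assume e: "e > 0"
      show "nq p u \<le> K powr (2 / p) * (nq 2 (gradient u) + nq 2 u) + e"
        using main[OF u, of "e / K powr (2 / p)"] K e by (simp add: distrib_left)
    qed
  qed
qed

text \<open>After normalising \<open>nq 2 u = 1\<close>, splitting at height \<open>M\<close> bounds the \<open>L\<^sup>2\<close> norm by the \<open>L\<^sup>p\<close> norm and the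
  \<open>L\<^sup>3\<close> norm, which the Sobolev inequality controls.\<close>

lemma sub_quadratic_inequality:
  assumes dim: "CARD('n::finite) = 2 \<or> CARD('n) = 3" and p: "1 < p" "p < 2"
  shows "\<exists>c>0. \<forall>u \<in> (H1 :: (real ^ 'n \<Rightarrow> complex) set). u \<in> Lspace p \<longrightarrow> c * nq 2 u \<le> nq 2 (gradient u) + nq p u"
proof -
  have "ereal 3 < critical_exponent CARD('n)" using dim by (auto simp: critical_exponent_def)
  then obtain K where K: "K > 0" and B: "\<And>u :: real ^ 'n \<Rightarrow> complex. u \<in> H1 \<Longrightarrow> u \<in> Lspace 3 \<and> nq 3 u \<le> K * (nq 2 (gradient u) + nq 2 u)"
    using sobolev_inequality[OF dim, of 3] by auto
  \<comment> \<open>With unit mass and energy at most 1, the Sobolev inequality bounds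
    \<open>nq 3 u\<close> by 2 K and so the integral of |u|^3 by \<open>K'\<close>. Splitting at M =
    2 \<open>K'\<close> leaves at most half of the mass above M; the other half bounds the integral
    of |u|^p below by 1 / (2 M^(2-p)), whose power 2/p is c. If the energy exceeds 1 there is
    nothing to prove.\<close>
  define K' where "K' = (K * 2) powr (3 / 2)"
  define M where "M = 2 * K'"
  have M: "K' > 0" "M > 0" using K by (simp_all add: K'_def M_def)
  define c where "c = (1 / (2 * M powr (2 - p))) powr (2 / p)"
  have c: "c > 0" using M by (simp add: c_def)
  have norm1: "min 1 c \<le> nq 2 (gradient u) + nq p u"
    if u: "u \<in> H1" and up: "u \<in> Lspace p" and u1: "nq 2 u = 1" for u :: "real ^ 'n \<Rightarrow> complex"
  proof (cases "nq 2 (gradient u) \<le> 1")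
    case False
    then show ?thesis using nq_nonneg[of p u] by linarith
  next
    case True
    have [measurable]: "u \<in> borel_measurable lebesgue" using up by (simp add: Lspace_iff)
    have u3: "u \<in> Lspace 3" using B[OF u] by simp
    have "nq 3 u \<le> K * 2" using B[OF u] True u1 K
      by (intro order_trans[OF conjunct2[OF B[OF u]]] mult_left_mono) auto
    then have "(nq 3 u) powr (3 / 2) \<le> K'" unfolding K'_def by (intro powr_mono2) auto
    then have L3: "Lint 3 u \<le> ennreal K'"
      using u3 by (auto simp: nq_def powr_powr Lspace_iff intro: ennreal_leI dest: ennreal_leI)
    have pt: "y\<^sup>2 \<le> M powr (2 - p) * y powr p + (1 / M) * y powr 3" if y: "0 \<le> y" for y :: real
    proof (cases "y \<le> M")
      case True
      show ?thesis
      proof (cases "y = 0")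
        case False
        then have "y\<^sup>2 = y powr (2 - p) * y powr p" using y by (simp add: powr_add[symmetric])
        also have "\<dots> \<le> M powr (2 - p) * y powr p"
          using True y p by (intro mult_right_mono powr_mono2) auto
        finally show ?thesis using M y by (simp add: add_increasing2)
      qed (use M p in simp)
    next
      case False
      have "1 \<le> y / M" using False M by simp
      then have "y\<^sup>2 \<le> (y / M) * y\<^sup>2" using mult_right_mono[of 1 "y / M" "y\<^sup>2"] by simp
      also have "\<dots> = (1 / M) * y powr 3" using y by (simp add: power3_eq_cube power2_eq_square)
      finally show ?thesis using M by (simp add: add_increasing)
    qed
    have "ennreal 1 = Lint 2 u" using H1D(1)[OF u] u1 by (simp add: Lint_2_eq)
    also have "\<dots> \<le> (\<integral>\<^sup>+x. ennreal (M powr (2 - p)) * ennreal (norm (u x) powr p) + ennreal (1 / M) * ennreal (norm (u x) powr 3) \<partial>lebesgue)"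
      unfolding Lint_2
    proof (rule nn_integral_mono)
      fix x
      have "ennreal ((norm (u x))\<^sup>2) \<le> ennreal (M powr (2 - p) * norm (u x) powr p + (1 / M) * norm (u x) powr 3)"
        by (intro ennreal_leI pt) simp
      then show "ennreal ((norm (u x))\<^sup>2) \<le> ennreal (M powr (2 - p)) * ennreal (norm (u x) powr p) + ennreal (1 / M) * ennreal (norm (u x) powr 3)"
        using M by (simp only: ennreal_plus ennreal_mult powr_ge_zero zero_le_divide_1_iff less_imp_le mult_nonneg_nonneg)
    qed
    also have "\<dots> = ennreal (M powr (2 - p)) * Lint p u + ennreal (1 / M) * Lint 3 u"
      unfolding Lint_def by (simp add: nn_integral_add nn_integral_cmult del: powr_numeral)
    also have "\<dots> \<le> ennreal (M powr (2 - p)) * ennreal (enn2real (Lint p u)) + ennreal (1 / M) * ennreal K'"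
      using L3 up by (intro add_mono mult_left_mono) (auto simp: Lspace_iff)
    also have "\<dots> = ennreal (M powr (2 - p) * enn2real (Lint p u) + (1 / M) * K')"
      using M by (simp add: ennreal_plus[symmetric] ennreal_mult[symmetric] del: ennreal_plus)
    finally have "1 \<le> M powr (2 - p) * enn2real (Lint p u) + (1 / M) * K'"
      using M by (subst (asm) ennreal_le_iff) auto
    moreover have "(1 / M) * K' = 1 / 2" using M by (simp add: M_def)
    ultimately have "1 / (2 * M powr (2 - p)) \<le> enn2real (Lint p u)"
      using M by (simp add: field_simps)
    then have "c \<le> nq p u" unfolding c_def nq_def using M p by (intro powr_mono2) auto
    then show ?thesis using nq_nonneg[of 2 "gradient u"] by linarith
  qed
  show ?thesis
  proof (intro exI[of _ "min 1 c"] conjI ballI impI)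
    show "0 < min 1 c" using c by simp
    fix u :: "real ^ 'n \<Rightarrow> complex" assume u: "u \<in> H1" and up: "u \<in> Lspace p"
    show "min 1 c * nq 2 u \<le> nq 2 (gradient u) + nq p u"
    proof (cases "nq 2 u = 0")
      case False
      then have N: "nq 2 u > 0" using nq_nonneg[of 2 u] by linarith
      define a where "a = 1 / sqrt (nq 2 u)"
      have a: "a\<^sup>2 = 1 / nq 2 u" using N by (simp add: a_def power_divide)
      have "min 1 c \<le> nq 2 (gradient (\<lambda>x. a *\<^sub>R u x)) + nq p (\<lambda>x. a *\<^sub>R u x)"
        using nq_scaleR[OF H1D(1)[OF u], of a] N a
        by (intro norm1 H1_scaleR u Lspace_scaleR up) auto
      also have "\<dots> = (nq 2 (gradient u) + nq p u) / nq 2 u"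
        using nq_scaleR[OF up, of a] H1_scaleR(2)[OF u, of a] a p by (simp add: add_divide_distrib)
      finally show ?thesis using N by (simp add: pos_le_divide_eq)
    qed simp
  qed
qed

subsection \<open>Approximation and concentration\<close>

lemma nq_tendsto:
  assumes "\<And>n. f n \<in> borel_measurable lebesgue" "g \<in> Lspace q" "0 < q"
    and "\<And>n x. norm (f n x) \<le> norm (g x)" "\<And>x. (\<lambda>n. norm (f n x)) \<longlonglongrightarrow> norm (g x)"
  shows "(\<lambda>n. nq q (f n)) \<longlonglongrightarrow> nq q g"
proof -
  have "(\<lambda>n. Lint q (f n)) \<longlonglongrightarrow> Lint q g"
    using assms by (intro Lint_tendsto) (auto simp: Lspace_iff)
  moreover have "Lint q g = ennreal (enn2real (Lint q g))" using assms(2) by (simp add: Lspace_iff)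
  ultimately have "(\<lambda>n. enn2real (Lint q (f n))) \<longlonglongrightarrow> enn2real (Lint q g)"
    by (intro tendsto_enn2real) auto
  then show ?thesis
    unfolding nq_def using assms(3) by (intro tendsto_powr2 tendsto_const) auto
qed

lemma Lspace_dominated:
  assumes "f \<in> borel_measurable lebesgue" "g \<in> Lspace q" "0 \<le> q" "\<And>x. norm (f x) \<le> norm (g x)"
  shows "f \<in> Lspace q"
proof -
  have "Lint q f \<le> Lint q g" using assms by (intro Lint_mono_AE) auto
  then show ?thesis using assms by (auto simp: Lspace_iff intro: order.strict_trans1)
qed

text \<open>Pointwise, |f|^q is at most |f|^2 where |f| > 1 and at most 1 elsewhere on the ball,
  whose volume is finite.\<close>

lemma Lspace_bounded_support:
  fixes f :: "real ^ 'n \<Rightarrow> 'b::euclidean_space"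
  assumes f: "f \<in> Lspace 2" and R: "\<And>x. norm x > R \<Longrightarrow> f x = 0" and q: "0 < q" "q \<le> 2"
  shows "f \<in> Lspace q"
proof -
  have [measurable]: "f \<in> borel_measurable lebesgue" using f by (simp add: Lspace_iff)
  have "Lint q f \<le> (\<integral>\<^sup>+x. indicator (cball 0 R) x + ennreal ((norm (f x))\<^sup>2) \<partial>lebesgue)"
    unfolding Lint_def
  proof (rule nn_integral_mono)
    fix x
    show "ennreal (norm (f x) powr q) \<le> indicator (cball 0 R) x + ennreal ((norm (f x))\<^sup>2)"
    proof (cases "norm x > R \<or> 1 < norm (f x)")
      case True
      have "norm (f x) powr q \<le> norm (f x) powr 2"
      proof (cases "1 < norm (f x)")
        case True
        then show ?thesis using q by (intro powr_mono) auto
      qed (use True R[of x] in simp)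
      then show ?thesis by (simp add: add_increasing ennreal_leI)
    next
      case False
      then have "norm (f x) powr q \<le> 1" using q by (intro powr_le1) auto
      then show ?thesis using False by (simp add: add_increasing2 ennreal_le_1)
    qed
  qed
  also have "(\<integral>\<^sup>+x. indicator (cball 0 R) x + ennreal ((norm (f x))\<^sup>2) \<partial>lebesgue) = emeasure lebesgue (cball (0 :: real ^ 'n) R) + Lint 2 f"
    unfolding Lint_2 by (subst nn_integral_add) auto
  also have "emeasure lebesgue (cball (0 :: real ^ 'n) R) + Lint 2 f < \<infinity>"
    using f emeasure_lborel_cball_finite[of "0 :: real ^ 'n" R] by (simp add: Lspace_iff)
  finally show ?thesis by (simp add: Lspace_iff)
qed

lemma cutoff_energy:
  fixes X :: "nat \<Rightarrow> real ^ 'n \<Rightarrow> real"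
  assumes cut: "cutoff_seq X C" and A: "A \<in> borel_measurable lebesgue" and \<psi>: "\<psi> \<in> H1_mag A"
  shows "(\<lambda>x. X n x *\<^sub>R \<psi> x) \<in> H1_mag A"
    "nq 2 (mag_gradient A (\<lambda>x. X n x *\<^sub>R \<psi> x)) \<le> (1 + 1 / real (Suc n)) * nq 2 (mag_gradient A \<psi>)
          + (1 / real (Suc n) + (1 / real (Suc n))\<^sup>2) * (C\<^sup>2 * nq 2 \<psi>)"
proof -
  note C = cutoff_seqD(1)[OF cut] and X = cutoff_seqD(2-7)[OF cut]
    note D = H1_magD[OF A \<psi>]
    let ?w = "\<lambda>x. X n x *\<^sub>R \<psi> x"
    let ?g = "\<lambda>x. X n x *\<^sub>R mag_gradient A \<psi> x + (\<chi> j. frechet_derivative (X n) (at x) (axis j 1) *\<^sub>R \<psi> x)"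
    define s where "s = real (Suc n)"
    have s: "s > 0" by (simp add: s_def)
    have g: "is_mag_gradient A ?w ?g" by (rule mag_gradient_test_mult[OF D(2) X(1)])
    have wm: "?w \<in> borel_measurable lebesgue"
      using D(1) test_function_lebesgue_measurable[OF X(1)[of n]] by (intro borel_measurable_scaleR) (auto simp: Lspace_iff)
    have w2: "?w \<in> Lspace 2"
      by (rule Lspace_dominated[OF wm D(1)]) (use X(2,3) in \<open>auto simp: mult_left_le_one_le\<close>)
    have le: "norm (?g x) \<le> norm (mag_gradient A \<psi> x) + C / s * norm (\<psi> x)" for x
    proof (rule order_trans[OF norm_triangle_ineq add_mono])
      show "norm (X n x *\<^sub>R mag_gradient A \<psi> x) \<le> norm (mag_gradient A \<psi> x)"
        using X(2,3)[of n x] by (simp add: mult_left_le_one_le)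
      show "norm (\<chi> j. frechet_derivative (X n) (at x) (axis j 1) *\<^sub>R \<psi> x) \<le> C / s * norm (\<psi> x)"
        unfolding s_def by (rule X(6))
    qed
    \<comment> \<open>Young's parameter is taken as 1 / s: the main term gets the factor 1 + 1/s and
      the remainder (1 + s) (C/s)^2 = C^2 (1/s + 1/s^2), so both errors vanish as s grows.\<close>
    have "Lint 2 ?g \<le> ennreal (1 + 1 / s) * Lint 2 (mag_gradient A \<psi>) + ennreal ((1 + 1 / (1 / s)) * (C / s)\<^sup>2) * Lint 2 \<psi>"
      by (rule Lint_2_add_le) (use D s C le in \<open>auto simp: Lspace_iff\<close>)
    also have "\<dots> = ennreal ((1 + 1 / s) * nq 2 (mag_gradient A \<psi>) + ((1 + 1 / (1 / s)) * (C / s)\<^sup>2) * nq 2 \<psi>)"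
      using s by (simp add: Lint_2_eq[OF D(1)] Lint_2_eq[OF D(3)] ennreal_plus[symmetric] ennreal_mult[symmetric] add_nonneg_nonneg del: ennreal_plus)
    also have "((1 + 1 / (1 / s)) * (C / s)\<^sup>2) * nq 2 \<psi> = (1 / s + (1 / s)\<^sup>2) * (C\<^sup>2 * nq 2 \<psi>)"
      using s by (simp add: field_simps power2_eq_square)
    finally have L: "Lint 2 ?g \<le> ennreal ((1 + 1 / s) * nq 2 (mag_gradient A \<psi>) + (1 / s + (1 / s)\<^sup>2) * (C\<^sup>2 * nq 2 \<psi>))" .
    then have fin: "Lint 2 ?g < \<infinity>" by (auto intro: order.strict_trans1)
    have "nq 2 (mag_gradient A ?w) = enn2real (Lint 2 ?g)"
      using H1_magI(2)[OF A w2 g fin, of 2] by (simp add: nq_2)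
    also have "\<dots> \<le> (1 + 1 / s) * nq 2 (mag_gradient A \<psi>) + (1 / s + (1 / s)\<^sup>2) * (C\<^sup>2 * nq 2 \<psi>)"
      using L s by (intro enn2real_leI) auto
    finally show "nq 2 (mag_gradient A ?w) \<le> (1 + 1 / real (Suc n)) * nq 2 (mag_gradient A \<psi>)
          + (1 / real (Suc n) + (1 / real (Suc n))\<^sup>2) * (C\<^sup>2 * nq 2 \<psi>)"
      by (simp add: s_def)
    show "?w \<in> H1_mag A" by (rule H1_magI(1)[OF A w2 g fin])
qed

lemma cutoff_bound_tendsto:
  "(\<lambda>n. (1 + 1 / real (Suc n)) * G + (1 / real (Suc n) + (1 / real (Suc n))\<^sup>2) * N) \<longlonglongrightarrow> G"
proof -
  have "(\<lambda>n. 1 / real (Suc n)) \<longlonglongrightarrow> 0" using LIMSEQ_inverse_real_of_nat by (simp add: inverse_eq_divide)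
  then have "(\<lambda>n. (1 + 1 / real (Suc n)) * G + (1 / real (Suc n) + (1 / real (Suc n))\<^sup>2) * N) \<longlonglongrightarrow> (1 + 0) * G + (0 + 0\<^sup>2) * N"
    by (intro tendsto_intros)
  then show ?thesis by simp
qed

text \<open>Near-optimality is an upper bound on the energy, so an upper bound \<open>B n\<close>
  with the right limit is recorded in place of the energies themselves.\<close>

lemma compact_approximation:
  fixes A :: "real ^ 'n \<Rightarrow> real ^ 'n"
  assumes A: "A \<in> borel_measurable lebesgue" and \<psi>: "\<psi> \<in> H1_mag A"
  shows "\<exists>w B. (\<forall>n. w n \<in> H1_mag A) \<and> (\<forall>n x. norm x > real (Suc n) \<longrightarrow> w n x = 0) \<and>
    (\<forall>n. nq 2 (mag_gradient A (w n)) \<le> B n) \<and> B \<longlonglongrightarrow> nq 2 (mag_gradient A \<psi>) \<and>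
    (\<lambda>n. nq 2 (w n)) \<longlonglongrightarrow> nq 2 \<psi>"
proof -
  obtain X :: "nat \<Rightarrow> real ^ 'n \<Rightarrow> real" and C :: real where cut: "cutoff_seq X C"
    using ex_cutoff_seq by blast
  note Xm = test_function_lebesgue_measurable[OF cutoff_seqD(2)[OF cut]] and X3 = cutoff_seqD(5)[OF cut] and X4 = cutoff_seqD(6)[OF cut]
  have X2: "\<bar>X n x\<bar> \<le> 1" for n x using cutoff_seqD(3,4)[OF cut, of n x] by simp
  note E = cutoff_energy[OF cut]
  note D = H1_magD[OF A \<psi>]
  show ?thesis
  proof (intro exI[of _ "\<lambda>n x. X n x *\<^sub>R \<psi> x"] exI[of _ "\<lambda>n. (1 + 1 / real (Suc n)) * nq 2 (mag_gradient A \<psi>)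
          + (1 / real (Suc n) + (1 / real (Suc n))\<^sup>2) * (C\<^sup>2 * nq 2 \<psi>)"] conjI allI impI)
    show "(\<lambda>x. X n x *\<^sub>R \<psi> x) \<in> H1_mag A" for n by (rule E(1)[OF A \<psi>])
    show "nq 2 (mag_gradient A (\<lambda>x. X n x *\<^sub>R \<psi> x)) \<le> (1 + 1 / real (Suc n)) * nq 2 (mag_gradient A \<psi>)
          + (1 / real (Suc n) + (1 / real (Suc n))\<^sup>2) * (C\<^sup>2 * nq 2 \<psi>)" for n by (rule E(2)[OF A \<psi>])
    show "(\<lambda>n. nq 2 (\<lambda>x. X n x *\<^sub>R \<psi> x)) \<longlonglongrightarrow> nq 2 \<psi>"
    proof (rule nq_tendsto[OF _ D(1)])
      show "(\<lambda>x. X n x *\<^sub>R \<psi> x) \<in> borel_measurable lebesgue" for n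
        using Xm[of n] D(1) by (intro borel_measurable_scaleR) (auto simp: Lspace_iff)
      show "norm (X n x *\<^sub>R \<psi> x) \<le> norm (\<psi> x)" for n x using X2[of n x] by (simp add: mult_left_le_one_le)
      show "(\<lambda>n. norm (X n x *\<^sub>R \<psi> x)) \<longlonglongrightarrow> norm (\<psi> x)" for x
        using tendsto_norm[OF tendsto_scaleR[OF X4 tendsto_const[of "\<psi> x"]], of x] by simp
    qed simp
    show "norm x > real (Suc n) \<Longrightarrow> X n x *\<^sub>R \<psi> x = 0" for n x by (simp add: X3)
  qed (rule cutoff_bound_tendsto)
qed

text \<open>First \<open>sat\<close> with parameter 1 / (n + 1) caps the height at n + 1 without
  raising the energy, then the cut-off bounds the support. The sequence approximates the modulus of
  u and not u, which the quantities \<open>nq\<close> cannot distinguish.\<close>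

lemma bounded_compact_approximation:
  fixes u :: "real ^ 'n \<Rightarrow> complex"
  assumes u: "u \<in> H1"
  shows "\<exists>w B. (\<forall>n. w n \<in> H1) \<and> (\<forall>n x. norm x > real (Suc n) \<longrightarrow> w n x = 0) \<and>
    (\<forall>n x. norm (w n x) \<le> real (Suc n)) \<and> (\<forall>n x. norm (w n x) \<le> norm (u x)) \<and>
    (\<forall>n. nq 2 (gradient (w n)) \<le> B n) \<and> B \<longlonglongrightarrow> nq 2 (gradient u) \<and>
    (\<forall>q. 0 < q \<longrightarrow> u \<in> Lspace q \<longrightarrow> (\<lambda>n. nq q (w n)) \<longlonglongrightarrow> nq q u)"
proof -
  obtain X :: "nat \<Rightarrow> real ^ 'n \<Rightarrow> real" and C :: real where cut: "cutoff_seq X C"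
    using ex_cutoff_seq by blast
  note Xm = test_function_lebesgue_measurable[OF cutoff_seqD(2)[OF cut]] and X3 = cutoff_seqD(5)[OF cut] and X4 = cutoff_seqD(6)[OF cut]
  have X2: "\<bar>X n x\<bar> \<le> 1" for n x using cutoff_seqD(3,4)[OF cut, of n x] by simp
  note E = cutoff_energy[OF cut]
  note D = H1D[OF u]
  define e where "e n = 1 / real (Suc n)" for n
  have e: "0 < e n" "0 \<le> e n" for n by (simp_all add: e_def)
  have e0: "e \<longlonglongrightarrow> 0" unfolding e_def[abs_def] using LIMSEQ_inverse_real_of_nat by (simp add: inverse_eq_divide)
  define v where "v n x = complex_of_real (sat (e n) (u x))" for n x
  have v: "v n \<in> H1" "nq 2 (gradient (v n)) \<le> nq 2 (gradient u)" for n
    unfolding v_def[abs_def] using H1_sat[OF zero_measurable u e(2)] by auto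
  have vu: "norm (v n x) \<le> norm (u x)" for n x using sat_le[OF e(2)] sat_nonneg[OF e(2)] by (simp add: v_def)
  have vn: "nq 2 (v n) \<le> nq 2 u" for n
    using vu by (intro nq_mono[OF D(1)] Lint_mono_AE) auto
  define w where "w n x = X n x *\<^sub>R v n x" for n x
  have wv: "norm (w n x) \<le> norm (v n x)" for n x using X2[of n x] by (simp add: w_def mult_left_le_one_le)
  have wH: "w n \<in> H1" for n unfolding w_def[abs_def] by (rule E(1)[OF zero_measurable v(1)])
  show ?thesis
  proof (intro exI[of _ w] exI[of _ "\<lambda>n. (1 + 1 / real (Suc n)) * nq 2 (gradient u)
          + (1 / real (Suc n) + (1 / real (Suc n))\<^sup>2) * (C\<^sup>2 * nq 2 u)"] conjI allI impI)
    show "w n \<in> H1" for n by (rule wH)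
    show "norm x > real (Suc n) \<Longrightarrow> w n x = 0" for n x by (simp add: w_def X3)
    show "norm (w n x) \<le> norm (u x)" for n x using wv vu order_trans by blast
    show "norm (w n x) \<le> real (Suc n)" for n x
    proof -
      have "norm (v n x) \<le> 1 / e n" using sat_bounded[OF e(1), of n "u x"] sat_nonneg[OF e(2), of n "u x"] by (simp add: v_def)
      then show ?thesis using wv[of n x] by (simp add: e_def)
    qed
    show "nq 2 (gradient (w n)) \<le> (1 + 1 / real (Suc n)) * nq 2 (gradient u)
          + (1 / real (Suc n) + (1 / real (Suc n))\<^sup>2) * (C\<^sup>2 * nq 2 u)" for n
    proof -
      have "nq 2 (gradient (w n)) \<le> (1 + 1 / real (Suc n)) * nq 2 (gradient (v n))
          + (1 / real (Suc n) + (1 / real (Suc n))\<^sup>2) * (C\<^sup>2 * nq 2 (v n))"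
        unfolding w_def[abs_def] by (rule E(2)[OF zero_measurable v(1)])
      also have "\<dots> \<le> (1 + 1 / real (Suc n)) * nq 2 (gradient u)
          + (1 / real (Suc n) + (1 / real (Suc n))\<^sup>2) * (C\<^sup>2 * nq 2 u)"
        by (intro add_mono mult_left_mono v vn) auto
      finally show ?thesis .
    qed
    fix q :: real assume q: "0 < q" "u \<in> Lspace q"
    show "(\<lambda>n. nq q (w n)) \<longlonglongrightarrow> nq q u"
    proof (rule nq_tendsto[OF _ q(2,1)])
      show "w n \<in> borel_measurable lebesgue" for n using H1D(1)[OF wH] by (simp add: Lspace_iff)
      show "norm (w n x) \<le> norm (u x)" for n x using wv vu order_trans by blast
      fix x
      have "(\<lambda>n. sat (e n) (u x)) \<longlonglongrightarrow> norm (u x) / (1 + 0 * norm (u x))"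
        unfolding sat_def by (intro tendsto_intros e0) auto
      then have "(\<lambda>n. v n x) \<longlonglongrightarrow> complex_of_real (norm (u x))"
        unfolding v_def by (intro tendsto_of_real) simp
      from tendsto_norm[OF tendsto_scaleR[OF X4 this]]
      show "(\<lambda>n. norm (w n x)) \<longlonglongrightarrow> norm (u x)" by (simp add: w_def)
    qed
  qed (rule cutoff_bound_tendsto)
qed

section \<open>Concentration of bounded profiles at the origin\<close>

lemma Lspace_loc_mono:
  fixes A :: "real ^ 'n \<Rightarrow> 'b::euclidean_space"
  assumes A: "A \<in> Lspace_loc r" and r: "2 \<le> r" shows "A \<in> Lspace_loc 2"
proof -
  have [measurable]: "A \<in> borel_measurable lebesgue" using A by (simp add: Lspace_loc_def)
  have "(\<integral>\<^sup>+x\<in>K. ennreal (norm (A x) powr 2) \<partial>lebesgue) < \<infinity>" if K: "compact K" for K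
  proof -
    have [measurable]: "K \<in> sets lebesgue" using K by (auto dest: compact_imp_closed intro: sets_completionI_sets)
    have "(\<integral>\<^sup>+x\<in>K. ennreal (norm (A x) powr 2) \<partial>lebesgue) \<le> (\<integral>\<^sup>+x. indicator K x + ennreal (norm (A x) powr r) * indicator K x \<partial>lebesgue)"
    proof (rule nn_integral_mono)
      fix x
      have "ennreal (norm (A x) powr 2) \<le> 1 + ennreal (norm (A x) powr r)"
      proof (cases "norm (A x) \<le> 1")
        case True
        then have "norm (A x) powr 2 \<le> 1" by (intro powr_le1) auto
        then show ?thesis by (simp add: add_increasing2 ennreal_le_1 del: powr_numeral)
      next
        case False
        then have "norm (A x) powr 2 \<le> norm (A x) powr r" using r by (intro powr_mono) auto
        then show ?thesis by (simp add: add_increasing ennreal_leI del: powr_numeral)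
      qed
      then show "ennreal (norm (A x) powr 2) * indicator K x \<le> indicator K x + ennreal (norm (A x) powr r) * indicator K x"
        by (auto simp: indicator_def simp del: powr_numeral)
    qed
    also have "\<dots> = emeasure lebesgue K + (\<integral>\<^sup>+x\<in>K. ennreal (norm (A x) powr r) \<partial>lebesgue)"
      by (subst nn_integral_add) auto
    also have "\<dots> < \<infinity>"
      using A K emeasure_compact_finite[OF K] by (auto simp: Lspace_loc_def compact_imp_closed)
    finally show ?thesis .
  qed
  then show ?thesis by (auto simp: Lspace_loc_def simp del: powr_numeral)
qed

text \<open>For bounded v with bounded support, A v is square integrable because A is locally so;
  hence v lies in both Sobolev spaces and its magnetic gradient is the free one plus i A v. Young's
  inequality with free \<eta> keeps the constant of the free energy near 1.\<close>

lemma concentrate: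
  fixes u :: "real ^ 'n \<Rightarrow> complex" and A :: "real ^ 'n \<Rightarrow> real ^ 'n"
  assumes A: "A \<in> Lspace_loc 2" and u: "u \<in> H1" and M: "\<And>x. norm (u x) \<le> M" and R: "\<And>x. norm x > R \<Longrightarrow> u x = 0"
    and \<sigma>: "\<sigma> > 0"
  defines "I \<equiv> \<integral>\<^sup>+x. ennreal ((norm (A x))\<^sup>2 * (norm (u (\<sigma> *\<^sub>R x)))\<^sup>2) \<partial>lebesgue"
  shows "(\<lambda>x. u (\<sigma> *\<^sub>R x)) \<in> H1_mag A" "I < \<infinity>"
    "\<eta> > 0 \<Longrightarrow> nq 2 (mag_gradient A (\<lambda>x. u (\<sigma> *\<^sub>R x))) \<le> (1 + \<eta>) * (\<sigma> powr (2 - real CARD('n)) * nq 2 (gradient u)) + (1 + 1 / \<eta>) * enn2real I"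
proof -
  have Am [measurable]: "A \<in> borel_measurable lebesgue" using A by (simp add: Lspace_loc_def)
  define v where "v x = u (\<sigma> *\<^sub>R x)" for x
  have v: "v \<in> H1" and vg: "nq 2 (gradient v) = \<sigma> powr (2 - real CARD('n)) * nq 2 (gradient u)"
    unfolding v_def[abs_def] using H1_dilation[OF u \<sigma>] by auto
  note D = H1D[OF v]
  have [measurable]: "v \<in> borel_measurable lebesgue" using D(1) by (simp add: Lspace_iff)
  define f where "f x = norm (A x) * norm (v x)" for x
  have [measurable]: "f \<in> borel_measurable lebesgue" unfolding f_def[abs_def] by measurable
  have If: "I = Lint 2 f"
    unfolding I_def Lint_2 by (simp add: f_def v_def power_mult_distrib)
  have M0: "0 \<le> M" using M[of 0] norm_ge_zero order_trans by blast
  have "I \<le> (\<integral>\<^sup>+x. ennreal (M\<^sup>2) * (ennreal (norm (A x) powr 2) * indicator (cball 0 (R / \<sigma>)) x) \<partial>lebesgue)"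
    unfolding I_def
  proof (rule nn_integral_mono)
    fix x
    show "ennreal ((norm (A x))\<^sup>2 * (norm (u (\<sigma> *\<^sub>R x)))\<^sup>2) \<le> ennreal (M\<^sup>2) * (ennreal (norm (A x) powr 2) * indicator (cball 0 (R / \<sigma>)) x)"
    proof (cases "norm x \<le> R / \<sigma>")
      case True
      have "(norm (A x))\<^sup>2 * (norm (u (\<sigma> *\<^sub>R x)))\<^sup>2 \<le> (norm (A x))\<^sup>2 * M\<^sup>2"
        by (intro mult_left_mono power_mono M) auto
      then show ?thesis using True by (simp add: ennreal_mult[symmetric] mult.commute ennreal_leI)
    next
      case False
      then have "norm (\<sigma> *\<^sub>R x) > R" using \<sigma> by (simp add: field_simps)
      then show ?thesis by (simp add: R)
    qed
  qed
  also have "\<dots> = ennreal (M\<^sup>2) * (\<integral>\<^sup>+x\<in>cball 0 (R / \<sigma>). ennreal (norm (A x) powr 2) \<partial>lebesgue)"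
    by (rule nn_integral_cmult) measurable
  also have "\<dots> < \<infinity>" using A by (auto simp: Lspace_loc_def ennreal_mult_less_top simp del: powr_numeral)
  finally show Ifin: "I < \<infinity>" .
  define g where "g x = gradient v x + (\<chi> j. \<i> * complex_of_real (A x $ j) * v x)" for x
  have g: "is_mag_gradient A v g" using D(2) by (simp add: is_mag_gradient_def g_def)
  have nA: "norm (\<chi> j. \<i> * complex_of_real (A x $ j) * v x) = f x" for x
    by (simp add: norm_vec_def norm_mult L2_set_def power_mult_distrib sum_distrib_right[symmetric] real_sqrt_mult f_def)
  have le: "norm (g x) \<le> norm (gradient v x) + 1 * norm (f x)" for x
    unfolding g_def using norm_triangle_ineq[of "gradient v x" "\<chi> j. \<i> * complex_of_real (A x $ j) * v x"] nA[of x]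
    by (simp add: f_def)
  have L: "Lint 2 g \<le> ennreal ((1 + \<eta>) * nq 2 (gradient v) + (1 + 1 / \<eta>) * enn2real I)" if \<eta>: "\<eta> > 0" for \<eta>
  proof -
    have "Lint 2 g \<le> ennreal (1 + \<eta>) * Lint 2 (gradient v) + ennreal ((1 + 1 / \<eta>) * 1\<^sup>2) * Lint 2 f"
      by (rule Lint_2_add_le) (use D(3) \<eta> le in \<open>auto simp: Lspace_iff\<close>)
    also have "\<dots> = ennreal (1 + \<eta>) * ennreal (nq 2 (gradient v)) + ennreal (1 + 1 / \<eta>) * ennreal (enn2real I)"
      using Ifin by (simp add: Lint_2_eq[OF D(3)] If)
    also have "\<dots> = ennreal ((1 + \<eta>) * nq 2 (gradient v) + (1 + 1 / \<eta>) * enn2real I)"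
      using \<eta> by (simp add: ennreal_plus[symmetric] ennreal_mult[symmetric] del: ennreal_plus)
    finally show ?thesis .
  qed
  have fin: "Lint 2 g < \<infinity>" using L[of 1] by (auto intro: order.strict_trans1)
  show "(\<lambda>x. u (\<sigma> *\<^sub>R x)) \<in> H1_mag A"
    using H1_magI(1)[OF Am D(1) g fin] by (simp add: v_def[abs_def])
  assume \<eta>: "\<eta> > 0"
  have "nq 2 (mag_gradient A v) = enn2real (Lint 2 g)" using H1_magI(2)[OF Am D(1) g fin, of 2] by (simp add: nq_2)
  also have "\<dots> \<le> (1 + \<eta>) * nq 2 (gradient v) + (1 + 1 / \<eta>) * enn2real I"
    using L[OF \<eta>] \<eta> by (intro enn2real_leI) auto
  finally show "nq 2 (mag_gradient A (\<lambda>x. u (\<sigma> *\<^sub>R x))) \<le> (1 + \<eta>) * (\<sigma> powr (2 - real CARD('n)) * nq 2 (gradient u)) + (1 + 1 / \<eta>) * enn2real I"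
    unfolding vg by (simp only: v_def[abs_def])
qed

text \<open>The free energy of the dilated profile scales as \<sigma>^(2-d), and the limit
  assumption says that the additional energy is of smaller order than this power.\<close>

lemma concentration_limit:
  fixes u :: "real ^ 'n \<Rightarrow> complex" and A :: "real ^ 'n \<Rightarrow> real ^ 'n"
  assumes A: "A \<in> Lspace_loc 2" and u: "u \<in> H1" and M: "\<And>x. norm (u x) \<le> M" and R: "\<And>x. norm x > R \<Longrightarrow> u x = 0"
    and lim: "((\<lambda>\<sigma>. ennreal (\<sigma> powr (real CARD('n) - 2)) * (\<integral>\<^sup>+x. ennreal ((norm (A x))\<^sup>2 * (norm (u (\<sigma> *\<^sub>R x)))\<^sup>2) \<partial>lebesgue)) \<longlongrightarrow> 0) at_top"
    and \<epsilon>: "\<epsilon> > 0"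
  shows "eventually (\<lambda>\<sigma>. \<sigma> > 0 \<and> (\<lambda>x. u (\<sigma> *\<^sub>R x)) \<in> H1_mag A \<and>
    nq 2 (mag_gradient A (\<lambda>x. u (\<sigma> *\<^sub>R x))) \<le> \<sigma> powr (2 - real CARD('n)) * (nq 2 (gradient u) + \<epsilon>)) at_top"
proof -
  define G where "G = nq 2 (gradient u)"
  \<comment> \<open>The allowance \<epsilon> is halved: \<eta> G stays below one half (the added 1
    covers G = 0), and \<kappa>, the bound on the rescaled additional energy, is chosen so that (1 +
    1/\<eta>) \<kappa> is the other half.\<close>
  define \<eta> where "\<eta> = \<epsilon> / (2 * (G + 1))"
  have G: "0 \<le> G" by (simp add: G_def)
  have \<eta>: "\<eta> > 0" using \<epsilon> G by (simp add: \<eta>_def add_nonneg_pos)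
  have \<eta>G: "\<eta> * G \<le> \<epsilon> / 2"
  proof -
    have "\<eta> * G = (\<epsilon> / 2) * (G / (G + 1))" using G by (simp add: \<eta>_def)
    also have "\<dots> \<le> (\<epsilon> / 2) * 1" using \<epsilon> G by (intro mult_left_mono) (auto simp: divide_le_eq_1)
    finally show ?thesis by simp
  qed
  define a where "a = 1 + 1 / \<eta>"
  have a: "a > 0" using \<eta> by (simp add: a_def add_pos_pos)
  define \<kappa> where "\<kappa> = \<epsilon> / (2 * a)"
  have \<kappa>: "\<kappa> > 0" using \<epsilon> a by (simp add: \<kappa>_def)
  have \<kappa>': "(1 + 1 / \<eta>) * \<kappa> = \<epsilon> / 2"
    unfolding a_def[symmetric] using a by (simp add: \<kappa>_def)
  have "eventually (\<lambda>\<sigma>. ennreal (\<sigma> powr (real CARD('n) - 2)) * (\<integral>\<^sup>+x. ennreal ((norm (A x))\<^sup>2 * (norm (u (\<sigma> *\<^sub>R x)))\<^sup>2) \<partial>lebesgue) < ennreal \<kappa>) at_top"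
    using \<kappa> by (intro order_tendstoD(2)[OF lim]) auto
  with eventually_gt_at_top[of 0] show ?thesis
  proof eventually_elim
    case (elim \<sigma>)
    note \<sigma> = elim(1)
    let ?I = "\<integral>\<^sup>+x. ennreal ((norm (A x))\<^sup>2 * (norm (u (\<sigma> *\<^sub>R x)))\<^sup>2) \<partial>lebesgue"
    have "ennreal (\<sigma> powr (real CARD('n) - 2)) * ?I \<le> ennreal \<kappa>" using elim(2) by simp
    then have "?I \<le> ennreal (\<kappa> / \<sigma> powr (real CARD('n) - 2))"
      using \<sigma> \<kappa> by (intro ennreal_mult_le_imp_le_divide) auto
    then have I: "enn2real ?I \<le> \<sigma> powr (2 - real CARD('n)) * \<kappa>"
      using \<kappa> \<sigma> by (intro enn2real_leI) (auto simp: powr_diff field_simps)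
    have "nq 2 (mag_gradient A (\<lambda>x. u (\<sigma> *\<^sub>R x))) \<le> (1 + \<eta>) * (\<sigma> powr (2 - real CARD('n)) * G) + (1 + 1 / \<eta>) * enn2real ?I"
      unfolding G_def by (rule concentrate(3)[OF A u M _ \<sigma> \<eta>]) (rule R)
    also have "\<dots> \<le> (1 + \<eta>) * (\<sigma> powr (2 - real CARD('n)) * G) + (1 + 1 / \<eta>) * (\<sigma> powr (2 - real CARD('n)) * \<kappa>)"
      using I \<eta> by (intro add_left_mono mult_left_mono) auto
    also have "\<dots> = \<sigma> powr (2 - real CARD('n)) * (G + \<eta> * G + (1 + 1 / \<eta>) * \<kappa>)" by (simp add: algebra_simps)
    also have "\<dots> \<le> \<sigma> powr (2 - real CARD('n)) * (G + \<epsilon>)"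
      unfolding \<kappa>' using \<eta>G by (intro mult_left_mono) auto
    finally have e: "nq 2 (mag_gradient A (\<lambda>x. u (\<sigma> *\<^sub>R x))) \<le> \<sigma> powr (2 - real CARD('n)) * (G + \<epsilon>)" .
    have "(\<lambda>x. u (\<sigma> *\<^sub>R x)) \<in> H1_mag A" by (rule concentrate(1)[OF A u M _ \<sigma>]) (rule R)
    then show ?case using \<sigma> e by (simp add: G_def)
  qed
qed

subsection \<open>Optimal constants and scaling\<close>

text \<open>Membership in both Lebesgue spaces keeps \<open>nq a\<close> and \<open>nq b\<close>
  from taking the default value 0 on functions of infinite norm.\<close>

definition adm :: "(real ^ 'n \<Rightarrow> real ^ 'n) \<Rightarrow> real \<Rightarrow> real \<Rightarrow> (real ^ 'n \<Rightarrow> complex) set" where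
  "adm A a b = {\<psi> \<in> H1_mag A. \<not> ae_zero \<psi> \<and> \<psi> \<in> Lspace a \<and> \<psi> \<in> Lspace b}"

abbreviation energy :: "(real ^ 'n \<Rightarrow> real ^ 'n) \<Rightarrow> (real ^ 'n \<Rightarrow> complex) \<Rightarrow> real" where
  "energy A \<psi> \<equiv> nq 2 (mag_gradient A \<psi>)"

text \<open>\<open>mopt A 2 p\<close> is \<open>\<mu>\<close> and \<open>mopt A p 2\<close> is \<open>\<nu>\<close>; the scaling argument is the same for both.\<close>

definition mopt :: "(real ^ 'n \<Rightarrow> real ^ 'n) \<Rightarrow> real \<Rightarrow> real \<Rightarrow> real \<Rightarrow> real" where
  "mopt A a b = affine_inf (adm A a b) (energy A) (nq a) (nq b)"

lemma filterlim_powr_at_top: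
  assumes "(0::real) < p" shows "filterlim (\<lambda>x. x powr p) at_top at_top"
proof -
  have "filterlim (\<lambda>x::real. exp (p * ln x)) at_top at_top"
    by (intro filterlim_compose[OF exp_at_top] filterlim_tendsto_pos_mult_at_top[OF tendsto_const assms] ln_at_top)
  then show ?thesis
  proof (rule filterlim_mono_eventually[OF _ order_refl order_refl])
    show "\<forall>\<^sub>F x::real in at_top. exp (p * ln x) = x powr p"
      using eventually_gt_at_top[of 0] by eventually_elim (simp add: powr_def)
  qed
qed

lemma adm_pos: "0 < b \<Longrightarrow> \<psi> \<in> adm A a b \<Longrightarrow> 0 < nq b \<psi>"
  using nq_pos by (auto simp: adm_def)

text \<open>The passage to the modulus by which every bound with field is compared with the
  field-free problem: all integrability data are kept and the energy does not increase.\<close>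

lemma norm_in_H1:
  fixes \<psi> :: "real ^ 'n \<Rightarrow> complex"
  assumes A: "A \<in> borel_measurable lebesgue" and \<psi>: "\<psi> \<in> H1_mag A"
  defines "u \<equiv> \<lambda>x. complex_of_real (norm (\<psi> x))"
  shows "u \<in> H1" "nq 2 (gradient u) \<le> energy A \<psi>" "nq q u = nq q \<psi>"
    "u \<in> Lspace q \<longleftrightarrow> \<psi> \<in> Lspace q" "ae_zero u \<longleftrightarrow> ae_zero \<psi>" "Lint q u = Lint q \<psi>"
proof -
  show "u \<in> H1" "nq 2 (gradient u) \<le> energy A \<psi>"
    using H1_sat[OF A \<psi> order_refl] by (simp_all add: sat_0 u_def)
  then have um: "u \<in> borel_measurable lebesgue" using H1D(1) by (auto simp: Lspace_iff)
  have \<psi>m: "\<psi> \<in> borel_measurable lebesgue" using H1_magD(1)[OF A \<psi>] by (simp add: Lspace_iff)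
  show L: "Lint q u = Lint q \<psi>" for q by (rule Lint_cong_AE) (simp add: u_def)
  show "nq q u = nq q \<psi>" by (simp add: nq_def L)
  show "u \<in> Lspace q \<longleftrightarrow> \<psi> \<in> Lspace q" using um \<psi>m by (simp add: Lspace_iff L)
  show "ae_zero u \<longleftrightarrow> ae_zero \<psi>" by (simp add: ae_zero_def u_def)
qed

lemma norm_in_adm:
  assumes "A \<in> borel_measurable lebesgue" "\<psi> \<in> adm A a b"
  shows "(\<lambda>x. complex_of_real (norm (\<psi> x))) \<in> adm (\<lambda>_. 0) a b"
  using assms norm_in_H1(1,4,5)[OF assms(1), of \<psi>] by (auto simp: adm_def)

text \<open>The inequality at parameter 1 is applied to u (x / \<sigma>) and multiplied by
  \<sigma>^(2-d), which restores the gradient term; the squared L^q norm then carries \<sigma>^(2 -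
  d + 2d/q).\<close>

lemma free_mopt_scaling:
  fixes u :: "real ^ 'n \<Rightarrow> complex"
  assumes ab: "0 < a" "0 < b" and u: "u \<in> adm (\<lambda>_. 0) a b" and \<sigma>: "\<sigma> > 0"
  defines "d \<equiv> real CARD('n)"
  shows "mopt (\<lambda>_ :: real ^ 'n. 0) a b 1 * (\<sigma> powr (2 - d + 2 * d / b)) * nq b u
    \<le> nq 2 (gradient u) + \<sigma> powr (2 - d + 2 * d / a) * nq a u"
proof -
  define \<tau> where "\<tau> = 1 / \<sigma>"
  have \<tau>: "\<tau> > 0" using \<sigma> by (simp add: \<tau>_def)
  let ?v = "\<lambda>x. u (\<tau> *\<^sub>R x)"
  have uH: "u \<in> H1" and ua: "u \<in> Lspace a" and ub: "u \<in> Lspace b" and uz: "\<not> ae_zero u" using u by (auto simp: adm_def)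
  have v: "?v \<in> adm (\<lambda>_. 0) a b"
  proof -
    have um: "u \<in> borel_measurable lebesgue" and vm: "?v \<in> borel_measurable lebesgue"
      using ua Lspace_dilation[OF ua \<tau>] by (simp_all add: Lspace_iff)
    have "0 < nq a ?v" using nq_pos[OF ua ab(1) uz] nq_dilation[OF ua ab(1) \<tau>] \<tau> by simp
    then have "\<not> ae_zero ?v" using nq_zero[OF vm, of a] by auto
    then show ?thesis
      using H1_dilation(1)[OF uH \<tau>] Lspace_dilation[OF ua \<tau>] Lspace_dilation[OF ub \<tau>] by (simp add: adm_def)
  qed
  have "mopt (\<lambda>_ :: real ^ 'n. 0) a b 1 * nq b ?v \<le> nq 2 (gradient ?v) + 1 * nq a ?v"
    unfolding mopt_def by (rule affine_inf_mult_le[OF v, of _ 0]) (use ab adm_pos in auto)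
  then have "mopt (\<lambda>_ :: real ^ 'n. 0) a b 1 * (\<tau> powr (- 2 * d / b) * nq b u) \<le> \<tau> powr (2 - d) * nq 2 (gradient u) + \<tau> powr (- 2 * d / a) * nq a u"
    unfolding nq_dilation[OF ub ab(2) \<tau>] nq_dilation[OF ua ab(1) \<tau>] H1_dilation(2)[OF uH \<tau>] d_def by simp
  then have "\<sigma> powr (2 - d) * (mopt (\<lambda>_ :: real ^ 'n. 0) a b 1 * (\<tau> powr (- 2 * d / b) * nq b u))
     \<le> \<sigma> powr (2 - d) * (\<tau> powr (2 - d) * nq 2 (gradient u) + \<tau> powr (- 2 * d / a) * nq a u)"
    by (rule mult_left_mono) simp
  note le = this
  have \<tau>p: "\<tau> powr r = \<sigma> powr (- r)" for r
    using \<sigma> by (simp add: \<tau>_def powr_divide powr_minus_divide)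
  have e: "\<sigma> powr (2 - d) * \<tau> powr (- 2 * d / b) = \<sigma> powr (2 - d + 2 * d / b)"
    "\<sigma> powr (2 - d) * \<tau> powr (- 2 * d / a) = \<sigma> powr (2 - d + 2 * d / a)"
    "\<sigma> powr (2 - d) * \<tau> powr (2 - d) = 1"
    using \<sigma> by (simp_all add: \<tau>p powr_add[symmetric])
  have l: "\<sigma> powr (2 - d) * (mopt (\<lambda>_ :: real ^ 'n. 0) a b 1 * (\<tau> powr (- 2 * d / b) * nq b u))
    = mopt (\<lambda>_ :: real ^ 'n. 0) a b 1 * (\<sigma> powr (2 - d + 2 * d / b)) * nq b u"
    unfolding e(1)[symmetric] by (simp only: mult_ac)
  have r: "\<sigma> powr (2 - d) * (\<tau> powr (2 - d) * nq 2 (gradient u) + \<tau> powr (- 2 * d / a) * nq a u)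
    = nq 2 (gradient u) + \<sigma> powr (2 - d + 2 * d / a) * nq a u"
    unfolding distrib_left mult.assoc[symmetric] e by simp
  show ?thesis using le unfolding l r .
qed

text \<open>A competitor below the infimum plus \<epsilon> satisfies a strict inequality between
  quantities that pass to the limit along the truncations, so it holds for a late truncation, whose
  norm is also still positive.\<close>

lemma free_near_minimizer:
  fixes \<epsilon> :: real
  assumes ab: "0 < a" "0 < b" and T: "adm (\<lambda>_ :: real ^ 'n. 0) a b \<noteq> {}" and \<epsilon>: "\<epsilon> > 0"
  shows "\<exists>(w :: real ^ 'n \<Rightarrow> complex) M R. w \<in> adm (\<lambda>_. 0) a b \<and> (\<forall>x. norm (w x) \<le> M) \<and> (\<forall>x. norm x > R \<longrightarrow> w x = 0) \<and>
     nq 2 (gradient w) + nq a w < (mopt (\<lambda>_ :: real ^ 'n. 0) a b 1 + \<epsilon>) * nq b w"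
proof -
  let ?T = "adm (\<lambda>_ :: real ^ 'n. 0) a b" and ?C = "mopt (\<lambda>_ :: real ^ 'n. 0) a b 1"
  obtain u where u: "u \<in> ?T" and lt: "(nq 2 (gradient u) + 1 * nq a u) / nq b u < ?C + \<epsilon>"
  proof -
    have "\<exists>u\<in>?T. (nq 2 (gradient u) + 1 * nq a u) / nq b u < ?C + \<epsilon>"
    proof (rule ccontr)
      assume "\<not> ?thesis"
      then have "?C + \<epsilon> \<le> affine_inf ?T (energy (\<lambda>_. 0)) (nq a) (nq b) 1"
        unfolding affine_inf_def by (intro cINF_greatest[OF T]) (auto simp: not_less)
      then show False using \<epsilon> by (simp add: mopt_def)
    qed
    then show ?thesis using that by blast
  qed
  have uH: "u \<in> H1" and ua: "u \<in> Lspace a" and ub: "u \<in> Lspace b" and uz: "\<not> ae_zero u" using u by (auto simp: adm_def)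
  have ubp: "0 < nq b u" by (rule adm_pos[OF ab(2) u])
  obtain w B where w: "\<forall>n. w n \<in> H1" "\<forall>n x. norm x > real (Suc n) \<longrightarrow> w n x = 0"
    "\<forall>n x. norm (w n x) \<le> real (Suc n)" "\<forall>n x. norm (w n x) \<le> norm (u x)"
    "\<forall>n. nq 2 (gradient (w n)) \<le> B n" "B \<longlonglongrightarrow> nq 2 (gradient u)"
    "\<forall>q. 0 < q \<longrightarrow> u \<in> Lspace q \<longrightarrow> (\<lambda>n. nq q (w n)) \<longlonglongrightarrow> nq q u"
    using bounded_compact_approximation[OF uH] by blast
  note w = w(1-5)[rule_format] w(6) w(7)[rule_format]
  have "(\<lambda>n. (?C + \<epsilon>) * nq b (w n) - (B n + nq a (w n))) \<longlonglongrightarrow> (?C + \<epsilon>) * nq b u - (nq 2 (gradient u) + nq a u)"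
    by (intro tendsto_intros w ab ua ub)
  moreover have "0 < (?C + \<epsilon>) * nq b u - (nq 2 (gradient u) + nq a u)" using lt ubp by (simp add: pos_divide_less_eq)
  ultimately have "eventually (\<lambda>n. 0 < (?C + \<epsilon>) * nq b (w n) - (B n + nq a (w n))) sequentially"
    by (rule order_tendstoD(1))
  moreover have "eventually (\<lambda>n. 0 < nq b (w n)) sequentially"
    by (rule order_tendstoD(1)[OF w(7)[OF ab(2) ub] ubp])
  ultimately have "eventually (\<lambda>n. 0 < (?C + \<epsilon>) * nq b (w n) - (B n + nq a (w n)) \<and> 0 < nq b (w n)) sequentially"
    by eventually_elim simp
  then obtain n where n: "0 < (?C + \<epsilon>) * nq b (w n) - (B n + nq a (w n))" "0 < nq b (w n)"
    by (auto simp: eventually_sequentially)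
  have wm: "w n \<in> borel_measurable lebesgue" using H1D(1)[OF w(1)] by (simp add: Lspace_iff)
  have "w n \<in> ?T"
    unfolding adm_def
  proof (intro CollectI conjI w(1))
    show "\<not> ae_zero (w n)" using nq_zero[OF wm, of b] n(2) by auto
    show "w n \<in> Lspace a" by (rule Lspace_dominated[OF wm ua _ w(4)]) (use ab in simp)
    show "w n \<in> Lspace b" by (rule Lspace_dominated[OF wm ub _ w(4)]) (use ab in simp)
  qed
  moreover have "nq 2 (gradient (w n)) + nq a (w n) < (?C + \<epsilon>) * nq b (w n)" using n(1) w(5)[of n] by linarith
  ultimately show ?thesis using w(2,3) by (intro exI[of _ "w n"] exI[of _ "real (Suc n)"]) auto
qed

text \<open>The common consequence of the exponential weight and of the shrinking balls: for each
  bounded profile of bounded support, the additional energy of its dilation is of smaller order than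
  \<sigma>^(2-d).\<close>

definition concentrates :: "(real ^ 'n \<Rightarrow> real ^ 'n) \<Rightarrow> bool" where
  "concentrates A \<longleftrightarrow> (\<forall>(u :: real ^ 'n \<Rightarrow> complex) M R. (\<forall>x. norm (u x) \<le> M) \<longrightarrow> (\<forall>x. norm x > R \<longrightarrow> u x = 0) \<longrightarrow>
     ((\<lambda>\<sigma>. ennreal (\<sigma> powr (real CARD('n) - 2)) * (\<integral>\<^sup>+x. ennreal ((norm (A x))\<^sup>2 * (norm (u (\<sigma> *\<^sub>R x)))\<^sup>2) \<partial>lebesgue)) \<longlongrightarrow> 0) at_top)"

text \<open>The diamagnetic inequality replaces \<psi> by its modulus, to which the field-free
  scaling applies. Using \<sigma> as parameter makes both sides exact powers.\<close>

lemma mopt_lower: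
  fixes A :: "real ^ 'n \<Rightarrow> real ^ 'n"
  assumes A: "A \<in> borel_measurable lebesgue" and T: "adm A a b \<noteq> {}" and ab: "0 < a" "0 < b" and \<sigma>: "\<sigma> > 0"
  defines "d \<equiv> real CARD('n)"
  shows "mopt (\<lambda>_ :: real ^ 'n. 0) a b 1 * \<sigma> powr (2 - d + 2 * d / b) \<le> mopt A a b (\<sigma> powr (2 - d + 2 * d / a))"
  unfolding mopt_def[of A]
proof (rule affine_inf_greatest[OF T])
  show "0 < nq b \<psi>" if "\<psi> \<in> adm A a b" for \<psi> by (rule adm_pos[OF ab(2) that])
  fix \<psi> assume \<psi>: "\<psi> \<in> adm A a b"
  then have \<psi>H: "\<psi> \<in> H1_mag A" by (simp add: adm_def)
  note n = norm_in_H1[OF A \<psi>H]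
  have "mopt (\<lambda>_ :: real ^ 'n. 0) a b 1 * \<sigma> powr (2 - d + 2 * d / b) * nq b \<psi>
     \<le> nq 2 (gradient (\<lambda>x. complex_of_real (norm (\<psi> x)))) + \<sigma> powr (2 - d + 2 * d / a) * nq a \<psi>"
    using free_mopt_scaling[OF ab norm_in_adm[OF A \<psi>] \<sigma>] by (simp add: n(3) d_def)
  also have "\<dots> \<le> energy A \<psi> + \<sigma> powr (2 - d + 2 * d / a) * nq a \<psi>" using n(2) by simp
  finally show "mopt (\<lambda>_ :: real ^ 'n. 0) a b 1 * \<sigma> powr (2 - d + 2 * d / b) * nq b \<psi>
     \<le> energy A \<psi> + \<sigma> powr (2 - d + 2 * d / a) * nq a \<psi>" .
qed

text \<open>The competitor is the dilation of a field-free near-minimiser. All its terms scale as in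
  the field-free problem, except for the additional energy, which the concentration property
  absorbs.\<close>

lemma mopt_upper:
  fixes A :: "real ^ 'n \<Rightarrow> real ^ 'n"
  assumes A: "A \<in> Lspace_loc 2" and T: "adm (\<lambda>_ :: real ^ 'n. 0) a b \<noteq> {}" and ab: "0 < a" "0 < b"
    and conc: "concentrates A" and \<epsilon>: "\<epsilon> > 0"
  defines "d \<equiv> real CARD('n)"
  shows "eventually (\<lambda>\<sigma>. mopt A a b (\<sigma> powr (2 - d + 2 * d / a))
    \<le> (mopt (\<lambda>_ :: real ^ 'n. 0) a b 1 + \<epsilon>) * \<sigma> powr (2 - d + 2 * d / b)) at_top"
proof -
  let ?C = "mopt (\<lambda>_ :: real ^ 'n. 0) a b 1"
  obtain w :: "real ^ 'n \<Rightarrow> complex" and M R where w: "w \<in> adm (\<lambda>_. 0) a b" and M: "\<And>x. norm (w x) \<le> M" and R: "\<And>x. norm x > R \<Longrightarrow> w x = 0"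
    and lt: "nq 2 (gradient w) + nq a w < (?C + \<epsilon>) * nq b w"
    using free_near_minimizer[OF ab T \<epsilon>] by blast
  have wH: "w \<in> H1" and wa: "w \<in> Lspace a" and wb: "w \<in> Lspace b" and wz: "\<not> ae_zero w" using w by (auto simp: adm_def)
  \<comment> \<open>The margin by which the near-minimiser beats the constant plus \<epsilon>; it is
    spent entirely on the magnetic contribution to the energy.\<close>
  define \<delta> where "\<delta> = (?C + \<epsilon>) * nq b w - (nq 2 (gradient w) + nq a w)"
  have \<delta>: "\<delta> > 0" using lt by (simp add: \<delta>_def)
  have lim: "((\<lambda>\<sigma>. ennreal (\<sigma> powr (real CARD('n) - 2)) * (\<integral>\<^sup>+x. ennreal ((norm (A x))\<^sup>2 * (norm (w (\<sigma> *\<^sub>R x)))\<^sup>2) \<partial>lebesgue)) \<longlongrightarrow> 0) at_top"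
    using conc M R unfolding concentrates_def by blast
  have "eventually (\<lambda>\<sigma>. \<sigma> > 0 \<and> (\<lambda>x. w (\<sigma> *\<^sub>R x)) \<in> H1_mag A \<and>
    energy A (\<lambda>x. w (\<sigma> *\<^sub>R x)) \<le> \<sigma> powr (2 - real CARD('n)) * (nq 2 (gradient w) + \<delta>)) at_top"
    by (rule concentration_limit[OF A wH M _ lim \<delta>]) (rule R)
  then show ?thesis
  proof eventually_elim
    case (elim \<sigma>)
    then have \<sigma>: "\<sigma> > 0" by simp
    let ?v = "\<lambda>x. w (\<sigma> *\<^sub>R x)"
    have vm: "?v \<in> borel_measurable lebesgue" using Lspace_dilation[OF wa \<sigma>] by (simp add: Lspace_iff)
    have "0 < nq a ?v" using nq_pos[OF wa ab(1) wz] nq_dilation[OF wa ab(1) \<sigma>] \<sigma> by simp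
    then have "\<not> ae_zero ?v" using nq_zero[OF vm, of a] by auto
    then have v: "?v \<in> adm A a b"
      using elim Lspace_dilation[OF wa \<sigma>] Lspace_dilation[OF wb \<sigma>] by (simp add: adm_def)
    let ?m = "mopt A a b (\<sigma> powr (2 - d + 2 * d / a))"
    have "?m * nq b ?v \<le> energy A ?v + \<sigma> powr (2 - d + 2 * d / a) * nq a ?v"
      unfolding mopt_def by (rule affine_inf_mult_le[OF v, of _ 0]) (use ab adm_pos in auto)
    also have "\<dots> \<le> \<sigma> powr (2 - d) * (nq 2 (gradient w) + \<delta>) + \<sigma> powr (2 - d + 2 * d / a) * (\<sigma> powr (- 2 * d / a) * nq a w)"
      using elim unfolding nq_dilation[OF wa ab(1) \<sigma>] d_def by simp
    also have "\<sigma> powr (2 - d + 2 * d / a) * (\<sigma> powr (- 2 * d / a) * nq a w) = \<sigma> powr (2 - d) * nq a w"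
      by (simp add: mult.assoc[symmetric] powr_add[symmetric])
    also have "\<sigma> powr (2 - d) * (nq 2 (gradient w) + \<delta>) + \<sigma> powr (2 - d) * nq a w = \<sigma> powr (2 - d) * ((?C + \<epsilon>) * nq b w)"
      by (simp add: \<delta>_def algebra_simps)
    finally have "?m * (\<sigma> powr (- 2 * d / b) * nq b w) \<le> \<sigma> powr (2 - d) * ((?C + \<epsilon>) * nq b w)"
      unfolding nq_dilation[OF wb ab(2) \<sigma>] d_def by simp
    then have "(?m * \<sigma> powr (- 2 * d / b)) * nq b w \<le> (\<sigma> powr (2 - d) * (?C + \<epsilon>)) * nq b w" by (simp add: mult.assoc)
    then have "?m * \<sigma> powr (- 2 * d / b) \<le> \<sigma> powr (2 - d) * (?C + \<epsilon>)"
      by (rule mult_right_le_imp_le) (rule adm_pos[OF ab(2) w])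
    then have "(?m * \<sigma> powr (- 2 * d / b)) * \<sigma> powr (2 * d / b) \<le> (\<sigma> powr (2 - d) * (?C + \<epsilon>)) * \<sigma> powr (2 * d / b)"
      by (rule mult_right_mono) simp
    note fin = this
    have f1: "(?m * \<sigma> powr (- 2 * d / b)) * \<sigma> powr (2 * d / b) = ?m"
      using \<sigma> by (simp add: mult.assoc powr_add[symmetric])
    have f2: "(\<sigma> powr (2 - d) * (?C + \<epsilon>)) * \<sigma> powr (2 * d / b) = (?C + \<epsilon>) * \<sigma> powr (2 - d + 2 * d / b)"
      by (simp add: powr_add mult_ac)
    show ?case using fin unfolding f1 f2 .
  qed
qed

text \<open>A positive exponent \<kappa> makes \<sigma> = \<alpha>^(1/\<kappa>) a change of
  parameter that tends to infinity with \<alpha>. The lower bound is then exact and the upper bound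
  holds up to \<epsilon>.\<close>

lemma mopt_asymptotics:
  fixes A :: "real ^ 'n \<Rightarrow> real ^ 'n"
  assumes A: "A \<in> Lspace_loc 2" and T: "adm A a b \<noteq> {}" and ab: "0 < a" "0 < b" and conc: "concentrates A"
  defines "d \<equiv> real CARD('n)"
  assumes \<kappa>: "0 < 2 - d + 2 * d / a"
  shows "((\<lambda>\<alpha>. mopt A a b \<alpha> * \<alpha> powr (- ((2 - d + 2 * d / b) / (2 - d + 2 * d / a)))) \<longlongrightarrow> mopt (\<lambda>_ :: real ^ 'n. 0) a b 1) at_top"
proof -
  define \<kappa> where "\<kappa> = 2 - d + 2 * d / a"
  define l where "l = 2 - d + 2 * d / b"
  let ?C = "mopt (\<lambda>_ :: real ^ 'n. 0) a b 1"
  have Am: "A \<in> borel_measurable lebesgue" using A by (simp add: Lspace_loc_def)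
  have T0: "adm (\<lambda>_ :: real ^ 'n. 0) a b \<noteq> {}" using T norm_in_adm[OF Am] by blast
  have \<kappa>0: "\<kappa> > 0" using \<kappa> by (simp add: \<kappa>_def)
  have sub: "filterlim (\<lambda>\<alpha>::real. \<alpha> powr (1 / \<kappa>)) at_top at_top"
    using \<kappa>0 by (intro filterlim_powr_at_top[of "1 / \<kappa>"]) auto
  show ?thesis
    unfolding \<kappa>_def[symmetric] l_def[symmetric]
  proof (rule tendsto_sandwich[OF _ _ tendsto_const])
    show "\<forall>\<^sub>F \<alpha> in at_top. ?C \<le> mopt A a b \<alpha> * \<alpha> powr (- (l / \<kappa>))"
      using eventually_gt_at_top[of 0]
    proof eventually_elim
      case (elim \<alpha>)
      have "?C * (\<alpha> powr (1 / \<kappa>)) powr l \<le> mopt A a b ((\<alpha> powr (1 / \<kappa>)) powr \<kappa>)"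
        unfolding \<kappa>_def l_def d_def using elim by (intro mopt_lower[OF Am T ab]) simp
      then have "?C * \<alpha> powr (l / \<kappa>) \<le> mopt A a b \<alpha>" using \<kappa>0 elim by (simp add: powr_powr)
      then have "(?C * \<alpha> powr (l / \<kappa>)) * \<alpha> powr (- (l / \<kappa>)) \<le> mopt A a b \<alpha> * \<alpha> powr (- (l / \<kappa>))"
        by (rule mult_right_mono) simp
      then show ?case using elim by (simp add: mult.assoc powr_add[symmetric])
    qed
  next
    show "((\<lambda>\<alpha>. mopt A a b \<alpha> * \<alpha> powr (- (l / \<kappa>))) \<longlongrightarrow> ?C) at_top"
    proof (rule order_tendstoI)
      fix c assume c: "c < ?C"
      show "\<forall>\<^sub>F \<alpha> in at_top. c < mopt A a b \<alpha> * \<alpha> powr (- (l / \<kappa>))"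
        using eventually_gt_at_top[of 0]
      proof eventually_elim
        case (elim \<alpha>)
        have "?C * (\<alpha> powr (1 / \<kappa>)) powr l \<le> mopt A a b ((\<alpha> powr (1 / \<kappa>)) powr \<kappa>)"
          unfolding \<kappa>_def l_def d_def using elim by (intro mopt_lower[OF Am T ab]) simp
        then have "?C * \<alpha> powr (l / \<kappa>) \<le> mopt A a b \<alpha>" using \<kappa>0 elim by (simp add: powr_powr)
        then have "(?C * \<alpha> powr (l / \<kappa>)) * \<alpha> powr (- (l / \<kappa>)) \<le> mopt A a b \<alpha> * \<alpha> powr (- (l / \<kappa>))"
          by (rule mult_right_mono) simp
        then show ?case using elim c by (simp add: mult.assoc powr_add[symmetric])
      qed
    next
      fix c assume c: "?C < c"
      define \<epsilon> where "\<epsilon> = (c - ?C) / 2"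
      have \<epsilon>: "\<epsilon> > 0" "?C + \<epsilon> < c" using c by (simp_all add: \<epsilon>_def field_simps)
      have "\<forall>\<^sub>F \<alpha> in at_top. mopt A a b ((\<alpha> powr (1 / \<kappa>)) powr \<kappa>) \<le> (?C + \<epsilon>) * (\<alpha> powr (1 / \<kappa>)) powr l"
        using eventually_compose_filterlim[OF mopt_upper[OF A T0 ab conc \<epsilon>(1)] sub] by (simp add: \<kappa>_def l_def d_def)
      then show "\<forall>\<^sub>F \<alpha> in at_top. mopt A a b \<alpha> * \<alpha> powr (- (l / \<kappa>)) < c"
        using eventually_gt_at_top[of 0]
      proof eventually_elim
        case (elim \<alpha>)
        then have "mopt A a b \<alpha> \<le> (?C + \<epsilon>) * \<alpha> powr (l / \<kappa>)" using \<kappa>0 by (simp add: powr_powr)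
        then have "mopt A a b \<alpha> * \<alpha> powr (- (l / \<kappa>)) \<le> ((?C + \<epsilon>) * \<alpha> powr (l / \<kappa>)) * \<alpha> powr (- (l / \<kappa>))"
          by (rule mult_right_mono) simp
        also have "\<dots> = ?C + \<epsilon>" using elim by (simp add: mult.assoc powr_add[symmetric])
        finally show ?case using \<epsilon> by linarith
      qed
    qed
  qed simp
qed

text \<open>When the field-free constant is positive, the lower bound \<open>mopt_lower\<close> is a
  positive multiple of a positive power of \<sigma>.\<close>

lemma mopt_unbounded:
  fixes A :: "real ^ 'n \<Rightarrow> real ^ 'n"
  assumes A: "A \<in> borel_measurable lebesgue" and T: "adm A a b \<noteq> {}" and ab: "0 < a" "0 < b"
    and C: "0 < mopt (\<lambda>_ :: real ^ 'n. 0) a b 1"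
  defines "d \<equiv> real CARD('n)"
  assumes \<kappa>: "0 < 2 - d + 2 * d / a" and l: "0 < 2 - d + 2 * d / b"
  shows "\<exists>\<alpha>>0. M < mopt A a b \<alpha>"
proof -
  let ?C = "mopt (\<lambda>_ :: real ^ 'n. 0) a b 1"
  have "filterlim (\<lambda>\<sigma>::real. ?C * \<sigma> powr (2 - d + 2 * d / b)) at_top at_top"
    using C l by (intro filterlim_tendsto_pos_mult_at_top[OF tendsto_const] filterlim_powr_at_top) auto
  then have "eventually (\<lambda>\<sigma>. M < ?C * \<sigma> powr (2 - d + 2 * d / b)) at_top"
    by (simp add: filterlim_at_top_dense)
  with eventually_gt_at_top[of 0] have "eventually (\<lambda>\<sigma>. 0 < \<sigma> \<and> M < ?C * \<sigma> powr (2 - d + 2 * d / b)) at_top"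
    by eventually_elim simp
  then obtain \<sigma> where \<sigma>: "0 < \<sigma>" "M < ?C * \<sigma> powr (2 - d + 2 * d / b)"
    by (auto simp: eventually_at_top_linorder)
  then have "M < mopt A a b (\<sigma> powr (2 - d + 2 * d / a))"
    using mopt_lower[OF A T ab \<sigma>(1)] by (simp add: d_def)
  then show ?thesis using \<sigma>(1) by (intro exI[of _ "\<sigma> powr (2 - d + 2 * d / a)"]) simp
qed

text \<open>Elements of S outside T carry the value infinity and leave the infimum unchanged; this
  is how functions outside L^p enter the Gagliardo-Nirenberg constant for p < 2.\<close>

lemma INF_ereal_eq_affine_inf:
  assumes T: "T \<noteq> {}" and Z: "\<And>t. t \<in> T \<Longrightarrow> 0 < Z t" and k: "\<And>t. t \<in> T \<Longrightarrow> k * Z t \<le> X t + a * Y t"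
    and "T \<subseteq> S" and F: "\<And>t. t \<in> T \<Longrightarrow> F t = ereal ((X t + a * Y t) / Z t)" "\<And>t. t \<in> S - T \<Longrightarrow> F t = \<infinity>"
  shows "(INF t\<in>S. F t) = ereal (affine_inf T X Y Z a)"
proof (rule INF_eqI)
  fix t assume "t \<in> S"
  then show "ereal (affine_inf T X Y Z a) \<le> F t"
    using F affine_inf_lower[where T=T and X=X and Y=Y and Z=Z and a=a and k=k and t=t] Z k by (cases "t \<in> T") auto
next
  fix y assume y: "\<And>t. t \<in> S \<Longrightarrow> y \<le> F t"
  show "y \<le> ereal (affine_inf T X Y Z a)"
  proof (cases y)
    case (real r)
    have "r \<le> affine_inf T X Y Z a"
      unfolding affine_inf_def using y F(1) real \<open>T \<subseteq> S\<close> by (intro cINF_greatest T) force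
    then show ?thesis using real by simp
  next
    case PInf
    obtain t where "t \<in> T" using T by blast
    then show ?thesis using y[of t] F(1)[of t] PInf \<open>T \<subseteq> S\<close> by auto
  qed simp
qed

subsection \<open>The constants for power nonlinearities\<close>

lemma concave_on_cong_on:
  fixes f g :: "real \<Rightarrow> real"
  assumes "concave_on S f" "\<And>x. x \<in> S \<Longrightarrow> g x = f x" shows "concave_on S g"
proof -
  have S: "convex S" using assms(1) by (rule concave_on_imp_convex)
  show ?thesis
    using assms(1) unfolding concave_on_iff
  proof (elim conjE, intro conjI ballI allI impI)
    fix x y u v :: real
    assume H: "\<forall>x\<in>S. \<forall>y\<in>S. \<forall>u\<ge>0. \<forall>v\<ge>0. u + v = 1 \<longrightarrow> u * f x + v * f y \<le> f (u *\<^sub>R x + v *\<^sub>R y)"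
      and "x \<in> S" "y \<in> S" "0 \<le> u" "0 \<le> v" "u + v = 1"
    moreover have "u *\<^sub>R x + v *\<^sub>R y \<in> S" using calculation S by (intro convexD)
    ultimately show "u * g x + v * g y \<le> g (u *\<^sub>R x + v *\<^sub>R y)" using assms(2) by simp
  qed (use S in auto)
qed

lemma compact_near_ground_state:
  assumes A: "A \<in> borel_measurable lebesgue" and \<psi>: "\<psi> \<in> H1_mag A" "\<not> ae_zero \<psi>"
    and eq: "energy A \<psi> = \<Lambda> * nq 2 \<psi>" and \<epsilon>: "\<epsilon> > 0"
  shows "\<exists>w R. w \<in> H1_mag A \<and> \<not> ae_zero w \<and> (\<forall>x. norm x > R \<longrightarrow> w x = 0) \<and> energy A w < (\<Lambda> + \<epsilon>) * nq 2 w"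
proof -
  have N: "0 < nq 2 \<psi>" by (rule nq_pos) (use H1_magD(1)[OF A \<psi>(1)] \<psi>(2) in auto)
  obtain w B where w: "\<forall>n. w n \<in> H1_mag A" "\<forall>n x. norm x > real (Suc n) \<longrightarrow> w n x = 0"
    "\<forall>n. energy A (w n) \<le> B n" "B \<longlonglongrightarrow> energy A \<psi>" "(\<lambda>n. nq 2 (w n)) \<longlonglongrightarrow> nq 2 \<psi>"
    using compact_approximation[OF A \<psi>(1)] by blast
  have "(\<lambda>n. (\<Lambda> + \<epsilon>) * nq 2 (w n) - B n) \<longlonglongrightarrow> (\<Lambda> + \<epsilon>) * nq 2 \<psi> - energy A \<psi>"
    by (intro tendsto_intros w)
  moreover have "0 < (\<Lambda> + \<epsilon>) * nq 2 \<psi> - energy A \<psi>" using N \<epsilon> by (simp add: eq algebra_simps)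
  ultimately have "eventually (\<lambda>n. 0 < (\<Lambda> + \<epsilon>) * nq 2 (w n) - B n) sequentially" by (rule order_tendstoD(1))
  moreover have "eventually (\<lambda>n. 0 < nq 2 (w n)) sequentially" by (rule order_tendstoD(1)[OF w(5) N])
  ultimately have "eventually (\<lambda>n. 0 < (\<Lambda> + \<epsilon>) * nq 2 (w n) - B n \<and> 0 < nq 2 (w n)) sequentially"
    by eventually_elim simp
  then obtain n where n: "0 < (\<Lambda> + \<epsilon>) * nq 2 (w n) - B n" "0 < nq 2 (w n)" by (auto simp: eventually_sequentially)
  have "w n \<in> borel_measurable lebesgue" using H1_magD(1)[OF A] w(1) by (auto simp: Lspace_iff)
  then have "\<not> ae_zero (w n)" using nq_zero[of "w n" 2] n(2) by auto
  moreover have "energy A (w n) < (\<Lambda> + \<epsilon>) * nq 2 (w n)" using n(1) w(3)[rule_format, of n] by linarith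
  ultimately show ?thesis using w(1,2) by (intro exI[of _ "w n"] exI[of _ "real (Suc n)"]) auto
qed

lemma H1_mag_Lspace_subcritical:
  fixes A :: "real ^ 'n \<Rightarrow> real ^ 'n"
  assumes dim: "CARD('n) = 2 \<or> CARD('n) = 3" and A: "A \<in> borel_measurable lebesgue"
    and p: "2 < p" "ereal p < critical_exponent CARD('n)"
  shows "\<exists>K>0. \<forall>\<psi>\<in>H1_mag A. \<psi> \<in> Lspace p \<and> nq p \<psi> \<le> K * (energy A \<psi> + nq 2 \<psi>)"
proof -
  obtain K where K: "K > 0" "\<And>u :: real ^ 'n \<Rightarrow> complex. u \<in> H1 \<Longrightarrow> u \<in> Lspace p \<and> nq p u \<le> K * (nq 2 (gradient u) + nq 2 u)"
    using sobolev_inequality[OF dim p] by blast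
  show ?thesis
  proof (intro exI[of _ K] conjI K(1) ballI)
    fix \<psi> assume \<psi>: "\<psi> \<in> H1_mag A"
    note n = norm_in_H1[OF A \<psi>]
    note k = K(2)[OF n(1)]
    show "\<psi> \<in> Lspace p" using k n(4) by blast
    have "nq p \<psi> \<le> K * (nq 2 (gradient (\<lambda>x. complex_of_real (norm (\<psi> x)))) + nq 2 \<psi>)" using k by (simp add: n(3))
    also have "\<dots> \<le> K * (energy A \<psi> + nq 2 \<psi>)" using n(2) K(1) by (intro mult_left_mono add_right_mono) auto
    finally show "nq p \<psi> \<le> K * (energy A \<psi> + nq 2 \<psi>)" .
  qed
qed

lemma subcritical_exponent_pos:
  assumes "CARD('n::finite) = 2 \<or> CARD('n) = 3" "2 < p" "ereal p < critical_exponent CARD('n)"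
  shows "0 < 2 - real CARD('n) + 2 * real CARD('n) / p"
  using assms by (auto simp: critical_exponent_def field_simps)

text \<open>X + \<alpha> Y - s (X + Y) equals (1 - s) (X - \<Lambda> Y) + (\<Lambda> + \<alpha> - s
  (\<Lambda> + 1)) Y, and s is the largest number for which both coefficients are
  nonnegative.\<close>

lemma coercivity:
  assumes \<alpha>: "- \<Lambda> < \<alpha>" and \<Lambda>: "0 < \<Lambda>"
  obtains s :: real where "0 < s" "\<And>X Y. 0 \<le> Y \<Longrightarrow> \<Lambda> * Y \<le> X \<Longrightarrow> s * (X + Y) \<le> X + \<alpha> * Y"
proof -
  define s where "s = min 1 ((\<Lambda> + \<alpha>) / (\<Lambda> + 1))"
  have s: "0 < s" "s \<le> 1" using assms by (auto simp: s_def)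
  have "s * (\<Lambda> + 1) \<le> \<Lambda> + \<alpha>"
  proof -
    have "s \<le> (\<Lambda> + \<alpha>) / (\<Lambda> + 1)" by (simp add: s_def)
    then show ?thesis using \<Lambda> by (simp add: pos_le_divide_eq)
  qed
  then have "s * (X + Y) \<le> X + \<alpha> * Y" if "0 \<le> Y" "\<Lambda> * Y \<le> X" for X Y
  proof -
    have "(1 - s) * (\<Lambda> * Y) \<le> (1 - s) * X" using that s by (intro mult_left_mono) auto
    moreover have "(s * (\<Lambda> + 1)) * Y \<le> (\<Lambda> + \<alpha>) * Y" using that \<open>s * (\<Lambda> + 1) \<le> \<Lambda> + \<alpha>\<close> by (intro mult_right_mono)
    ultimately show ?thesis by (simp add: algebra_simps)
  qed
  with s(1) show thesis by (rule that)
qed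

lemma mu_mag_eq_mopt:
  fixes A :: "real ^ 'n \<Rightarrow> real ^ 'n"
  assumes A: "A \<in> borel_measurable lebesgue" and T: "adm A 2 p \<noteq> {}" and p: "2 < p"
    and Lp: "\<And>\<psi>. \<psi> \<in> H1_mag A \<Longrightarrow> \<psi> \<in> Lspace p"
    and k: "\<And>t. t \<in> adm A 2 p \<Longrightarrow> k * nq p t \<le> energy A t + \<alpha> * nq 2 t"
  shows "mu_mag A p \<alpha> = ereal (mopt A 2 p \<alpha>)"
  unfolding mu_mag_def mopt_def
proof (rule optimal_constant_eq_affine_inf[OF T _ k])
  show "0 < nq p t" if "t \<in> adm A 2 p" for t by (rule adm_pos[OF _ that]) (use p in simp)
  fix c
  have eq: "ereal c * (Lnorm p \<psi>)\<^sup>2 \<le> (Lnorm 2 (mag_gradient A \<psi>))\<^sup>2 + ereal \<alpha> * (Lnorm 2 \<psi>)\<^sup>2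
     \<longleftrightarrow> c * nq p \<psi> \<le> energy A \<psi> + \<alpha> * nq 2 \<psi>" if "\<psi> \<in> H1_mag A" for \<psi>
    using H1_magD[OF A that] Lp[OF that] by (simp add: Lnorm_sq)
  have z: "c * nq p \<psi> \<le> energy A \<psi> + \<alpha> * nq 2 \<psi>" if "\<psi> \<in> H1_mag A" "ae_zero \<psi>" for \<psi>
    using nq_zero[of \<psi>] H1_magD(1)[OF A that(1)] that(2) by (simp add: Lspace_iff)
  show "(\<forall>\<psi>\<in>H1_mag A. ereal c * (Lnorm p \<psi>)\<^sup>2 \<le> (Lnorm 2 (mag_gradient A \<psi>))\<^sup>2 + ereal \<alpha> * (Lnorm 2 \<psi>)\<^sup>2)
     \<longleftrightarrow> (\<forall>t\<in>adm A 2 p. c * nq p t \<le> energy A t + \<alpha> * nq 2 t)"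
    using eq z Lp H1_magD(1)[OF A] by (auto simp: adm_def)
qed auto

text \<open>Since \<beta> > 0, a function outside L^p has infinity on the larger side of its
  constraint, which is void; null functions give 0 on both sides. What remains are the constraints
  of admissible functions.\<close>

lemma nu_mag_eq_mopt:
  fixes A :: "real ^ 'n \<Rightarrow> real ^ 'n"
  assumes A: "A \<in> borel_measurable lebesgue" and T: "adm A p 2 \<noteq> {}" and \<beta>: "0 < \<beta>"
    and k: "\<And>t. t \<in> adm A p 2 \<Longrightarrow> k * nq 2 t \<le> energy A t + \<beta> * nq p t"
  shows "nu_mag A p \<beta> = ereal (mopt A p 2 \<beta>)"
  unfolding nu_mag_def mopt_def
proof (rule optimal_constant_eq_affine_inf[OF T _ k])
  show "0 < nq 2 t" if "t \<in> adm A p 2" for t by (rule adm_pos[OF _ that]) simp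
  fix c
  have eq: "ereal c * (Lnorm 2 \<psi>)\<^sup>2 \<le> (Lnorm 2 (mag_gradient A \<psi>))\<^sup>2 + ereal \<beta> * (Lnorm p \<psi>)\<^sup>2
     \<longleftrightarrow> (\<psi> \<in> Lspace p \<longrightarrow> c * nq 2 \<psi> \<le> energy A \<psi> + \<beta> * nq p \<psi>)" if "\<psi> \<in> H1_mag A" for \<psi>
    using H1_magD[OF A that] \<beta> by (cases "\<psi> \<in> Lspace p") (simp_all add: Lnorm_sq Lnorm_sq_infinite)
  have z: "c * nq 2 \<psi> \<le> energy A \<psi> + \<beta> * nq p \<psi>" if "\<psi> \<in> H1_mag A" "ae_zero \<psi>" for \<psi>
    using nq_zero[of \<psi>] H1_magD(1)[OF A that(1)] that(2) by (simp add: Lspace_iff)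
  show "(\<forall>\<psi>\<in>H1_mag A. ereal c * (Lnorm 2 \<psi>)\<^sup>2 \<le> (Lnorm 2 (mag_gradient A \<psi>))\<^sup>2 + ereal \<beta> * (Lnorm p \<psi>)\<^sup>2)
     \<longleftrightarrow> (\<forall>t\<in>adm A p 2. c * nq 2 t \<le> energy A t + \<beta> * nq p t)"
    using eq z H1_magD(1)[OF A] by (auto simp: adm_def)
qed auto

lemma GN_constant_gt_2:
  assumes T: "adm (\<lambda>_ :: real ^ 'n. 0) 2 p \<noteq> {}" and p: "2 < p"
    and Lp: "\<And>u :: real ^ 'n \<Rightarrow> complex. u \<in> H1 \<Longrightarrow> u \<in> Lspace p"
  shows "GN_constant TYPE('n) p = ereal (mopt (\<lambda>_ :: real ^ 'n. 0) 2 p 1)"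
  unfolding GN_constant_def mopt_def
proof (rule INF_ereal_eq_affine_inf[OF T, where k=0])
  show P: "0 < nq p t" if "t \<in> adm (\<lambda>_ :: real ^ 'n. 0) 2 p" for t by (rule adm_pos[OF _ that]) (use p in simp)
  show "(if 2 < p then ((Lnorm 2 (gradient t))\<^sup>2 + (Lnorm 2 t)\<^sup>2) / (Lnorm p t)\<^sup>2 else ((Lnorm 2 (gradient t))\<^sup>2 + (Lnorm p t)\<^sup>2) / (Lnorm 2 t)\<^sup>2)
     = ereal ((energy (\<lambda>_. 0) t + 1 * nq 2 t) / nq p t)" if "t \<in> adm (\<lambda>_ :: real ^ 'n. 0) 2 p" for t
    using p P[OF that] that H1D[of t] by (simp add: adm_def Lnorm_sq)
qed (use Lp H1D(1) in \<open>auto simp: adm_def\<close>)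

lemma GN_constant_lt_2:
  assumes T: "adm (\<lambda>_ :: real ^ 'n. 0) p 2 \<noteq> {}" and p: "p < 2"
  shows "GN_constant TYPE('n) p = ereal (mopt (\<lambda>_ :: real ^ 'n. 0) p 2 1)"
  unfolding GN_constant_def mopt_def
proof (rule INF_ereal_eq_affine_inf[OF T, where k=0])
  show P: "0 < nq 2 t" if "t \<in> adm (\<lambda>_ :: real ^ 'n. 0) p 2" for t by (rule adm_pos[OF _ that]) simp
  show "(if 2 < p then ((Lnorm 2 (gradient t))\<^sup>2 + (Lnorm 2 t)\<^sup>2) / (Lnorm p t)\<^sup>2 else ((Lnorm 2 (gradient t))\<^sup>2 + (Lnorm p t)\<^sup>2) / (Lnorm 2 t)\<^sup>2)
     = ereal ((energy (\<lambda>_. 0) t + 1 * nq p t) / nq 2 t)" if "t \<in> adm (\<lambda>_ :: real ^ 'n. 0) p 2" for t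
    using p P[OF that] that H1D[of t] by (simp add: adm_def Lnorm_sq)
  fix t assume t: "t \<in> {u \<in> H1. \<not> ae_zero u} - adm (\<lambda>_ :: real ^ 'n. 0) p 2"
  then have "t \<in> H1" "\<not> ae_zero t" "t \<notin> Lspace p" using H1D(1) by (auto simp: adm_def)
  moreover have "0 < nq 2 t" using calculation H1D(1) by (intro nq_pos) auto
  ultimately show "(if 2 < p then ((Lnorm 2 (gradient t))\<^sup>2 + (Lnorm 2 t)\<^sup>2) / (Lnorm p t)\<^sup>2 else ((Lnorm 2 (gradient t))\<^sup>2 + (Lnorm p t)\<^sup>2) / (Lnorm 2 t)\<^sup>2) = \<infinity>"
    using p H1D[of t] by (simp add: Lnorm_sq Lnorm_sq_infinite)
qed (auto simp: adm_def)

lemma free_mopt_pos: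
  assumes dim: "CARD('n::finite) = 2 \<or> CARD('n) = 3" and p: "2 < p" "ereal p < critical_exponent CARD('n)"
    and T0: "adm (\<lambda>_ :: real ^ 'n. 0) 2 p \<noteq> {}"
  shows "0 < mopt (\<lambda>_ :: real ^ 'n. 0) 2 p 1"
proof -
  obtain K where K: "K > 0" "\<And>u :: real ^ 'n \<Rightarrow> complex. u \<in> H1 \<Longrightarrow> u \<in> Lspace p \<and> nq p u \<le> K * (nq 2 (gradient u) + nq 2 u)"
    using sobolev_inequality[OF dim p] by blast
  have pp: "0 < p" using p by simp
  have "1 / K \<le> mopt (\<lambda>_ :: real ^ 'n. 0) 2 p 1"
    unfolding mopt_def
  proof (rule affine_inf_greatest[OF T0 adm_pos[OF pp]])
    fix t assume "t \<in> adm (\<lambda>_ :: real ^ 'n. 0) 2 p"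
    then have "nq p t \<le> K * (nq 2 (gradient t) + nq 2 t)" using K(2) by (auto simp: adm_def)
    then show "1 / K * nq p t \<le> energy (\<lambda>_. 0) t + 1 * nq 2 t" using K(1) by (simp add: divide_le_eq mult.commute)
  qed simp
  moreover have "0 < 1 / K" using K by simp
  ultimately show ?thesis by linarith
qed

lemma mu_mag_properties:
  fixes A :: "real ^ 'n \<Rightarrow> real ^ 'n"
  assumes dim: "CARD('n) = 2 \<or> CARD('n) = 3" and A2: "A \<in> Lspace_loc 2" and \<Lambda>: "0 < \<Lambda>"
    and ineq: "\<forall>\<psi>\<in>H1_mag A. \<Lambda> * nq 2 \<psi> \<le> energy A \<psi>"
    and \<psi>0: "\<psi>0 \<in> H1_mag A" "\<not> ae_zero \<psi>0" "energy A \<psi>0 = \<Lambda> * nq 2 \<psi>0"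
    and p: "2 < p" "ereal p < critical_exponent CARD('n)" and conc: "concentrates A"
  shows "\<And>\<alpha>. - \<Lambda> < \<alpha> \<Longrightarrow> 0 < mu_mag A p \<alpha> \<and> mu_mag A p \<alpha> < \<infinity>"
    "strict_mono_on {- \<Lambda> <..} (mu_mag A p)"
    "concave_on {- \<Lambda> <..} (\<lambda>\<alpha>. real_of_ereal (mu_mag A p \<alpha>))"
    "(mu_mag A p \<longlongrightarrow> 0) (at_right (- \<Lambda>))"
    "((\<lambda>\<alpha>. mu_mag A p \<alpha> * ereal (\<alpha> powr ((real CARD('n) - 2) / 2 - real CARD('n) / p))) \<longlongrightarrow> GN_constant TYPE('n) p) at_top"
proof -
  have A: "A \<in> borel_measurable lebesgue" using A2 by (simp add: Lspace_loc_def)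
  obtain K where K: "K > 0" "\<And>\<psi>. \<psi> \<in> H1_mag A \<Longrightarrow> \<psi> \<in> Lspace p \<and> nq p \<psi> \<le> K * (energy A \<psi> + nq 2 \<psi>)"
    using H1_mag_Lspace_subcritical[OF dim A p] by blast
  obtain K0 where K0: "K0 > 0" "\<And>u :: real ^ 'n \<Rightarrow> complex. u \<in> H1 \<Longrightarrow> u \<in> Lspace p \<and> nq p u \<le> K0 * (nq 2 (gradient u) + nq 2 u)"
    using sobolev_inequality[OF dim p] by blast
  have pp: "0 < p" using p by simp
  have t0: "\<psi>0 \<in> adm A 2 p" using \<psi>0 K(2) H1_magD(1)[OF A] by (auto simp: adm_def)
  then have T: "adm A 2 p \<noteq> {}" by blast
  have T0: "adm (\<lambda>_ :: real ^ 'n. 0) 2 p \<noteq> {}" using norm_in_adm[OF A t0] by blast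
  have Z: "\<And>t. t \<in> adm A 2 p \<Longrightarrow> 0 < nq p t" by (rule adm_pos[OF pp])
  \<comment> \<open>Part of the energy absorbs a negative \<alpha> (\<open>coercivity\<close>), and
    the rest controls the squared L^p norm by the Sobolev inequality.\<close>
  have kex: "\<exists>k>0. \<forall>t\<in>adm A 2 p. k * nq p t \<le> energy A t + \<alpha> * nq 2 t" if \<alpha>: "- \<Lambda> < \<alpha>" for \<alpha>
  proof -
    obtain s where s: "0 < s" and le: "\<And>X Y. 0 \<le> Y \<Longrightarrow> \<Lambda> * Y \<le> X \<Longrightarrow> s * (X + Y) \<le> X + \<alpha> * Y"
      by (rule coercivity[OF \<alpha> \<Lambda>]) blast
    show ?thesis
    proof (intro exI[of _ "s / K"] conjI ballI)
      fix t assume t: "t \<in> adm A 2 p"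
      then have tH: "t \<in> H1_mag A" by (simp add: adm_def)
      have "(s / K) * nq p t \<le> (s / K) * (K * (energy A t + nq 2 t))" using K(2)[OF tH] s K(1) by (intro mult_left_mono) auto
      also have "\<dots> = s * (energy A t + nq 2 t)" using K(1) by simp
      also have "\<dots> \<le> energy A t + \<alpha> * nq 2 t" by (rule le[OF nq_nonneg ineq[rule_format, OF tH]])
      finally show "(s / K) * nq p t \<le> energy A t + \<alpha> * nq 2 t" .
    qed (use s K in simp)
  qed
  then obtain k where k: "\<And>\<alpha>. - \<Lambda> < \<alpha> \<Longrightarrow> 0 < k \<alpha>"
    "\<And>\<alpha> t. - \<Lambda> < \<alpha> \<Longrightarrow> t \<in> adm A 2 p \<Longrightarrow> k \<alpha> * nq p t \<le> energy A t + \<alpha> * nq 2 t" by metis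
  have eq: "mu_mag A p \<alpha> = ereal (mopt A 2 p \<alpha>)" if "- \<Lambda> < \<alpha>" for \<alpha>
    by (rule mu_mag_eq_mopt[OF A T p(1) _ k(2)[OF that]]) (use K(2) in auto)
  have pos: "0 < mopt A 2 p \<alpha>" if "- \<Lambda> < \<alpha>" for \<alpha>
  proof -
    have "k \<alpha> \<le> mopt A 2 p \<alpha>" unfolding mopt_def by (rule affine_inf_greatest[OF T Z k(2)[OF that]])
    then show ?thesis using k(1)[OF that] by linarith
  qed
  show "0 < mu_mag A p \<alpha> \<and> mu_mag A p \<alpha> < \<infinity>" if "- \<Lambda> < \<alpha>" for \<alpha> using pos[OF that] by (simp add: eq[OF that])
  have conc_mopt: "concave_on {- \<Lambda> <..} (mopt A 2 p)"
    unfolding mopt_def by (rule concave_on_affine_inf[OF _ T Z, where k=k]) (use k(2) in auto)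
  show "concave_on {- \<Lambda> <..} (\<lambda>\<alpha>. real_of_ereal (mu_mag A p \<alpha>))"
    by (rule concave_on_cong_on[OF conc_mopt]) (simp add: eq)
  have C: "0 < mopt (\<lambda>_ :: real ^ 'n. 0) 2 p 1" by (rule free_mopt_pos[OF dim p T0])
  have unb: "\<exists>\<alpha>>- \<Lambda>. M < mopt A 2 p \<alpha>" for M
  proof -
    have "\<exists>\<alpha>>0. M < mopt A 2 p \<alpha>"
      by (rule mopt_unbounded[OF A T _ pp C]) (use subcritical_exponent_pos[OF dim p] in auto)
    then show ?thesis using \<Lambda> by (meson less_trans neg_less_0_iff_less)
  qed
  have mono: "mopt A 2 p \<alpha> \<le> mopt A 2 p \<beta>" if "- \<Lambda> < \<alpha>" "\<alpha> \<le> \<beta>" for \<alpha> \<beta>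
    unfolding mopt_def by (rule affine_inf_mono[OF T Z _ k(2)[OF that(1)] that(2)]) auto
  have smono: "strict_mono_on {- \<Lambda> <..} (mopt A 2 p)"
    by (rule concave_unbounded_strict_mono[OF conc_mopt mono unb])
  then show "strict_mono_on {- \<Lambda> <..} (mu_mag A p)"
    by (auto simp: strict_mono_on_def eq)
  show "(mu_mag A p \<longlongrightarrow> 0) (at_right (- \<Lambda>))"
  proof -
    have "(mopt A 2 p \<longlongrightarrow> 0) (at_right (- \<Lambda>))"
    proof (rule tendsto_sandwich[OF _ _ tendsto_const])
      show "\<forall>\<^sub>F \<alpha> in at_right (- \<Lambda>). 0 \<le> mopt A 2 p \<alpha>"
        using eventually_at_right_less by eventually_elim (rule less_imp_le[OF pos])
      \<comment> \<open>The ground state is the competitor; its energy is \<Lambda> times its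
        squared L^2 norm, so its quotient vanishes as \<alpha> tends to - \<Lambda>.\<close>
      show "\<forall>\<^sub>F \<alpha> in at_right (- \<Lambda>). mopt A 2 p \<alpha> \<le> (\<Lambda> + \<alpha>) * (nq 2 \<psi>0 / nq p \<psi>0)"
        using eventually_at_right_less
      proof eventually_elim
        case (elim \<alpha>)
        have "mopt A 2 p \<alpha> * nq p \<psi>0 \<le> energy A \<psi>0 + \<alpha> * nq 2 \<psi>0"
          unfolding mopt_def by (rule affine_inf_mult_le[OF t0 Z k(2)[OF elim]])
        then show ?case using Z[OF t0] by (simp add: \<psi>0(3) pos_le_divide_eq algebra_simps)
      qed
      have "((\<lambda>\<alpha>. (\<Lambda> + \<alpha>) * (nq 2 \<psi>0 / nq p \<psi>0)) \<longlongrightarrow> (\<Lambda> + - \<Lambda>) * (nq 2 \<psi>0 / nq p \<psi>0)) (at_right (- \<Lambda>))"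
        by (intro tendsto_intros)
      then show "((\<lambda>\<alpha>. (\<Lambda> + \<alpha>) * (nq 2 \<psi>0 / nq p \<psi>0)) \<longlongrightarrow> 0) (at_right (- \<Lambda>))" by simp
    qed
    then have L: "((\<lambda>\<alpha>. ereal (mopt A 2 p \<alpha>)) \<longlongrightarrow> 0) (at_right (- \<Lambda>))"
      unfolding zero_ereal_def by (rule tendsto_ereal)
    have E: "\<forall>\<^sub>F \<alpha> in at_right (- \<Lambda>). ereal (mopt A 2 p \<alpha>) = mu_mag A p \<alpha>"
      using eventually_at_right_less by eventually_elim (simp add: eq)
    show ?thesis by (rule Lim_transform_eventually[OF L E])
  qed
  show "((\<lambda>\<alpha>. mu_mag A p \<alpha> * ereal (\<alpha> powr ((real CARD('n) - 2) / 2 - real CARD('n) / p))) \<longlongrightarrow> GN_constant TYPE('n) p) at_top"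
  proof -
    let ?e = "(real CARD('n) - 2) / 2 - real CARD('n) / p"
    \<comment> \<open>For a = 2 the exponent 2 - d + 2d/a of the parameter is 2, that is, \<alpha> =
      \<sigma>^2.\<close>
    have e: "- ((2 - real CARD('n) + 2 * real CARD('n) / p) / (2 - real CARD('n) + 2 * real CARD('n) / 2)) = ?e"
      using pp by (simp add: field_simps)
    have "((\<lambda>\<alpha>. mopt A 2 p \<alpha> * \<alpha> powr ?e) \<longlongrightarrow> mopt (\<lambda>_ :: real ^ 'n. 0) 2 p 1) at_top"
      using mopt_asymptotics[OF A2 T _ pp conc] unfolding e by simp
    then have L: "((\<lambda>\<alpha>. ereal (mopt A 2 p \<alpha> * \<alpha> powr ?e)) \<longlongrightarrow> ereal (mopt (\<lambda>_ :: real ^ 'n. 0) 2 p 1)) at_top"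
      by (rule tendsto_ereal)
    have G: "GN_constant TYPE('n) p = ereal (mopt (\<lambda>_ :: real ^ 'n. 0) 2 p 1)"
      by (rule GN_constant_gt_2[OF T0 p(1)]) (use K0(2) in blast)
    have E: "\<forall>\<^sub>F \<alpha> in at_top. ereal (mopt A 2 p \<alpha> * \<alpha> powr ?e) = mu_mag A p \<alpha> * ereal (\<alpha> powr ?e)"
      using eventually_gt_at_top[of "- \<Lambda>"] by eventually_elim (simp add: eq)
    show ?thesis unfolding G by (rule Lim_transform_eventually[OF L E])
  qed
qed

lemma nu_mag_properties:
  fixes A :: "real ^ 'n \<Rightarrow> real ^ 'n"
  assumes dim: "CARD('n) = 2 \<or> CARD('n) = 3" and A2: "A \<in> Lspace_loc 2" and \<Lambda>: "0 < \<Lambda>"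
    and ineq: "\<forall>\<psi>\<in>H1_mag A. \<Lambda> * nq 2 \<psi> \<le> energy A \<psi>"
    and \<psi>0: "\<psi>0 \<in> H1_mag A" "\<not> ae_zero \<psi>0" "energy A \<psi>0 = \<Lambda> * nq 2 \<psi>0"
    and p: "1 < p" "p < 2" and conc: "concentrates A"
  shows "\<And>\<beta>. 0 < \<beta> \<Longrightarrow> ereal \<Lambda> < nu_mag A p \<beta> \<and> nu_mag A p \<beta> < \<infinity>"
    "strict_mono_on {0 <..} (nu_mag A p)"
    "concave_on {0 <..} (\<lambda>\<beta>. real_of_ereal (nu_mag A p \<beta>))"
    "(nu_mag A p \<longlongrightarrow> ereal \<Lambda>) (at_right 0)"
    "((\<lambda>\<beta>. nu_mag A p \<beta> * ereal (\<beta> powr (- (2 * p / (2 * p + real CARD('n) * (2 - p)))))) \<longlongrightarrow> GN_constant TYPE('n) p) at_top"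
proof -
  have A: "A \<in> borel_measurable lebesgue" using A2 by (simp add: Lspace_loc_def)
  have pp: "0 < p" using p by simp
  have near: "\<exists>t\<in>adm A p 2. energy A t < (\<Lambda> + \<epsilon>) * nq 2 t" if \<epsilon>: "\<epsilon> > 0" for \<epsilon>
  proof -
    obtain w R where w: "w \<in> H1_mag A" "\<not> ae_zero w" "\<forall>x. norm x > R \<longrightarrow> w x = 0" "energy A w < (\<Lambda> + \<epsilon>) * nq 2 w"
      using compact_near_ground_state[OF A \<psi>0 \<epsilon>] by blast
    have w2: "w \<in> Lspace 2" using H1_magD(1)[OF A w(1)] .
    have "w \<in> Lspace p" by (rule Lspace_bounded_support[OF w2]) (use w(3) p in auto)
    then have "w \<in> adm A p 2" using w w2 by (simp add: adm_def)
    then show ?thesis using w(4) by blast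
  qed
  then have T: "adm A p 2 \<noteq> {}" using zero_less_one by blast
  have T0: "adm (\<lambda>_ :: real ^ 'n. 0) p 2 \<noteq> {}" using T norm_in_adm[OF A] by blast
  have Z: "\<And>t. t \<in> adm A p 2 \<Longrightarrow> 0 < nq 2 t" by (rule adm_pos) simp
  have k: "\<Lambda> * nq 2 t \<le> energy A t + \<beta> * nq p t" if "0 < \<beta>" "t \<in> adm A p 2" for \<beta> t
  proof -
    have "\<Lambda> * nq 2 t \<le> energy A t" using that by (intro ineq[rule_format]) (simp add: adm_def)
    moreover have "0 \<le> \<beta> * nq p t" using that by simp
    ultimately show ?thesis by linarith
  qed
  have eq: "nu_mag A p \<beta> = ereal (mopt A p 2 \<beta>)" if "0 < \<beta>" for \<beta>
    by (rule nu_mag_eq_mopt[OF A T that k[OF that]])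
  have ge: "\<Lambda> \<le> mopt A p 2 \<beta>" if "0 < \<beta>" for \<beta>
    unfolding mopt_def by (rule affine_inf_greatest[OF T Z k[OF that]])
  have conc_mopt: "concave_on {0 <..} (mopt A p 2)"
    unfolding mopt_def by (rule concave_on_affine_inf[OF _ T Z, where k="\<lambda>_. \<Lambda>"]) (use k in auto)
  show "concave_on {0 <..} (\<lambda>\<beta>. real_of_ereal (nu_mag A p \<beta>))"
    by (rule concave_on_cong_on[OF conc_mopt]) (simp add: eq)
  obtain c where c: "c > 0" "\<And>u :: real ^ 'n \<Rightarrow> complex. u \<in> H1 \<Longrightarrow> u \<in> Lspace p \<Longrightarrow> c * nq 2 u \<le> nq 2 (gradient u) + nq p u"
    using sub_quadratic_inequality[OF dim p] by blast
  have C: "0 < mopt (\<lambda>_ :: real ^ 'n. 0) p 2 1"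
  proof -
    have "c \<le> mopt (\<lambda>_ :: real ^ 'n. 0) p 2 1"
      unfolding mopt_def
    proof (rule affine_inf_greatest[OF T0])
      fix t assume "t \<in> adm (\<lambda>_ :: real ^ 'n. 0) p 2"
      then show "c * nq 2 t \<le> energy (\<lambda>_. 0) t + 1 * nq p t" "0 < nq 2 t" using c(2) adm_pos[of 2 t] by (auto simp: adm_def)
    qed
    then show ?thesis using c(1) by linarith
  qed
  have \<kappa>: "0 < 2 - real CARD('n) + 2 * real CARD('n) / p"
  proof -
    have "1 < 2 / p" using p by simp
    then have "real CARD('n) * 1 < real CARD('n) * (2 / p)" by (intro mult_strict_left_mono) auto
    then show ?thesis by (simp add: mult.commute)
  qed
  have unb: "\<exists>\<beta>>0. M < mopt A p 2 \<beta>" for M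
    by (rule mopt_unbounded[OF A T pp _ C]) (use \<kappa> in auto)
  have mono: "mopt A p 2 \<alpha> \<le> mopt A p 2 \<beta>" if "0 < \<alpha>" "\<alpha> \<le> \<beta>" for \<alpha> \<beta>
    unfolding mopt_def by (rule affine_inf_mono[OF T Z _ k[OF that(1)] that(2)]) auto
  have smono: "strict_mono_on {0 <..} (mopt A p 2)"
    by (rule concave_unbounded_strict_mono[OF conc_mopt mono unb])
  then show "strict_mono_on {0 <..} (nu_mag A p)"
    by (auto simp: strict_mono_on_def eq)
  \<comment> \<open>The value at \<beta> / 2 is at least \<Lambda>, and strict monotonicity lifts
    the value at \<beta> above it.\<close>
  show "ereal \<Lambda> < nu_mag A p \<beta> \<and> nu_mag A p \<beta> < \<infinity>" if "0 < \<beta>" for \<beta>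
  proof -
    have "mopt A p 2 (\<beta> / 2) < mopt A p 2 \<beta>" using smono that by (auto simp: strict_mono_on_def)
    then show ?thesis using ge[of "\<beta> / 2"] that by (simp add: eq)
  qed
  show "(nu_mag A p \<longlongrightarrow> ereal \<Lambda>) (at_right 0)"
  proof -
    have "(mopt A p 2 \<longlongrightarrow> \<Lambda>) (at_right 0)"
    proof (rule order_tendstoI)
      fix a assume "a < \<Lambda>"
      then show "\<forall>\<^sub>F \<beta> in at_right 0. a < mopt A p 2 \<beta>"
        using eventually_at_right_less[of "0 :: real"] by (auto elim!: eventually_mono dest!: ge)
    next
      fix a assume a: "\<Lambda> < a"
      \<comment> \<open>The competitor is fixed before \<beta> tends to 0, so its L^p term, however
        large, disappears in the limit.\<close>
      then obtain t where t: "t \<in> adm A p 2" "energy A t < (\<Lambda> + (a - \<Lambda>)) * nq 2 t" using near[of "a - \<Lambda>"] by auto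
      have "((\<lambda>\<beta>. (energy A t + \<beta> * nq p t) / nq 2 t) \<longlongrightarrow> (energy A t + 0 * nq p t) / nq 2 t) (at_right 0)"
        using Z[OF t(1)] by (intro tendsto_intros) auto
      moreover have "(energy A t + 0 * nq p t) / nq 2 t < a" using t(2) Z[OF t(1)] by (simp add: pos_divide_less_eq)
      ultimately have "\<forall>\<^sub>F \<beta> in at_right 0. (energy A t + \<beta> * nq p t) / nq 2 t < a" by (rule order_tendstoD(2))
      then show "\<forall>\<^sub>F \<beta> in at_right 0. mopt A p 2 \<beta> < a"
        using eventually_at_right_less[of "0 :: real"]
      proof eventually_elim
        case (elim \<beta>)
        have "mopt A p 2 \<beta> * nq 2 t \<le> energy A t + \<beta> * nq p t"
          unfolding mopt_def by (rule affine_inf_mult_le[OF t(1) Z k[OF elim(2)]])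
        then have "mopt A p 2 \<beta> \<le> (energy A t + \<beta> * nq p t) / nq 2 t" using Z[OF t(1)] by (simp add: pos_le_divide_eq)
        then show ?case using elim(1) by linarith
      qed
    qed
    then have "((\<lambda>\<beta>. ereal (mopt A p 2 \<beta>)) \<longlongrightarrow> ereal \<Lambda>) (at_right 0)" by (rule tendsto_ereal)
    moreover have "\<forall>\<^sub>F \<beta> in at_right 0. ereal (mopt A p 2 \<beta>) = nu_mag A p \<beta>"
      using eventually_at_right_less[of "0 :: real"] by eventually_elim (simp add: eq)
    ultimately show ?thesis by (rule Lim_transform_eventually)
  qed
  show "((\<lambda>\<beta>. nu_mag A p \<beta> * ereal (\<beta> powr (- (2 * p / (2 * p + real CARD('n) * (2 - p)))))) \<longlongrightarrow> GN_constant TYPE('n) p) at_top"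
  proof -
    let ?e = "- (2 * p / (2 * p + real CARD('n) * (2 - p)))"
    \<comment> \<open>The exponents have changed places: b = 2 gives 2 in the numerator, and a = p
      gives this denominator.\<close>
    have "2 - real CARD('n) + 2 * real CARD('n) / p = (2 * p + real CARD('n) * (2 - p)) / p"
      using pp by (simp add: field_simps)
    then have e: "- ((2 - real CARD('n) + 2 * real CARD('n) / 2) / (2 - real CARD('n) + 2 * real CARD('n) / p)) = ?e" by simp
    have "((\<lambda>\<beta>. mopt A p 2 \<beta> * \<beta> powr ?e) \<longlongrightarrow> mopt (\<lambda>_ :: real ^ 'n. 0) p 2 1) at_top"
      using mopt_asymptotics[OF A2 T pp _ conc \<kappa>] unfolding e by simp
    then have L: "((\<lambda>\<beta>. ereal (mopt A p 2 \<beta> * \<beta> powr ?e)) \<longlongrightarrow> ereal (mopt (\<lambda>_ :: real ^ 'n. 0) p 2 1)) at_top"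
      by (rule tendsto_ereal)
    have G: "GN_constant TYPE('n) p = ereal (mopt (\<lambda>_ :: real ^ 'n. 0) p 2 1)"
      by (rule GN_constant_lt_2[OF T0 p(2)])
    have E: "\<forall>\<^sub>F \<beta> in at_top. ereal (mopt A p 2 \<beta> * \<beta> powr ?e) = nu_mag A p \<beta> * ereal (\<beta> powr ?e)"
      using eventually_gt_at_top[of 0] by eventually_elim (simp add: eq)
    show ?thesis unfolding G by (rule Lim_transform_eventually[OF L E])
  qed
qed

subsection \<open>The logarithmic Sobolev inequality\<close>

lemma entropy_density_eq:
  "\<psi> \<in> Lspace 2 \<Longrightarrow> entropy_density \<psi> x = (norm (\<psi> x))\<^sup>2 * ln ((norm (\<psi> x))\<^sup>2 / nq 2 \<psi>)"
  by (simp add: entropy_density_def Lnorm_def nq_2 Lint_def powr_half_sqrt)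

lemma entropy_density_measurable:
  assumes "\<psi> \<in> Lspace 2" shows "entropy_density \<psi> \<in> borel_measurable lebesgue"
proof -
  have [measurable]: "\<psi> \<in> borel_measurable lebesgue" using assms by (simp add: Lspace_iff)
  show ?thesis unfolding entropy_density_eq[OF assms, abs_def] by measurable
qed

text \<open>The tangent inequality \<open>ln y \<le> y / l - 1 + ln l\<close> at \<open>y = norm (\<psi> x) / sqrt (nq 2 \<psi>)\<close>; integrating it and optimising
  over \<open>l\<close> controls the entropy by the \<open>L\<^sup>3\<close> norm.\<close>

lemma entropy_density_le:
  assumes \<psi>: "\<psi> \<in> Lspace 2" and N: "0 < nq 2 \<psi>" and l: "0 < l"
  shows "entropy_density \<psi> x \<le> 2 / (l * sqrt (nq 2 \<psi>)) * norm (\<psi> x) powr 3 + 2 * (ln l - 1) * (norm (\<psi> x))\<^sup>2"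
proof (cases "\<psi> x = 0")
  case False
  define a where "a = norm (\<psi> x)"
  define s where "s = sqrt (nq 2 \<psi>)"
  have a: "a > 0" and s: "s > 0" using False N by (simp_all add: a_def s_def)
  have sN: "nq 2 \<psi> = s\<^sup>2" using N by (simp add: s_def)
  have "ln (a / (l * s)) \<le> a / (l * s) - 1" using a s l by (intro ln_le_minus_one) simp
  then have le: "ln (a / s) \<le> a / (l * s) - 1 + ln l" using a s l by (simp add: ln_div ln_mult)
  have "ln (a\<^sup>2 / s\<^sup>2) = 2 * ln (a / s)" using a s by (simp add: power_divide[symmetric] ln_realpow)
  then have "entropy_density \<psi> x = 2 * a\<^sup>2 * ln (a / s)"
    unfolding entropy_density_eq[OF \<psi>] sN by (simp add: a_def)
  also have "\<dots> \<le> 2 * a\<^sup>2 * (a / (l * s) - 1 + ln l)" using le by (intro mult_left_mono) auto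
  also have "\<dots> = 2 / (l * s) * a ^ 3 + 2 * (ln l - 1) * a\<^sup>2"
    by (simp add: algebra_simps power2_eq_square power3_eq_cube)
  finally show ?thesis unfolding a_def s_def by simp
qed (simp add: entropy_density_def)

lemma Lspace_integrable:
  assumes f: "f \<in> Lspace q"
  shows "integrable lebesgue (\<lambda>x. norm (f x) powr q)" "(\<integral>x. norm (f x) powr q \<partial>lebesgue) = enn2real (Lint q f)"
proof -
  have [measurable]: "f \<in> borel_measurable lebesgue" using f by (simp add: Lspace_iff)
  have [measurable]: "(\<lambda>x. norm (f x) powr q) \<in> borel_measurable lebesgue" by measurable
  show "integrable lebesgue (\<lambda>x. norm (f x) powr q)"
    using f by (intro integrableI_nonneg) (auto simp: Lspace_iff Lint_def)
  show "(\<integral>x. norm (f x) powr q \<partial>lebesgue) = enn2real (Lint q f)"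
    unfolding Lint_def by (rule integral_eq_nn_integral) auto
qed

lemma Lspace_2_integrable:
  assumes f: "f \<in> Lspace 2"
  shows "integrable lebesgue (\<lambda>x. (norm (f x))\<^sup>2)" "(\<integral>x. (norm (f x))\<^sup>2 \<partial>lebesgue) = nq 2 f"
  using Lspace_integrable[OF f] by (simp_all add: nq_2)

text \<open>For l = e the quadratic term in \<open>entropy_density_le\<close> has coefficient 0, so
  the density lies below a multiple of |\<psi>|^3.\<close>

lemma entropy_positive_part_finite:
  assumes \<psi>: "\<psi> \<in> Lspace 2" "\<psi> \<in> Lspace 3" "\<not> ae_zero \<psi>"
  shows "(\<integral>\<^sup>+x. ennreal (entropy_density \<psi> x) \<partial>lebesgue) < \<infinity>"
proof -
  have [measurable]: "\<psi> \<in> borel_measurable lebesgue" using \<psi>(1) by (simp add: Lspace_iff)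
  have [measurable]: "(\<lambda>x. norm (\<psi> x) powr 3) \<in> borel_measurable lebesgue" by measurable
  have N: "0 < nq 2 \<psi>" by (rule nq_pos[OF \<psi>(1) _ \<psi>(3)]) simp
  let ?c = "2 / (exp 1 * sqrt (nq 2 \<psi>))"
  have "(\<integral>\<^sup>+x. ennreal (entropy_density \<psi> x) \<partial>lebesgue) \<le> (\<integral>\<^sup>+x. ennreal ?c * ennreal (norm (\<psi> x) powr 3) \<partial>lebesgue)"
  proof (rule nn_integral_mono)
    fix x
    have "entropy_density \<psi> x \<le> ?c * norm (\<psi> x) powr 3"
      using entropy_density_le[OF \<psi>(1) N exp_gt_zero[of 1], of x] by simp
    then show "ennreal (entropy_density \<psi> x) \<le> ennreal ?c * ennreal (norm (\<psi> x) powr 3)"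
      using N by (subst ennreal_mult[symmetric]) (auto intro!: ennreal_leI simp del: powr_numeral)
  qed
  also have "\<dots> = ennreal ?c * Lint 3 \<psi>" unfolding Lint_def by (rule nn_integral_cmult) measurable
  also have "\<dots> < \<infinity>" using \<psi>(2) by (auto simp: Lspace_iff ennreal_mult_less_top)
  finally show ?thesis .
qed

text \<open>The positive part is finite by the L^3 bound, so integrability can fail only through the
  negative part. The difference is then - infinity, and the case of infinity minus infinity does not
  arise.\<close>

lemma entropy_integral_eq:
  assumes \<psi>: "\<psi> \<in> Lspace 2" "\<psi> \<in> Lspace 3" "\<not> ae_zero \<psi>"
  shows "entropy_integral \<psi> = (if integrable lebesgue (entropy_density \<psi>)
    then ereal (\<integral>x. entropy_density \<psi> x \<partial>lebesgue) else - \<infinity>)"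
proof -
  define p where "p = (\<integral>\<^sup>+x. ennreal (entropy_density \<psi> x) \<partial>lebesgue)"
  define n where "n = (\<integral>\<^sup>+x. ennreal (- entropy_density \<psi> x) \<partial>lebesgue)"
  have p: "p < \<infinity>" unfolding p_def by (rule entropy_positive_part_finite[OF \<psi>])
  have i: "integrable lebesgue (entropy_density \<psi>) \<longleftrightarrow> n \<noteq> \<infinity>"
    using p entropy_density_measurable[OF \<psi>(1)] by (simp add: real_integrable_def p_def n_def less_top)
  have e: "entropy_integral \<psi> = enn2ereal p - enn2ereal n" by (simp add: entropy_integral_def p_def n_def)
  obtain p' where p': "0 \<le> p'" "p = ennreal p'" using p by (cases p) auto
  show ?thesis
  proof (cases "n = \<infinity>")
    case True
    then show ?thesis using i by (simp add: e p')
  next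
    case False
    then obtain n' where n': "0 \<le> n'" "n = ennreal n'" by (cases n) auto
    have "(\<integral>x. entropy_density \<psi> x \<partial>lebesgue) = enn2real p - enn2real n"
      using False i real_lebesgue_integral_def[of lebesgue "entropy_density \<psi>"] by (simp add: p_def n_def)
    then show ?thesis using i False p' n' by (simp add: e)
  qed
qed

lemma entropy_integral_zero:
  assumes "ae_zero \<psi>" shows "entropy_integral \<psi> = 0"
proof -
  have "AE x in lebesgue. entropy_density \<psi> x = 0"
    using assms unfolding ae_zero_def by eventually_elim (simp add: entropy_density_def)
  then have "AE x in lebesgue. ennreal (entropy_density \<psi> x) = 0" "AE x in lebesgue. ennreal (- entropy_density \<psi> x) = 0"
    by (auto elim: eventually_mono)
  then have "(\<integral>\<^sup>+x. ennreal (entropy_density \<psi> x) \<partial>lebesgue) = (\<integral>\<^sup>+(x :: real ^ 'a). 0 \<partial>lebesgue)"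
    "(\<integral>\<^sup>+x. ennreal (- entropy_density \<psi> x) \<partial>lebesgue) = (\<integral>\<^sup>+(x :: real ^ 'a). 0 \<partial>lebesgue)"
    by (intro nn_integral_cong_AE; simp)+
  then show ?thesis by (simp add: entropy_integral_def)
qed

text \<open>With w the density relative to the mass, ln (1/w) \<le> 1/w - 1 gives - w ln w \<le> 1.
  The negative part is thus bounded by the mass, and on a ball this is integrable.\<close>

lemma entropy_integrable_bounded_support:
  fixes \<psi> :: "real ^ 'n \<Rightarrow> complex"
  assumes \<psi>: "\<psi> \<in> Lspace 2" "\<psi> \<in> Lspace 3" "\<not> ae_zero \<psi>" and R: "\<And>x. norm x > R \<Longrightarrow> \<psi> x = 0"
  shows "integrable lebesgue (entropy_density \<psi>)"
proof -
  have N: "0 < nq 2 \<psi>" by (rule nq_pos[OF \<psi>(1) _ \<psi>(3)]) simp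
  have "(\<integral>\<^sup>+x. ennreal (- entropy_density \<psi> x) \<partial>lebesgue) \<le> (\<integral>\<^sup>+x. ennreal (nq 2 \<psi>) * indicator (cball (0 :: real ^ 'n) R) x \<partial>lebesgue)"
  proof (rule nn_integral_mono)
    fix x
    show "ennreal (- entropy_density \<psi> x) \<le> ennreal (nq 2 \<psi>) * indicator (cball 0 R) x"
    proof (cases "\<psi> x = 0")
      case False
      define w where "w = (norm (\<psi> x))\<^sup>2 / nq 2 \<psi>"
      have w: "w > 0" using False N by (simp add: w_def)
      have "ln (1 / w) \<le> 1 / w - 1" using w by (intro ln_le_minus_one) simp
      then have "- ln w \<le> 1 / w" using w by (simp add: ln_div)
      then have "w * (- ln w) \<le> w * (1 / w)" using w by (intro mult_left_mono) auto
      then have "nq 2 \<psi> * (- (w * ln w)) \<le> nq 2 \<psi> * 1" using w N by (intro mult_left_mono) auto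
      moreover have "nq 2 \<psi> * w = (norm (\<psi> x))\<^sup>2" using N by (simp add: w_def)
      ultimately have "- entropy_density \<psi> x \<le> nq 2 \<psi>"
        unfolding entropy_density_eq[OF \<psi>(1)] w_def[symmetric] by (simp add: mult.assoc[symmetric])
      moreover have "norm x \<le> R" using R False not_less by blast
      ultimately show ?thesis by (simp add: ennreal_leI)
    qed (simp add: entropy_density_def)
  qed
  also have "\<dots> = ennreal (nq 2 \<psi>) * emeasure lebesgue (cball (0 :: real ^ 'n) R)" by (rule nn_integral_cmult_indicator) simp
  also have "\<dots> < \<infinity>"
    using emeasure_lborel_cball_finite[of "0 :: real ^ 'n" R] by (auto simp: ennreal_mult_less_top)
  finally show ?thesis
    using entropy_positive_part_finite[OF \<psi>] entropy_density_measurable[OF \<psi>(1)]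
    by (simp add: real_integrable_def less_top)
qed

text \<open>Jensen's inequality for the logarithm of |\<psi>| under the probability density
  |\<psi>|^2 / \<open>nq 2 \<psi>\<close>, carried out with a tangent line.\<close>

lemma entropy_le_L3:
  assumes \<psi>: "\<psi> \<in> Lspace 2" "\<psi> \<in> Lspace 3" "\<not> ae_zero \<psi>" and i: "integrable lebesgue (entropy_density \<psi>)"
  shows "(\<integral>x. entropy_density \<psi> x \<partial>lebesgue) \<le> 3 * nq 2 \<psi> * ln (nq 3 \<psi> / nq 2 \<psi>)"
proof -
  define N where "N = nq 2 \<psi>"
  define L where "L = enn2real (Lint 3 \<psi>)"
  \<comment> \<open>The tangent point is the mean of |\<psi>| / \<open>sqrt N\<close> under this
    density: the cubic term becomes 2 N and cancels the term - 2 N of the tangent, leaving 2 N ln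
    l.\<close>
  define l where "l = L / (N * sqrt N)"
  have N: "0 < N" unfolding N_def by (rule nq_pos[OF \<psi>(1) _ \<psi>(3)]) simp
  have n3: "0 < nq 3 \<psi>" by (rule nq_pos[OF \<psi>(2) _ \<psi>(3)]) simp
  then have "L \<noteq> 0" by (auto simp: nq_def L_def)
  moreover have "0 \<le> L" by (simp add: L_def)
  ultimately have L: "0 < L" by simp
  have l: "0 < l" using L N by (simp add: l_def)
  have "(\<integral>x. entropy_density \<psi> x \<partial>lebesgue)
     \<le> (\<integral>x. 2 / (l * sqrt N) * norm (\<psi> x) powr 3 + 2 * (ln l - 1) * (norm (\<psi> x))\<^sup>2 \<partial>lebesgue)"
    unfolding N_def
    by (intro integral_mono i Bochner_Integration.integrable_add integrable_mult_right Lspace_2_integrable Lspace_integrable \<psi>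
        entropy_density_le[OF \<psi>(1) N[unfolded N_def] l])
  also have "\<dots> = 2 / (l * sqrt N) * L + 2 * (ln l - 1) * N"
    unfolding N_def L_def
    by (subst Bochner_Integration.integral_add)
       (auto simp: Lspace_2_integrable[OF \<psi>(1)] Lspace_integrable[OF \<psi>(2)] simp del: powr_numeral)
  also have "2 / (l * sqrt N) * L = 2 * N" using N L by (simp add: l_def)
  also have "2 * N + 2 * (ln l - 1) * N = 2 * N * ln l" by (simp add: algebra_simps)
  also have "ln l = 3 / 2 * ln (nq 3 \<psi> / N)"
  proof -
    have "ln (nq 3 \<psi>) = 2 / 3 * ln L" using L by (simp add: nq_def L_def ln_powr)
    moreover have "ln (N * sqrt N) = 3 / 2 * ln N" using N by (simp add: ln_mult ln_sqrt)
    ultimately show ?thesis using L N n3 by (simp add: l_def ln_div)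
  qed
  finally show ?thesis unfolding N_def by simp
qed

text \<open>Integrability is demanded so that the Bochner integral of the density is the true
  entropy and not the default 0.\<close>

definition ent_adm :: "(real ^ 'n \<Rightarrow> real ^ 'n) \<Rightarrow> (real ^ 'n \<Rightarrow> complex) set" where
  "ent_adm A = {\<psi> \<in> H1_mag A. \<not> ae_zero \<psi> \<and> integrable lebesgue (entropy_density \<psi>)}"

text \<open>The entropy enters with a minus sign so that \<gamma> is the affine parameter. This
  coefficient has no fixed sign, so concavity carries over from the general lemmas but monotonicity
  does not.\<close>

definition xi_opt :: "(real ^ 'n \<Rightarrow> real ^ 'n) \<Rightarrow> real \<Rightarrow> real" where
  "xi_opt A = affine_inf (ent_adm A) (energy A) (\<lambda>\<psi>. - (\<integral>x. entropy_density \<psi> x \<partial>lebesgue)) (nq 2)"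

lemma ent_adm_pos: "A \<in> borel_measurable lebesgue \<Longrightarrow> \<psi> \<in> ent_adm A \<Longrightarrow> 0 < nq 2 \<psi>"
  using nq_pos[of \<psi> 2] H1_magD(1)[of A \<psi>] by (auto simp: ent_adm_def)

text \<open>The \<open>L\<^sup>3\<close> norm is bounded by \<open>mopt A 2 3 (3 * \<gamma>)\<close>: with this parameter, linearising the logarithm produces
  exactly \<open>energy A \<psi>\<close>.\<close>

lemma log_sobolev:
  fixes A :: "real ^ 'n \<Rightarrow> real ^ 'n"
  assumes A: "A \<in> borel_measurable lebesgue" and L3: "H1_mag A \<subseteq> Lspace 3"
    and C: "0 < mopt (\<lambda>_ :: real ^ 'n. 0) 2 3 1" and \<psi>: "\<psi> \<in> ent_adm A" and \<gamma>: "0 < \<gamma>"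
  shows "- \<gamma> * (real CARD('n) / 2 * ln (3 * \<gamma>) - 3 * ln (mopt (\<lambda>_ :: real ^ 'n. 0) 2 3 1)) * nq 2 \<psi>
     \<le> energy A \<psi> + \<gamma> * (- (\<integral>x. entropy_density \<psi> x \<partial>lebesgue))"
proof -
  let ?C = "mopt (\<lambda>_ :: real ^ 'n. 0) 2 3 1"
  let ?d = "real CARD('n)"
  have H: "\<psi> \<in> H1_mag A" "\<not> ae_zero \<psi>" "integrable lebesgue (entropy_density \<psi>)" using \<psi> by (auto simp: ent_adm_def)
  note L2 = H1_magD(1)[OF A H(1)]
  define N where "N = nq 2 \<psi>"
  define X where "X = energy A \<psi>"
  \<comment> \<open>The field-free scaling for a = 2 is parametrised by \<sigma>^2, which is here 3
    \<gamma>.\<close>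
  define \<sigma> where "\<sigma> = sqrt (3 * \<gamma>)"
  have N: "0 < N" unfolding N_def by (rule ent_adm_pos[OF A \<psi>])
  have X: "0 \<le> X" by (simp add: X_def)
  have \<sigma>: "0 < \<sigma>" "\<sigma>\<^sup>2 = 3 * \<gamma>" using \<gamma> by (simp_all add: \<sigma>_def)
  have n3: "0 < nq 3 \<psi>" by (rule nq_pos[OF subsetD[OF L3 H(1)] _ H(2)]) simp
  have adm: "\<psi> \<in> adm A 2 3" using H L2 subsetD[OF L3] by (simp add: adm_def)
  have "?C * \<sigma> powr (2 - ?d + 2 * ?d / 3) * nq 3 \<psi> \<le> X + \<sigma>\<^sup>2 * N"
  proof -
    have "?C * \<sigma> powr (2 - ?d + 2 * ?d / 3) \<le> mopt A 2 3 (\<sigma> powr (2 - ?d + 2 * ?d / 2))"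
      by (rule mopt_lower[OF A _ _ _ \<sigma>(1)]) (use adm in auto)
    then have "?C * \<sigma> powr (2 - ?d + 2 * ?d / 3) \<le> mopt A 2 3 (\<sigma>\<^sup>2)" using \<sigma>(1) by simp
    then have "?C * \<sigma> powr (2 - ?d + 2 * ?d / 3) * nq 3 \<psi> \<le> mopt A 2 3 (\<sigma>\<^sup>2) * nq 3 \<psi>" using n3 by (intro mult_right_mono) auto
    also have "\<dots> \<le> X + \<sigma>\<^sup>2 * N"
      unfolding mopt_def X_def N_def by (rule affine_inf_mult_le[OF adm, of _ 0]) (use adm_pos[of 3] in auto)
    finally show ?thesis .
  qed
  then have "ln (?C * \<sigma> powr (2 - ?d + 2 * ?d / 3) * nq 3 \<psi>) \<le> ln (X + \<sigma>\<^sup>2 * N)"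
    using C \<sigma>(1) n3 by (subst ln_le_cancel_iff) (auto intro: less_le_trans[rotated])
  moreover have "ln (?C * \<sigma> powr (2 - ?d + 2 * ?d / 3) * nq 3 \<psi>) = ln ?C + (2 - ?d / 3) * ln \<sigma> + ln (nq 3 \<psi>)"
    using C \<sigma>(1) n3 by (simp add: ln_mult ln_powr)
  \<comment> \<open>The logarithm is linearised around \<sigma>^2 N, the value without energy. The
    resulting X / (\<sigma>^2 N), multiplied by the factor 3 N of \<open>entropy_le_L3\<close>, is X
    / \<gamma>.\<close>
  moreover have "ln (X + \<sigma>\<^sup>2 * N) \<le> 2 * ln \<sigma> + ln N + X / (\<sigma>\<^sup>2 * N)"
  proof -
    have "X + \<sigma>\<^sup>2 * N = (\<sigma>\<^sup>2 * N) * (1 + X / (\<sigma>\<^sup>2 * N))" using \<sigma>(1) N by (simp add: field_simps)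
    moreover have "0 \<le> X / (\<sigma>\<^sup>2 * N)" using X N by simp
    ultimately have "ln (X + \<sigma>\<^sup>2 * N) = ln (\<sigma>\<^sup>2 * N) + ln (1 + X / (\<sigma>\<^sup>2 * N))"
      using \<sigma>(1) N by (simp only:) (rule ln_mult_pos, auto)
    also have "ln (1 + X / (\<sigma>\<^sup>2 * N)) \<le> X / (\<sigma>\<^sup>2 * N)" using X N by (intro ln_add_one_self_le_self) simp
    also have "ln (\<sigma>\<^sup>2 * N) = 2 * ln \<sigma> + ln N" using \<sigma>(1) N by (simp add: ln_mult ln_realpow)
    finally show ?thesis by simp
  qed
  ultimately have "ln (nq 3 \<psi>) - ln N \<le> X / (\<sigma>\<^sup>2 * N) + ?d / 3 * ln \<sigma> - ln ?C" by (simp add: algebra_simps)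
  then have "ln (nq 3 \<psi> / N) \<le> X / (\<sigma>\<^sup>2 * N) + ?d / 3 * ln \<sigma> - ln ?C" using n3 N by (simp add: ln_div)
  then have "3 * N * ln (nq 3 \<psi> / N) \<le> 3 * N * (X / (\<sigma>\<^sup>2 * N) + ?d / 3 * ln \<sigma> - ln ?C)"
    using N by (intro mult_left_mono) auto
  then have "(\<integral>x. entropy_density \<psi> x \<partial>lebesgue) \<le> 3 * N * (X / (\<sigma>\<^sup>2 * N) + ?d / 3 * ln \<sigma> - ln ?C)"
    using entropy_le_L3[OF L2 subsetD[OF L3 H(1)] H(2,3)] unfolding N_def by linarith
  also have "3 * N * (X / (\<sigma>\<^sup>2 * N) + ?d / 3 * ln \<sigma> - ln ?C) = X / \<gamma> + N * (?d / 2 * ln (3 * \<gamma>) - 3 * ln ?C)"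
  proof -
    have "ln \<sigma> = ln (3 * \<gamma>) / 2" using \<gamma> by (simp add: \<sigma>_def ln_sqrt)
    then show ?thesis using N \<gamma> unfolding \<sigma>(2) by (simp add: field_simps)
  qed
  finally have "\<gamma> * (\<integral>x. entropy_density \<psi> x \<partial>lebesgue) \<le> \<gamma> * (X / \<gamma> + N * (?d / 2 * ln (3 * \<gamma>) - 3 * ln ?C))"
    using \<gamma> by (intro mult_left_mono) auto
  also have "\<dots> = X + \<gamma> * (?d / 2 * ln (3 * \<gamma>) - 3 * ln ?C) * N" using \<gamma> by (simp add: distrib_left mult_ac)
  finally show ?thesis by (simp add: X_def N_def)
qed

text \<open>For \<gamma> > 0 an entropy of - infinity makes the constraint void, and null functions
  give 0 on both sides, so c is constrained only by functions with integrable entropy.\<close>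

lemma xi_mag_eq:
  fixes A :: "real ^ 'n \<Rightarrow> real ^ 'n"
  assumes A: "A \<in> borel_measurable lebesgue" and L3: "H1_mag A \<subseteq> Lspace 3"
    and T: "ent_adm A \<noteq> {}" and \<gamma>: "0 < \<gamma>"
    and k: "\<And>t. t \<in> ent_adm A \<Longrightarrow> k * nq 2 t \<le> energy A t + \<gamma> * (- (\<integral>x. entropy_density t x \<partial>lebesgue))"
  shows "xi_mag A \<gamma> = ereal (xi_opt A \<gamma>)"
  unfolding xi_mag_def xi_opt_def
proof (rule optimal_constant_eq_affine_inf[OF T _ k])
  show "0 < nq 2 t" if "t \<in> ent_adm A" for t by (rule ent_adm_pos[OF A that])
  fix c
  have eq: "ereal \<gamma> * entropy_integral \<psi> + ereal c * (Lnorm 2 \<psi>)\<^sup>2 \<le> (Lnorm 2 (mag_gradient A \<psi>))\<^sup>2 \<longleftrightarrow>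
    (\<psi> \<in> ent_adm A \<longrightarrow> c * nq 2 \<psi> \<le> energy A \<psi> + \<gamma> * (- (\<integral>x. entropy_density \<psi> x \<partial>lebesgue)))"
    if \<psi>: "\<psi> \<in> H1_mag A" for \<psi>
  proof (cases "ae_zero \<psi>")
    case True
    then have "nq 2 \<psi> = 0" using nq_zero[of \<psi> 2] H1_magD(1)[OF A \<psi>] by (simp add: Lspace_iff)
    then show ?thesis using True H1_magD[OF A \<psi>] by (simp add: ent_adm_def Lnorm_sq entropy_integral_zero)
  next
    case False
    show ?thesis
      using False \<gamma> H1_magD[OF A \<psi>] \<psi> entropy_integral_eq[OF H1_magD(1)[OF A \<psi>] subsetD[OF L3 \<psi>] False]
      by (cases "integrable lebesgue (entropy_density \<psi>)") (auto simp: ent_adm_def Lnorm_sq)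
  qed
  show "(\<forall>\<psi>\<in>H1_mag A. ereal \<gamma> * entropy_integral \<psi> + ereal c * (Lnorm 2 \<psi>)\<^sup>2 \<le> (Lnorm 2 (mag_gradient A \<psi>))\<^sup>2)
     \<longleftrightarrow> (\<forall>t\<in>ent_adm A. c * nq 2 t \<le> energy A t + \<gamma> * (- (\<integral>x. entropy_density t x \<partial>lebesgue)))"
    using eq by (auto simp: ent_adm_def)
qed

text \<open>Concavity gives continuity in the interior, and the chord from 0 to 1 gives the lower
  estimate at the end point. A concave function may still jump upwards just to the right of 0, which
  assumption \<open>u\<close> excludes.\<close>

lemma concave_on_continuous_Ici:
  fixes f :: "real \<Rightarrow> real"
  assumes c: "concave_on {0..} f" and u: "\<And>a. f 0 < a \<Longrightarrow> \<forall>\<^sub>F x in at_right 0. f x < a"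
  shows "continuous_on {0..} f"
proof -
  have "concave_on {0<..} f" using c by (auto simp: concave_on_iff convex_real_interval)
  then have "continuous_on {0<..} (\<lambda>x. - f x)"
    unfolding concave_on_def by (intro convex_on_continuous) auto
  then have "continuous_on {0<..} (\<lambda>x. - (- f x))" by (rule continuous_on_minus)
  then have pos: "isCont f x" if "x > 0" for x
    using that by (simp add: continuous_on_eq_continuous_at)
  have "(f \<longlongrightarrow> f 0) (at_right 0)"
  proof (rule order_tendstoI)
    fix a assume a: "a < f 0"
    have "((\<lambda>x. (1 - x) * f 0 + x * f 1) \<longlongrightarrow> (1 - 0) * f 0 + 0 * f 1) (at_right 0)" by (intro tendsto_intros)
    then have "\<forall>\<^sub>F x in at_right 0. a < (1 - x) * f 0 + x * f 1" using a by (intro order_tendstoD(1)) auto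
    moreover have "\<forall>\<^sub>F x::real in at_right 0. x < 1" by (rule order_tendstoD(2)[OF tendsto_ident_at]) simp
    moreover note eventually_at_right_less[of "0 :: real"]
    ultimately show "\<forall>\<^sub>F x in at_right 0. a < f x"
    proof eventually_elim
      case (elim x)
      have "(1 - x) * f 0 + x * f 1 \<le> f ((1 - x) *\<^sub>R 0 + x *\<^sub>R 1)"
        by (rule concave_onD[OF c]) (use elim in auto)
      then show ?case using elim by simp
    qed
  qed (rule u)
  then have zero: "continuous (at 0 within {0..}) f" by (simp add: continuous_within at_within_Ici_at_right)
  show ?thesis
    unfolding continuous_on_eq_continuous_within
  proof
    fix x :: real assume "x \<in> {0..}"
    then consider "x = 0" | "x > 0" by fastforce
    then show "continuous (at x within {0..}) f"
      using zero continuous_at_imp_continuous_at_within[OF pos] by cases auto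
  qed
qed

subsection \<open>The hypotheses on the potential and the logarithmic constant\<close>

text \<open>On the support of the dilated profile \<sigma> |x| \<le> R, so the exponential weight is
  at least e^(-R) there and the squared profile is at most M^2 e^R times the weight.\<close>

lemma concentrates_exp:
  fixes A :: "real ^ 'n \<Rightarrow> real ^ 'n"
  assumes [measurable]: "A \<in> borel_measurable lebesgue"
    and lim: "((\<lambda>\<sigma>::real. ennreal (\<sigma> powr (real CARD('n) - 2)) *
      (\<integral>\<^sup>+ x. ennreal ((norm (A x))\<^sup>2 * exp (- \<sigma> * norm x)) \<partial>lebesgue)) \<longlongrightarrow> 0) at_top"
  shows "concentrates A"
  unfolding concentrates_def
proof (intro allI impI)
  fix u :: "real ^ 'n \<Rightarrow> complex" and M R :: real
  assume M: "\<forall>x. norm (u x) \<le> M" and R: "\<forall>x. norm x > R \<longrightarrow> u x = 0"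
  have [measurable]: "(\<lambda>x :: real ^ 'n. x) \<in> borel_measurable lebesgue" by (rule measurable_completion) simp
  let ?J = "\<lambda>\<sigma>. \<integral>\<^sup>+ x. ennreal ((norm (A x))\<^sup>2 * exp (- \<sigma> * norm x)) \<partial>lebesgue"
  let ?I = "\<lambda>\<sigma>. \<integral>\<^sup>+ x. ennreal ((norm (A x))\<^sup>2 * (norm (u (\<sigma> *\<^sub>R x)))\<^sup>2) \<partial>lebesgue"
  let ?K = "M\<^sup>2 * exp R"
  have le: "?I \<sigma> \<le> ennreal ?K * ?J \<sigma>" if \<sigma>: "0 < \<sigma>" for \<sigma>
  proof -
    have "?I \<sigma> \<le> (\<integral>\<^sup>+ x. ennreal ?K * ennreal ((norm (A x))\<^sup>2 * exp (- \<sigma> * norm x)) \<partial>lebesgue)"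
    proof (rule nn_integral_mono)
      fix x
      have "(norm (u (\<sigma> *\<^sub>R x)))\<^sup>2 \<le> ?K * exp (- \<sigma> * norm x)"
      proof (cases "\<sigma> * norm x \<le> R")
        case True
        have "(norm (u (\<sigma> *\<^sub>R x)))\<^sup>2 * 1 \<le> M\<^sup>2 * exp (R - \<sigma> * norm x)"
          using M True by (intro mult_mono power_mono) auto
        then show ?thesis by (simp add: exp_diff exp_minus field_simps)
      qed (use R \<sigma> in simp)
      then have "(norm (A x))\<^sup>2 * (norm (u (\<sigma> *\<^sub>R x)))\<^sup>2 \<le> (norm (A x))\<^sup>2 * (?K * exp (- \<sigma> * norm x))"
        by (rule mult_left_mono) simp
      then show "ennreal ((norm (A x))\<^sup>2 * (norm (u (\<sigma> *\<^sub>R x)))\<^sup>2) \<le> ennreal ?K * ennreal ((norm (A x))\<^sup>2 * exp (- \<sigma> * norm x))"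
        by (subst ennreal_mult[symmetric]) (auto intro!: ennreal_leI simp: mult_ac)
    qed
    also have "\<dots> = ennreal ?K * ?J \<sigma>" by (rule nn_integral_cmult) measurable
    finally show ?thesis .
  qed
  show "((\<lambda>\<sigma>. ennreal (\<sigma> powr (real CARD('n) - 2)) * ?I \<sigma>) \<longlongrightarrow> 0) at_top"
  proof (rule tendsto_sandwich[OF _ _ tendsto_const])
    show "((\<lambda>\<sigma>. ennreal ?K * (ennreal (\<sigma> powr (real CARD('n) - 2)) * ?J \<sigma>)) \<longlongrightarrow> 0) at_top"
      using ennreal_tendsto_cmult[OF _ lim, of "ennreal ?K"] by simp
    show "\<forall>\<^sub>F \<sigma> in at_top. ennreal (\<sigma> powr (real CARD('n) - 2)) * ?I \<sigma> \<le> ennreal ?K * (ennreal (\<sigma> powr (real CARD('n) - 2)) * ?J \<sigma>)"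
      using eventually_gt_at_top[of 0]
    proof eventually_elim
      case (elim \<sigma>)
      have "ennreal (\<sigma> powr (real CARD('n) - 2)) * ?I \<sigma> \<le> ennreal (\<sigma> powr (real CARD('n) - 2)) * (ennreal ?K * ?J \<sigma>)"
        by (rule mult_left_mono[OF le[OF elim]]) simp
      then show ?case by (simp only: mult.left_commute)
    qed
  qed simp
qed

text \<open>The dilated profile lives in the ball of radius R / \<sigma>. The hypothesis at the
  parameter \<sigma> / b covers this ball, and the power of \<sigma> changes only by the factor
  b^(d-2).\<close>

lemma concentrates_ball:
  fixes A :: "real ^ 'n \<Rightarrow> real ^ 'n"
  assumes [measurable]: "A \<in> borel_measurable lebesgue"
    and lim: "((\<lambda>\<sigma>::real. ennreal (\<sigma> powr (real CARD('n) - 2)) *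
      (\<integral>\<^sup>+ x \<in> {x. norm x < 1 / \<sigma>}. ennreal ((norm (A x))\<^sup>2) \<partial>lebesgue)) \<longlongrightarrow> 0) at_top"
  shows "concentrates A"
  unfolding concentrates_def
proof (intro allI impI)
  fix u :: "real ^ 'n \<Rightarrow> complex" and M R :: real
  assume M: "\<forall>x. norm (u x) \<le> M" and R: "\<forall>x. norm x > R \<longrightarrow> u x = 0"
  \<comment> \<open>Larger than R, so that the closed ball carrying the profile fits into the open
    one of the hypothesis, and positive also when R is negative.\<close>
  define b where "b = max R 0 + 1"
  have b: "0 < b" "R < b" by (auto simp: b_def)
  let ?d = "real CARD('n) - 2"
  let ?J = "\<lambda>\<sigma>. \<integral>\<^sup>+ x \<in> {x. norm x < 1 / \<sigma>}. ennreal ((norm (A x))\<^sup>2) \<partial>lebesgue"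
  let ?I = "\<lambda>\<sigma>. \<integral>\<^sup>+ x. ennreal ((norm (A x))\<^sup>2 * (norm (u (\<sigma> *\<^sub>R x)))\<^sup>2) \<partial>lebesgue"
  have le: "?I \<sigma> \<le> ennreal (M\<^sup>2) * ?J (1 / b * \<sigma>)" if \<sigma>: "0 < \<sigma>" for \<sigma>
  proof -
    have [measurable]: "{x :: real ^ 'n. norm x < 1 / (1 / b * \<sigma>)} \<in> sets lebesgue"
      by (intro sets_completionI_sets) simp
    have "?I \<sigma> \<le> (\<integral>\<^sup>+ x. ennreal (M\<^sup>2) * (ennreal ((norm (A x))\<^sup>2) * indicator {x. norm x < 1 / (1 / b * \<sigma>)} x) \<partial>lebesgue)"
    proof (rule nn_integral_mono)
      fix x :: "real ^ 'n"
      show "ennreal ((norm (A x))\<^sup>2 * (norm (u (\<sigma> *\<^sub>R x)))\<^sup>2) \<le> ennreal (M\<^sup>2) * (ennreal ((norm (A x))\<^sup>2) * indicator {x. norm x < 1 / (1 / b * \<sigma>)} x)"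
      proof (cases "\<sigma> * norm x \<le> R")
        case True
        then have "norm x < 1 / (1 / b * \<sigma>)" using b \<sigma> by (simp add: field_simps)
        moreover have "(norm (A x))\<^sup>2 * (norm (u (\<sigma> *\<^sub>R x)))\<^sup>2 \<le> (norm (A x))\<^sup>2 * M\<^sup>2"
          using M by (intro mult_left_mono power_mono) auto
        ultimately show ?thesis by (simp add: ennreal_mult[symmetric] mult.commute ennreal_leI)
      qed (use R \<sigma> in simp)
    qed
    also have "\<dots> = ennreal (M\<^sup>2) * ?J (1 / b * \<sigma>)" by (rule nn_integral_cmult) measurable
    finally show ?thesis .
  qed
  let ?K = "b powr ?d * M\<^sup>2"
  have fl: "filterlim (\<lambda>\<sigma>::real. 1 / b * \<sigma>) at_top at_top"
    using b by (intro filterlim_tendsto_pos_mult_at_top[OF tendsto_const]) (auto simp: filterlim_ident)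
  show "((\<lambda>\<sigma>. ennreal (\<sigma> powr ?d) * ?I \<sigma>) \<longlongrightarrow> 0) at_top"
  proof (rule tendsto_sandwich[OF _ _ tendsto_const])
    show "((\<lambda>\<sigma>. ennreal ?K * (ennreal ((1 / b * \<sigma>) powr ?d) * ?J (1 / b * \<sigma>))) \<longlongrightarrow> 0) at_top"
      using ennreal_tendsto_cmult[OF _ filterlim_compose[OF lim fl], of "ennreal ?K"] by simp
    show "\<forall>\<^sub>F \<sigma> in at_top. ennreal (\<sigma> powr ?d) * ?I \<sigma> \<le> ennreal ?K * (ennreal ((1 / b * \<sigma>) powr ?d) * ?J (1 / b * \<sigma>))"
      using eventually_gt_at_top[of 0]
    proof eventually_elim
      case (elim \<sigma>)
      have "\<sigma> powr ?d = b powr ?d * (1 / b * \<sigma>) powr ?d"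
        using b elim by (subst powr_mult[symmetric]) auto
      then have e: "ennreal (\<sigma> powr ?d) * ennreal (M\<^sup>2) = ennreal ?K * ennreal ((1 / b * \<sigma>) powr ?d)"
        by (simp only: ennreal_mult[symmetric] powr_ge_zero zero_le_power2 mult_nonneg_nonneg) (simp only: mult_ac)
      have "ennreal (\<sigma> powr ?d) * ?I \<sigma> \<le> ennreal (\<sigma> powr ?d) * (ennreal (M\<^sup>2) * ?J (1 / b * \<sigma>))"
        by (rule mult_left_mono[OF le[OF elim]]) simp
      also have "\<dots> = ennreal ?K * (ennreal ((1 / b * \<sigma>) powr ?d) * ?J (1 / b * \<sigma>))"
        unfolding mult.assoc[symmetric] e ..
      finally show ?case .
    qed
  qed simp
qed

text \<open>Dilation by sqrt \<gamma> matches the Gaussian, which is at least e^(-R^2) where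
  \<gamma> |x|^2 \<le> R^2. The rescaled additional energy is only shown to be o(ln \<gamma>), which
  is still small against the entropy gained by concentration.\<close>

lemma gaussian_concentration:
  fixes A :: "real ^ 'n \<Rightarrow> real ^ 'n" and u :: "real ^ 'n \<Rightarrow> complex"
  assumes [measurable]: "A \<in> borel_measurable lebesgue"
    and lim: "((\<lambda>\<sigma>::real. ennreal (\<sigma> powr (real CARD('n) / 2 - 1) / ln \<sigma>) *
      (\<integral>\<^sup>+ x. ennreal ((norm (A x))\<^sup>2 * exp (- \<sigma> * (norm x)\<^sup>2)) \<partial>lebesgue)) \<longlongrightarrow> 0) at_top"
    and M: "\<And>x. norm (u x) \<le> M" and R: "\<And>x. norm x > R \<Longrightarrow> u x = 0"
  shows "((\<lambda>\<gamma>. \<gamma> powr (real CARD('n) / 2 - 1) / ln \<gamma> *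
      enn2real (\<integral>\<^sup>+ x. ennreal ((norm (A x))\<^sup>2 * (norm (u (sqrt \<gamma> *\<^sub>R x)))\<^sup>2) \<partial>lebesgue)) \<longlongrightarrow> 0) at_top"
proof -
  have [measurable]: "(\<lambda>x :: real ^ 'n. x) \<in> borel_measurable lebesgue" by (rule measurable_completion) simp
  let ?J = "\<lambda>\<sigma>. \<integral>\<^sup>+ x. ennreal ((norm (A x))\<^sup>2 * exp (- \<sigma> * (norm x)\<^sup>2)) \<partial>lebesgue"
  let ?I = "\<lambda>\<gamma>. \<integral>\<^sup>+ x. ennreal ((norm (A x))\<^sup>2 * (norm (u (sqrt \<gamma> *\<^sub>R x)))\<^sup>2) \<partial>lebesgue"
  let ?K = "M\<^sup>2 * exp (R\<^sup>2)"
  let ?c = "\<lambda>\<gamma>::real. \<gamma> powr (real CARD('n) / 2 - 1) / ln \<gamma>"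
  have le: "?I \<gamma> \<le> ennreal ?K * ?J \<gamma>" if \<gamma>: "0 < \<gamma>" for \<gamma>
  proof -
    have "?I \<gamma> \<le> (\<integral>\<^sup>+ x. ennreal ?K * ennreal ((norm (A x))\<^sup>2 * exp (- \<gamma> * (norm x)\<^sup>2)) \<partial>lebesgue)"
    proof (rule nn_integral_mono)
      fix x
      have "(norm (u (sqrt \<gamma> *\<^sub>R x)))\<^sup>2 \<le> ?K * exp (- \<gamma> * (norm x)\<^sup>2)"
      proof (cases "norm (sqrt \<gamma> *\<^sub>R x) \<le> R")
        case True
        then have "(norm (sqrt \<gamma> *\<^sub>R x))\<^sup>2 \<le> R\<^sup>2" by (intro power_mono) auto
        then have "\<gamma> * (norm x)\<^sup>2 \<le> R\<^sup>2" using \<gamma> by (simp add: power_mult_distrib)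
        then have "(norm (u (sqrt \<gamma> *\<^sub>R x)))\<^sup>2 * 1 \<le> M\<^sup>2 * exp (R\<^sup>2 - \<gamma> * (norm x)\<^sup>2)"
          using M by (intro mult_mono power_mono) auto
        then show ?thesis by (simp add: exp_diff exp_minus field_simps)
      qed (use R[of "sqrt \<gamma> *\<^sub>R x"] in simp)
      then have "(norm (A x))\<^sup>2 * (norm (u (sqrt \<gamma> *\<^sub>R x)))\<^sup>2 \<le> (norm (A x))\<^sup>2 * (?K * exp (- \<gamma> * (norm x)\<^sup>2))"
        by (rule mult_left_mono) simp
      then show "ennreal ((norm (A x))\<^sup>2 * (norm (u (sqrt \<gamma> *\<^sub>R x)))\<^sup>2) \<le> ennreal ?K * ennreal ((norm (A x))\<^sup>2 * exp (- \<gamma> * (norm x)\<^sup>2))"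
        by (subst ennreal_mult[symmetric]) (auto intro!: ennreal_leI simp: mult_ac)
    qed
    also have "\<dots> = ennreal ?K * ?J \<gamma>" by (rule nn_integral_cmult) measurable
    finally show ?thesis .
  qed
  have "((\<lambda>\<gamma>. ennreal (?c \<gamma>) * ?I \<gamma>) \<longlongrightarrow> 0) at_top"
  proof (rule tendsto_sandwich[OF _ _ tendsto_const])
    show "((\<lambda>\<gamma>. ennreal ?K * (ennreal (?c \<gamma>) * ?J \<gamma>)) \<longlongrightarrow> 0) at_top"
      using ennreal_tendsto_cmult[OF _ lim, of "ennreal ?K"] by simp
    show "\<forall>\<^sub>F \<gamma> in at_top. ennreal (?c \<gamma>) * ?I \<gamma> \<le> ennreal ?K * (ennreal (?c \<gamma>) * ?J \<gamma>)"
      using eventually_gt_at_top[of 0]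
    proof eventually_elim
      case (elim \<gamma>)
      have "ennreal (?c \<gamma>) * ?I \<gamma> \<le> ennreal (?c \<gamma>) * (ennreal ?K * ?J \<gamma>)"
        by (rule mult_left_mono[OF le[OF elim]]) simp
      then show ?case by (simp only: mult.left_commute)
    qed
  qed simp
  then have "((\<lambda>\<gamma>. enn2real (ennreal (?c \<gamma>) * ?I \<gamma>)) \<longlongrightarrow> 0) at_top"
    by (intro tendsto_enn2real) auto
  then show ?thesis
  proof (rule Lim_transform_eventually)
    show "\<forall>\<^sub>F \<gamma> in at_top. enn2real (ennreal (?c \<gamma>) * ?I \<gamma>) = ?c \<gamma> * enn2real (?I \<gamma>)"
      \<comment> \<open>Beyond 1 the prefactor is positive; below 1 the logarithm is negative and
        \<open>ennreal\<close> would cut the prefactor to 0.\<close>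
      using eventually_gt_at_top[of 1] by eventually_elim (simp add: enn2real_mult)
  qed
qed

lemma integrable_affine:
  fixes t :: "real ^ 'n" and f :: "real ^ 'n \<Rightarrow> 'b::euclidean_space"
  assumes "c \<noteq> 0" and f: "integrable lebesgue f"
  shows "integrable lebesgue (\<lambda>x. f (t + c *\<^sub>R x))"
proof -
  have [measurable]: "f \<in> borel_measurable lebesgue" using f by simp
  note [measurable] = measurable_affine[OF assms(1), of f t]
  have "(\<integral>\<^sup>+x. ennreal (norm (f x)) \<partial>lebesgue) = ennreal (\<bar>c\<bar> ^ CARD('n)) * (\<integral>\<^sup>+x. ennreal (norm (f (t + c *\<^sub>R x))) \<partial>lebesgue)"
    by (rule nn_integral_affine[OF assms(1)]) measurable
  moreover have "(\<integral>\<^sup>+x. ennreal (norm (f x)) \<partial>lebesgue) < \<infinity>" using f by (simp add: integrable_iff_bounded)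
  ultimately show ?thesis
    using assms(1) by (auto simp: integrable_iff_bounded ennreal_mult_less_top)
qed

text \<open>Inside the logarithm only the normalising mass changes: it is divided by \<sigma>^d,
  which adds d ln \<sigma> times the mass. The volume factor \<sigma>^(-d) comes from the change of
  variables.\<close>

lemma entropy_dilation:
  fixes u :: "real ^ 'n \<Rightarrow> complex"
  assumes u: "u \<in> Lspace 2" "0 < nq 2 u" and i: "integrable lebesgue (entropy_density u)" and \<sigma>: "\<sigma> > 0"
  shows "integrable lebesgue (entropy_density (\<lambda>x. u (\<sigma> *\<^sub>R x)))"
    "(\<integral>x. entropy_density (\<lambda>x. u (\<sigma> *\<^sub>R x)) x \<partial>lebesgue)
      = \<sigma> powr (- real CARD('n)) * ((\<integral>x. entropy_density u x \<partial>lebesgue) + real CARD('n) * ln \<sigma> * nq 2 u)"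
proof -
  let ?d = "real CARD('n)"
  let ?f = "\<lambda>x. entropy_density u x + ?d * ln \<sigma> * (norm (u x))\<^sup>2"
  have "entropy_density (\<lambda>x. u (\<sigma> *\<^sub>R x)) x = ?f (0 + \<sigma> *\<^sub>R x)" for x
  proof (cases "u (\<sigma> *\<^sub>R x) = 0")
    case False
    have "nq 2 (\<lambda>x. u (\<sigma> *\<^sub>R x)) = \<sigma> powr (- ?d) * nq 2 u" using nq_dilation[OF u(1) _ \<sigma>] by simp
    then have "ln ((norm (u (\<sigma> *\<^sub>R x)))\<^sup>2 / nq 2 (\<lambda>x. u (\<sigma> *\<^sub>R x))) = ln ((norm (u (\<sigma> *\<^sub>R x)))\<^sup>2 / nq 2 u) + ?d * ln \<sigma>"
      using False u(2) \<sigma> by (simp add: ln_div ln_mult ln_powr)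
    then show ?thesis
      unfolding entropy_density_eq[OF Lspace_dilation[OF u(1) \<sigma>]] entropy_density_eq[OF u(1)] by (simp add: algebra_simps)
  qed (simp add: entropy_density_def)
  then have eq: "entropy_density (\<lambda>x. u (\<sigma> *\<^sub>R x)) = (\<lambda>x. ?f (0 + \<sigma> *\<^sub>R x))" by blast
  have f: "integrable lebesgue ?f" using i Lspace_2_integrable(1)[OF u(1)] by simp
  show "integrable lebesgue (entropy_density (\<lambda>x. u (\<sigma> *\<^sub>R x)))"
    unfolding eq by (rule integrable_affine[OF _ f]) (use \<sigma> in simp)
  have "\<sigma> ^ CARD('n) * (\<integral>x. ?f (0 + \<sigma> *\<^sub>R x) \<partial>lebesgue) = (\<integral>x. ?f x \<partial>lebesgue)"
    using integral_affine[of \<sigma> ?f 0] f \<sigma> by simp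
  also have "\<dots> = (\<integral>x. entropy_density u x \<partial>lebesgue) + ?d * ln \<sigma> * nq 2 u"
    using i Lspace_2_integrable[OF u(1)] by simp
  finally have "\<sigma> powr ?d * (\<integral>x. ?f (0 + \<sigma> *\<^sub>R x) \<partial>lebesgue) = (\<integral>x. entropy_density u x \<partial>lebesgue) + ?d * ln \<sigma> * nq 2 u"
    using \<sigma> by (simp add: powr_realpow)
  then show "(\<integral>x. entropy_density (\<lambda>x. u (\<sigma> *\<^sub>R x)) x \<partial>lebesgue) = \<sigma> powr (- ?d) * ((\<integral>x. entropy_density u x \<partial>lebesgue) + ?d * ln \<sigma> * nq 2 u)"
    unfolding eq using \<sigma> by (simp add: powr_minus field_simps)
qed

section \<open>The logarithmic constant: regularity and growth\<close>

lemma xi_opt_properties: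
  fixes A :: "real ^ 'n \<Rightarrow> real ^ 'n"
  assumes dim: "CARD('n) = 2 \<or> CARD('n) = 3" and A2: "A \<in> Lspace_loc 2"
    and Lam: "Lambda_mag A = ereal \<Lambda>"
    and ineq: "\<forall>\<psi>\<in>H1_mag A. \<Lambda> * nq 2 \<psi> \<le> energy A \<psi>"
    and \<psi>0: "\<psi>0 \<in> H1_mag A" "\<not> ae_zero \<psi>0" "energy A \<psi>0 = \<Lambda> * nq 2 \<psi>0"
  shows "\<And>\<gamma>. 0 \<le> \<gamma> \<Longrightarrow> xi_mag A \<gamma> = ereal (xi_opt A \<gamma>)"
    "continuous_on {0..} (xi_opt A)" "concave_on {0..} (xi_opt A)"
    "0 < mopt (\<lambda>_ :: real ^ 'n. 0) 2 3 1" "adm (\<lambda>_ :: real ^ 'n. 0) 2 3 \<noteq> {}" "ent_adm A \<noteq> {}"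
    "H1_mag A \<subseteq> Lspace 3"
proof -
  have A: "A \<in> borel_measurable lebesgue" using A2 by (simp add: Lspace_loc_def)
  have p: "(2::real) < 3" "ereal 3 < critical_exponent CARD('n)" using dim by (auto simp: critical_exponent_def)
  show L3: "H1_mag A \<subseteq> Lspace 3" using H1_mag_Lspace_subcritical[OF dim A p] by blast
  have "\<psi>0 \<in> adm A 2 3" using \<psi>0 L3 H1_magD(1)[OF A] by (auto simp: adm_def)
  then show T0: "adm (\<lambda>_ :: real ^ 'n. 0) 2 3 \<noteq> {}" using norm_in_adm[OF A] by blast
  show C: "0 < mopt (\<lambda>_ :: real ^ 'n. 0) 2 3 1" by (rule free_mopt_pos[OF dim p T0])
  have near: "\<exists>t\<in>ent_adm A. energy A t < (\<Lambda> + \<epsilon>) * nq 2 t" if \<epsilon>: "\<epsilon> > 0" for \<epsilon>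
  proof -
    obtain w R where w: "w \<in> H1_mag A" "\<not> ae_zero w" "\<forall>x. norm x > R \<longrightarrow> w x = 0" "energy A w < (\<Lambda> + \<epsilon>) * nq 2 w"
      using compact_near_ground_state[OF A \<psi>0 \<epsilon>] by blast
    have "integrable lebesgue (entropy_density w)"
      by (rule entropy_integrable_bounded_support[OF H1_magD(1)[OF A w(1)] subsetD[OF L3 w(1)] w(2)]) (use w(3) in auto)
    then have "w \<in> ent_adm A" using w by (simp add: ent_adm_def)
    then show ?thesis using w(4) by blast
  qed
  then show T: "ent_adm A \<noteq> {}" using zero_less_one by blast
  let ?S = "\<lambda>t. - (\<integral>x. entropy_density t x \<partial>lebesgue)"
  \<comment> \<open>For \<gamma> > 0 the bound is the logarithmic Sobolev inequality; at 0 it is the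
    sharp spectral bound, from which the value of \<open>xi_opt A 0\<close> is read off.\<close>
  define k where "k \<gamma> = (if \<gamma> = 0 then \<Lambda> else - \<gamma> * (real CARD('n) / 2 * ln (3 * \<gamma>) - 3 * ln (mopt (\<lambda>_ :: real ^ 'n. 0) 2 3 1)))" for \<gamma>
  have k: "k \<gamma> * nq 2 t \<le> energy A t + \<gamma> * ?S t" if "0 \<le> \<gamma>" "t \<in> ent_adm A" for \<gamma> t
  proof (cases "\<gamma> = 0")
    case True
    then show ?thesis using ineq that by (simp add: k_def ent_adm_def)
  next
    case False
    then show ?thesis using log_sobolev[OF A L3 C that(2), of \<gamma>] that(1) by (simp add: k_def)
  qed
  have Z: "\<And>t. t \<in> ent_adm A \<Longrightarrow> 0 < nq 2 t" by (rule ent_adm_pos[OF A])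
  have upper: "xi_opt A \<gamma> \<le> (energy A t + \<gamma> * ?S t) / nq 2 t" if "0 \<le> \<gamma>" "t \<in> ent_adm A" for \<gamma> t
    unfolding xi_opt_def by (rule affine_inf_lower[OF Z k[OF that(1)] that(2)])
  \<comment> \<open>The infimum runs over functions with integrable entropy, and the ground state
    need not be one; compactly supported near ground states show that the value is still
    \<Lambda>.\<close>
  have m0: "xi_opt A 0 = \<Lambda>"
  proof (rule antisym)
    show "\<Lambda> \<le> xi_opt A 0"
      unfolding xi_opt_def using k[of 0] by (intro affine_inf_greatest[OF T Z]) (auto simp: k_def)
    show "xi_opt A 0 \<le> \<Lambda>"
    proof (rule field_le_epsilon)
      fix \<epsilon> :: real assume "\<epsilon> > 0"
      then obtain t where t: "t \<in> ent_adm A" "energy A t < (\<Lambda> + \<epsilon>) * nq 2 t" using near by blast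
      then have "(energy A t + 0 * ?S t) / nq 2 t < \<Lambda> + \<epsilon>" using Z[OF t(1)] by (simp add: pos_divide_less_eq)
      then show "xi_opt A 0 \<le> \<Lambda> + \<epsilon>" using upper[OF order_refl t(1)] by linarith
    qed
  qed
  show "xi_mag A \<gamma> = ereal (xi_opt A \<gamma>)" if "0 \<le> \<gamma>" for \<gamma>
  proof (cases "\<gamma> = 0")
    case True
    have "xi_mag A 0 = Lambda_mag A" by (simp add: xi_mag_def Lambda_mag_def zero_ereal_def[symmetric])
    then show ?thesis using True m0 Lam by simp
  next
    case False
    show ?thesis by (rule xi_mag_eq[OF A L3 T _ k]) (use False that in auto)
  qed
  show conc: "concave_on {0..} (xi_opt A)"
    unfolding xi_opt_def by (rule concave_on_affine_inf[OF _ T Z, where k=k]) (use k in auto)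
  show "continuous_on {0..} (xi_opt A)"
  proof (rule concave_on_continuous_Ici[OF conc])
    fix a assume "xi_opt A 0 < a"
    then have a: "\<Lambda> < a" by (simp add: m0)
    then obtain t where t: "t \<in> ent_adm A" "energy A t < (\<Lambda> + (a - \<Lambda>)) * nq 2 t" using near[of "a - \<Lambda>"] by auto
    have "((\<lambda>\<gamma>. (energy A t + \<gamma> * ?S t) / nq 2 t) \<longlongrightarrow> (energy A t + 0 * ?S t) / nq 2 t) (at_right 0)"
      using Z[OF t(1)] by (intro tendsto_intros) auto
    moreover have "(energy A t + 0 * ?S t) / nq 2 t < a" using t(2) Z[OF t(1)] by (simp add: pos_divide_less_eq)
    ultimately have "\<forall>\<^sub>F \<gamma> in at_right 0. (energy A t + \<gamma> * ?S t) / nq 2 t < a" by (rule order_tendstoD(2))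
    then show "\<forall>\<^sub>F \<gamma> in at_right 0. xi_opt A \<gamma> < a"
      using eventually_at_right_less[of "0 :: real"]
    proof eventually_elim
      case (elim \<gamma>)
      then show ?case using upper[OF less_imp_le[OF elim(2)] t(1)] by linarith
    qed
  qed
qed

text \<open>Both sides are divided by \<gamma> ln \<gamma>, and each quotient tends to - d/2; this
  limit is nonzero, so the ratio of the two tends to 1.\<close>

lemma xi_opt_asymptotics:
  fixes A :: "real ^ 'n \<Rightarrow> real ^ 'n"
  assumes A2: "A \<in> Lspace_loc 2" and L3: "H1_mag A \<subseteq> Lspace 3"
    and C: "0 < mopt (\<lambda>_ :: real ^ 'n. 0) 2 3 1" and T0: "adm (\<lambda>_ :: real ^ 'n. 0) 2 3 \<noteq> {}" and T: "ent_adm A \<noteq> {}"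
    and lim: "((\<lambda>\<sigma>::real. ennreal (\<sigma> powr (real CARD('n) / 2 - 1) / ln \<sigma>) *
      (\<integral>\<^sup>+ x. ennreal ((norm (A x))\<^sup>2 * exp (- \<sigma> * (norm x)\<^sup>2)) \<partial>lebesgue)) \<longlongrightarrow> 0) at_top"
  shows "xi_opt A \<sim>[at_top] (\<lambda>\<gamma>. real CARD('n) / 2 * \<gamma> * ln (pi * (exp 1)\<^sup>2 / \<gamma>))"
proof -
  let ?d = "real CARD('n)"
  let ?C = "mopt (\<lambda>_ :: real ^ 'n. 0) 2 3 1"
  let ?S = "\<lambda>t. - (\<integral>x. entropy_density t x \<partial>lebesgue)"
  have A: "A \<in> borel_measurable lebesgue" using A2 by (simp add: Lspace_loc_def)
  have Z: "\<And>t. t \<in> ent_adm A \<Longrightarrow> 0 < nq 2 t" by (rule ent_adm_pos[OF A])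
  \<comment> \<open>Only the leading order is at stake, so one fixed bounded profile of bounded
    support serves for all \<gamma>; the slack 1 is arbitrary.\<close>
  obtain u :: "real ^ 'n \<Rightarrow> complex" and M R where u: "u \<in> adm (\<lambda>_. 0) 2 3" and M: "\<And>x. norm (u x) \<le> M"
    and R: "\<And>x. norm x > R \<Longrightarrow> u x = 0"
    using free_near_minimizer[OF _ _ T0 zero_less_one] by auto
  have uH: "u \<in> H1" and u2: "u \<in> Lspace 2" and u3: "u \<in> Lspace 3" and uz: "\<not> ae_zero u" using u by (auto simp: adm_def)
  have ui: "integrable lebesgue (entropy_density u)" by (rule entropy_integrable_bounded_support[OF u2 u3 uz]) (rule R)
  define N G E where "N = nq 2 u" and "G = nq 2 (gradient u)" and "E = (\<integral>x. entropy_density u x \<partial>lebesgue)"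
  have N: "0 < N" unfolding N_def by (rule nq_pos[OF u2 _ uz]) simp
  let ?I = "\<lambda>\<gamma>. enn2real (\<integral>\<^sup>+ x. ennreal ((norm (A x))\<^sup>2 * (norm (u (sqrt \<gamma> *\<^sub>R x)))\<^sup>2) \<partial>lebesgue)"
  let ?h = "\<lambda>\<gamma>. \<gamma> powr (?d / 2 - 1) / ln \<gamma> * ?I \<gamma>"
  have h: "(?h \<longlongrightarrow> 0) at_top" by (rule gaussian_concentration[OF A lim M]) (rule R)
  have lower: "- (?d / 2) - (?d / 2 * ln 3 - 3 * ln ?C) * inverse (ln \<gamma>) \<le> xi_opt A \<gamma> / (\<gamma> * ln \<gamma>)" if \<gamma>: "1 < \<gamma>" for \<gamma>
  proof -
    have ln: "0 < ln \<gamma>" using \<gamma> by simp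
    have "- \<gamma> * (?d / 2 * ln (3 * \<gamma>) - 3 * ln ?C) \<le> xi_opt A \<gamma>"
      unfolding xi_opt_def by (rule affine_inf_greatest[OF T Z log_sobolev[OF A L3 C]]) (use \<gamma> in auto)
    then have "- \<gamma> * (?d / 2 * ln (3 * \<gamma>) - 3 * ln ?C) / (\<gamma> * ln \<gamma>) \<le> xi_opt A \<gamma> / (\<gamma> * ln \<gamma>)"
      using \<gamma> ln by (intro divide_right_mono) auto
    also have "- \<gamma> * (?d / 2 * ln (3 * \<gamma>) - 3 * ln ?C) / (\<gamma> * ln \<gamma>) = - (?d / 2) - (?d / 2 * ln 3 - 3 * ln ?C) * inverse (ln \<gamma>)"
      using \<gamma> ln by (simp add: ln_mult field_simps)
    finally show ?thesis .
  qed
  have upper: "xi_opt A \<gamma> / (\<gamma> * ln \<gamma>) \<le> (2 * G - E) / N * inverse (ln \<gamma>) + 2 / N * ?h \<gamma> - ?d / 2" if \<gamma>: "1 < \<gamma>" for \<gamma>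
  proof -
    \<comment> \<open>At scale sqrt \<gamma> the kinetic energy per unit mass is of order \<gamma>,
      while the entropy per unit mass grows like (d/2) ln \<gamma> and produces the leading
      term.\<close>
    define \<sigma> where "\<sigma> = sqrt \<gamma>"
    define P where "P = \<gamma> powr (?d / 2)"
    have ln: "0 < ln \<gamma>" and \<sigma>: "0 < \<sigma>" and P: "0 < P" using \<gamma> by (simp_all add: \<sigma>_def P_def)
    have \<sigma>p: "\<sigma> powr a = \<gamma> powr (a / 2)" for a using \<gamma> by (simp add: \<sigma>_def powr_half_sqrt[symmetric] powr_powr)
    have p1: "\<sigma> powr (- ?d) = 1 / P" "\<sigma> powr (2 - ?d) = \<gamma> / P" "\<gamma> powr (?d / 2 - 1) = P / \<gamma>"
      using \<gamma> by (simp_all add: \<sigma>p P_def powr_minus_divide powr_diff diff_divide_distrib)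
    have ls: "ln \<sigma> = ln \<gamma> / 2" using \<gamma> by (simp add: \<sigma>_def ln_sqrt)
    let ?t = "\<lambda>x. u (\<sigma> *\<^sub>R x)"
    have Nt: "nq 2 ?t = N / P" using nq_dilation[OF u2 _ \<sigma>] by (simp add: N_def p1)
    have St: "(\<integral>x. entropy_density ?t x \<partial>lebesgue) = (E + ?d / 2 * ln \<gamma> * N) / P" and ti: "integrable lebesgue (entropy_density ?t)"
      using entropy_dilation[OF u2 N[unfolded N_def] ui \<sigma>] by (simp_all add: p1 ls E_def N_def)
    have tH: "?t \<in> H1_mag A" by (rule concentrate(1)[OF A2 uH M _ \<sigma>]) (rule R)
    \<comment> \<open>The crude choice \<eta> = 1 doubles terms that, per unit mass, are O(\<gamma>)
      or o(\<gamma> ln \<gamma>), which the leading order does not see.\<close>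
    have "energy A ?t \<le> (1 + 1) * (\<sigma> powr (2 - ?d) * G) + (1 + 1 / 1) * ?I \<gamma>"
      unfolding G_def \<sigma>_def[symmetric] by (rule concentrate(3)[OF A2 uH M _ \<sigma> zero_less_one]) (rule R)
    then have Xt: "energy A ?t \<le> 2 * (\<gamma> / P * G) + 2 * ?I \<gamma>" unfolding p1 by simp
    have "\<not> ae_zero ?t" using nq_zero[of ?t 2] Lspace_dilation[OF u2 \<sigma>] Nt N P by (auto simp: Lspace_iff)
    then have t: "?t \<in> ent_adm A" using tH ti by (simp add: ent_adm_def)
    have "xi_opt A \<gamma> * (N / P) \<le> energy A ?t + \<gamma> * ?S ?t"
      unfolding xi_opt_def Nt[symmetric]
      by (rule affine_inf_mult_le[OF t Z log_sobolev[OF A L3 C]]) (use \<gamma> in auto)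
    also have "\<dots> \<le> 2 * (\<gamma> / P * G) + 2 * ?I \<gamma> - \<gamma> * ((E + ?d / 2 * ln \<gamma> * N) / P)" using Xt by (simp add: St)
    finally have "xi_opt A \<gamma> * (N / P) * (P / (\<gamma> * ln \<gamma> * N))
       \<le> (2 * (\<gamma> / P * G) + 2 * ?I \<gamma> - \<gamma> * ((E + ?d / 2 * ln \<gamma> * N) / P)) * (P / (\<gamma> * ln \<gamma> * N))"
      using \<gamma> ln N P by (intro mult_right_mono) auto
    also have "xi_opt A \<gamma> * (N / P) * (P / (\<gamma> * ln \<gamma> * N)) = xi_opt A \<gamma> / (\<gamma> * ln \<gamma>)" using N P by simp
    also have "(2 * (\<gamma> / P * G) + 2 * ?I \<gamma> - \<gamma> * ((E + ?d / 2 * ln \<gamma> * N) / P)) * (P / (\<gamma> * ln \<gamma> * N))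
      = (2 * G - E) / N * inverse (ln \<gamma>) + 2 / N * ?h \<gamma> - ?d / 2"
      using \<gamma> ln N P unfolding p1 by (simp add: field_simps)
    finally show ?thesis .
  qed
  have inv: "((\<lambda>\<gamma>::real. inverse (ln \<gamma>)) \<longlongrightarrow> 0) at_top" by (rule tendsto_inverse_0_at_top[OF ln_at_top])
  have m: "((\<lambda>\<gamma>. xi_opt A \<gamma> / (\<gamma> * ln \<gamma>)) \<longlongrightarrow> - (?d / 2)) at_top"
  proof (rule tendsto_sandwich)
    have "((\<lambda>\<gamma>. - (?d / 2) - (?d / 2 * ln 3 - 3 * ln ?C) * inverse (ln \<gamma>)) \<longlongrightarrow> - (?d / 2) - (?d / 2 * ln 3 - 3 * ln ?C) * 0) at_top"
      by (intro tendsto_intros inv)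
    then show "((\<lambda>\<gamma>. - (?d / 2) - (?d / 2 * ln 3 - 3 * ln ?C) * inverse (ln \<gamma>)) \<longlongrightarrow> - (?d / 2)) at_top" by simp
    have "((\<lambda>\<gamma>. (2 * G - E) / N * inverse (ln \<gamma>) + 2 / N * ?h \<gamma> - ?d / 2) \<longlongrightarrow> (2 * G - E) / N * 0 + 2 / N * 0 - ?d / 2) at_top"
      by (intro tendsto_intros inv h)
    then show "((\<lambda>\<gamma>. (2 * G - E) / N * inverse (ln \<gamma>) + 2 / N * ?h \<gamma> - ?d / 2) \<longlongrightarrow> - (?d / 2)) at_top" by simp
    show "\<forall>\<^sub>F \<gamma> in at_top. - (?d / 2) - (?d / 2 * ln 3 - 3 * ln ?C) * inverse (ln \<gamma>) \<le> xi_opt A \<gamma> / (\<gamma> * ln \<gamma>)"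
      using eventually_gt_at_top[of 1] by eventually_elim (rule lower)
    show "\<forall>\<^sub>F \<gamma> in at_top. xi_opt A \<gamma> / (\<gamma> * ln \<gamma>) \<le> (2 * G - E) / N * inverse (ln \<gamma>) + 2 / N * ?h \<gamma> - ?d / 2"
      using eventually_gt_at_top[of 1] by eventually_elim (rule upper)
  qed
  \<comment> \<open>The logarithm is ln (pi e^2) - ln \<gamma>, and its constant part disappears
    after division by ln \<gamma>.\<close>
  let ?g = "\<lambda>\<gamma>. ?d / 2 * \<gamma> * ln (pi * (exp 1)\<^sup>2 / \<gamma>)"
  have g: "((\<lambda>\<gamma>. ?g \<gamma> / (\<gamma> * ln \<gamma>)) \<longlongrightarrow> - (?d / 2)) at_top"
  proof (rule Lim_transform_eventually)
    have "((\<lambda>\<gamma>. ?d / 2 * ln (pi * (exp 1)\<^sup>2) * inverse (ln \<gamma>) - ?d / 2) \<longlongrightarrow> ?d / 2 * ln (pi * (exp 1)\<^sup>2) * 0 - ?d / 2) at_top"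
      by (intro tendsto_intros inv)
    then show "((\<lambda>\<gamma>. ?d / 2 * ln (pi * (exp 1)\<^sup>2) * inverse (ln \<gamma>) - ?d / 2) \<longlongrightarrow> - (?d / 2)) at_top" by simp
    show "\<forall>\<^sub>F \<gamma> in at_top. ?d / 2 * ln (pi * (exp 1)\<^sup>2) * inverse (ln \<gamma>) - ?d / 2 = ?g \<gamma> / (\<gamma> * ln \<gamma>)"
      using eventually_gt_at_top[of "1::real"]
    proof eventually_elim
      case (elim \<gamma>)
      define c where "c = pi * (exp 1)\<^sup>2"
      have "0 < c" by (simp add: c_def)
      then have e: "ln (c / \<gamma>) = ln c - ln \<gamma>" using elim by (simp add: ln_div)
      have "0 < ln \<gamma>" using elim by simp
      then show ?case using elim unfolding c_def[symmetric] e by (simp add: field_simps)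
    qed
  qed
  have "((\<lambda>\<gamma>. (xi_opt A \<gamma> / (\<gamma> * ln \<gamma>)) / (?g \<gamma> / (\<gamma> * ln \<gamma>))) \<longlongrightarrow> - (?d / 2) / - (?d / 2)) at_top"
    by (intro tendsto_divide m g) simp
  then have "((\<lambda>\<gamma>. (xi_opt A \<gamma> / (\<gamma> * ln \<gamma>)) / (?g \<gamma> / (\<gamma> * ln \<gamma>))) \<longlongrightarrow> 1) at_top" by simp
  then have "((\<lambda>\<gamma>. xi_opt A \<gamma> / ?g \<gamma>) \<longlongrightarrow> 1) at_top"
  proof (rule Lim_transform_eventually)
    show "\<forall>\<^sub>F \<gamma> in at_top. (xi_opt A \<gamma> / (\<gamma> * ln \<gamma>)) / (?g \<gamma> / (\<gamma> * ln \<gamma>)) = xi_opt A \<gamma> / ?g \<gamma>"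
      using eventually_gt_at_top[of "1::real"] by eventually_elim simp
  qed
  then show ?thesis by (rule asymp_equivI')
qed

theorem theorem1p1:
  fixes A :: "real ^ 'n \<Rightarrow> real ^ 'n" and r \<Lambda> :: real
  assumes dim: "CARD('n) = 2 \<and> r > 2 \<or> CARD('n) = 3 \<and> r = 3"
    and A: "A \<in> Lspace_loc r"
    and Lambda: "Lambda_mag A = ereal \<Lambda>" "\<Lambda> > 0"
    and ineq: "\<forall>\<psi> \<in> H1_mag A.
      (Lnorm 2 (mag_gradient A \<psi>))\<^sup>2 \<ge> ereal \<Lambda> * (Lnorm 2 \<psi>)\<^sup>2"
    and attained: "\<exists>\<psi> \<in> H1_mag A. \<not> ae_zero \<psi> \<and>
      (Lnorm 2 (mag_gradient A \<psi>))\<^sup>2 = ereal \<Lambda> * (Lnorm 2 \<psi>)\<^sup>2"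
  shows
    "(\<forall>p::real. 2 < p \<longrightarrow> ereal p < critical_exponent CARD('n) \<longrightarrow>
        ((\<lambda>\<sigma>::real. ennreal (\<sigma> powr (real CARD('n) - 2)) *
            (\<integral>\<^sup>+ x. ennreal ((norm (A x))\<^sup>2 * exp (- \<sigma> * norm x)) \<partial>lebesgue)) \<longlongrightarrow> 0) at_top \<longrightarrow>
        (\<forall>\<alpha>. \<alpha> > - \<Lambda> \<longrightarrow> 0 < mu_mag A p \<alpha> \<and> mu_mag A p \<alpha> < \<infinity>) \<and>
        strict_mono_on {- \<Lambda> <..} (mu_mag A p) \<and>
        concave_on {- \<Lambda> <..} (\<lambda>\<alpha>. real_of_ereal (mu_mag A p \<alpha>)) \<and>
        (mu_mag A p \<longlongrightarrow> 0) (at_right (- \<Lambda>)) \<and>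
        ((\<lambda>\<alpha>. mu_mag A p \<alpha> *
            ereal (\<alpha> powr ((real CARD('n) - 2) / 2 - real CARD('n) / p)))
          \<longlongrightarrow> GN_constant TYPE('n) p) at_top)
     \<and>
     (\<forall>p::real. 1 < p \<longrightarrow> p < 2 \<longrightarrow>
        ((\<lambda>\<sigma>::real. ennreal (\<sigma> powr (real CARD('n) - 2)) *
            (\<integral>\<^sup>+ x \<in> {x. norm x < 1 / \<sigma>}. ennreal ((norm (A x))\<^sup>2) \<partial>lebesgue)) \<longlongrightarrow> 0) at_top \<longrightarrow>
        (\<forall>\<beta>>0. ereal \<Lambda> < nu_mag A p \<beta> \<and> nu_mag A p \<beta> < \<infinity>) \<and>
        strict_mono_on {0 <..} (nu_mag A p) \<and>
        concave_on {0 <..} (\<lambda>\<beta>. real_of_ereal (nu_mag A p \<beta>)) \<and>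
        (nu_mag A p \<longlongrightarrow> ereal \<Lambda>) (at_right 0) \<and>
        ((\<lambda>\<beta>. nu_mag A p \<beta> *
            ereal (\<beta> powr (- (2 * p / (2 * p + real CARD('n) * (2 - p))))))
          \<longlongrightarrow> GN_constant TYPE('n) p) at_top)
     \<and>
     (((\<lambda>\<sigma>::real. ennreal (\<sigma> powr (real CARD('n) / 2 - 1) / ln \<sigma>) *
            (\<integral>\<^sup>+ x. ennreal ((norm (A x))\<^sup>2 * exp (- \<sigma> * (norm x)\<^sup>2)) \<partial>lebesgue)) \<longlongrightarrow> 0) at_top \<longrightarrow>
        (\<forall>\<gamma>\<ge>0. \<bar>xi_mag A \<gamma>\<bar> \<noteq> \<infinity>) \<and>
        continuous_on {0..} (\<lambda>\<gamma>. real_of_ereal (xi_mag A \<gamma>)) \<and>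
        concave_on {0..} (\<lambda>\<gamma>. real_of_ereal (xi_mag A \<gamma>)) \<and>
        xi_mag A 0 = Lambda_mag A \<and>
        (\<lambda>\<gamma>. real_of_ereal (xi_mag A \<gamma>)) \<sim>[at_top]
          (\<lambda>\<gamma>. real CARD('n) / 2 * \<gamma> * ln (pi * (exp 1)\<^sup>2 / \<gamma>)))"
proof -
  have dim': "CARD('n) = 2 \<or> CARD('n) = 3" using dim by auto
  have A2: "A \<in> Lspace_loc 2" by (rule Lspace_loc_mono[OF A]) (use dim in auto)
  then have Am: "A \<in> borel_measurable lebesgue" by (simp add: Lspace_loc_def)
  have ineq': "\<forall>\<psi>\<in>H1_mag A. \<Lambda> * nq 2 \<psi> \<le> energy A \<psi>"
  proof
    fix \<psi> assume "\<psi> \<in> H1_mag A"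
    then show "\<Lambda> * nq 2 \<psi> \<le> energy A \<psi>" using ineq H1_magD[OF Am] by (auto simp: Lnorm_sq)
  qed
  obtain \<psi>0 where \<psi>0: "\<psi>0 \<in> H1_mag A" "\<not> ae_zero \<psi>0"
    "(Lnorm 2 (mag_gradient A \<psi>0))\<^sup>2 = ereal \<Lambda> * (Lnorm 2 \<psi>0)\<^sup>2" using attained by blast
  have eq: "energy A \<psi>0 = \<Lambda> * nq 2 \<psi>0" using \<psi>0(3) H1_magD[OF Am \<psi>0(1)] by (simp add: Lnorm_sq)
  note mu = mu_mag_properties[OF dim' A2 Lambda(2) ineq' \<psi>0(1,2) eq]
  note nu = nu_mag_properties[OF dim' A2 Lambda(2) ineq' \<psi>0(1,2) eq]
  note xi = xi_opt_properties[OF dim' A2 Lambda(1) ineq' \<psi>0(1,2) eq]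
  have xi_mag: "\<gamma> \<ge> 0 \<Longrightarrow> real_of_ereal (xi_mag A \<gamma>) = xi_opt A \<gamma>" for \<gamma> by (simp add: xi(1))
  show ?thesis
  proof (intro conjI allI impI; (elim conjE)?)
    fix p \<alpha> :: real
    assume p: "2 < p" "ereal p < critical_exponent CARD('n)"
      and lim: "((\<lambda>\<sigma>::real. ennreal (\<sigma> powr (real CARD('n) - 2)) *
            (\<integral>\<^sup>+ x. ennreal ((norm (A x))\<^sup>2 * exp (- \<sigma> * norm x)) \<partial>lebesgue)) \<longlongrightarrow> 0) at_top"
    note mu = mu[OF p concentrates_exp[OF Am lim]]
    show "- \<Lambda> < \<alpha> \<Longrightarrow> 0 < mu_mag A p \<alpha>" "- \<Lambda> < \<alpha> \<Longrightarrow> mu_mag A p \<alpha> < \<infinity>"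
      using mu(1)[of \<alpha>] by auto
    show "strict_mono_on {- \<Lambda> <..} (mu_mag A p)"
      "concave_on {- \<Lambda> <..} (\<lambda>\<alpha>. real_of_ereal (mu_mag A p \<alpha>))"
      "(mu_mag A p \<longlongrightarrow> 0) (at_right (- \<Lambda>))"
      "((\<lambda>\<alpha>. mu_mag A p \<alpha> * ereal (\<alpha> powr ((real CARD('n) - 2) / 2 - real CARD('n) / p))) \<longlongrightarrow> GN_constant TYPE('n) p) at_top"
      using mu(2-) by auto
  next
    fix p \<beta> :: real
    assume p: "1 < p" "p < 2"
      and lim: "((\<lambda>\<sigma>::real. ennreal (\<sigma> powr (real CARD('n) - 2)) *
            (\<integral>\<^sup>+ x \<in> {x. norm x < 1 / \<sigma>}. ennreal ((norm (A x))\<^sup>2) \<partial>lebesgue)) \<longlongrightarrow> 0) at_top"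
    note nu = nu[OF p concentrates_ball[OF Am lim]]
    show "0 < \<beta> \<Longrightarrow> ereal \<Lambda> < nu_mag A p \<beta>" "0 < \<beta> \<Longrightarrow> nu_mag A p \<beta> < \<infinity>"
      using nu(1)[of \<beta>] by auto
    show "strict_mono_on {0 <..} (nu_mag A p)"
      "concave_on {0 <..} (\<lambda>\<beta>. real_of_ereal (nu_mag A p \<beta>))"
      "(nu_mag A p \<longlongrightarrow> ereal \<Lambda>) (at_right 0)"
      "((\<lambda>\<beta>. nu_mag A p \<beta> * ereal (\<beta> powr (- (2 * p / (2 * p + real CARD('n) * (2 - p)))))) \<longlongrightarrow> GN_constant TYPE('n) p) at_top"
      using nu(2-) by auto
  next
    show "\<gamma> \<ge> 0 \<Longrightarrow> \<bar>xi_mag A \<gamma>\<bar> \<noteq> \<infinity>" for \<gamma> by (simp add: xi(1))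
    show "continuous_on {0..} (\<lambda>\<gamma>. real_of_ereal (xi_mag A \<gamma>))"
    proof (subst continuous_on_cong[OF refl])
      show "real_of_ereal (xi_mag A \<gamma>) = xi_opt A \<gamma>" if "\<gamma> \<in> {0..}" for \<gamma> using that by (intro xi_mag) simp
    qed (rule xi(2))
    show "concave_on {0..} (\<lambda>\<gamma>. real_of_ereal (xi_mag A \<gamma>))"
      by (rule concave_on_cong_on[OF xi(3)]) (simp add: xi_mag)
    show "xi_mag A 0 = Lambda_mag A" by (simp add: xi_mag_def Lambda_mag_def zero_ereal_def[symmetric])
    assume lim: "((\<lambda>\<sigma>::real. ennreal (\<sigma> powr (real CARD('n) / 2 - 1) / ln \<sigma>) *
            (\<integral>\<^sup>+ x. ennreal ((norm (A x))\<^sup>2 * exp (- \<sigma> * (norm x)\<^sup>2)) \<partial>lebesgue)) \<longlongrightarrow> 0) at_top"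
    have E: "\<forall>\<^sub>F \<gamma> in at_top. xi_opt A \<gamma> = real_of_ereal (xi_mag A \<gamma>)"
      using eventually_ge_at_top[of "0::real"] by eventually_elim (simp add: xi_mag)
    show "(\<lambda>\<gamma>. real_of_ereal (xi_mag A \<gamma>)) \<sim>[at_top] (\<lambda>\<gamma>. real CARD('n) / 2 * \<gamma> * ln (pi * (exp 1)\<^sup>2 / \<gamma>))"
      by (rule asymp_equiv_transfer[OF xi_opt_asymptotics[OF A2 xi(7) xi(4,5,6) lim] E]) (intro always_eventually allI refl)
  qed
qed

end
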